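(* Assume Hypotheses 1, 2* and 3 (stated in the context) for some integer $r\ge2$. Let $K:=\Pi_\perp(\Gamma)=\Pi_\perp(U)$. Then $\Gamma$ contains every subset of $U$ that is positively invariant under the flow, and there exists a $C^r$ function $h:K\to\mathbb{R}^n$ such that $\Gamma=\{(h(z),z):z\in K\}$. Moreover, $\|h(z_2)-h(z_1)\|<\|z_2-z_1\|$ for all $z_1\ne z_2$ in $K$, $\|Dh(z)\|<1$ for all $z\in K$, and all higher derivatives of $h$ (up to order $r$) are bounded on $K$.
   Context: System $\dot a=f(a,z)$, $\dot z=g(a,z)$, $(a,z)\in\mathbb{R}^n\times\mathbb{R}^m$, $x=(a,z)$, $X=\mathbb{R}^n\times\mathbb{R}^m$; Euclidean inner product, norm and induced operator norm. $\Phi$ is the flow; $\Gamma\subseteq U$ is positively invariant if $\Phi(t,x)$ exists for all $t\ge0$ for each $x\in\Gamma$ and $\Phi(t,\Gamma)\subseteq\Gamma$ for $t\ge0$. $\Pi(a,z)=a$, $\Pi_\perp(a,z)=z$. $\mathbb{B}_d(x)=\{(a',z'):\|a'-a\|\le d,\|z'-z\|\le d\}$; $\mathcal{L}(x_1,x_2)=\|a_2-a_1\|^2-\|z_2-z_1\|^2$; $\mathcal{C}(x)=\{x'\in X:\mathcal{L}(x',x)\ge0\}$. Hypothesis 1: $U$ is open and convex, and there is $d>0$ with $\mathcal{C}(x)\cap U\subset\mathbb{B}_d(x)$ for all $x\in U$. Hypothesis 2*: $f,g$ are $C^r$ ($r\ge2$) on $U$ with first through $r$-th derivatives bounded on $U$;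 there exist a continuous positive $\alpha:U\to\mathbb{R}$, a continuous nonnegative $\ell:U\to\mathbb{R}$ and constants $c_1,c_r>0$ such that for all $x\in U$: $\langle a',D_af(x)a'\rangle\ge\alpha(x)\|a'\|^2$ ($a'\in\mathbb{R}^n$); $\langle z',D_zg(x)z'\rangle\le\ell(x)\|z'\|^2$ ($z'\in\mathbb{R}^m$); $\alpha(x)\ge\ell(x)+\|D_zf(x)\|+\|D_ag(x)\|+c_1$; and $\alpha(x)\ge r\ell(x)+(r+1)\|D_ag(x)\|+c_r$. Hypothesis 3: $\Gamma\subset U$ is positively invariant and $\Pi_\perp(\Gamma)=\Pi_\perp(U)$. *)

theory Defs
  imports "HOL-Analysis.Analysis"
begin

text \<open>Higher Frechet derivatives, encoded as a family D :: 'a => 'a list => 'b: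
  D x [] = f x, and D x (v # vs) is the derivative in direction v of y |-> D y vs,
  i.e. D x [v_1,...,v_j] is the j-th derivative at x applied to v_1,...,v_j.
  higher_derivs r U f D says f is C^r on U (the derivatives of order below r exist
  and the r-th one is continuous; in finite dimensions pointwise continuity of the
  multilinear map equals continuity in operator norm) with derivative family D.\<close>
definition higher_derivs ::
  "nat \<Rightarrow> 'a::real_normed_vector set \<Rightarrow> ('a \<Rightarrow> 'b::real_normed_vector)
     \<Rightarrow> ('a \<Rightarrow> 'a list \<Rightarrow> 'b) \<Rightarrow> bool" where
  "higher_derivs r U f D \<longleftrightarrow>
     (\<forall>x\<in>U. D x [] = f x) \<and>
     (\<forall>j<r. \<forall>vs. length vs = j \<longrightarrow>
        (\<forall>x\<in>U. ((\<lambda>y. D y vs) has_derivative (\<lambda>v. D x (v # vs))) (at x within U))) \<and>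
     (\<forall>vs. length vs = r \<longrightarrow> continuous_on U (\<lambda>x. D x vs))"

definition deriv_bounded_on ::
  "'a::real_normed_vector set \<Rightarrow> ('a \<Rightarrow> 'a list \<Rightarrow> 'b::real_normed_vector) \<Rightarrow> nat \<Rightarrow> bool" where
  "deriv_bounded_on U D j \<longleftrightarrow>
     (\<exists>B. \<forall>x\<in>U. \<forall>vs. length vs = j \<longrightarrow> norm (D x vs) \<le> B * prod_list (map norm vs))"

definition Lq :: "('n::real_normed_vector \<times> 'm::real_normed_vector) \<Rightarrow> 'n \<times> 'm \<Rightarrow> real" where
  "Lq x1 x2 = (norm (fst x2 - fst x1))\<^sup>2 - (norm (snd x2 - snd x1))\<^sup>2"

definition cone :: "('n::real_normed_vector \<times> 'm::real_normed_vector) \<Rightarrow> ('n \<times> 'm) set" where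
  "cone x = {x'. Lq x' x \<ge> 0}"

definition boxB :: "real \<Rightarrow> ('n::real_normed_vector \<times> 'm::real_normed_vector) \<Rightarrow> ('n \<times> 'm) set" where
  "boxB d x = {x'. norm (fst x' - fst x) \<le> d \<and> norm (snd x' - snd x) \<le> d}"

definition fwd_sol :: "('x::real_normed_vector \<Rightarrow> 'x) \<Rightarrow> 'x set \<Rightarrow> 'x \<Rightarrow> (real \<Rightarrow> 'x) \<Rightarrow> bool" where
  "fwd_sol F U x0 \<phi> \<longleftrightarrow> \<phi> 0 = x0 \<and>
     (\<forall>t\<ge>0. \<phi> t \<in> U \<and> (\<phi> has_vector_derivative F (\<phi> t)) (at t within {0..}))"

definition pos_invariant :: "('x::real_normed_vector \<Rightarrow> 'x) \<Rightarrow> 'x set \<Rightarrow> 'x set \<Rightarrow> bool" where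
  "pos_invariant F U G \<longleftrightarrow> G \<subseteq> U \<and>
     (\<forall>x\<in>G. (\<exists>\<phi>. fwd_sol F U x \<phi>) \<and> (\<forall>\<phi>. fwd_sol F U x \<phi> \<longrightarrow> (\<forall>t\<ge>0. \<phi> t \<in> G)))"

end

theory Submission
  imports Defs
begin

text \<open>Along two solutions in \<open>U\<close> the cone where the difference of the \<open>a\<close>-components dominates is
  forward invariant, and inside it that difference grows exponentially, which contradicts the bound
  imposed on cones by Hypothesis 1. Hence \<open>\<Gamma>\<close> is the graph of a contraction \<open>h\<close> and contains every
  positively invariant set.

  Smoothness comes from one estimate. Let \<open>W\<close> be a finite family of functions on the base, evolving
  along the induced semiflow at rate at least \<open>a\<close>, whereas the base expands at rate at most \<open>\<gamma> < a\<close>. A combination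
  \<open>\<Sum>\<^sub>j c\<^sub>j (W (x\<^sub>j) - W (y\<^sub>j))\<close> with \<open>\<Sum>\<^sub>j c\<^sub>j (x\<^sub>j - y\<^sub>j) = 0\<close>, divided by the expansion of the base, grows
  exponentially unless it is small; being bounded because \<open>W\<close> is Lipschitz, it is small. This is strict
  differentiability of \<open>W\<close>, obtained without solving the variational equation and without knowing a candidate for
  the derivative. It is applied to \<open>h\<close> and then successively to the
  coordinates of \<open>D\<^sup>kh\<close>, whose evolution equation follows from that of \<open>D\<^sup>k\<^sup>-\<^sup>1h\<close> by a commutator argument;
  in the Hilbert--Schmidt norm its rate is at least \<open>\<alpha> - \<parallel>D\<^sub>ag\<parallel> - k (\<ell> + \<parallel>D\<^sub>ag\<parallel>)\<close>, and the gap
  condition of order \<open>r\<close> lets the induction reach \<open>D\<^sup>r\<close>.\<close>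

section \<open>Scalar differential inequalities\<close>

text \<open>\<open>\<Gamma>\<close> is only forward invariant, and forward in time the direction
  normal to it expands, so nearby graphs are driven away from it. Information is therefore extracted
  by contradiction: a wrong value is amplified until it violates a bound. Each such argument runs
  over a finite time, so that linearisations need only be uniform on compact orbit segments.

  Each order k >= 1 is passed twice. The first pass knows only that \<open>D^k h\<close> is bounded
  and yields a Lipschitz bound; increments of the unknown cannot yet be estimated and must be kept
  exactly. The Lipschitz bound then makes linearisation errors proportional to distances in the
  base, as the second pass, strict differentiability, requires. For \<open>h\<close> itself the cone
  argument supplies the Lipschitz bound.\<close>

lemma barrier_nonneg:
  fixes y y' :: "real \<Rightarrow> real"
  assumes d: "\<And>t. t \<in> {0..T} \<Longrightarrow> (y has_real_derivative y' t) (at t within {0..T})"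
    and y0: "y 0 \<ge> 0"
    and pos: "\<And>t. t \<in> {0..T} \<Longrightarrow> y t = 0 \<Longrightarrow> (\<And>s. s \<in> {0..t} \<Longrightarrow> y s \<ge> 0) \<Longrightarrow> y' t > 0"
    and t: "t \<in> {0..T}"
  shows "y t \<ge> 0"
proof (rule ccontr)
  assume "\<not> y t \<ge> 0"
  hence t1: "y t < 0" by simp
  have cont: "continuous_on {0..T} y"
    using d by (meson DERIV_continuous continuous_on_eq_continuous_within)
  define S where "S = {s \<in> {0..t}. y s < 0}"
  define t0 where "t0 = Inf S"
  have SS: "S \<noteq> {}" "bdd_below S" using t1 t by (auto simp: S_def intro!: bdd_belowI[of _ 0])
  have t0: "0 \<le> t0" "t0 \<le> t"
    using SS t1 t by (auto simp: t0_def S_def intro!: cInf_greatest cInf_lower)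
  have before: "y s \<ge> 0" if "0 \<le> s" "s < t0" for s
    using cInf_lower[of s S] SS that t0 unfolding t0_def S_def by force
  have near: "\<exists>s\<in>S. s < t0 + e" if "e > 0" for e
    using cInf_lessD[of S "t0 + e"] SS that unfolding t0_def by auto
  have lim: "\<exists>e>0. \<forall>s\<in>{0..T}. \<bar>s - t0\<bar> < e \<longrightarrow> \<bar>y s - y t0\<bar> < \<epsilon>" if "\<epsilon> > 0" for \<epsilon>
    using cont t0 t that unfolding continuous_on_iff dist_real_def by auto
  have nonneg: "y t0 \<ge> 0"
  proof (rule ccontr)
    assume "\<not> y t0 \<ge> 0"
    hence neg: "y t0 < 0" by simp
    hence "t0 > 0" using y0 t0 by (cases "t0 = 0") auto
    obtain e where e: "e > 0" "\<And>s. s\<in>{0..T} \<Longrightarrow> \<bar>s - t0\<bar> < e \<Longrightarrow> \<bar>y s - y t0\<bar> < - y t0"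
      using lim[of "- y t0"] neg by auto
    define s where "s = max 0 (t0 - e/2)"
    have "y s \<ge> 0" using before[of s] \<open>t0 > 0\<close> e(1) unfolding s_def by auto
    moreover have "\<bar>y s - y t0\<bar> < - y t0"
      using e(2)[of s] e(1) \<open>t0 > 0\<close> t0 t unfolding s_def by (auto simp: max_def)
    ultimately show False by linarith
  qed
  have "y t0 \<le> 0"
  proof (rule ccontr)
    assume "\<not> y t0 \<le> 0"
    then obtain e where e: "e > 0" "\<And>s. s\<in>{0..T} \<Longrightarrow> \<bar>s - t0\<bar> < e \<Longrightarrow> \<bar>y s - y t0\<bar> < y t0"
      using lim[of "y t0"] by auto
    obtain s where s: "s \<in> S" "s < t0 + e" using near[OF e(1)] by auto
    have "t0 \<le> s" using s SS unfolding t0_def by (simp add: cInf_lower)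
    thus False using e(2)[of s] s t unfolding S_def by auto
  qed
  hence z: "y t0 = 0" using nonneg by simp
  have "y s \<ge> 0" if "s \<in> {0..t0}" for s
    using before[of s] z that by (cases "s = t0") auto
  \<comment> \<open>Positivity of the derivative is demanded only at zeros before which
    \<open>y\<close> has not been negative. Growth estimates valid only while the cone has not been
    left can therefore be used to verify it.\<close>
  hence "y' t0 > 0" using pos[of t0] z t0 t by auto
  from has_real_derivative_pos_inc_right[OF d[of t0] this] t0 t
  obtain e where e: "e > 0" "\<And>h. h > 0 \<Longrightarrow> t0 + h \<in> {0..T} \<Longrightarrow> h < e \<Longrightarrow> y t0 < y (t0 + h)"
    by auto
  obtain s where s: "s \<in> S" "s < t0 + e" using near[OF e(1)] by auto
  have "t0 \<le> s" "t0 \<noteq> s" using s SS z unfolding t0_def by (auto simp add: cInf_lower S_def)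
  thus False using e(2)[of "s - t0"] s t z unfolding S_def by auto
qed

text \<open>\<open>exp (- \<Lambda> t) * y t\<close> is nondecreasing. The rate enters through a
  given antiderivative \<open>\<Lambda>\<close>, so that one primitive on a long interval serves all
  shorter ones. The inequality is linear in \<open>y\<close>, so negation yields the upper
  bound.\<close>

lemma gronwall_lower:
  fixes y y' \<kappa> \<Lambda> :: "real \<Rightarrow> real"
  assumes d: "\<And>t. t \<in> {0..T} \<Longrightarrow> (y has_real_derivative y' t) (at t within {0..T})"
    and dL: "\<And>t. t \<in> {0..T} \<Longrightarrow> (\<Lambda> has_real_derivative \<kappa> t) (at t within {0..T})"
    and ge: "\<And>t. t \<in> {0..T} \<Longrightarrow> y' t \<ge> \<kappa> t * y t"
    and T: "T \<ge> 0"
  shows "y T \<ge> exp (\<Lambda> T - \<Lambda> 0) * y 0"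
proof -
  define w where "w t = exp (- \<Lambda> t) * y t" for t
  have dw: "(w has_real_derivative exp (- \<Lambda> t) * (y' t - \<kappa> t * y t)) (at t within {0..T})"
    if "t \<in> {0..T}" for t
    unfolding w_def using d[OF that] dL[OF that]
    by (auto intro!: derivative_eq_intros simp: algebra_simps)
  have "w 0 \<le> w T"
  proof (rule DERIV_nonneg_imp_increasing_open[OF T])
    fix t assume t: "0 < t" "t < T"
    have "at t within {0..T} = at t" using t by (intro at_within_interior) auto
    hence "DERIV w t :> exp (- \<Lambda> t) * (y' t - \<kappa> t * y t)" using dw[of t] t by auto
    moreover have "exp (- \<Lambda> t) * (y' t - \<kappa> t * y t) \<ge> 0" using ge[of t] t by simp
    ultimately show "\<exists>y. DERIV w t :> y \<and> 0 \<le> y" by blast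
  next
    show "continuous_on {0..T} w"
      using dw by (meson DERIV_continuous continuous_on_eq_continuous_within)
  qed
  hence "exp (\<Lambda> T) * (exp (- \<Lambda> 0) * y 0) \<le> exp (\<Lambda> T) * (exp (- \<Lambda> T) * y T)"
    unfolding w_def by (intro mult_left_mono) auto
  thus ?thesis by (simp add: exp_diff exp_minus field_simps)
qed

lemma gronwall_upper:
  fixes y y' \<kappa> \<Lambda> :: "real \<Rightarrow> real"
  assumes d: "\<And>t. t \<in> {0..T} \<Longrightarrow> (y has_real_derivative y' t) (at t within {0..T})"
    and dL: "\<And>t. t \<in> {0..T} \<Longrightarrow> (\<Lambda> has_real_derivative \<kappa> t) (at t within {0..T})"
    and le: "\<And>t. t \<in> {0..T} \<Longrightarrow> y' t \<le> \<kappa> t * y t"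
    and T: "T \<ge> 0"
  shows "y T \<le> exp (\<Lambda> T - \<Lambda> 0) * y 0"
  using gronwall_lower[of T "\<lambda>t. - y t" "\<lambda>t. - y' t" \<Lambda> \<kappa>] d dL le T
  by (auto intro!: DERIV_minus)

text \<open>With \<open>s = sqrt Q\<close> the hypothesis reads
  \<open>s' \<ge> \<kappa> * s - \<omega>\<close>, but \<open>s\<close> need not be differentiable
  where it vanishes. Completing the square gives
  \<open>Q' \<ge> \<kappa> * (Q - (\<omega>/\<kappa>)\<^sup>2)\<close> instead: half of the rate
  \<open>2 * \<kappa>\<close> is spent on the forcing.\<close>

lemma forced_growth:
  fixes Q Q' :: "real \<Rightarrow> real"
  assumes T: "T \<ge> 0" and \<kappa>: "\<kappa> > 0"
    and dQ: "\<And>t. t \<in> {0..T} \<Longrightarrow> (Q has_real_derivative Q' t) (at t within {0..T})"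
    and Q: "\<And>t. t \<in> {0..T} \<Longrightarrow> Q t \<ge> 0"
    and ge: "\<And>t. t \<in> {0..T} \<Longrightarrow> Q' t \<ge> 2 * (\<kappa> * Q t - \<omega> * sqrt (Q t))"
  shows "Q T - (\<omega>/\<kappa>)\<^sup>2 \<ge> exp (\<kappa> * T) * (Q 0 - (\<omega>/\<kappa>)\<^sup>2)"
proof -
  have "Q T - (\<omega>/\<kappa>)\<^sup>2 \<ge> exp (\<kappa> * T - \<kappa> * 0) * (Q 0 - (\<omega>/\<kappa>)\<^sup>2)"
  proof (rule gronwall_lower[where y' = Q' and \<kappa> = "\<lambda>_. \<kappa>"])
    fix t assume t: "t \<in> {0..T}"
    show "((\<lambda>t. Q t - (\<omega>/\<kappa>)\<^sup>2) has_real_derivative Q' t) (at t within {0..T})"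
      using dQ[OF t] by (auto intro!: derivative_eq_intros)
    show "((*) \<kappa> has_real_derivative \<kappa>) (at t within {0..T})"
      by (auto intro!: derivative_eq_intros)
    define s where "s = sqrt (Q t)"
    have s2: "s\<^sup>2 = Q t" using Q[OF t] by (simp add: s_def)
    have "0 \<le> (\<kappa> * s - \<omega>)\<^sup>2" by simp
    hence "2 * \<omega> * \<kappa> * s \<le> \<kappa>\<^sup>2 * s\<^sup>2 + \<omega>\<^sup>2" by (simp add: power2_eq_square algebra_simps)
    hence "2 * \<omega> * s \<le> \<kappa> * s\<^sup>2 + \<omega>\<^sup>2 / \<kappa>"
      using \<kappa> by (simp add: field_simps power2_eq_square)
    hence "2 * (\<kappa> * Q t - \<omega> * s) \<ge> \<kappa> * Q t - \<omega>\<^sup>2 / \<kappa>" using s2 by (simp add: algebra_simps)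
    also have "\<kappa> * Q t - \<omega>\<^sup>2 / \<kappa> = \<kappa> * (Q t - (\<omega>/\<kappa>)\<^sup>2)"
      using \<kappa> by (simp add: field_simps power2_eq_square)
    finally show "\<kappa> * (Q t - (\<omega>/\<kappa>)\<^sup>2) \<le> Q' t" using ge[OF t] unfolding s_def by linarith
  qed (use T in auto)
  thus ?thesis by simp
qed

text \<open>The cone \<open>Z \<le> Q\<close> cannot be left while \<open>Q\<close> stays above the error level,
  and inside the cone \<open>Q\<close> grows exponentially.\<close>
lemma cone_escape:
  fixes Q Q' Z Z' F G :: "real \<Rightarrow> real"
  assumes T: "T \<ge> 0" and \<kappa>: "\<kappa> > 0" and \<omega>: "\<omega> \<ge> 0" "2 * \<omega> < \<kappa> * \<eta>"
    and dQ: "\<And>t. t \<in> {0..T} \<Longrightarrow> (Q has_real_derivative Q' t) (at t within {0..T})"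
    and dZ: "\<And>t. t \<in> {0..T} \<Longrightarrow> (Z has_real_derivative Z' t) (at t within {0..T})"
    and Q: "\<And>t. t \<in> {0..T} \<Longrightarrow> Q t \<ge> 0" and Z: "\<And>t. t \<in> {0..T} \<Longrightarrow> Z t \<ge> 0"
    and F: "\<And>t. t \<in> {0..T} \<Longrightarrow> F t \<ge> 0"
    and Q': "\<And>t. t \<in> {0..T} \<Longrightarrow>
        Q' t \<ge> 2 * ((F t + \<kappa>) * Q t - F t * sqrt (Q t) * sqrt (Z t) - \<omega> * sqrt (Q t))"
    and Z': "\<And>t. t \<in> {0..T} \<Longrightarrow>
        Z' t \<le> 2 * (- G t * Z t + G t * sqrt (Q t) * sqrt (Z t) + \<omega> * sqrt (Z t))"
    and Z0: "Z 0 = 0" and C: "Q T \<le> C" and big: "exp (\<kappa> * T) * (3/4 * \<eta>\<^sup>2) > C"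
  shows "Q 0 < \<eta>\<^sup>2"
proof (rule ccontr)
  assume "\<not> Q 0 < \<eta>\<^sup>2"
  hence Q0: "Q 0 \<ge> \<eta>\<^sup>2" by simp
  have \<eta>: "\<eta> > 0" using \<omega> \<kappa> by (smt (verit) zero_less_mult_pos)
  \<comment> \<open>The error level \<open>\<omega>/\<kappa>\<close> lies below
    \<open>\<eta>/2\<close>, so at least \<open>3/4 * \<eta>\<^sup>2\<close> of \<open>Q 0\<close>
    remains after subtracting its square. This is the \<open>3/4\<close> in the assumption
    \<open>big\<close>.\<close>
  have "2 * (\<omega>/\<kappa>) < \<eta>" using \<omega> \<kappa> by (simp add: field_simps)
  hence "(2 * (\<omega>/\<kappa>))\<^sup>2 \<le> \<eta>\<^sup>2" using \<omega> \<kappa> by (intro power_mono) auto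
  hence small: "(\<omega>/\<kappa>)\<^sup>2 \<le> \<eta>\<^sup>2 / 4" by (simp add: power_mult_distrib power_divide mult.commute)
  have grow: "Q t \<ge> \<eta>\<^sup>2 \<and> Q t \<ge> exp (\<kappa> * t) * (3/4 * \<eta>\<^sup>2)"
    if t: "t \<in> {0..T}" and le: "\<And>s. s \<in> {0..t} \<Longrightarrow> Q s - Z s \<ge> 0" for t
  proof -
    have g1: "Q t - (\<omega>/\<kappa>)\<^sup>2 \<ge> exp (\<kappa> * t) * (Q 0 - (\<omega>/\<kappa>)\<^sup>2)"
    proof (rule forced_growth[where Q' = Q'])
      fix s assume s: "s \<in> {0..t}"
      hence sT: "s \<in> {0..T}" using t by auto
      show "(Q has_real_derivative Q' s) (at s within {0..t})"
        using dQ[OF sT] by (rule DERIV_subset) (use t in auto)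
      have "sqrt (Q s) * sqrt (Z s) \<le> sqrt (Q s) * sqrt (Q s)"
        using le[OF s] Q[OF sT] by (intro mult_left_mono) auto
      hence "F s * (sqrt (Q s) * sqrt (Z s)) \<le> F s * Q s"
        using F[OF sT] Q[OF sT] by (intro mult_left_mono) auto
      thus "2 * (\<kappa> * Q s - \<omega> * sqrt (Q s)) \<le> Q' s"
        using Q'[OF sT] by (simp add: algebra_simps)
    qed (use t \<kappa> Q in auto)
    have "Q 0 - (\<omega>/\<kappa>)\<^sup>2 \<ge> 0"
      using small Q0 zero_le_power2[of \<eta>] by linarith
    hence g2: "exp (\<kappa> * t) * (Q 0 - (\<omega>/\<kappa>)\<^sup>2) \<ge> 1 * (Q 0 - (\<omega>/\<kappa>)\<^sup>2)"
      using t \<kappa> by (intro mult_right_mono) auto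
    have g3: "exp (\<kappa> * t) * (Q 0 - (\<omega>/\<kappa>)\<^sup>2) \<ge> exp (\<kappa> * t) * (3/4 * \<eta>\<^sup>2)"
      using small Q0 by (intro mult_left_mono) auto
    have arith: "p \<le> q - w \<Longrightarrow> 1 * (a - w) \<le> p \<Longrightarrow> v \<le> p \<Longrightarrow> w \<ge> 0 \<Longrightarrow> e \<le> a \<Longrightarrow> e \<le> q \<and> v \<le> q"
      for p q w a v e :: real by simp
    show ?thesis by (rule arith[OF g1 g2 g3 zero_le_power2 Q0])
  qed
  \<comment> \<open>Where \<open>Q = Z\<close> the \<open>F\<close> terms cancel in the bound of
    \<open>Q'\<close> and the \<open>G\<close> terms in that of \<open>Z'\<close>. What is left is
    \<open>\<kappa> * Q\<close> against two error terms \<open>\<omega> * sqrt Q\<close>, and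
    \<open>2 * \<omega> < \<kappa> * \<eta>\<close> decides because
    \<open>sqrt Q \<ge> \<eta>\<close>.\<close>
  have "Q t - Z t \<ge> 0" if "t \<in> {0..T}" for t
  proof (rule barrier_nonneg[where y = "\<lambda>t. Q t - Z t" and y' = "\<lambda>t. Q' t - Z' t" and T = T])
    fix t assume t: "t \<in> {0..T}"
    show "((\<lambda>a. Q a - Z a) has_real_derivative Q' t - Z' t) (at t within {0..T})"
      using dQ[OF t] dZ[OF t] by (rule DERIV_diff)
    assume eq: "Q t - Z t = 0" and le: "\<And>s. s \<in> {0..t} \<Longrightarrow> Q s - Z s \<ge> 0"
    have "Q t \<ge> \<eta>\<^sup>2" using grow[OF t le] by blast
    define q where "q = sqrt (Q t)"
    have q: "q \<ge> \<eta>" unfolding q_def using \<open>Q t \<ge> \<eta>\<^sup>2\<close> \<eta> by (metis real_le_rsqrt)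
    have q2: "Q t = q\<^sup>2" "Z t = q\<^sup>2" "sqrt (Z t) = q" using Q[OF t] eq by (auto simp: q_def)
    have "Q' t \<ge> 2 * (\<kappa> * q\<^sup>2 - \<omega> * q)"
      using Q'[OF t] q2 unfolding q_def[symmetric] by (simp add: algebra_simps power2_eq_square)
    moreover have "Z' t \<le> 2 * \<omega> * q"
      using Z'[OF t] q2 unfolding q_def[symmetric] by (simp add: algebra_simps power2_eq_square)
    moreover have "2 * \<omega> * q < \<kappa> * q * q"
    proof -
      have "\<kappa> * \<eta> \<le> \<kappa> * q" using q \<kappa> by simp
      thus ?thesis using \<omega> q \<eta> by (intro mult_strict_right_mono) auto
    qed
    ultimately show "Q' t - Z' t > 0" by (simp add: power2_eq_square)
  qed (use Q0 Z0 that in \<open>auto intro: order_trans[OF zero_le_power2]\<close>)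
  hence "Q T \<ge> exp (\<kappa> * T) * (3/4 * \<eta>\<^sup>2)" using grow[of T] T by auto
  thus False using C big by linarith
qed

lemma continuous_has_antiderivative:
  fixes \<gamma> :: "real \<Rightarrow> real"
  assumes "continuous_on {0..T} \<gamma>"
  obtains \<Lambda> where "\<Lambda> 0 = 0"
    "\<And>t. t \<in> {0..T} \<Longrightarrow> (\<Lambda> has_real_derivative \<gamma> t) (at t within {0..T})"
proof (rule that[of "\<lambda>t. integral {0..t} \<gamma>"])
  show "integral {0..0} \<gamma> = 0" by simp
  show "((\<lambda>t. integral {0..t} \<gamma>) has_real_derivative \<gamma> t) (at t within {0..T})"
    if "t \<in> {0..T}" for t
    using integral_has_real_derivative[OF assms that] .
qed

section \<open>Strict differentiability of invariant graphs\<close>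

lemma has_real_derivative_inner_self:
  fixes u :: "real \<Rightarrow> 'a::real_inner"
  assumes "(u has_vector_derivative u') (at t within S)"
  shows "((\<lambda>t. (norm (u t))\<^sup>2) has_real_derivative 2 * (u t \<bullet> u')) (at t within S)"
proof -
  have "((\<lambda>t. u t \<bullet> u t) has_derivative (\<lambda>h. u t \<bullet> (h *\<^sub>R u') + (h *\<^sub>R u') \<bullet> u t)) (at t within S)"
    using assms unfolding has_vector_derivative_def by (intro has_derivative_inner) auto
  moreover have "(\<lambda>h. u t \<bullet> (h *\<^sub>R u') + (h *\<^sub>R u') \<bullet> u t) = (*) (2 * (u t \<bullet> u'))"
    by (auto simp: inner_commute)
  ultimately show ?thesis
    unfolding has_field_derivative_def by (simp add: power2_norm_eq_inner)
qed

lemma norm_sum_scaleR_le: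
  fixes v :: "'j \<Rightarrow> 'a::real_normed_vector"
  assumes "\<And>j. j \<in> J \<Longrightarrow> norm (v j) \<le> w * p j"
  shows "norm (\<Sum>j\<in>J. c j *\<^sub>R v j) \<le> w * (\<Sum>j\<in>J. \<bar>c j\<bar> * p j)"
proof -
  have "norm (\<Sum>j\<in>J. c j *\<^sub>R v j) \<le> (\<Sum>j\<in>J. \<bar>c j\<bar> * (w * p j))"
    by (rule sum_norm_le) (auto intro!: mult_left_mono assms)
  thus ?thesis by (simp add: sum_distrib_left mult.left_commute mult.commute)
qed

text \<open>\<open>L z x y\<close> approximates \<open>u x - u y\<close> for two points near the
  base point \<open>z\<close>, uniformly for \<open>z\<close> in compact sets such as orbit
  segments. \<open>L\<close> receives both points rather than their difference because it may
  contain increments of functions not yet known to be differentiable.\<close>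

definition strict_lin ::
  "'b::euclidean_space set \<Rightarrow> ('b \<Rightarrow> 'b \<Rightarrow> 'b \<Rightarrow> 'a::real_normed_vector) \<Rightarrow> ('b \<Rightarrow> 'a) \<Rightarrow> bool" where
  "strict_lin K L u \<longleftrightarrow> (\<forall>C. compact C \<longrightarrow> C \<subseteq> K \<longrightarrow> (\<forall>\<omega>>0. \<exists>\<delta>>0. \<forall>z\<in>C.
     \<forall>x\<in>K \<inter> ball z \<delta>. \<forall>y\<in>K \<inter> ball z \<delta>. norm (u x - u y - L z x y) \<le> \<omega> * norm (x - y)))"

lemma strict_linD:
  assumes "strict_lin K L u" "compact C" "C \<subseteq> K" "\<omega> > 0"
  obtains \<delta> where "\<delta> > 0"
    "\<And>z x y. z \<in> C \<Longrightarrow> x \<in> K \<Longrightarrow> y \<in> K \<Longrightarrow> dist z x < \<delta> \<Longrightarrow> dist z y < \<delta> \<Longrightarrow>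
       norm (u x - u y - L z x y) \<le> \<omega> * norm (x - y)"
  using assms unfolding strict_lin_def by (metis IntI mem_ball)

text \<open>With two or more pairs this condition expresses at once the Cauchy property of difference quotients,
  additivity of the derivative in the direction, and its continuity in the base point.\<close>
definition strictly_diff_at :: "'b::euclidean_space set \<Rightarrow> ('b \<Rightarrow> 'a::real_normed_vector) \<Rightarrow> 'b \<Rightarrow> bool" where
  "strictly_diff_at K u z0 \<longleftrightarrow> (\<forall>\<eta>>0. \<exists>\<delta>>0. \<forall>(J::'b set) c x y. finite J \<longrightarrow>
      (\<forall>j\<in>J. x j \<in> K \<inter> ball z0 \<delta> \<and> y j \<in> K \<inter> ball z0 \<delta>) \<longrightarrow>
      (\<Sum>j\<in>J. c j *\<^sub>R (x j - y j)) = 0 \<longrightarrow> (\<Sum>j\<in>J. \<bar>c j\<bar> * norm (x j - y j)) \<le> 1 \<longrightarrow>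
      norm (\<Sum>j\<in>J. c j *\<^sub>R (u (x j) - u (y j))) \<le> \<eta>)"

section \<open>Semiflows on the base\<close>

locale semiflow =
  fixes K :: "'b::euclidean_space set" and \<theta> :: "'b \<Rightarrow> real \<Rightarrow> 'b" and G :: "'b \<Rightarrow> 'b" and Lg :: real
  assumes openK: "open K"
    and \<theta>_0: "z \<in> K \<Longrightarrow> \<theta> z 0 = z"
    and \<theta>_in: "z \<in> K \<Longrightarrow> t \<ge> 0 \<Longrightarrow> \<theta> z t \<in> K"
    and \<theta>_deriv: "z \<in> K \<Longrightarrow> t \<ge> 0 \<Longrightarrow> (\<theta> z has_vector_derivative G (\<theta> z t)) (at t within {0..})"
    and Lg: "Lg \<ge> 0"
    and G_lip: "x \<in> K \<Longrightarrow> y \<in> K \<Longrightarrow> norm (G x - G y) \<le> Lg * norm (x - y)"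
begin

text \<open>The rate \<open>\<phi>\<close> is a derivative of \<open>W\<close> along orbits only, so
  the notion makes sense before \<open>W\<close> is known to be differentiable.\<close>

definition evolves :: "('b \<Rightarrow> 'a::real_normed_vector) \<Rightarrow> ('b \<Rightarrow> 'a) \<Rightarrow> bool" where
  "evolves W \<phi> \<longleftrightarrow> (\<forall>z\<in>K. \<forall>t\<ge>0. ((\<lambda>t. W (\<theta> z t)) has_vector_derivative \<phi> (\<theta> z t)) (at t within {0..}))"

lemma evolvesD:
  "evolves W \<phi> \<Longrightarrow> z \<in> K \<Longrightarrow> t \<in> {0..T} \<Longrightarrow>
    ((\<lambda>t. W (\<theta> z t)) has_vector_derivative \<phi> (\<theta> z t)) (at t within {0..T})"
  unfolding evolves_def by (rule has_vector_derivative_within_subset[of _ _ _ "{0..}"]) auto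

lemma \<theta>_derivT:
  "z \<in> K \<Longrightarrow> t \<in> {0..T} \<Longrightarrow> (\<theta> z has_vector_derivative G (\<theta> z t)) (at t within {0..T})"
  by (rule has_vector_derivative_within_subset[OF \<theta>_deriv]) auto

lemma continuous_\<theta>: "z \<in> K \<Longrightarrow> continuous_on {0..T} (\<theta> z)"
  using \<theta>_derivT by (meson has_vector_derivative_continuous continuous_on_eq_continuous_within)

lemma compact_orbit: "z \<in> K \<Longrightarrow> compact (\<theta> z ` {0..T})"
  by (intro compact_continuous_image continuous_\<theta>) auto

lemma orbit_subset: "z \<in> K \<Longrightarrow> \<theta> z ` {0..T} \<subseteq> K"
  using \<theta>_in by auto

text \<open>Gronwall for the squared distance, which is differentiable also at zero. The rate is
  one-sided and varies in time: the gap conditions compare \<open>\<alpha>\<close> with such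
  pointwise expansion rates, not with a global Lipschitz constant.\<close>

lemma orbit_dist_le:
  assumes x: "x \<in> K" and y: "y \<in> K" and t: "t \<ge> 0"
    and T: "t \<le> T"
    and dL: "\<And>s. s \<in> {0..T} \<Longrightarrow> (\<Lambda> has_real_derivative \<gamma> s) (at s within {0..T})"
    and le: "\<And>s. s \<in> {0..t} \<Longrightarrow>
       (\<theta> x s - \<theta> y s) \<bullet> (G (\<theta> x s) - G (\<theta> y s)) \<le> \<gamma> s * (norm (\<theta> x s - \<theta> y s))\<^sup>2"
  shows "norm (\<theta> x t - \<theta> y t) \<le> exp (\<Lambda> t - \<Lambda> 0) * norm (x - y)"
proof -
  have "(norm (\<theta> x t - \<theta> y t))\<^sup>2 \<le> exp (2 * \<Lambda> t - 2 * \<Lambda> 0) * (norm (\<theta> x 0 - \<theta> y 0))\<^sup>2"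
  proof (rule gronwall_upper[where \<kappa> = "\<lambda>s. 2 * \<gamma> s" and \<Lambda> = "\<lambda>s. 2 * \<Lambda> s"
        and y' = "\<lambda>s. 2 * ((\<theta> x s - \<theta> y s) \<bullet> (G (\<theta> x s) - G (\<theta> y s)))"])
    fix s assume s: "s \<in> {0..t}"
    hence sT: "s \<in> {0..T}" using T by auto
    show "((\<lambda>t. (norm (\<theta> x t - \<theta> y t))\<^sup>2) has_real_derivative
       2 * ((\<theta> x s - \<theta> y s) \<bullet> (G (\<theta> x s) - G (\<theta> y s)))) (at s within {0..t})"
      by (rule has_real_derivative_inner_self)
         (intro has_vector_derivative_diff \<theta>_derivT x y s)
    show "((\<lambda>s. 2 * \<Lambda> s) has_real_derivative 2 * \<gamma> s) (at s within {0..t})"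
      by (rule DERIV_cmult[OF DERIV_subset[OF dL[OF sT]]]) (use T in auto)
    show "2 * ((\<theta> x s - \<theta> y s) \<bullet> (G (\<theta> x s) - G (\<theta> y s))) \<le> 2 * \<gamma> s * (norm (\<theta> x s - \<theta> y s))\<^sup>2"
      using le[OF s] by simp
  qed (rule t)
  also have "\<dots> = (exp (\<Lambda> t - \<Lambda> 0) * norm (x - y))\<^sup>2"
    using x y by (simp add: \<theta>_0 power_mult_distrib exp_double[symmetric] algebra_simps)
  finally show ?thesis by (rule power2_le_imp_le) simp
qed

text \<open>A crude bound. It keeps neighbouring orbits inside the ball where a linearisation is
  valid, which must be known before the sharp rate can be used.\<close>

lemma orbit_dist_exp:
  assumes x: "x \<in> K" and y: "y \<in> K" and t: "t \<ge> 0"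
  shows "norm (\<theta> x t - \<theta> y t) \<le> exp (Lg * t) * norm (x - y)"
proof -
  have "norm (\<theta> x t - \<theta> y t) \<le> exp (Lg * t - Lg * 0) * norm (x - y)"
  proof (rule orbit_dist_le[OF x y t order_refl])
    fix s assume s: "s \<in> {0..t}"
    show "((*) Lg has_real_derivative Lg) (at s within {0..t})"
      by (auto intro!: derivative_eq_intros)
    have "(\<theta> x s - \<theta> y s) \<bullet> (G (\<theta> x s) - G (\<theta> y s)) \<le> norm (\<theta> x s - \<theta> y s) * norm (G (\<theta> x s) - G (\<theta> y s))"
      by (rule norm_cauchy_schwarz)
    also have "\<dots> \<le> norm (\<theta> x s - \<theta> y s) * (Lg * norm (\<theta> x s - \<theta> y s))"
      using s by (intro mult_left_mono G_lip \<theta>_in x y) auto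
    finally show "(\<theta> x s - \<theta> y s) \<bullet> (G (\<theta> x s) - G (\<theta> y s)) \<le> Lg * (norm (\<theta> x s - \<theta> y s))\<^sup>2"
      by (simp add: power2_eq_square mult_ac)
  qed
  thus ?thesis by simp
qed

end

lemma finite_common_radius:
  assumes "finite I" "\<And>i. i \<in> I \<Longrightarrow> \<exists>\<delta>>0::real. P i \<delta>"
    and mono: "\<And>i \<delta> \<epsilon>. i \<in> I \<Longrightarrow> P i \<delta> \<Longrightarrow> 0 < \<epsilon> \<Longrightarrow> \<epsilon> \<le> \<delta> \<Longrightarrow> P i \<epsilon>"
  shows "\<exists>\<delta>>0. \<forall>i\<in>I. P i \<delta>"
  using assms
proof (induction I rule: finite_induct)
  case empty
  show ?case by (auto intro: exI[of _ 1])
next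
  case (insert i I)
  have "\<exists>\<delta>>0. \<forall>i\<in>I. P i \<delta>"
    by (rule insert.IH; rule insert.prems) auto
  then obtain d1 where d1: "d1 > 0" "\<forall>i\<in>I. P i d1" by auto
  obtain d2 where d2: "d2 > 0" "P i d2" using insert.prems(1)[of i] by auto
  have "P k (min d1 d2)" if "k \<in> insert i I" for k
    using that d1 d2 insert.prems(2)[of k] by (cases "k = i") auto
  thus ?case using d1 d2 by (intro exI[of _ "min d1 d2"]) auto
qed

context semiflow
begin

text \<open>For a combination with vanishing base part let \<open>q\<close> be the combined
  increments of \<open>W\<close> and \<open>\<zeta>\<close> those of the base, both transported by
  the semiflow. All increments are linearised along the one orbit of \<open>z0\<close>, so
  \<open>q\<close> and \<open>\<zeta>\<close> obey approximately linear equations with common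
  coefficients. Dividing \<open>q\<close> by \<open>M\<close> turns the couplings in
  \<open>num\<phi>\<close> and \<open>numG\<close> into \<open>F\<close> and \<open>g\<close>;
  dividing both by the bound \<open>exp (\<Lambda> t)\<close> for the growth of base distances makes
  the errors small constants. Then \<open>cone_escape\<close> applies: \<open>Z\<close> starts at
  zero, and \<open>Q\<close> stays bounded because \<open>W\<close> is Lipschitz.\<close>

lemma strictly_diff_invariant_graph:
  fixes I :: "'i set" and W \<phi> :: "'i \<Rightarrow> 'b \<Rightarrow> 'a::euclidean_space"
    and L\<phi> :: "'b \<Rightarrow> ('i \<Rightarrow> 'a) \<Rightarrow> 'b \<Rightarrow> 'i \<Rightarrow> 'a" and LG :: "'b \<Rightarrow> ('i \<Rightarrow> 'a) \<Rightarrow> 'b \<Rightarrow> 'b"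
    and a l F g :: "'b \<Rightarrow> real" and M gap :: real
  assumes finI: "finite I" and M: "M > 0" and gap: "gap > 0"
    and ev: "\<And>i. i \<in> I \<Longrightarrow> evolves (W i) (\<phi> i)"
    and lip: "\<And>x y. x \<in> K \<Longrightarrow> y \<in> K \<Longrightarrow> L2_set (\<lambda>i. norm (W i x - W i y)) I \<le> M * norm (x - y)"
    and app\<phi>: "\<And>i. i \<in> I \<Longrightarrow> strict_lin K (\<lambda>z x y. L\<phi> z (\<lambda>i. W i x - W i y) (x - y) i) (\<phi> i)"
    and appG: "strict_lin K (\<lambda>z x y. LG z (\<lambda>i. W i x - W i y) (x - y)) G"
    and lin\<phi>: "\<And>z i J c w v. z \<in> K \<Longrightarrow> i \<in> I \<Longrightarrow> finite (J::'b set) \<Longrightarrow>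
        L\<phi> z (\<lambda>i. \<Sum>j\<in>J. c j *\<^sub>R w j i) (\<Sum>j\<in>J. c j *\<^sub>R v j) i = (\<Sum>j\<in>J. c j *\<^sub>R L\<phi> z (w j) (v j) i)"
    and linG: "\<And>z J c w v. z \<in> K \<Longrightarrow> finite (J::'b set) \<Longrightarrow>
        LG z (\<lambda>i. \<Sum>j\<in>J. c j *\<^sub>R w j i) (\<Sum>j\<in>J. c j *\<^sub>R v j) = (\<Sum>j\<in>J. c j *\<^sub>R LG z (w j) (v j))"
    and num\<phi>: "\<And>z w v. z \<in> K \<Longrightarrow> (\<Sum>i\<in>I. w i \<bullet> L\<phi> z w v i) \<ge>
        a z * (L2_set (\<lambda>i. norm (w i)) I)\<^sup>2 - F z * M * L2_set (\<lambda>i. norm (w i)) I * norm v"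
    and numG: "\<And>z w v. z \<in> K \<Longrightarrow> v \<bullet> LG z w v \<le>
        l z * (norm v)\<^sup>2 + g z / M * L2_set (\<lambda>i. norm (w i)) I * norm v"
    and rate: "\<And>z. z \<in> K \<Longrightarrow> a z \<ge> l z + F z + g z + gap"
    and F: "\<And>z. z \<in> K \<Longrightarrow> F z \<ge> 0" and g: "\<And>z. z \<in> K \<Longrightarrow> g z \<ge> 0"
    and cont: "continuous_on K (\<lambda>z. l z + g z)"
    and z0: "z0 \<in> K" and i0: "i0 \<in> I"
  shows "strictly_diff_at K (W i0) z0"
  unfolding strictly_diff_at_def
proof (intro allI impI)
  fix \<eta> :: real assume \<eta>: "\<eta> > 0"
  define n where "n = real (card I)"
  define \<kappa> where "\<kappa> = gap / 2"
  define \<eta>' where "\<eta>' = \<eta> / M"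
  \<comment> \<open>The first entry lets half of \<open>gap\<close> absorb the error
    \<open>\<omega>\<close> in the base rate \<open>\<gamma>\<close>. The second meets the smallness
    condition of \<open>cone_escape\<close>, where the factor \<open>1 + n / M\<close> dominates the
    error of the base and that of \<open>n\<close> members divided by \<open>M\<close>.\<close>
  define \<omega> where "\<omega> = min \<kappa> (\<kappa> * \<eta>' / (4 * (1 + n / M)))"
  \<comment> \<open>Since \<open>exp x > x\<close>, this time lets
    \<open>3/4 * \<eta>'\<^sup>2\<close> grow past \<open>n\<^sup>2\<close>, the bound for
    \<open>Q T\<close> that the Lipschitz condition provides.\<close>
  define T where "T = n\<^sup>2 / (3/4 * \<eta>'\<^sup>2 * \<kappa>)"
  have n: "n \<ge> 0" and \<kappa>: "\<kappa> > 0" and \<eta>': "\<eta>' > 0"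
    using gap M \<eta> by (auto simp: n_def \<kappa>_def \<eta>'_def)
  have n1: "1 + n / M > 0" using n M by (simp add: add_pos_nonneg)
  have \<omega>: "\<omega> > 0" "\<omega> \<le> \<kappa>" using \<kappa> \<eta>' n1 by (auto simp: \<omega>_def)
  have \<omega>s: "2 * (\<omega> * (1 + n / M)) < \<kappa> * \<eta>'"
  proof -
    have "\<omega> * (1 + n / M) \<le> \<kappa> * \<eta>' / (4 * (1 + n / M)) * (1 + n / M)"
      using n1 by (intro mult_right_mono) (auto simp: \<omega>_def)
    also have "N > 0 \<Longrightarrow> p / (4 * N) * N = p / 4" for p N :: real by simp
    note this[OF n1]
    finally have "\<omega> * (1 + n / M) \<le> \<kappa> * \<eta>' / 4" .
    moreover have "0 < \<kappa> * \<eta>'" using \<kappa> \<eta>' by simp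
    ultimately show ?thesis by linarith
  qed
  have T: "T \<ge> 0" using \<kappa> \<eta>' by (simp add: T_def)
  have big: "exp (\<kappa> * T) * (3/4 * \<eta>'\<^sup>2) > n\<^sup>2"
  proof -
    have "\<kappa> * T * (3/4 * \<eta>'\<^sup>2) = n\<^sup>2" using \<kappa> \<eta>' by (simp add: T_def field_simps)
    moreover have "exp (\<kappa> * T) > \<kappa> * T" using exp_ge_add_one_self[of "\<kappa> * T"] by linarith
    hence "exp (\<kappa> * T) * (3/4 * \<eta>'\<^sup>2) > \<kappa> * T * (3/4 * \<eta>'\<^sup>2)"
      using \<eta>' by (intro mult_strict_right_mono) auto
    ultimately show ?thesis by simp
  qed
  define C where "C = \<theta> z0 ` {0..T}"
  have C: "compact C" "C \<subseteq> K" unfolding C_def using z0 compact_orbit orbit_subset by auto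
  have "\<exists>\<delta>>0. \<forall>i\<in>I. \<forall>z\<in>C. \<forall>x\<in>K \<inter> ball z \<delta>. \<forall>y\<in>K \<inter> ball z \<delta>.
      norm (\<phi> i x - \<phi> i y - L\<phi> z (\<lambda>i. W i x - W i y) (x - y) i) \<le> \<omega> * norm (x - y)"
    by (rule finite_common_radius[OF finI])
       (use app\<phi> C \<omega> in \<open>auto simp: strict_lin_def\<close>)
  then obtain \<delta>1 where \<delta>1: "\<delta>1 > 0" and ap0: "\<forall>i\<in>I. \<forall>z\<in>C. \<forall>x\<in>K \<inter> ball z \<delta>1.
      \<forall>y\<in>K \<inter> ball z \<delta>1.
      norm (\<phi> i x - \<phi> i y - L\<phi> z (\<lambda>i. W i x - W i y) (x - y) i) \<le> \<omega> * norm (x - y)"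
    by (elim exE conjE)
  have ap\<phi>: "norm (\<phi> i x - \<phi> i y - L\<phi> z (\<lambda>i. W i x - W i y) (x - y) i) \<le> \<omega> * norm (x - y)"
    if "i \<in> I" "z \<in> C" "x \<in> K" "y \<in> K" "dist z x < \<delta>1" "dist z y < \<delta>1" for i z x y
    using ap0[rule_format, of i z x y] that by simp
  obtain \<delta>2 where \<delta>2: "\<delta>2 > 0" and apG: "\<And>z x y. z \<in> C \<Longrightarrow> x \<in> K \<Longrightarrow> y \<in> K \<Longrightarrow>
      dist z x < \<delta>2 \<Longrightarrow> dist z y < \<delta>2 \<Longrightarrow>
      norm (G x - G y - LG z (\<lambda>i. W i x - W i y) (x - y)) \<le> \<omega> * norm (x - y)"
    by (rule strict_linD[OF appG C \<omega>(1)]) blast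
  \<comment> \<open>Shrunk by the crude growth factor, so that both orbits of each pair stay within
    \<open>min \<delta>1 \<delta>2\<close> of the orbit of \<open>z0\<close> up to time
    \<open>T\<close>.\<close>
  define \<delta> where "\<delta> = min \<delta>1 \<delta>2 * exp (- Lg * T)"
  have \<delta>: "\<delta> > 0" using \<delta>1 \<delta>2 by (simp add: \<delta>_def)
  have near: "dist (\<theta> z0 t) (\<theta> x t) < min \<delta>1 \<delta>2"
    if "x \<in> K" "dist z0 x < \<delta>" "t \<in> {0..T}" for x t
  proof -
    have "norm (\<theta> z0 t - \<theta> x t) \<le> exp (Lg * t) * norm (z0 - x)"
      using that z0 by (intro orbit_dist_exp) auto
    also have "\<dots> \<le> exp (Lg * T) * norm (z0 - x)"
      using that Lg by (intro mult_right_mono) (auto intro: mult_left_mono)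
    also have "\<dots> < exp (Lg * T) * \<delta>"
      using that by (intro mult_strict_left_mono) (auto simp: dist_norm)
    also have "\<dots> = min \<delta>1 \<delta>2" by (simp add: \<delta>_def exp_minus)
    finally show ?thesis by (simp add: dist_norm)
  qed
  \<comment> \<open>The rate for the distance of an individual pair. A single pair satisfies the
    Lipschitz bound for \<open>W\<close>, so the coupling \<open>g / M\<close> contributes just
    \<open>g\<close>.\<close>
  define \<gamma> where "\<gamma> t = l (\<theta> z0 t) + g (\<theta> z0 t) + \<omega>" for t
  have "continuous_on {0..T} \<gamma>"
    unfolding \<gamma>_def
    by (intro continuous_on_add continuous_on_const
        continuous_on_compose2[OF cont continuous_\<theta>[OF z0]]) (use orbit_subset[OF z0] in auto)
  then obtain \<Lambda> where \<Lambda>0: "\<Lambda> 0 = 0" and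
    d\<Lambda>: "\<And>t. t \<in> {0..T} \<Longrightarrow> (\<Lambda> has_real_derivative \<gamma> t) (at t within {0..T})"
    by (rule continuous_has_antiderivative) blast
  show "\<exists>\<delta>>0. \<forall>(J::'b set) c x y. finite J \<longrightarrow>
      (\<forall>j\<in>J. x j \<in> K \<inter> ball z0 \<delta> \<and> y j \<in> K \<inter> ball z0 \<delta>) \<longrightarrow>
      (\<Sum>j\<in>J. c j *\<^sub>R (x j - y j)) = 0 \<longrightarrow> (\<Sum>j\<in>J. \<bar>c j\<bar> * norm (x j - y j)) \<le> 1 \<longrightarrow>
      norm (\<Sum>j\<in>J. c j *\<^sub>R (W i0 (x j) - W i0 (y j))) \<le> \<eta>"
  proof (intro exI[of _ \<delta>] conjI \<delta> allI impI)
    fix J :: "'b set" and c x y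
    assume finJ: "finite J" and xy: "\<forall>j\<in>J. x j \<in> K \<inter> ball z0 \<delta> \<and> y j \<in> K \<inter> ball z0 \<delta>"
      and bary: "(\<Sum>j\<in>J. c j *\<^sub>R (x j - y j)) = 0"
      and len: "(\<Sum>j\<in>J. \<bar>c j\<bar> * norm (x j - y j)) \<le> 1"
    have xyK: "x j \<in> K" "y j \<in> K" if "j \<in> J" for j using xy that by auto
    define q where "q t i = (\<Sum>j\<in>J. c j *\<^sub>R (W i (\<theta> (x j) t) - W i (\<theta> (y j) t)))" for t i
    define q' where "q' t i = (\<Sum>j\<in>J. c j *\<^sub>R (\<phi> i (\<theta> (x j) t) - \<phi> i (\<theta> (y j) t)))" for t i
    define \<zeta> where "\<zeta> t = (\<Sum>j\<in>J. c j *\<^sub>R (\<theta> (x j) t - \<theta> (y j) t))" for t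
    define \<zeta>' where "\<zeta>' t = (\<Sum>j\<in>J. c j *\<^sub>R (G (\<theta> (x j) t) - G (\<theta> (y j) t)))" for t
    have dq: "((\<lambda>t. q t i) has_vector_derivative q' t i) (at t within {0..T})"
      if "i \<in> I" "t \<in> {0..T}" for i t
      unfolding q_def q'_def using that xyK
      by (auto intro!: derivative_eq_intros evolvesD[OF ev])
    have d\<zeta>: "(\<zeta> has_vector_derivative \<zeta>' t) (at t within {0..T})" if "t \<in> {0..T}" for t
      unfolding \<zeta>_def[abs_def] \<zeta>'_def using that xyK
      by (auto intro!: derivative_eq_intros \<theta>_derivT)
    have dist_j: "norm (\<theta> (x j) t - \<theta> (y j) t) \<le> exp (\<Lambda> t) * norm (x j - y j)"
      if j: "j \<in> J" and t: "t \<in> {0..T}" for j t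
    proof -
      have "norm (\<theta> (x j) t - \<theta> (y j) t) \<le> exp (\<Lambda> t - \<Lambda> 0) * norm (x j - y j)"
      proof (rule orbit_dist_le[OF xyK[OF j] _ _ d\<Lambda>])
        fix s assume s: "s \<in> {0..t}"
        hence sT: "s \<in> {0..T}" using t by auto
        define z where "z = \<theta> z0 s"
        have z: "z \<in> C" "z \<in> K" using sT C unfolding z_def C_def by auto
        define \<Delta> where "\<Delta> = \<theta> (x j) s - \<theta> (y j) s"
        define \<Delta>W where "\<Delta>W i = W i (\<theta> (x j) s) - W i (\<theta> (y j) s)" for i
        have K2: "\<theta> (x j) s \<in> K" "\<theta> (y j) s \<in> K" using s xyK[OF j] by (auto intro: \<theta>_in)
        have e: "norm (G (\<theta> (x j) s) - G (\<theta> (y j) s) - LG z \<Delta>W \<Delta>) \<le> \<omega> * norm \<Delta>"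
          unfolding \<Delta>_def \<Delta>W_def
          using near[of "x j" s] near[of "y j" s] xy j sT
          by (intro apG z K2) (auto simp: z_def)
        have "\<Delta> \<bullet> (G (\<theta> (x j) s) - G (\<theta> (y j) s)) =
            \<Delta> \<bullet> LG z \<Delta>W \<Delta> + \<Delta> \<bullet> (G (\<theta> (x j) s) - G (\<theta> (y j) s) - LG z \<Delta>W \<Delta>)"
          by (simp add: inner_diff_right)
        also have "\<dots> \<le> (l z * (norm \<Delta>)\<^sup>2 + g z / M * L2_set (\<lambda>i. norm (\<Delta>W i)) I * norm \<Delta>) + norm \<Delta> * (\<omega> * norm \<Delta>)"
          by (intro add_mono numG z order_trans[OF norm_cauchy_schwarz] mult_left_mono e) auto
        also have "g z / M * L2_set (\<lambda>i. norm (\<Delta>W i)) I * norm \<Delta> \<le> g z / M * (M * norm \<Delta>) * norm \<Delta>"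
          using lip[OF K2] g[OF z(2)] M unfolding \<Delta>W_def \<Delta>_def
          by (intro mult_right_mono mult_left_mono) auto
        also have "\<dots> = g z * (norm \<Delta>)\<^sup>2" using M by (simp add: power2_eq_square)
        finally have "\<Delta> \<bullet> (G (\<theta> (x j) s) - G (\<theta> (y j) s)) \<le> \<gamma> s * (norm \<Delta>)\<^sup>2"
          unfolding \<gamma>_def z_def[symmetric] by (simp add: algebra_simps power2_eq_square)
        thus "(\<theta> (x j) s - \<theta> (y j) s) \<bullet> (G (\<theta> (x j) s) - G (\<theta> (y j) s))
            \<le> \<gamma> s * (norm (\<theta> (x j) s - \<theta> (y j) s))\<^sup>2"
          unfolding \<Delta>_def .
      qed (use t in auto)
      thus ?thesis using \<Lambda>0 by simp
    qed
    have len_t: "(\<Sum>j\<in>J. \<bar>c j\<bar> * norm (\<theta> (x j) t - \<theta> (y j) t)) \<le> exp (\<Lambda> t)" if t: "t \<in> {0..T}" for t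
    proof -
      have "(\<Sum>j\<in>J. \<bar>c j\<bar> * norm (\<theta> (x j) t - \<theta> (y j) t)) \<le> (\<Sum>j\<in>J. \<bar>c j\<bar> * (exp (\<Lambda> t) * norm (x j - y j)))"
        by (intro sum_mono mult_left_mono dist_j t) auto
      also have "\<dots> = exp (\<Lambda> t) * (\<Sum>j\<in>J. \<bar>c j\<bar> * norm (x j - y j))"
        by (simp add: sum_distrib_left mult_ac)
      also have "\<dots> \<le> exp (\<Lambda> t) * 1" by (intro mult_left_mono len) auto
      finally show ?thesis by simp
    qed
    have err\<phi>: "norm (q' t i - L\<phi> (\<theta> z0 t) (q t) (\<zeta> t) i) \<le> \<omega> * exp (\<Lambda> t)"
      if t: "t \<in> {0..T}" and i: "i \<in> I" for t i
    proof -
      have z: "\<theta> z0 t \<in> C" "\<theta> z0 t \<in> K" using t C unfolding C_def by auto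
      have "q' t i - L\<phi> (\<theta> z0 t) (q t) (\<zeta> t) i = (\<Sum>j\<in>J. c j *\<^sub>R (\<phi> i (\<theta> (x j) t) - \<phi> i (\<theta> (y j) t)
          - L\<phi> (\<theta> z0 t) (\<lambda>i. W i (\<theta> (x j) t) - W i (\<theta> (y j) t)) (\<theta> (x j) t - \<theta> (y j) t) i))"
        unfolding q_def[abs_def] \<zeta>_def q'_def lin\<phi>[OF z(2) i finJ]
        by (simp add: sum_subtractf scaleR_diff_right)
      also have "norm \<dots> \<le> \<omega> * (\<Sum>j\<in>J. \<bar>c j\<bar> * norm (\<theta> (x j) t - \<theta> (y j) t))"
        using near xy t xyK
        by (intro norm_sum_scaleR_le ap\<phi> i z) (auto intro!: \<theta>_in)
      also have "\<dots> \<le> \<omega> * exp (\<Lambda> t)" using len_t[OF t] \<omega> by (intro mult_left_mono) auto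
      finally show ?thesis .
    qed
    have errG: "norm (\<zeta>' t - LG (\<theta> z0 t) (q t) (\<zeta> t)) \<le> \<omega> * exp (\<Lambda> t)"
      if t: "t \<in> {0..T}" for t
    proof -
      have z: "\<theta> z0 t \<in> C" "\<theta> z0 t \<in> K" using t C unfolding C_def by auto
      have "\<zeta>' t - LG (\<theta> z0 t) (q t) (\<zeta> t) = (\<Sum>j\<in>J. c j *\<^sub>R (G (\<theta> (x j) t) - G (\<theta> (y j) t)
          - LG (\<theta> z0 t) (\<lambda>i. W i (\<theta> (x j) t) - W i (\<theta> (y j) t)) (\<theta> (x j) t - \<theta> (y j) t)))"
        unfolding q_def[abs_def] \<zeta>_def \<zeta>'_def linG[OF z(2) finJ]
        by (simp add: sum_subtractf scaleR_diff_right)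
      also have "norm \<dots> \<le> \<omega> * (\<Sum>j\<in>J. \<bar>c j\<bar> * norm (\<theta> (x j) t - \<theta> (y j) t))"
        using near xy t xyK
        by (intro norm_sum_scaleR_le apG z) (auto intro!: \<theta>_in)
      also have "\<dots> \<le> \<omega> * exp (\<Lambda> t)" using len_t[OF t] \<omega> by (intro mult_left_mono) auto
      finally show ?thesis .
    qed
    define S where "S t = L2_set (\<lambda>i. norm (q t i)) I" for t
    have S: "S t \<ge> 0" "(\<Sum>i\<in>I. (norm (q t i))\<^sup>2) = (S t)\<^sup>2" for t
      unfolding S_def L2_set_def by (auto simp: sum_nonneg)
    have qS: "norm (q t i) \<le> S t" if "i \<in> I" for t i
      unfolding S_def using member_le_L2_set[OF finI that, of "\<lambda>i. norm (q t i)"] by simp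
    define e where "e t = exp (- \<Lambda> t)" for t
    have e: "e t > 0" "e t * exp (\<Lambda> t) = 1" for t by (auto simp: e_def exp_minus)
    define Q where "Q t = (e t / M)\<^sup>2 * (\<Sum>i\<in>I. (norm (q t i))\<^sup>2)" for t
    define Z where "Z t = (e t)\<^sup>2 * (norm (\<zeta> t))\<^sup>2" for t
    define Q' where "Q' t = (e t / M)\<^sup>2 * (\<Sum>i\<in>I. 2 * (q t i \<bullet> q' t i)) - 2 * \<gamma> t * Q t" for t
    define Z' where "Z' t = (e t)\<^sup>2 * (2 * (\<zeta> t \<bullet> \<zeta>' t)) - 2 * \<gamma> t * Z t" for t
    have de: "(e has_real_derivative - \<gamma> t * e t) (at t within {0..T})" if "t \<in> {0..T}" for t
      unfolding e_def[abs_def] using d\<Lambda>[OF that] by (auto intro!: derivative_eq_intros)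
    have dQ: "(Q has_real_derivative Q' t) (at t within {0..T})" if t: "t \<in> {0..T}" for t
    proof -
      have 1: "((\<lambda>t. \<Sum>i\<in>I. (norm (q t i))\<^sup>2) has_real_derivative (\<Sum>i\<in>I. 2 * (q t i \<bullet> q' t i))) (at t within {0..T})"
        by (intro DERIV_sum has_real_derivative_inner_self dq t)
      have 2: "((\<lambda>t. (e t / M)\<^sup>2) has_real_derivative - 2 * \<gamma> t * (e t / M)\<^sup>2) (at t within {0..T})"
        using de[OF t] M by (auto intro!: derivative_eq_intros simp: power2_eq_square field_simps)
      show ?thesis unfolding Q_def[abs_def] Q'_def
        by (rule DERIV_cong[OF DERIV_mult[OF 2 1]]) (simp add: algebra_simps)
    qed
    have dZ: "(Z has_real_derivative Z' t) (at t within {0..T})" if t: "t \<in> {0..T}" for t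
    proof -
      have 1: "((\<lambda>t. (norm (\<zeta> t))\<^sup>2) has_real_derivative (2 * (\<zeta> t \<bullet> \<zeta>' t))) (at t within {0..T})"
        by (intro has_real_derivative_inner_self d\<zeta> t)
      have 2: "((\<lambda>t. (e t)\<^sup>2) has_real_derivative - 2 * \<gamma> t * (e t)\<^sup>2) (at t within {0..T})"
        using de[OF t] M by (auto intro!: derivative_eq_intros simp: power2_eq_square field_simps)
      show ?thesis unfolding Z_def[abs_def] Z'_def
        by (rule DERIV_cong[OF DERIV_mult[OF 2 1]]) (simp add: algebra_simps)
    qed
    have Qs: "Q t = (e t / M * S t)\<^sup>2" "sqrt (Q t) = e t / M * S t" for t
    proof -
      show 1: "Q t = (e t / M * S t)\<^sup>2" by (simp add: Q_def S power_mult_distrib power_divide)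
      show "sqrt (Q t) = e t / M * S t" unfolding 1 using e(1)[of t] M S(1)[of t] by simp
    qed
    have Zs: "Z t = (e t * norm (\<zeta> t))\<^sup>2" "sqrt (Z t) = e t * norm (\<zeta> t)" for t
    proof -
      show 1: "Z t = (e t * norm (\<zeta> t))\<^sup>2" by (simp add: Z_def power_mult_distrib)
      show "sqrt (Z t) = e t * norm (\<zeta> t)" unfolding 1 using e(1)[of t] by simp
    qed
    have "Q 0 < \<eta>'\<^sup>2"
    proof (rule cone_escape[where F = "\<lambda>t. F (\<theta> z0 t)" and G = "\<lambda>t. g (\<theta> z0 t)" and C = "n\<^sup>2"
          and \<omega> = "\<omega> * (1 + n / M)" and \<kappa> = \<kappa>, OF T \<kappa> _ _ dQ dZ])
      show "0 \<le> \<omega> * (1 + n / M)" using \<omega> n1 by simp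
      show "2 * (\<omega> * (1 + n / M)) < \<kappa> * \<eta>'" by (rule \<omega>s)
      show "exp (\<kappa> * T) * (3/4 * \<eta>'\<^sup>2) > n\<^sup>2" by (rule big)
      show "Z 0 = 0" using bary xyK by (simp add: Z_def \<zeta>_def \<theta>_0)
      show "Q t \<ge> 0" "Z t \<ge> 0" for t unfolding Qs Zs by simp_all
      show "F (\<theta> z0 t) \<ge> 0" if "t \<in> {0..T}" for t using that z0 by (intro F \<theta>_in) auto
      have "S T \<le> (\<Sum>i\<in>I. norm (q T i))" unfolding S_def by (rule L2_set_le_sum) auto
      also have "\<dots> \<le> (\<Sum>i\<in>I. M * exp (\<Lambda> T))"
      proof (rule sum_mono)
        fix i assume i: "i \<in> I"
        have "norm (q T i) \<le> M * (\<Sum>j\<in>J. \<bar>c j\<bar> * norm (\<theta> (x j) T - \<theta> (y j) T))"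
          unfolding q_def
        proof (rule norm_sum_scaleR_le)
          fix j assume j: "j \<in> J"
          have K2: "\<theta> (x j) T \<in> K" "\<theta> (y j) T \<in> K" using T xyK[OF j] by (auto intro: \<theta>_in)
          show "norm (W i (\<theta> (x j) T) - W i (\<theta> (y j) T)) \<le> M * norm (\<theta> (x j) T - \<theta> (y j) T)"
            using member_le_L2_set[OF finI i, of "\<lambda>i. norm (W i (\<theta> (x j) T) - W i (\<theta> (y j) T))"] lip[OF K2]
            by simp
        qed
        also have "\<dots> \<le> M * exp (\<Lambda> T)" using len_t[of T] T M by (intro mult_left_mono) auto
        finally show "norm (q T i) \<le> M * exp (\<Lambda> T)" .
      qed
      also have "\<dots> = n * (M * exp (\<Lambda> T))" by (simp add: n_def)
      finally have "e T / M * S T \<le> e T / M * (n * (M * exp (\<Lambda> T)))"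
        using e(1)[of T] M by (intro mult_left_mono) auto
      also have "\<dots> = n" using M e(2)[of T] by (simp add: field_simps)
      finally show "Q T \<le> n\<^sup>2" unfolding Qs using e(1)[of T] M S(1)[of T] by (intro power_mono) auto
    next
      fix t assume t: "t \<in> {0..T}"
      define z where "z = \<theta> z0 t"
      have z: "z \<in> K" using t z0 unfolding z_def by (auto intro: \<theta>_in)
      have "(\<Sum>i\<in>I. q t i \<bullet> q' t i) = (\<Sum>i\<in>I. q t i \<bullet> L\<phi> z (q t) (\<zeta> t) i)
          + (\<Sum>i\<in>I. q t i \<bullet> (q' t i - L\<phi> z (q t) (\<zeta> t) i))"
        by (simp add: inner_diff_right sum_subtractf)
      moreover have "(\<Sum>i\<in>I. q t i \<bullet> L\<phi> z (q t) (\<zeta> t) i) \<ge> a z * (S t)\<^sup>2 - F z * M * S t * norm (\<zeta> t)"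
        unfolding S_def by (rule num\<phi>[OF z])
      moreover have "\<bar>\<Sum>i\<in>I. q t i \<bullet> (q' t i - L\<phi> z (q t) (\<zeta> t) i)\<bar> \<le> (\<Sum>i\<in>I. S t * (\<omega> * exp (\<Lambda> t)))"
        using err\<phi>[OF t] qS S(1)[of t] unfolding z_def
        by (intro order_trans[OF sum_abs] sum_mono order_trans[OF Cauchy_Schwarz_ineq2] mult_mono) auto
      ultimately have 1: "(\<Sum>i\<in>I. q t i \<bullet> q' t i) \<ge>
          a z * (S t)\<^sup>2 - F z * M * S t * norm (\<zeta> t) - n * (S t * (\<omega> * exp (\<Lambda> t)))"
        by (simp add: n_def)
      define X where "X = e t / M * S t"
      define Y where "Y = e t * norm (\<zeta> t)"
      have QX: "Q t = X\<^sup>2" and ZY: "Z t = Y\<^sup>2" by (simp_all only: Qs(1) Zs(1) X_def Y_def)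
      have sq: "sqrt (Q t) = X" "sqrt (Z t) = Y" by (simp_all only: Qs(2) Zs(2) X_def Y_def)
      have XY: "X \<ge> 0" "Y \<ge> 0" unfolding X_def Y_def using e(1)[of t] M S(1)[of t] by auto
      have "(e t / M)\<^sup>2 * (\<Sum>i\<in>I. q t i \<bullet> q' t i) \<ge> (e t / M)\<^sup>2 *
          (a z * (S t)\<^sup>2 - F z * M * S t * norm (\<zeta> t) - n * (S t * (\<omega> * exp (\<Lambda> t))))"
        by (rule mult_left_mono[OF 1]) simp
      also have "(e t / M)\<^sup>2 *
          (a z * (S t)\<^sup>2 - F z * M * S t * norm (\<zeta> t) - n * (S t * (\<omega> * exp (\<Lambda> t)))) =
          a z * X\<^sup>2 - F z * X * Y - (e t * exp (\<Lambda> t)) * (\<omega> * (n / M)) * X"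
        using M by (simp add: X_def Y_def power2_eq_square field_simps)
      finally have 2: "(e t / M)\<^sup>2 * (\<Sum>i\<in>I. q t i \<bullet> q' t i) \<ge> a z * X\<^sup>2 - F z * X * Y - \<omega> * (n / M) * X"
        using e(2)[of t] by simp
      have Q1: "Q' t = 2 * ((e t / M)\<^sup>2 * (\<Sum>i\<in>I. q t i \<bullet> q' t i) - \<gamma> t * X\<^sup>2)"
        unfolding Q'_def by (simp add: Qs X_def sum_distrib_left[symmetric] algebra_simps)
      have Q2: "a z * X\<^sup>2 \<ge> (F z + \<kappa> + \<gamma> t) * X\<^sup>2"
        using rate[OF z] \<omega>(2) unfolding \<gamma>_def z_def[symmetric] \<kappa>_def by (intro mult_right_mono) auto
      have Q3: "\<omega> * (n / M) * X \<le> \<omega> * (1 + n / M) * X"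
        using XY \<omega> by (intro mult_right_mono[OF mult_left_mono]) auto
      have "Q' t \<ge> 2 * ((F z + \<kappa>) * X\<^sup>2 - F z * X * Y - \<omega> * (1 + n / M) * X)"
      proof -
        have "q = 2 * (E - c * s) \<Longrightarrow> A \<ge> (f + k + c) * s \<Longrightarrow> V \<le> U \<Longrightarrow> E \<ge> A - P - V \<Longrightarrow>
           q \<ge> 2 * ((f + k) * s - P - U)" for q E c s A f k V U P :: real
          by (simp add: distrib_right)
        from this[OF Q1 Q2 Q3 2] show ?thesis .
      qed
      thus "Q' t \<ge> 2 * ((F (\<theta> z0 t) + \<kappa>) * Q t - F (\<theta> z0 t) * sqrt (Q t) * sqrt (Z t)
           - \<omega> * (1 + n / M) * sqrt (Q t))"
        unfolding sq z_def[symmetric] unfolding QX .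
      have "\<zeta> t \<bullet> \<zeta>' t = \<zeta> t \<bullet> LG z (q t) (\<zeta> t) + \<zeta> t \<bullet> (\<zeta>' t - LG z (q t) (\<zeta> t))"
        by (simp add: inner_diff_right)
      also have "\<dots> \<le> (l z * (norm (\<zeta> t))\<^sup>2 + g z / M * S t * norm (\<zeta> t)) + norm (\<zeta> t) * (\<omega> * exp (\<Lambda> t))"
        unfolding S_def using errG[OF t] unfolding z_def
        by (intro add_mono numG z[unfolded z_def] order_trans[OF norm_cauchy_schwarz] mult_left_mono) auto
      finally have "(e t)\<^sup>2 * (\<zeta> t \<bullet> \<zeta>' t) \<le> (e t)\<^sup>2 *
         ((l z * (norm (\<zeta> t))\<^sup>2 + g z / M * S t * norm (\<zeta> t)) + norm (\<zeta> t) * (\<omega> * exp (\<Lambda> t)))"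
        by (rule mult_left_mono) simp
      also have "\<dots> = l z * Y\<^sup>2 + g z * X * Y + (e t * exp (\<Lambda> t)) * \<omega> * Y"
        using M by (simp add: X_def Y_def power2_eq_square field_simps)
      finally have 3: "(e t)\<^sup>2 * (\<zeta> t \<bullet> \<zeta>' t) \<le> l z * Y\<^sup>2 + g z * X * Y + \<omega> * Y"
        using e(2)[of t] by simp
      have Z1: "Z' t = 2 * ((e t)\<^sup>2 * (\<zeta> t \<bullet> \<zeta>' t) - \<gamma> t * Y\<^sup>2)"
        unfolding Z'_def by (simp add: Zs Y_def algebra_simps)
      have Z2: "\<gamma> t * Y\<^sup>2 \<ge> (l z + g z) * Y\<^sup>2"
        using \<omega> unfolding \<gamma>_def z_def[symmetric] by (intro mult_right_mono) auto
      have Z3: "\<omega> * Y \<le> \<omega> * (1 + n / M) * Y"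
        using XY \<omega> n M mult_left_mono[of 1 "1 + n / M" \<omega>] by (intro mult_right_mono) auto
      have "Z' t \<le> 2 * (- g z * Y\<^sup>2 + g z * X * Y + \<omega> * (1 + n / M) * Y)"
      proof -
        have "q = 2 * (E - c) \<Longrightarrow> c \<ge> (f + k) * s \<Longrightarrow> V \<le> U \<Longrightarrow> E \<le> f * s + P + V \<Longrightarrow>
           q \<le> 2 * (- k * s + P + U)" for q E c s f k V U P :: real
          by (simp add: distrib_right)
        from this[OF Z1 Z2 Z3 3] show ?thesis .
      qed
      thus "Z' t \<le> 2 * (- g (\<theta> z0 t) * Z t + g (\<theta> z0 t) * sqrt (Q t) * sqrt (Z t)
           + \<omega> * (1 + n / M) * sqrt (Z t))"
        unfolding sq z_def[symmetric] unfolding ZY .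
    qed
    hence "e 0 / M * S 0 < \<eta>'" unfolding Qs using \<eta>' by (simp add: power2_less_imp_less)
    hence "S 0 < \<eta>" using \<Lambda>0 M unfolding e_def \<eta>'_def by (simp add: field_simps)
    hence "norm (q 0 i0) \<le> \<eta>" using qS[OF i0, of 0] by simp
    thus "norm (\<Sum>j\<in>J. c j *\<^sub>R (W i0 (x j) - W i0 (y j))) \<le> \<eta>"
      using xyK by (simp add: q_def \<theta>_0)
  qed
qed

end

section \<open>Continuously differentiable functions\<close>

text \<open>The direction comes first so that \<open>Dd v u\<close> is again a function of the point
  and can be differentiated further.\<close>

definition Dd :: "'b::real_normed_vector \<Rightarrow> ('b \<Rightarrow> 'a::real_normed_vector) \<Rightarrow> 'b \<Rightarrow> 'a" where
  "Dd v u z = frechet_derivative u (at z) v"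

lemma Dd_eq: "(u has_derivative u') (at z) \<Longrightarrow> Dd v u z = u' v"
  unfolding Dd_def by (metis frechet_derivative_at)

lemma has_derivative_Dd: "u differentiable (at z) \<Longrightarrow> (u has_derivative (\<lambda>v. Dd v u z)) (at z)"
  unfolding Dd_def by (simp add: frechet_derivative_works[symmetric])

lemma linear_Dd: "u differentiable (at z) \<Longrightarrow> linear (\<lambda>v. Dd v u z)"
  using has_derivative_Dd has_derivative_linear by blast

lemma Dd_eq_sum_Basis:
  fixes v :: "'b::euclidean_space"
  assumes "u differentiable (at z)"
  shows "Dd v u z = (\<Sum>b\<in>Basis. (v \<bullet> b) *\<^sub>R Dd b u z)"
proof -
  interpret linear "\<lambda>v. Dd v u z" by (rule linear_Dd[OF assms])
  have "Dd v u z = Dd (\<Sum>b\<in>Basis. (v \<bullet> b) *\<^sub>R b) u z" by (simp add: euclidean_representation)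
  also have "\<dots> = (\<Sum>b\<in>Basis. (v \<bullet> b) *\<^sub>R Dd b u z)" by (simp add: sum scaleR)
  finally show ?thesis .
qed

definition C1 :: "'b::euclidean_space set \<Rightarrow> ('b \<Rightarrow> 'a::real_normed_vector) \<Rightarrow> bool" where
  "C1 S u \<longleftrightarrow> (\<forall>z\<in>S. u differentiable (at z)) \<and> (\<forall>b\<in>Basis. continuous_on S (Dd b u))"

lemma C1D: "C1 S u \<Longrightarrow> z \<in> S \<Longrightarrow> u differentiable (at z)"
  by (simp add: C1_def)

lemma C1_continuous_Dd:
  assumes "C1 S u" shows "continuous_on S (Dd v u)"
proof -
  have "continuous_on S (\<lambda>z. \<Sum>b\<in>Basis. (v \<bullet> b) *\<^sub>R Dd b u z)"
    using assms by (intro continuous_intros) (auto simp: C1_def)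
  thus ?thesis using assms Dd_eq_sum_Basis[of u _ v]
    by (subst continuous_on_cong[OF refl, where g = "\<lambda>z. \<Sum>b\<in>Basis. (v \<bullet> b) *\<^sub>R Dd b u z"])
       (auto simp: C1_def)
qed

lemma C1I:
  assumes "\<And>z. z \<in> S \<Longrightarrow> (u has_derivative u' z) (at z)"
    and "\<And>b. b \<in> Basis \<Longrightarrow> continuous_on S (\<lambda>z. u' z b)"
  shows "C1 S u"
  unfolding C1_def
proof (intro conjI ballI)
  fix b :: 'a assume "b \<in> Basis"
  thus "continuous_on S (Dd b u)"
    using assms(2)[of b] by (subst continuous_on_cong[OF refl Dd_eq[OF assms(1)]]) auto
qed (use assms(1) in \<open>auto simp: differentiable_def\<close>)

text \<open>\<open>C\<close> thickened by a small closed ball is compact and still inside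
  \<open>K\<close>, so the finitely many partial derivatives are uniformly continuous there. Each
  receives the share \<open>\<omega> / DIM('b)\<close>.\<close>

lemma C1_Dd_near_compact:
  fixes u :: "'b::euclidean_space \<Rightarrow> 'a::euclidean_space"
  assumes "open K" and u: "C1 K u" and C: "compact C" "C \<subseteq> K" and \<omega>: "\<omega> > 0"
  obtains \<delta> where "\<delta> > 0"
    "\<And>z p. z \<in> C \<Longrightarrow> dist z p < \<delta> \<Longrightarrow> p \<in> K"
    "\<And>z p v. z \<in> C \<Longrightarrow> dist z p < \<delta> \<Longrightarrow> norm (Dd v u p - Dd v u z) \<le> \<omega> * norm v"
proof -
  obtain e where e: "e > 0" "(\<Union>x\<in>C. cball x e) \<subseteq> K"
    using compact_subset_open_imp_cball_epsilon_subset[OF C(1) assms(1) C(2)] by auto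
  define C' where "C' = {x + y |x y. x \<in> C \<and> y \<in> cball 0 e}"
  have C': "compact C'" unfolding C'_def by (intro compact_sums C compact_cball)
  have C'e: "cball z e \<subseteq> C'" if "z \<in> C" for z
  proof
    fix x assume "x \<in> cball z e"
    hence "x = z + (x - z)" "x - z \<in> cball 0 e" by (auto simp: dist_norm norm_minus_commute)
    thus "x \<in> C'" using that unfolding C'_def by blast
  qed
  have C'K: "C' \<subseteq> K"
  proof
    fix p assume "p \<in> C'"
    then obtain x y where "p = x + y" "x \<in> C" "norm y \<le> e" by (auto simp: C'_def)
    hence "p \<in> cball x e" by (simp add: dist_norm)
    thus "p \<in> K" using e \<open>x \<in> C\<close> by blast
  qed
  define \<epsilon> where "\<epsilon> = \<omega> / DIM('b)"
  have \<epsilon>: "\<epsilon> > 0" using \<omega> by (simp add: \<epsilon>_def)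
  have "\<exists>\<delta>>0. \<forall>b\<in>Basis. \<forall>x\<in>C'. \<forall>y\<in>C'. dist x y < \<delta> \<longrightarrow> norm (Dd b u x - Dd b u y) \<le> \<epsilon>"
  proof (rule finite_common_radius[OF finite_Basis])
    fix b :: 'b assume b: "b \<in> Basis"
    have "uniformly_continuous_on C' (Dd b u)"
      using u b C'K by (intro compact_uniformly_continuous C') (auto simp: C1_def intro: continuous_on_subset)
    from uniformly_continuous_onE[OF this \<epsilon>]
    obtain d where "d > 0" "\<And>x y. x \<in> C' \<Longrightarrow> y \<in> C' \<Longrightarrow> dist y x < d \<Longrightarrow> dist (Dd b u y) (Dd b u x) < \<epsilon>"
      by metis
    thus "\<exists>\<delta>>0. \<forall>x\<in>C'. \<forall>y\<in>C'. dist x y < \<delta> \<longrightarrow> norm (Dd b u x - Dd b u y) \<le> \<epsilon>"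
      by (intro exI[of _ d]) (auto simp: dist_norm intro!: less_imp_le)
  qed auto
  then obtain \<delta> where \<delta>: "\<delta> > 0" "\<And>b x y. b \<in> Basis \<Longrightarrow> x \<in> C' \<Longrightarrow> y \<in> C' \<Longrightarrow> dist x y < \<delta> \<Longrightarrow>
      norm (Dd b u x - Dd b u y) \<le> \<epsilon>"
    by metis
  show ?thesis
  proof (rule that[of "min \<delta> e"])
    show "min \<delta> e > 0" using \<delta> e by simp
    fix z p assume z: "z \<in> C" and p: "dist z p < min \<delta> e"
    hence pC: "p \<in> C'" "z \<in> C'" using C'e[OF z] e by auto
    thus pK: "p \<in> K" using C'K by auto
    have zK: "z \<in> K" using z C by auto
    fix v
    have "Dd v u p - Dd v u z = (\<Sum>b\<in>Basis. (v \<bullet> b) *\<^sub>R (Dd b u p - Dd b u z))"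
      using Dd_eq_sum_Basis[OF C1D[OF u pK], of v] Dd_eq_sum_Basis[OF C1D[OF u zK], of v]
      by (simp add: sum_subtractf scaleR_diff_right)
    also have "norm \<dots> \<le> \<epsilon> * (\<Sum>b\<in>(Basis::'b set). \<bar>v \<bullet> b\<bar> * 1)"
      using p pC by (intro norm_sum_scaleR_le) (auto intro!: \<delta>(2) simp: dist_commute)
    also have "\<dots> \<le> \<epsilon> * (\<Sum>b\<in>(Basis::'b set). norm v)"
      using \<epsilon> by (intro mult_left_mono sum_mono) (auto simp: Basis_le_norm)
    also have "\<dots> = \<omega> * norm v" by (simp add: \<epsilon>_def)
    finally show "norm (Dd v u p - Dd v u z) \<le> \<omega> * norm v" .
  qed
qed

text \<open>Mean value inequality for \<open>u\<close> minus its linear part at \<open>z\<close>: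
  the derivative of this difference is at most \<open>\<omega>\<close> on a ball whose radius is
  uniform over the compact set.\<close>

lemma C1_strict_lin:
  fixes u :: "'b::euclidean_space \<Rightarrow> 'a::euclidean_space"
  assumes K: "open K" and u: "C1 K u"
  shows "strict_lin K (\<lambda>z x y. Dd (x - y) u z) u"
  unfolding strict_lin_def
proof (intro allI impI)
  fix C and \<omega> :: real assume C: "compact C" "C \<subseteq> K" and \<omega>: "\<omega> > 0"
  obtain \<delta> where \<delta>: "\<delta> > 0"
    "\<And>z p. z \<in> C \<Longrightarrow> dist z p < \<delta> \<Longrightarrow> p \<in> K"
    "\<And>z p v. z \<in> C \<Longrightarrow> dist z p < \<delta> \<Longrightarrow> norm (Dd v u p - Dd v u z) \<le> \<omega> * norm v"
    using C1_Dd_near_compact[OF K u C \<omega>] by blast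
  show "\<exists>\<delta>>0. \<forall>z\<in>C. \<forall>x\<in>K \<inter> ball z \<delta>. \<forall>y\<in>K \<inter> ball z \<delta>. norm (u x - u y - Dd (x - y) u z) \<le> \<omega> * norm (x - y)"
  proof (intro exI[of _ \<delta>] conjI ballI \<delta>(1))
    fix z x y assume z: "z \<in> C" and x: "x \<in> K \<inter> ball z \<delta>" and y: "y \<in> K \<inter> ball z \<delta>"
    have zK: "z \<in> K" using z C by auto
    have lin: "bounded_linear (\<lambda>v. Dd v u z)"
      using linear_Dd[OF C1D[OF u zK]] by (simp add: linear_conv_bounded_linear)
    define w where "w p = u p - Dd p u z" for p
    have "norm (w x - w y) \<le> \<omega> * norm (x - y)"
    proof (rule differentiable_bound[where S = "ball z \<delta>" and f' = "\<lambda>p v. Dd v u p - Dd v u z"])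
      fix p assume p: "p \<in> ball z \<delta>"
      hence pK: "p \<in> K" using \<delta>(2)[OF z] by auto
      show "(w has_derivative (\<lambda>v. Dd v u p - Dd v u z)) (at p within ball z \<delta>)"
        unfolding w_def using has_derivative_Dd[OF C1D[OF u pK]] lin
        by (intro has_derivative_diff bounded_linear_imp_has_derivative) (auto intro: has_derivative_at_withinI)
      show "onorm (\<lambda>v. Dd v u p - Dd v u z) \<le> \<omega>" using \<delta>(3)[OF z] p by (intro onorm_le) auto
    qed (use x y in auto)
    moreover have "w x - w y = u x - u y - Dd (x - y) u z"
      using linear_diff[OF linear_Dd[OF C1D[OF u zK]], of x y] by (simp add: w_def)
    ultimately show "norm (u x - u y - Dd (x - y) u z) \<le> \<omega> * norm (x - y)" by simp
  qed
qed

text \<open>The definition is homogeneous in the coefficients, and dividing them by the total length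
  normalises that length to 1. If it is zero, every term vanishes.\<close>

lemma strictly_diff_at_scaled:
  fixes K :: "'b::euclidean_space set"
  assumes "strictly_diff_at K u z0" "\<eta> > 0"
  shows "\<exists>\<delta>>0. \<forall>(J::'b set) c x y. finite J \<longrightarrow>
      (\<forall>j\<in>J. x j \<in> K \<and> dist z0 (x j) < \<delta> \<and> y j \<in> K \<and> dist z0 (y j) < \<delta>) \<longrightarrow>
      (\<Sum>j\<in>J. c j *\<^sub>R (x j - y j)) = 0 \<longrightarrow>
      norm (\<Sum>j\<in>J. c j *\<^sub>R (u (x j) - u (y j))) \<le> \<eta> * (\<Sum>j\<in>J. \<bar>c j\<bar> * norm (x j - y j))"
proof -
  obtain \<delta> where \<delta>: "\<delta> > 0" and sd: "\<forall>(J::'b set) c x y. finite J \<longrightarrow>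
      (\<forall>j\<in>J. x j \<in> K \<inter> ball z0 \<delta> \<and> y j \<in> K \<inter> ball z0 \<delta>) \<longrightarrow>
      (\<Sum>j\<in>J. c j *\<^sub>R (x j - y j)) = 0 \<longrightarrow> (\<Sum>j\<in>J. \<bar>c j\<bar> * norm (x j - y j)) \<le> 1 \<longrightarrow>
      norm (\<Sum>j\<in>J. c j *\<^sub>R (u (x j) - u (y j))) \<le> \<eta>"
    using assms(1)[unfolded strictly_diff_at_def, rule_format, OF assms(2)] by (elim exE conjE)
  show ?thesis
  proof (intro exI[of _ \<delta>] conjI \<delta> allI impI)
    fix J :: "'b set" and c x y
    assume J: "finite J" and xy: "\<forall>j\<in>J. x j \<in> K \<and> dist z0 (x j) < \<delta> \<and> y j \<in> K \<and> dist z0 (y j) < \<delta>"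
      and b: "(\<Sum>j\<in>J. c j *\<^sub>R (x j - y j)) = 0"
    define s where "s = (\<Sum>j\<in>J. \<bar>c j\<bar> * norm (x j - y j))"
    have s0: "s \<ge> 0" by (simp add: s_def sum_nonneg)
    have "norm (\<Sum>j\<in>J. c j *\<^sub>R (u (x j) - u (y j))) \<le> \<eta> * s"
    proof (cases "s = 0")
      case True
      hence "\<forall>j\<in>J. \<bar>c j\<bar> * norm (x j - y j) = 0"
        unfolding s_def by (subst (asm) sum_nonneg_eq_0_iff) (auto simp: J)
      hence "(\<Sum>j\<in>J. c j *\<^sub>R (u (x j) - u (y j))) = 0" by (intro sum.neutral) auto
      thus ?thesis using s0 assms(2) by simp
    next
      case False
      hence s: "s > 0" using s0 by simp
      have sc: "(\<Sum>j\<in>J. (c j / s) *\<^sub>R p j) = (1 / s) *\<^sub>R (\<Sum>j\<in>J. c j *\<^sub>R p j)" for p :: "'b \<Rightarrow> 'c::real_vector"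
        by (simp add: scaleR_sum_right)
      have "(\<Sum>j\<in>J. \<bar>c j / s\<bar> * norm (x j - y j)) = (\<Sum>j\<in>J. \<bar>c j\<bar> * norm (x j - y j)) / s"
        using s by (simp add: sum_divide_distrib)
      also have "\<dots> = 1" using s by (simp add: s_def[symmetric])
      finally have "(\<Sum>j\<in>J. \<bar>c j / s\<bar> * norm (x j - y j)) = 1" .
      moreover have "(\<Sum>j\<in>J. (c j / s) *\<^sub>R (x j - y j)) = 0"
        unfolding sc b by simp
      ultimately have "norm (\<Sum>j\<in>J. (c j / s) *\<^sub>R (u (x j) - u (y j))) \<le> \<eta>"
        using sd[rule_format, of J x y "\<lambda>j. c j / s"] J xy s by auto
      thus ?thesis unfolding sc using s by (simp add: field_simps)
    qed
    thus "norm (\<Sum>j\<in>J. c j *\<^sub>R (u (x j) - u (y j))) \<le> \<eta> * (\<Sum>j\<in>J. \<bar>c j\<bar> * norm (x j - y j))"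
      by (simp add: s_def)
  qed
qed

text \<open>Each assertion is one choice of pairs. Two difference quotients in the same direction,
  with different points and step sizes, give the Cauchy property and the continuity of the limit.
  The increment from \<open>z\<close> to \<open>y\<close> against one quotient for each basis vector
  gives the Frechet derivative.\<close>

lemma strictly_diff_imp_C1:
  fixes u :: "'b::euclidean_space \<Rightarrow> 'a::euclidean_space"
  assumes K: "open K" and sd: "\<And>z. z \<in> K \<Longrightarrow> strictly_diff_at K u z"
  shows "C1 K u"
proof -
  define e where "e n = inverse (real (Suc n))" for n
  have e: "e n > 0" "e \<longlonglongrightarrow> 0" for n
    unfolding e_def by (simp, rule LIMSEQ_inverse_real_of_nat)
  define quot where "quot b z n = (1 / e n) *\<^sub>R (u (z + e n *\<^sub>R b) - u z)" for b z n
  have near: "\<forall>\<^sub>F n in sequentially. z + e n *\<^sub>R b \<in> V" if "open V" "z \<in> V" for z b :: 'b and V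
  proof -
    have "(\<lambda>n. z + e n *\<^sub>R b) \<longlonglongrightarrow> z + 0 *\<^sub>R b" by (intro tendsto_intros e)
    thus ?thesis using that by (simp add: topological_tendstoD)
  qed
  have two: "\<exists>\<delta>>0. \<forall>x y \<epsilon> \<epsilon>'. \<epsilon> > 0 \<longrightarrow> \<epsilon>' > 0 \<longrightarrow> {x, y, x + \<epsilon> *\<^sub>R b, y + \<epsilon>' *\<^sub>R b} \<subseteq> K \<inter> ball z \<delta> \<longrightarrow>
     norm ((1/\<epsilon>) *\<^sub>R (u (x + \<epsilon> *\<^sub>R b) - u x) - (1/\<epsilon>') *\<^sub>R (u (y + \<epsilon>' *\<^sub>R b) - u y)) \<le> \<eta>"
    if z: "z \<in> K" and b: "b \<in> Basis" and \<eta>: "\<eta> > 0" for z b \<eta>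
  proof -
    have "\<eta> / 2 > 0" using \<eta> by simp
    from strictly_diff_at_scaled[OF sd[OF z] this]
    obtain \<delta> where \<delta>: "\<delta> > 0" and h: "\<forall>(J::'b set) c x y. finite J \<longrightarrow>
      (\<forall>j\<in>J. x j \<in> K \<and> dist z (x j) < \<delta> \<and> y j \<in> K \<and> dist z (y j) < \<delta>) \<longrightarrow>
      (\<Sum>j\<in>J. c j *\<^sub>R (x j - y j)) = 0 \<longrightarrow>
      norm (\<Sum>j\<in>J. c j *\<^sub>R (u (x j) - u (y j))) \<le> \<eta> / 2 * (\<Sum>j\<in>J. \<bar>c j\<bar> * norm (x j - y j))"
      by (elim exE conjE)
    show ?thesis
    proof (intro exI[of _ \<delta>] conjI \<delta> allI impI)
      fix x y \<epsilon> \<epsilon>' assume p: "\<epsilon> > (0::real)" "\<epsilon>' > (0::real)"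
        and sub: "{x, y, x + \<epsilon> *\<^sub>R b, y + \<epsilon>' *\<^sub>R b} \<subseteq> K \<inter> ball z \<delta>"
      have b0: "0 \<noteq> b" using b by auto
      \<comment> \<open>Indices are points of the space; \<open>0\<close> and \<open>b\<close> serve
        as two labels. The weights make the combination \<open>b - b = 0\<close> and its total
        length 2, which explains \<open>\<eta> / 2\<close>.\<close>
      have "norm (\<Sum>j\<in>{0,b}. (if j = 0 then 1/\<epsilon> else - 1/\<epsilon>') *\<^sub>R
           (u (if j = 0 then x + \<epsilon> *\<^sub>R b else y + \<epsilon>' *\<^sub>R b) - u (if j = 0 then x else y)))
         \<le> \<eta> / 2 * (\<Sum>j\<in>{0,b}. \<bar>if j = 0 then 1/\<epsilon> else - 1/\<epsilon>'\<bar> *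
            norm ((if j = 0 then x + \<epsilon> *\<^sub>R b else y + \<epsilon>' *\<^sub>R b) - (if j = 0 then x else y)))"
        by (rule h[rule_format]) (use sub b0 p in auto)
      thus "norm ((1/\<epsilon>) *\<^sub>R (u (x + \<epsilon> *\<^sub>R b) - u x) - (1/\<epsilon>') *\<^sub>R (u (y + \<epsilon>' *\<^sub>R b) - u y)) \<le> \<eta>"
        using b0 b p by simp
    qed
  qed
  define d where "d b z = lim (quot b z)" for b z
  have d: "quot b z \<longlonglongrightarrow> d b z" if z: "z \<in> K" and b: "b \<in> Basis" for b z
  proof -
    have "Cauchy (quot b z)"
    proof (rule metric_CauchyI)
      fix \<eta> :: real assume \<eta>: "\<eta> > 0"
      hence "\<eta> / 2 > 0" by simp
      from two[OF z b this] obtain \<delta> where \<delta>: "\<delta> > 0" and t: "\<forall>x y \<epsilon> \<epsilon>'. \<epsilon> > 0 \<longrightarrow> \<epsilon>' > 0 \<longrightarrow>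
         {x, y, x + \<epsilon> *\<^sub>R b, y + \<epsilon>' *\<^sub>R b} \<subseteq> K \<inter> ball z \<delta> \<longrightarrow>
         norm ((1/\<epsilon>) *\<^sub>R (u (x + \<epsilon> *\<^sub>R b) - u x) - (1/\<epsilon>') *\<^sub>R (u (y + \<epsilon>' *\<^sub>R b) - u y)) \<le> \<eta> / 2"
        by (elim exE conjE)
      obtain N where N: "\<And>n. n \<ge> N \<Longrightarrow> z + e n *\<^sub>R b \<in> K \<inter> ball z \<delta>"
        using near[of "K \<inter> ball z \<delta>" z b] z \<delta> K by (auto simp: eventually_sequentially)
      show "\<exists>M. \<forall>m\<ge>M. \<forall>n\<ge>M. dist (quot b z m) (quot b z n) < \<eta>"
      proof (intro exI[of _ N] allI impI)
        fix m n assume "m \<ge> N" "n \<ge> N"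
        hence "norm (quot b z m - quot b z n) \<le> \<eta> / 2"
          unfolding quot_def using N z \<delta> e(1) by (intro t[rule_format]) auto
        thus "dist (quot b z m) (quot b z n) < \<eta>" using \<eta> by (simp add: dist_norm)
      qed
    qed
    thus ?thesis unfolding d_def by (simp add: Cauchy_convergent_iff convergent_LIMSEQ_iff)
  qed
  have cont: "continuous_on K (d b)" if b: "b \<in> Basis" for b
    unfolding continuous_on_iff
  proof (intro ballI allI impI)
    fix z and \<eta> :: real assume z: "z \<in> K" and \<eta>: "\<eta> > 0"
    hence "\<eta> / 2 > 0" by simp
    from two[OF z b this] obtain \<delta> where \<delta>: "\<delta> > 0" and t: "\<forall>x y \<epsilon> \<epsilon>'. \<epsilon> > 0 \<longrightarrow> \<epsilon>' > 0 \<longrightarrow>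
       {x, y, x + \<epsilon> *\<^sub>R b, y + \<epsilon>' *\<^sub>R b} \<subseteq> K \<inter> ball z \<delta> \<longrightarrow>
       norm ((1/\<epsilon>) *\<^sub>R (u (x + \<epsilon> *\<^sub>R b) - u x) - (1/\<epsilon>') *\<^sub>R (u (y + \<epsilon>' *\<^sub>R b) - u y)) \<le> \<eta> / 2"
      by (elim exE conjE)
    show "\<exists>\<delta>>0. \<forall>x\<in>K. dist x z < \<delta> \<longrightarrow> dist (d b x) (d b z) < \<eta>"
    proof (intro exI[of _ \<delta>] conjI \<delta> ballI impI)
      fix x assume x: "x \<in> K" "dist x z < \<delta>"
      have "(\<lambda>n. norm (quot b x n - quot b z n)) \<longlonglongrightarrow> norm (d b x - d b z)"
        by (intro tendsto_intros d x z b)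
      moreover have "\<forall>\<^sub>F n in sequentially. z + e n *\<^sub>R b \<in> K \<inter> ball z \<delta>"
        "\<forall>\<^sub>F n in sequentially. x + e n *\<^sub>R b \<in> K \<inter> ball z \<delta>"
        by (rule near; use x z \<delta> K in \<open>auto simp: dist_commute\<close>)+
      hence "\<forall>\<^sub>F n in sequentially. norm (quot b x n - quot b z n) \<le> \<eta> / 2"
      proof eventually_elim
        case (elim n)
        thus ?case unfolding quot_def using x z \<delta> e(1) by (intro t[rule_format]) (auto simp: dist_commute)
      qed
      ultimately have "norm (d b x - d b z) \<le> \<eta> / 2" by (rule tendsto_upperbound) simp
      thus "dist (d b x) (d b z) < \<eta>" using \<eta> by (simp add: dist_norm)
    qed
  qed
  have der: "(u has_derivative (\<lambda>v. \<Sum>b\<in>Basis. (v \<bullet> b) *\<^sub>R d b z)) (at z)" if z: "z \<in> K" for z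
    unfolding has_derivative_at_alt
  proof (intro conjI allI impI)
    show "bounded_linear (\<lambda>v. \<Sum>b\<in>Basis. (v \<bullet> b) *\<^sub>R d b z)"
      by (intro bounded_linear_sum bounded_linear_scaleR_const bounded_linear_inner_left)
    fix \<epsilon> :: real assume \<epsilon>: "\<epsilon> > 0"
    \<comment> \<open>The combination below has length at most
      \<open>(1 + DIM('b)) * norm w\<close>: label \<open>0\<close> carries the increment
      \<open>w\<close> itself, and each basis label \<open>b\<close> carries a quotient in direction
      \<open>b\<close> weighted by the coordinate \<open>w \<bullet> b\<close>.\<close>
    define \<eta> where "\<eta> = \<epsilon> / (1 + DIM('b))"
    have \<eta>: "\<eta> > 0" using \<epsilon> by (simp add: \<eta>_def)
    from strictly_diff_at_scaled[OF sd[OF z] this]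
    obtain \<delta> where \<delta>: "\<delta> > 0" and h: "\<forall>(J::'b set) c x y. finite J \<longrightarrow>
      (\<forall>j\<in>J. x j \<in> K \<and> dist z (x j) < \<delta> \<and> y j \<in> K \<and> dist z (y j) < \<delta>) \<longrightarrow>
      (\<Sum>j\<in>J. c j *\<^sub>R (x j - y j)) = 0 \<longrightarrow>
      norm (\<Sum>j\<in>J. c j *\<^sub>R (u (x j) - u (y j))) \<le> \<eta> * (\<Sum>j\<in>J. \<bar>c j\<bar> * norm (x j - y j))"
      by (elim exE conjE)
    obtain \<delta>' where \<delta>': "\<delta>' > 0" "ball z \<delta>' \<subseteq> K" using K z open_contains_ball by blast
    show "\<exists>\<rho>>0. \<forall>y. norm (y - z) < \<rho> \<longrightarrow>
        norm (u y - u z - (\<Sum>b\<in>Basis. ((y - z) \<bullet> b) *\<^sub>R d b z)) \<le> \<epsilon> * norm (y - z)"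
    proof (intro exI[of _ "min \<delta> \<delta>'"] conjI allI impI)
      show "min \<delta> \<delta>' > 0" using \<delta> \<delta>' by simp
      fix y assume y: "norm (y - z) < min \<delta> \<delta>'"
      hence yK: "y \<in> K" using \<delta>' by (auto simp: dist_norm norm_minus_commute)
      define w where "w = y - z"
      have "(\<lambda>n. norm (u y - u z - (\<Sum>b\<in>Basis. (w \<bullet> b) *\<^sub>R quot b z n))) \<longlonglongrightarrow>
          norm (u y - u z - (\<Sum>b\<in>Basis. (w \<bullet> b) *\<^sub>R d b z))"
        by (intro tendsto_intros d z)
      moreover have "\<forall>\<^sub>F n in sequentially.
          norm (u y - u z - (\<Sum>b\<in>Basis. (w \<bullet> b) *\<^sub>R quot b z n)) \<le> \<epsilon> * norm w"
      proof -
        have "\<forall>\<^sub>F n in sequentially. \<forall>b\<in>Basis. z + e n *\<^sub>R b \<in> K \<inter> ball z \<delta>"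
          using z \<delta> K by (intro eventually_ball_finite ballI near) auto
        thus ?thesis
        proof eventually_elim
          case (elim n)
          define x' where "x' j = (if j = 0 then y else z + e n *\<^sub>R j)" for j
          define c where "c j = (if j = 0 then 1 else - (w \<bullet> j) / e n)" for j
          have ne: "b \<noteq> 0" if "b \<in> Basis" for b :: 'b using that by auto
          have split: "(\<Sum>j\<in>insert 0 Basis. p j) = p 0 + (\<Sum>j\<in>Basis. p j)" for p :: "'b \<Rightarrow> 'q::comm_monoid_add"
            by (rule sum.insert) auto
          have "(\<Sum>j\<in>Basis. c j *\<^sub>R (x' j - z)) = (\<Sum>j\<in>Basis. - ((w \<bullet> j) *\<^sub>R j))"
            using e(1)[of n] ne by (intro sum.cong) (auto simp: c_def x'_def)
          hence bary: "(\<Sum>j\<in>insert 0 Basis. c j *\<^sub>R (x' j - z)) = 0"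
            unfolding split by (simp add: sum_negf euclidean_representation) (simp add: c_def x'_def w_def)
          have "norm (\<Sum>j\<in>insert 0 Basis. c j *\<^sub>R (u (x' j) - u z))
              \<le> \<eta> * (\<Sum>j\<in>insert 0 Basis. \<bar>c j\<bar> * norm (x' j - z))"
            by (rule h[rule_format, of _ x' "\<lambda>_. z" c, OF _ _ bary])
               (use elim z y yK \<delta> in \<open>auto simp: x'_def dist_norm norm_minus_commute\<close>)
          moreover have "(\<Sum>j\<in>Basis. c j *\<^sub>R (u (x' j) - u z)) = - (\<Sum>b\<in>Basis. (w \<bullet> b) *\<^sub>R quot b z n)"
            unfolding sum_negf[symmetric]
            by (intro sum.cong) (use ne in \<open>auto simp: c_def x'_def quot_def\<close>)
          moreover have "(\<Sum>j\<in>Basis. \<bar>c j\<bar> * norm (x' j - z)) \<le> (\<Sum>j\<in>(Basis::'b set). norm w)"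
          proof (rule sum_mono)
            fix b :: 'b assume b: "b \<in> Basis"
            show "\<bar>c b\<bar> * norm (x' b - z) \<le> norm w"
              using e(1)[of n] ne[OF b] Basis_le_norm[OF b, of w] b by (auto simp: c_def x'_def)
          qed
          hence "\<eta> * (norm w + (\<Sum>j\<in>Basis. \<bar>c j\<bar> * norm (x' j - z))) \<le> \<eta> * (norm w + (\<Sum>j\<in>(Basis::'b set). norm w))"
            using \<eta> by simp
          moreover have "\<eta> * (norm w + (\<Sum>j\<in>(Basis::'b set). norm w)) = \<epsilon> * norm w"
          proof -
            have "\<eta> * (norm w + (\<Sum>j\<in>(Basis::'b set). norm w)) = (\<eta> * (1 + DIM('b))) * norm w"
              by (simp add: algebra_simps)
            thus ?thesis by (simp add: \<eta>_def add_pos_nonneg order_less_imp_not_eq2)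
          qed
          ultimately show ?case unfolding split
            by (simp add: c_def x'_def w_def[symmetric])
        qed
      qed
      ultimately have "norm (u y - u z - (\<Sum>b\<in>Basis. (w \<bullet> b) *\<^sub>R d b z)) \<le> \<epsilon> * norm w"
        by (rule tendsto_upperbound) simp
      thus "norm (u y - u z - (\<Sum>b\<in>Basis. ((y - z) \<bullet> b) *\<^sub>R d b z)) \<le> \<epsilon> * norm (y - z)"
        by (simp add: w_def)
    qed
  qed
  show ?thesis
  proof (rule C1I[OF der])
    fix b :: 'b assume b: "b \<in> Basis"
    have "(\<Sum>b'\<in>Basis. (b \<bullet> b') *\<^sub>R d b' z) = d b z" for z
    proof -
      have "(\<Sum>b'\<in>Basis. (b \<bullet> b') *\<^sub>R d b' z) = (\<Sum>b'\<in>Basis. if b' = b then d b' z else 0)"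
        by (intro sum.cong) (auto simp: inner_Basis b)
      thus ?thesis using b by simp
    qed
    thus "continuous_on K (\<lambda>z. \<Sum>b'\<in>Basis. (b \<bullet> b') *\<^sub>R d b' z)" using cont[OF b] by simp
  qed
qed

section \<open>Bounded iterated derivatives\<close>

primrec nder :: "'b list \<Rightarrow> ('b::real_normed_vector \<Rightarrow> 'a::real_normed_vector) \<Rightarrow> 'b \<Rightarrow> 'a" where
  "nder [] u = u"
| "nder (b # bs) u = Dd b (nder bs u)"

lemma nder_snoc: "nder (bs @ [b]) u = nder bs (Dd b u)"
  by (induction bs) auto

text \<open>\<open>C^N\<close> with bounded derivatives, the function itself included. Only basis
  directions occur, so boundedness concerns finitely many functions.\<close>

definition CB :: "nat \<Rightarrow> 'b::euclidean_space set \<Rightarrow> ('b \<Rightarrow> 'a::real_normed_vector) \<Rightarrow> bool" where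
  "CB N S u \<longleftrightarrow> (\<forall>bs. set bs \<subseteq> Basis \<longrightarrow> length bs \<le> N \<longrightarrow>
     (length bs < N \<longrightarrow> (\<forall>z\<in>S. nder bs u differentiable (at z))) \<and>
     continuous_on S (nder bs u) \<and> bounded (nder bs u ` S))"

lemma CB_mono: "CB N S u \<Longrightarrow> M \<le> N \<Longrightarrow> CB M S u"
  unfolding CB_def by (meson le_trans less_le_trans)

lemma CB_continuous: "CB N S u \<Longrightarrow> continuous_on S u"
  and CB_bounded: "CB N S u \<Longrightarrow> bounded (u ` S)"
  unfolding CB_def by (metis empty_subsetI le0 list.set(1) list.size(3) nder.simps(1))+

lemma CB_differentiable: "CB (Suc N) S u \<Longrightarrow> z \<in> S \<Longrightarrow> u differentiable (at z)"
  unfolding CB_def by (metis empty_subsetI le0 list.set(1) list.size(3) nder.simps(1) zero_less_Suc)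

lemma CB_0: "CB 0 S u \<longleftrightarrow> continuous_on S u \<and> bounded (u ` S)"
  unfolding CB_def by auto

text \<open>Peels off the derivative taken first, which is the last entry of the list. Inductions on
  \<open>N\<close> can then generalise over the function and need not mention lists.\<close>

lemma CB_Suc:
  "CB (Suc N) S u \<longleftrightarrow> (\<forall>z\<in>S. u differentiable (at z)) \<and> bounded (u ` S) \<and> (\<forall>b\<in>Basis. CB N S (Dd b u))"
proof
  assume L: "CB (Suc N) S u"
  have "CB N S (Dd b u)" if "b \<in> Basis" for b
    unfolding CB_def nder_snoc[symmetric]
  proof (intro allI impI)
    fix bs :: "'a list" assume "set bs \<subseteq> Basis" "length bs \<le> N"
    thus "(length bs < N \<longrightarrow> (\<forall>z\<in>S. nder (bs @ [b]) u differentiable (at z))) \<and>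
       continuous_on S (nder (bs @ [b]) u) \<and> bounded (nder (bs @ [b]) u ` S)"
      using L[unfolded CB_def, rule_format, of "bs @ [b]"] that by auto
  qed
  thus "(\<forall>z\<in>S. u differentiable (at z)) \<and> bounded (u ` S) \<and> (\<forall>b\<in>Basis. CB N S (Dd b u))"
    using CB_differentiable[OF L] CB_bounded[OF L] by blast
next
  assume R: "(\<forall>z\<in>S. u differentiable (at z)) \<and> bounded (u ` S) \<and> (\<forall>b\<in>Basis. CB N S (Dd b u))"
  have cont: "continuous_on S u"
    using R by (meson continuous_at_imp_continuous_on differentiable_imp_continuous_within)
  show "CB (Suc N) S u"
    unfolding CB_def
  proof (intro allI impI)
    fix bs :: "'a list" assume bs: "set bs \<subseteq> Basis" "length bs \<le> Suc N"
    show "(length bs < Suc N \<longrightarrow> (\<forall>z\<in>S. nder bs u differentiable (at z))) \<and>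
       continuous_on S (nder bs u) \<and> bounded (nder bs u ` S)"
    proof (cases bs rule: rev_cases)
      case Nil
      thus ?thesis using R cont by simp
    next
      case (snoc as b)
      hence "CB N S (Dd b u)" using R bs by auto
      from this[unfolded CB_def, rule_format, of as] show ?thesis
        using bs snoc by (auto simp: nder_snoc)
    qed
  qed
qed

lemma CB_Suc_nder:
  assumes "\<And>b. b \<in> Basis \<Longrightarrow> CB N S (Dd b u)" "set bs \<subseteq> Basis" "bs \<noteq> []" "length bs \<le> Suc N"
  shows "CB (Suc N - length bs) S (nder bs u)"
proof -
  obtain as b where bs: "bs = as @ [b]" using assms(3) by (cases bs rule: rev_cases) auto
  have app: "nder cs (nder as v) = nder (cs @ as) v" for cs and v :: "'a \<Rightarrow> 'b" by (induction cs) auto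
  have C: "CB N S (Dd b u)" using assms bs by auto
  show ?thesis unfolding bs nder_snoc CB_def app
  proof (intro allI impI)
    fix cs :: "'a list" assume "set cs \<subseteq> Basis" "length cs \<le> Suc N - length (as @ [b])"
    thus "(length cs < Suc N - length (as @ [b]) \<longrightarrow> (\<forall>z\<in>S. nder (cs @ as) (Dd b u) differentiable (at z))) \<and>
       continuous_on S (nder (cs @ as) (Dd b u)) \<and> bounded (nder (cs @ as) (Dd b u) ` S)"
      using C[unfolded CB_def, rule_format, of "cs @ as"] assms(2,4) bs by auto
  qed
qed

lemma CB_1_C1: "CB (Suc N) S u \<Longrightarrow> C1 S u"
  unfolding C1_def CB_Suc using CB_continuous by blast

lemma C1_CB_1:
  assumes "C1 S u" "bounded (u ` S)" "\<And>b. b \<in> Basis \<Longrightarrow> bounded (Dd b u ` S)"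
  shows "CB 1 S u"
  using assms unfolding C1_def One_nat_def CB_Suc CB_0 by auto

lemma Dd_cong:
  assumes "open S" "z \<in> S" "\<And>x. x \<in> S \<Longrightarrow> u x = w x"
  shows "Dd b u z = Dd b w z" "u differentiable (at z) \<longleftrightarrow> w differentiable (at z)"
proof -
  have *: "(u has_derivative D) (at z) \<longleftrightarrow> (w has_derivative D) (at z)" for D
    using has_derivative_transform_within_open[of u D z UNIV S w]
      has_derivative_transform_within_open[of w D z UNIV S u] assms by auto
  show "Dd b u z = Dd b w z" unfolding Dd_def frechet_derivative_def * ..
  show "u differentiable (at z) \<longleftrightarrow> w differentiable (at z)" unfolding differentiable_def * ..
qed

lemma CB_cong:
  assumes "open S" "\<And>x. x \<in> S \<Longrightarrow> u x = w x"
  shows "CB N S u \<longleftrightarrow> CB N S w"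
  using assms(2)
proof (induction N arbitrary: u w)
  case 0
  thus ?case unfolding CB_0 by (metis continuous_on_cong image_cong)
next
  case (Suc N)
  have "CB N S (Dd b u) \<longleftrightarrow> CB N S (Dd b w)" for b
    using Dd_cong(1)[OF assms(1), of _ u w b] Suc.prems by (intro Suc.IH) auto
  moreover have "u ` S = w ` S" using Suc.prems by auto
  ultimately show ?case unfolding CB_Suc
    using Dd_cong(2)[OF assms(1), of _ u w] Suc.prems by auto
qed

lemma CB_SucI:
  assumes "open S" "bounded (u ` S)" "\<And>z. z \<in> S \<Longrightarrow> (u has_derivative u' z) (at z)"
    "\<And>b. b \<in> Basis \<Longrightarrow> CB N S (\<lambda>z. u' z b)"
  shows "CB (Suc N) S u"
  unfolding CB_Suc
proof (intro conjI ballI)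
  fix b :: 'a assume "b \<in> Basis"
  thus "CB N S (Dd b u)"
    using CB_cong[OF assms(1), of "Dd b u" "\<lambda>z. u' z b"] assms(3,4) by (auto simp: Dd_eq)
qed (use assms in \<open>auto simp: differentiable_def\<close>)

lemma CB_const:
  fixes S :: "'b::euclidean_space set" and c :: "'a::real_normed_vector"
  shows "CB N S (\<lambda>_. c)"
proof (induction N arbitrary: c)
  case 0 thus ?case by (auto simp: CB_0 image_constant_conv)
next
  case (Suc N)
  have "Dd b (\<lambda>_::'b. c) = (\<lambda>_. 0)" for b by (rule ext) (auto intro: Dd_eq)
  thus ?case using Suc[of 0] unfolding CB_Suc by (auto simp: image_constant_conv)
qed

lemma CB_linear:
  assumes "open S" "bounded_linear T" "CB N S u"
  shows "CB N S (\<lambda>z. T (u z))"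
  using assms(3)
proof (induction N arbitrary: u)
  case 0
  have "bounded (T ` (u ` S))" using 0 bounded_linear_image[OF _ assms(2), of "u ` S"] by (simp add: CB_0)
  moreover have "continuous_on S (\<lambda>z. T (u z))"
    using 0 by (intro bounded_linear.continuous_on[OF assms(2)]) (simp add: CB_0)
  ultimately show ?case by (simp add: CB_0 image_image)
next
  case (Suc N)
  show ?case
  proof (rule CB_SucI[OF assms(1)])
    show "bounded ((\<lambda>z. T (u z)) ` S)"
      using bounded_linear_image[OF CB_bounded[OF Suc.prems] assms(2)] by (simp add: image_image)
    show "((\<lambda>z. T (u z)) has_derivative (\<lambda>v. T (Dd v u z))) (at z)" if "z \<in> S" for z
      by (rule bounded_linear.has_derivative[OF assms(2) has_derivative_Dd[OF CB_differentiable[OF Suc.prems that]]])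
    show "CB N S (\<lambda>z. T (Dd b u z))" if "b \<in> Basis" for b
      using Suc.prems that by (intro Suc.IH) (simp add: CB_Suc)
  qed
qed

lemma CB_add:
  assumes "open S" "CB N S u" "CB N S w"
  shows "CB N S (\<lambda>z. u z + w z)"
  using assms(2,3)
proof (induction N arbitrary: u w)
  case 0
  thus ?case by (auto simp: CB_0 intro!: continuous_intros bounded_plus_comp)
next
  case (Suc N)
  show ?case
  proof (rule CB_SucI[OF assms(1)])
    show "bounded ((\<lambda>z. u z + w z) ` S)"
      using Suc.prems by (intro bounded_plus_comp CB_bounded)
    show "((\<lambda>z. u z + w z) has_derivative (\<lambda>v. Dd v u z + Dd v w z)) (at z)" if "z \<in> S" for z
      using Suc.prems that by (intro has_derivative_add has_derivative_Dd CB_differentiable)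
    show "CB N S (\<lambda>z. Dd b u z + Dd b w z)" if "b \<in> Basis" for b
      using Suc.prems that by (intro Suc.IH) (simp_all add: CB_Suc)
  qed
qed

lemma CB_minus: "open S \<Longrightarrow> CB N S u \<Longrightarrow> CB N S (\<lambda>z. - u z)"
  by (rule CB_linear[OF _ bounded_linear_minus[OF bounded_linear_ident]])

lemma CB_diff: "open S \<Longrightarrow> CB N S u \<Longrightarrow> CB N S w \<Longrightarrow> CB N S (\<lambda>z. u z - w z)"
  using CB_add[OF _ _ CB_minus, of S N u w] by simp

lemma CB_sum:
  assumes "open S" "\<And>i. i \<in> A \<Longrightarrow> CB N S (u i)"
  shows "CB N S (\<lambda>z. \<Sum>i\<in>A. u i z)"
  using assms(2)
  by (induction A rule: infinite_finite_induct) (auto intro: CB_const CB_add[OF assms(1)])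

lemma bounded_scaleR_comp:
  fixes u :: "'c \<Rightarrow> real" and w :: "'c \<Rightarrow> 'a::real_normed_vector"
  assumes "bounded (u ` S)" "bounded (w ` S)"
  shows "bounded ((\<lambda>z. u z *\<^sub>R w z) ` S)"
proof -
  obtain B C where B: "\<And>z. z \<in> S \<Longrightarrow> norm (u z) \<le> B" and C: "\<And>z. z \<in> S \<Longrightarrow> norm (w z) \<le> C"
    using assms unfolding bounded_iff by auto
  have "norm (u z *\<^sub>R w z) \<le> B * C" if "z \<in> S" for z
    unfolding norm_scaleR
    using B[OF that] C[OF that] order_trans[OF norm_ge_zero B[OF that]] by (intro mult_mono) auto
  thus ?thesis unfolding bounded_iff by blast
qed

lemma CB_scaleR:
  fixes u :: "'b::euclidean_space \<Rightarrow> real"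
  assumes "open S" "CB N S u" "CB N S w"
  shows "CB N S (\<lambda>z. u z *\<^sub>R w z)"
  using assms(2,3)
proof (induction N arbitrary: u w)
  case 0
  thus ?case by (auto simp: CB_0 intro!: continuous_intros bounded_scaleR_comp)
next
  case (Suc N)
  show ?case
  proof (rule CB_SucI[OF assms(1)])
    show "bounded ((\<lambda>z. u z *\<^sub>R w z) ` S)"
      using Suc.prems by (intro bounded_scaleR_comp CB_bounded)
    show "((\<lambda>z. u z *\<^sub>R w z) has_derivative (\<lambda>v. u z *\<^sub>R Dd v w z + Dd v u z *\<^sub>R w z)) (at z)" if "z \<in> S" for z
      using Suc.prems that by (intro has_derivative_scaleR has_derivative_Dd CB_differentiable)
    show "CB N S (\<lambda>z. u z *\<^sub>R Dd b w z + Dd b u z *\<^sub>R w z)" if "b \<in> Basis" for b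
      using Suc.prems that CB_mono[OF Suc.prems(1), of N] CB_mono[OF Suc.prems(2), of N]
      by (intro CB_add[OF assms(1)] Suc.IH) (simp_all add: CB_Suc)
  qed
qed

lemma CB_inner_scaleR:
  fixes u :: "'b::euclidean_space \<Rightarrow> 'c::euclidean_space"
  assumes "open S" "CB N S u" "CB N S w"
  shows "CB N S (\<lambda>z. (u z \<bullet> e) *\<^sub>R w z)"
  by (intro CB_scaleR assms CB_linear[OF assms(1) bounded_linear_inner_left])

text \<open>Chain rule by induction. Bounds are imposed on the derivatives of \<open>X\<close> and
  not on \<open>X\<close>, since the map onto the graph may be unbounded; order \<open>N\<close> of
  the composition involves \<open>Dd b X\<close> only to order \<open>N - 1\<close>.\<close>

lemma CB_compose:
  fixes X :: "'b::euclidean_space \<Rightarrow> 'c::euclidean_space" and u :: "'c \<Rightarrow> 'a::real_normed_vector"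
  assumes "open S" "open V" "X ` S \<subseteq> V"
    and X: "\<And>z. z \<in> S \<Longrightarrow> X differentiable (at z)"
  shows "CB N V u \<Longrightarrow> (\<And>b M. b \<in> Basis \<Longrightarrow> N = Suc M \<Longrightarrow> CB M S (Dd b X)) \<Longrightarrow> CB N S (\<lambda>z. u (X z))"
proof (induction N arbitrary: u)
  case 0
  have "continuous_on S X" using X by (meson continuous_at_imp_continuous_on differentiable_imp_continuous_within)
  moreover have "bounded ((\<lambda>z. u (X z)) ` S)"
    using CB_bounded[OF 0(1)] by (rule bounded_subset) (use assms(3) in auto)
  ultimately show ?case unfolding CB_0 using CB_continuous[OF 0(1)] assms(3)
    by (auto intro: continuous_on_compose2)
next
  case (Suc N)
  have IH: "CB N S (\<lambda>z. w (X z))" if "CB N V w" for w :: "'c \<Rightarrow> 'a"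
  proof (rule Suc.IH[OF that])
    fix b :: 'b and M assume "b \<in> Basis" "N = Suc M"
    thus "CB M S (Dd b X)" using Suc.prems(2)[of b N] CB_mono[of N S "Dd b X" M] by simp
  qed
  show ?case
  proof (rule CB_SucI[OF assms(1)])
    show "bounded ((\<lambda>z. u (X z)) ` S)"
      using CB_bounded[OF Suc.prems(1)] by (rule bounded_subset) (use assms(3) in auto)
    fix z assume z: "z \<in> S"
    have du: "u differentiable (at (X z))" using Suc.prems(1) z assms(3) by (intro CB_differentiable) auto
    have "((u \<circ> X) has_derivative ((\<lambda>v. Dd v u (X z)) \<circ> (\<lambda>v. Dd v X z))) (at z)"
      by (intro diff_chain_at has_derivative_Dd X z du)
    thus "((\<lambda>z. u (X z)) has_derivative (\<lambda>v. \<Sum>e\<in>Basis. (Dd v X z \<bullet> e) *\<^sub>R Dd e u (X z))) (at z)"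
      unfolding o_def Dd_eq_sum_Basis[OF du, symmetric] .
  next
    fix b :: 'b assume "b \<in> Basis"
    thus "CB N S (\<lambda>z. \<Sum>e\<in>Basis. (Dd b X z \<bullet> e) *\<^sub>R Dd e u (X z))"
      using Suc.prems by (intro CB_sum CB_inner_scaleR assms(1) IH) (auto simp: CB_Suc)
  qed
qed

lemma CB_Dd_bound:
  fixes u :: "'b::euclidean_space \<Rightarrow> 'a::euclidean_space"
  assumes u: "CB (Suc N) S u"
  obtains L where "L \<ge> 0" "\<And>z v. z \<in> S \<Longrightarrow> norm (Dd v u z) \<le> L * norm v"
proof -
  have "\<exists>B. \<forall>z\<in>S. norm (Dd b u z) \<le> B" if "b \<in> Basis" for b
  proof -
    have "bounded (Dd b u ` S)" using u that by (intro CB_bounded[of N]) (simp add: CB_Suc)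
    thus ?thesis by (simp add: bounded_iff)
  qed
  then obtain B where B: "\<And>b z. b \<in> Basis \<Longrightarrow> z \<in> S \<Longrightarrow> norm (Dd b u z) \<le> B b" by metis
  define L where "L = (\<Sum>b\<in>Basis. \<bar>B b\<bar>)"
  show ?thesis
  proof (rule that[of L])
    show "L \<ge> 0" by (simp add: L_def)
    fix z v assume z: "z \<in> S"
    have "norm (Dd v u z) \<le> (\<Sum>b\<in>Basis. norm v * \<bar>B b\<bar>)"
      by (subst Dd_eq_sum_Basis[OF CB_differentiable[OF u z]], rule sum_norm_le)
         (use B z in \<open>auto intro!: mult_mono Basis_le_norm intro: order_trans[OF _ abs_ge_self]\<close>)
    thus "norm (Dd v u z) \<le> L * norm v" by (simp add: L_def sum_distrib_left mult.commute)
  qed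
qed

lemma CB_lipschitz:
  fixes u :: "'b::euclidean_space \<Rightarrow> 'a::euclidean_space"
  assumes S: "convex S" and u: "CB (Suc N) S u"
  obtains L where "L \<ge> 0" "\<And>x y. x \<in> S \<Longrightarrow> y \<in> S \<Longrightarrow> norm (u x - u y) \<le> L * norm (x - y)"
proof -
  obtain L where L: "L \<ge> 0" "\<And>z v. z \<in> S \<Longrightarrow> norm (Dd v u z) \<le> L * norm v"
    using CB_Dd_bound[OF u] by blast
  show ?thesis
  proof (rule that[OF L(1)])
    fix x y assume xy: "x \<in> S" "y \<in> S"
    show "norm (u x - u y) \<le> L * norm (x - y)"
    proof (rule differentiable_bound[OF S])
      fix z assume z: "z \<in> S"
      show "(u has_derivative (\<lambda>v. Dd v u z)) (at z within S)"
        by (rule has_derivative_at_withinI[OF has_derivative_Dd[OF CB_differentiable[OF u z]]])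
      show "onorm (\<lambda>v. Dd v u z) \<le> L" using L z by (intro onorm_le) auto
    qed (use xy in auto)
  qed
qed

section \<open>Derivatives and Lipschitz bounds along a semiflow\<close>

lemma first_hitting_time:
  fixes f :: "real \<Rightarrow> real"
  assumes cont: "continuous_on {0..t} f" and "t \<ge> 0" "f 0 < \<rho>" "f t > \<rho>"
  obtains T where "T \<in> {0..t}" "f T = \<rho>" "\<And>s. s \<in> {0..T} \<Longrightarrow> f s \<le> \<rho>"
proof -
  define S where "S = {s \<in> {0..t}. f s = \<rho>}"
  have "S \<noteq> {}" using IVT'[of f 0 \<rho> t] assms by (auto simp: S_def)
  have "closed S" unfolding S_def by (rule continuous_closed_preimage_constant[OF cont]) simp
  have bdd: "bdd_below S" by (auto simp: S_def intro: bdd_belowI[of _ 0])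
  define T where "T = Inf S"
  have "T \<in> S" unfolding T_def by (rule closed_contains_Inf) fact+
  show ?thesis
  proof (rule that[of T])
    show "T \<in> {0..t}" "f T = \<rho>" using \<open>T \<in> S\<close> by (auto simp: S_def)
    fix s assume s: "s \<in> {0..T}"
    show "f s \<le> \<rho>"
    proof (rule ccontr)
      assume "\<not> f s \<le> \<rho>"
      moreover have "continuous_on {0..s} f"
        using cont by (rule continuous_on_subset) (use s \<open>T \<in> S\<close> in \<open>auto simp: S_def\<close>)
      ultimately obtain r where r: "0 \<le> r" "r \<le> s" "f r = \<rho>"
        using IVT'[of f 0 \<rho> s] assms s by auto
      hence "r \<in> S" using s \<open>T \<in> S\<close> by (auto simp: S_def)
      hence "T \<le> r" unfolding T_def using bdd by (rule cInf_lower)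
      hence "r = s" "s = T" using r s by auto
      thus False using \<open>\<not> f s \<le> \<rho>\<close> r by simp
    qed
  qed
qed

lemma difference_quotient_tendsto:
  fixes u :: "'b::real_normed_vector \<Rightarrow> 'a::real_normed_vector"
  assumes d: "u differentiable (at x)" and \<epsilon>: "\<And>n. \<epsilon> n > (0::real)" and \<epsilon>0: "\<epsilon> \<longlonglongrightarrow> 0"
  shows "(\<lambda>n. (1 / \<epsilon> n) *\<^sub>R (u (x + \<epsilon> n *\<^sub>R v) - u x)) \<longlonglongrightarrow> Dd v u x"
proof (rule tendstoI)
  fix e :: real assume e: "e > 0"
  define e' where "e' = e / (2 * (1 + norm v))"
  have nv: "1 + norm v > 0" by (simp add: add_pos_nonneg)
  have e': "e' > 0" using e nv by (simp add: e'_def)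
  obtain d where d': "d > 0" "\<And>y. norm (y - x) < d \<Longrightarrow> norm (u y - u x - Dd (y - x) u x) \<le> e' * norm (y - x)"
    using has_derivative_Dd[OF d] e' unfolding has_derivative_at_alt by metis
  have "(\<lambda>n. norm (\<epsilon> n *\<^sub>R v)) \<longlonglongrightarrow> norm (0 *\<^sub>R v)" by (intro tendsto_intros \<epsilon>0)
  hence "(\<lambda>n. norm (\<epsilon> n *\<^sub>R v)) \<longlonglongrightarrow> 0" by simp
  hence "\<forall>\<^sub>F n in sequentially. norm (\<epsilon> n *\<^sub>R v) < d" by (rule order_tendstoD) (rule d'(1))
  thus "\<forall>\<^sub>F n in sequentially. dist ((1 / \<epsilon> n) *\<^sub>R (u (x + \<epsilon> n *\<^sub>R v) - u x)) (Dd v u x) < e"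
  proof eventually_elim
    case (elim n)
    have "(1 / \<epsilon> n) *\<^sub>R (u (x + \<epsilon> n *\<^sub>R v) - u x) - Dd v u x =
        (1 / \<epsilon> n) *\<^sub>R (u (x + \<epsilon> n *\<^sub>R v) - u x - Dd (\<epsilon> n *\<^sub>R v) u x)"
      using \<epsilon>[of n] by (simp add: linear_cmul[OF linear_Dd[OF d]] scaleR_diff_right)
    also have "norm \<dots> = (1 / \<epsilon> n) * norm (u (x + \<epsilon> n *\<^sub>R v) - u x - Dd (\<epsilon> n *\<^sub>R v) u x)"
      using \<epsilon>[of n] by simp
    also have "\<dots> \<le> (1 / \<epsilon> n) * (e' * norm (\<epsilon> n *\<^sub>R v))"
      using d'(2)[of "x + \<epsilon> n *\<^sub>R v"] elim \<epsilon>[of n] by (intro mult_left_mono) auto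
    also have "\<dots> = e' * norm v" using \<epsilon>[of n] by simp
    also have "\<dots> < e" using e nv by (simp add: e'_def field_simps add_strict_increasing)
    finally show ?case by (simp add: dist_norm)
  qed
qed

context semiflow
begin

text \<open>Every point of \<open>K\<close> starts an orbit, and the chain rule at time 0 identifies
  the rate with the derivative in direction \<open>G\<close>. The equation thereby becomes available
  on translates of an orbit, which are not orbits themselves.\<close>

lemma evolves_direction:
  fixes W :: "'b \<Rightarrow> 'a::euclidean_space"
  assumes "evolves W \<phi>" "y \<in> K" "W differentiable (at y)"
  shows "Dd (G y) W y = \<phi> y"
proof (rule vector_derivative_unique_within)
  show "at (0::real) within {0..} \<noteq> bot"
    by (simp add: at_within_Ici_at_right)
  have "((W \<circ> \<theta> y) has_vector_derivative Dd (G (\<theta> y 0)) W (\<theta> y 0)) (at 0 within {0..})"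
    using assms by (intro vector_derivative_diff_chain_within \<theta>_deriv has_derivative_at_withinI[OF has_derivative_Dd])
      (auto simp: \<theta>_0)
  thus "((\<lambda>t. W (\<theta> y t)) has_vector_derivative Dd (G y) W y) (at 0 within {0..})"
    using assms by (simp add: o_def \<theta>_0)
  show "((\<lambda>t. W (\<theta> y t)) has_vector_derivative \<phi> y) (at 0 within {0..})"
    using assms unfolding evolves_def by (metis \<theta>_0 order_refl)
qed

text \<open>A commutator identity for \<open>Dd v\<close> and the derivative along the semiflow. Difference quotients in direction \<open>v\<close>
  evolve by explicit right-hand sides that converge uniformly on orbit segments, so \<open>W\<close> need not be twice differentiable.\<close>
lemma evolves_Dd:
  fixes W \<phi> :: "'b \<Rightarrow> 'a::euclidean_space"
  assumes ev: "evolves W \<phi>" and W: "C1 K W" and \<phi>: "C1 K \<phi>" and G: "C1 K G"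
  shows "evolves (Dd v W) (\<lambda>z. Dd v \<phi> z - Dd (Dd v G z) W z)"
  unfolding evolves_def
proof (intro ballI allI impI)
  fix z and t0 :: real assume z: "z \<in> K" and t0: "t0 \<ge> 0"
  \<comment> \<open>One unit beyond \<open>t0\<close>, so that derivatives at \<open>t0\<close>
    within \<open>{0..T}\<close> and within \<open>{0..}\<close> agree.\<close>
  define T where "T = t0 + 1"
  define C where "C = \<theta> z ` {0..T}"
  have C: "compact C" "C \<subseteq> K" unfolding C_def using z compact_orbit orbit_subset by auto
  obtain \<delta>0 where \<delta>0: "\<delta>0 > 0" "\<And>z p. z \<in> C \<Longrightarrow> dist z p < \<delta>0 \<Longrightarrow> p \<in> K"
    using C1_Dd_near_compact[OF openK W C zero_less_one] by metis
  define \<epsilon> where "\<epsilon> n = \<delta>0 / (1 + norm v) / real (Suc n)" for n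
  have nv: "1 + norm v > 0" by (simp add: add_pos_nonneg)
  have \<epsilon>: "\<epsilon> n > 0" for n using \<delta>0 nv by (simp add: \<epsilon>_def)
  have \<epsilon>v: "norm (\<epsilon> n *\<^sub>R v) < \<delta>0" for n
  proof -
    have "\<epsilon> n \<le> \<delta>0 / (1 + norm v) / 1" unfolding \<epsilon>_def using \<delta>0 nv by (intro divide_left_mono) auto
    hence "\<epsilon> n * norm v \<le> \<delta>0 / (1 + norm v) * norm v" by (intro mult_right_mono) auto
    also have "\<dots> < \<delta>0" using \<delta>0 nv by (simp add: field_simps)
    finally show ?thesis using \<epsilon>[of n] by simp
  qed
  have \<epsilon>0: "(\<lambda>n. \<epsilon> n *\<^sub>R v) \<longlonglongrightarrow> 0"
  proof -
    have "(\<lambda>n. (\<delta>0 / (1 + norm v) * inverse (real (Suc n))) *\<^sub>R v) \<longlonglongrightarrow> (\<delta>0 / (1 + norm v) * 0) *\<^sub>R v"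
      by (intro tendsto_intros LIMSEQ_inverse_real_of_nat)
    thus ?thesis by (simp add: \<epsilon>_def divide_inverse)
  qed
  have small: "\<forall>\<^sub>F n in sequentially. norm (\<epsilon> n *\<^sub>R v) < \<delta>" if "\<delta> > 0" for \<delta>
    using tendstoD[OF \<epsilon>0 that] by (simp add: dist_norm)
  have tC: "\<theta> z t \<in> C" "\<theta> z t \<in> K" "\<And>n. \<theta> z t + \<epsilon> n *\<^sub>R v \<in> K" if "t \<in> {0..T}" for t
  proof -
    show *: "\<theta> z t \<in> C" using that by (auto simp: C_def)
    thus "\<theta> z t \<in> K" using C by auto
    show "\<theta> z t + \<epsilon> n *\<^sub>R v \<in> K" for n using \<delta>0(2)[OF *] \<epsilon>v[of n] by (simp add: dist_norm)
  qed
  define q where "q n t = (1 / \<epsilon> n) *\<^sub>R (W (\<theta> z t + \<epsilon> n *\<^sub>R v) - W (\<theta> z t))" for n t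
  define q' where "q' n t = (1 / \<epsilon> n) *\<^sub>R (\<phi> (\<theta> z t + \<epsilon> n *\<^sub>R v) - \<phi> (\<theta> z t)) -
      Dd ((1 / \<epsilon> n) *\<^sub>R (G (\<theta> z t + \<epsilon> n *\<^sub>R v) - G (\<theta> z t))) W (\<theta> z t + \<epsilon> n *\<^sub>R v)" for n t
  define p where "p t = Dd v \<phi> (\<theta> z t) - Dd (Dd v G (\<theta> z t)) W (\<theta> z t)" for t
  have dq: "(q n has_vector_derivative q' n t) (at t within {0..T})" if t: "t \<in> {0..T}" for n t
  proof -
    let ?y = "\<theta> z t + \<epsilon> n *\<^sub>R v"
    have lin: "linear (\<lambda>v. Dd v W ?y)" by (intro linear_Dd C1D[OF W] tC t)
    have "((W \<circ> (\<lambda>t. \<theta> z t + \<epsilon> n *\<^sub>R v)) has_vector_derivative Dd (G (\<theta> z t)) W ?y) (at t within {0..T})"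
      by (intro vector_derivative_diff_chain_within has_derivative_at_withinI[OF has_derivative_Dd] C1D[OF W] tC t)
         (auto intro!: derivative_eq_intros \<theta>_derivT z t simp: tC[OF t])
    hence 1: "((\<lambda>t. W (\<theta> z t + \<epsilon> n *\<^sub>R v)) has_vector_derivative Dd (G (\<theta> z t)) W ?y) (at t within {0..T})"
      by (simp add: o_def)
    \<comment> \<open>The translated orbit moves with the velocity of the original one. Splitting
      off the velocity that belongs to \<open>?y\<close> produces \<open>\<phi> ?y\<close>; the
      remainder becomes the commutator term in the limit.\<close>
    have "Dd (G (\<theta> z t)) W ?y = Dd (G ?y) W ?y - Dd (G ?y - G (\<theta> z t)) W ?y"
      by (simp add: linear_diff[OF lin])
    also have "Dd (G ?y) W ?y = \<phi> ?y" by (intro evolves_direction ev C1D[OF W] tC t)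
    finally have 2: "Dd (G (\<theta> z t)) W ?y = \<phi> ?y - Dd (G ?y - G (\<theta> z t)) W ?y" .
    have "(q n has_vector_derivative (1 / \<epsilon> n) *\<^sub>R (Dd (G (\<theta> z t)) W ?y - \<phi> (\<theta> z t))) (at t within {0..T})"
      unfolding q_def[abs_def]
      using has_vector_derivative_diff[OF 1 evolvesD[OF ev z t]]
      by (rule bounded_linear.has_vector_derivative[OF bounded_linear_scaleR_right])
    thus ?thesis unfolding q'_def 2 linear_cmul[OF lin] by (simp add: algebra_simps)
  qed
  have unif: "\<forall>\<^sub>F n in sequentially. \<forall>t\<in>{0..T}. \<forall>h. norm (h *\<^sub>R q' n t - h *\<^sub>R p t) \<le> e * norm h"
    if e: "e > 0" for e
  proof -
    have "\<exists>M. M > 0 \<and> (\<forall>x\<in>C. norm (Dd v G x) \<le> M)"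
    proof -
      have "compact (Dd v G ` C)"
        by (intro compact_continuous_image C continuous_on_subset[OF C1_continuous_Dd[OF G]])
      then obtain M where "M > 0" "\<forall>y\<in>Dd v G ` C. norm y \<le> M" using compact_imp_bounded bounded_pos by blast
      thus ?thesis by auto
    qed
    then obtain M where M: "M > 0" "\<And>x. x \<in> C \<Longrightarrow> norm (Dd v G x) \<le> M" by auto
    have "\<exists>N. N > 0 \<and> (\<forall>x\<in>C. \<forall>w. norm (Dd w W x) \<le> N * norm w)"
    proof -
      have "\<exists>B. \<forall>x\<in>C. norm (Dd b W x) \<le> B" if "b \<in> Basis" for b
      proof -
        have "compact (Dd b W ` C)"
          by (intro compact_continuous_image C continuous_on_subset[OF C1_continuous_Dd[OF W]])
        thus ?thesis using compact_imp_bounded bounded_iff by (metis (no_types, lifting) image_eqI)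
      qed
      then obtain B where B: "\<And>b x. b \<in> Basis \<Longrightarrow> x \<in> C \<Longrightarrow> norm (Dd b W x) \<le> B b" by metis
      define N where "N = (\<Sum>b\<in>Basis. \<bar>B b\<bar>)"
      have "norm (Dd w W x) \<le> (1 + N) * norm w" if x: "x \<in> C" for x w
      proof -
        have xK: "x \<in> K" using x C by auto
        have "norm (Dd w W x) \<le> (\<Sum>b\<in>Basis. norm w * \<bar>B b\<bar>)"
          by (subst Dd_eq_sum_Basis[OF C1D[OF W xK]], rule sum_norm_le)
             (use B x in \<open>auto intro!: mult_mono Basis_le_norm intro: order_trans[OF _ abs_ge_self]\<close>)
        also have "\<dots> \<le> (1 + N) * norm w" by (simp add: N_def sum_distrib_left mult.commute distrib_left)
        finally show ?thesis .
      qed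
      moreover have "1 + N > 0" by (simp add: N_def sum_nonneg add_pos_nonneg)
      ultimately show ?thesis by blast
    qed
    then obtain N where N: "N > 0" "\<And>x w. x \<in> C \<Longrightarrow> norm (Dd w W x) \<le> N * norm w" by auto
    \<comment> \<open>Collects three errors: that of the quotient of \<open>\<phi>\<close>, the
      variation of \<open>DW\<close> applied to the quotient of \<open>G\<close>, and the error of
      that quotient inserted into \<open>DW\<close>. The final \<open>1\<close> keeps
      \<open>D\<close> positive.\<close>
    define D where "D = norm v + M + norm v + N * norm v + 1"
    define \<omega> where "\<omega> = min 1 (e / D)"
    have D: "D > 0" using M N by (simp add: D_def add_pos_nonneg add_nonneg_pos)
    have \<omega>: "\<omega> > 0" "\<omega> \<le> 1" using e D by (auto simp: \<omega>_def)
    have "\<omega> * D \<le> e / D * D" using D by (intro mult_right_mono) (auto simp: \<omega>_def)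
    hence \<omega>e: "\<omega> * D \<le> e" using D by simp
    obtain d1 where d1: "d1 > 0" "\<And>z x y. z \<in> C \<Longrightarrow> x \<in> K \<Longrightarrow> y \<in> K \<Longrightarrow> dist z x < d1 \<Longrightarrow> dist z y < d1 \<Longrightarrow>
        norm (\<phi> x - \<phi> y - Dd (x - y) \<phi> z) \<le> \<omega> * norm (x - y)"
      by (rule strict_linD[OF C1_strict_lin[OF openK \<phi>] C \<omega>(1)]) blast
    obtain d2 where d2: "d2 > 0" "\<And>z x y. z \<in> C \<Longrightarrow> x \<in> K \<Longrightarrow> y \<in> K \<Longrightarrow> dist z x < d2 \<Longrightarrow> dist z y < d2 \<Longrightarrow>
        norm (G x - G y - Dd (x - y) G z) \<le> \<omega> * norm (x - y)"
      by (rule strict_linD[OF C1_strict_lin[OF openK G] C \<omega>(1)]) blast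
    obtain d3 where d3: "d3 > 0"
        "\<And>z p v. z \<in> C \<Longrightarrow> dist z p < d3 \<Longrightarrow> norm (Dd v W p - Dd v W z) \<le> \<omega> * norm v"
      using C1_Dd_near_compact[OF openK W C \<omega>(1)] by metis
    have "min d1 (min d2 d3) > 0" using d1 d2 d3 by simp
    from small[OF this] show ?thesis
    proof eventually_elim
      case (elim n)
      show ?case
      proof (intro ballI allI)
        fix t h assume t: "t \<in> {0..T}"
        let ?x = "\<theta> z t" and ?y = "\<theta> z t + \<epsilon> n *\<^sub>R v"
        note K3 = tC[OF t]
        have ds: "dist ?x ?y < d1" "dist ?x ?y < d2" "dist ?x ?y < d3" using elim by (auto simp: dist_norm)
        have quot: "norm ((1 / \<epsilon> n) *\<^sub>R (u ?y - u ?x) - Dd v u ?x) \<le> \<omega> * norm v"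
          if "norm (u ?y - u ?x - Dd (?y - ?x) u ?x) \<le> \<omega> * norm (?y - ?x)" "u differentiable (at ?x)"
          for u :: "'b \<Rightarrow> 'c::euclidean_space"
        proof -
          have "(1 / \<epsilon> n) *\<^sub>R (u ?y - u ?x) - Dd v u ?x = (1 / \<epsilon> n) *\<^sub>R (u ?y - u ?x - Dd (?y - ?x) u ?x)"
            using \<epsilon>[of n] by (simp add: linear_cmul[OF linear_Dd[OF that(2)]] scaleR_diff_right)
          hence "norm ((1 / \<epsilon> n) *\<^sub>R (u ?y - u ?x) - Dd v u ?x) = (1 / \<epsilon> n) * norm (u ?y - u ?x - Dd (?y - ?x) u ?x)"
            using \<epsilon>[of n] by simp
          also have "\<dots> \<le> (1 / \<epsilon> n) * (\<omega> * norm (?y - ?x))"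
            using \<epsilon>[of n] that(1) by (intro mult_left_mono) auto
          also have "\<dots> = \<omega> * norm v" using \<epsilon>[of n] by simp
          finally show ?thesis .
        qed
        have e1: "norm ((1 / \<epsilon> n) *\<^sub>R (\<phi> ?y - \<phi> ?x) - Dd v \<phi> ?x) \<le> \<omega> * norm v"
          using d1 \<epsilon>v ds K3 by (intro quot d1(2) C1D[OF \<phi>]) auto
        define g where "g = (1 / \<epsilon> n) *\<^sub>R (G ?y - G ?x)"
        have e2: "norm (g - Dd v G ?x) \<le> \<omega> * norm v"
          unfolding g_def using d2 \<epsilon>v ds K3 by (intro quot d2(2) C1D[OF G]) auto
        have ng: "norm g \<le> M + norm v"
        proof -
          have "norm g \<le> norm (Dd v G ?x) + norm (g - Dd v G ?x)" by (metis add.commute norm_triangle_sub)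
          moreover have "\<omega> * norm v \<le> 1 * norm v" using \<omega> by (intro mult_right_mono) auto
          ultimately show ?thesis using e2 M(2)[OF K3(1)] by simp
        qed
        have e3: "norm (Dd g W ?y - Dd g W ?x) \<le> \<omega> * (M + norm v)"
          using d3(2)[OF K3(1) ds(3), of g] mult_left_mono[OF ng, of \<omega>] \<omega> by linarith
        have e4: "norm (Dd g W ?x - Dd (Dd v G ?x) W ?x) \<le> N * (\<omega> * norm v)"
        proof -
          have "Dd g W ?x - Dd (Dd v G ?x) W ?x = Dd (g - Dd v G ?x) W ?x"
            by (simp add: linear_diff[OF linear_Dd[OF C1D[OF W K3(2)]]])
          moreover have "norm (Dd (g - Dd v G ?x) W ?x) \<le> N * (\<omega> * norm v)"
            by (rule order_trans[OF N(2)[OF K3(1)] mult_left_mono[OF e2]]) (use N(1) in simp)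
          ultimately show ?thesis by simp
        qed
        have "q' n t - p t = ((1 / \<epsilon> n) *\<^sub>R (\<phi> ?y - \<phi> ?x) - Dd v \<phi> ?x) -
            ((Dd g W ?y - Dd g W ?x) + (Dd g W ?x - Dd (Dd v G ?x) W ?x))"
          unfolding q'_def p_def g_def by simp
        also have "norm \<dots> \<le> norm ((1 / \<epsilon> n) *\<^sub>R (\<phi> ?y - \<phi> ?x) - Dd v \<phi> ?x) +
            (norm (Dd g W ?y - Dd g W ?x) + norm (Dd g W ?x - Dd (Dd v G ?x) W ?x))"
          by (intro order_trans[OF norm_triangle_ineq4] add_mono norm_triangle_ineq order_refl)
        also have "\<dots> \<le> \<omega> * norm v + (\<omega> * (M + norm v) + N * (\<omega> * norm v))"
          by (intro add_mono e1 e3 e4)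
        also have "\<dots> \<le> \<omega> * D" using \<omega> by (simp add: D_def algebra_simps)
        also have "\<dots> \<le> e" by (rule \<omega>e)
        finally have "norm (q' n t - p t) \<le> e" .
        hence "\<bar>h\<bar> * norm (q' n t - p t) \<le> \<bar>h\<bar> * e" by (intro mult_left_mono) auto
        thus "norm (h *\<^sub>R q' n t - h *\<^sub>R p t) \<le> e * norm h"
          by (simp add: scaleR_diff_right[symmetric] mult.commute)
      qed
    qed
  qed
  have lim: "(\<lambda>n. q n t) \<longlonglongrightarrow> Dd v W (\<theta> z t)" if t: "t \<in> {0..T}" for t
  proof -
    have d: "W differentiable (at (\<theta> z t))" by (intro C1D[OF W] tC t)
    have "(\<lambda>n. \<delta>0 / (1 + norm v) * inverse (real (Suc n))) \<longlonglongrightarrow> \<delta>0 / (1 + norm v) * 0"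
      by (intro tendsto_intros LIMSEQ_inverse_real_of_nat)
    hence "\<epsilon> \<longlonglongrightarrow> 0" by (simp add: \<epsilon>_def[abs_def] divide_inverse)
    thus ?thesis unfolding q_def by (intro difference_quotient_tendsto d \<epsilon>)
  qed
  have T0: "(0::real) \<in> {0..T}" using t0 by (simp add: T_def)
  obtain g where g: "\<forall>x\<in>{0..T}. (\<lambda>n. q n x) \<longlonglongrightarrow> g x \<and> (g has_derivative (\<lambda>h. h *\<^sub>R p x)) (at x within {0..T})"
    using has_derivative_sequence[OF convex_real_interval(5) dq[unfolded has_vector_derivative_def] unif T0 lim[OF T0]]
    by blast
  have geq: "g t = Dd v W (\<theta> z t)" if "t \<in> {0..T}" for t
    using g that lim LIMSEQ_unique by blast
  have "((\<lambda>t. Dd v W (\<theta> z t)) has_vector_derivative p t0) (at t0 within {0..T})"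
    unfolding has_vector_derivative_def
    by (rule has_derivative_transform[where f = g]) (use g geq t0 in \<open>auto simp: T_def\<close>)
  moreover have "at t0 within {0..T} = at t0 within {0..}"
    by (rule at_within_nhd[of _ "{..<T}"]) (auto simp: T_def)
  ultimately show "((\<lambda>t. Dd v W (\<theta> z t)) has_vector_derivative Dd v \<phi> (\<theta> z t0) - Dd (Dd v G (\<theta> z t0)) W (\<theta> z t0))
      (at t0 within {0..})"
    by (simp add: p_def)
qed

text \<open>Divide \<open>S\<close> by the largest distance that the rate \<open>\<gamma>\<close>
  permits. Above the equilibrium \<open>D / gap\<close> of the forced inequality this quotient grows
  exponentially. Either the orbits stay within \<open>\<rho>\<close>, and the growth contradicts
  \<open>S t \<le> 2 * R\<close>; or they separate to \<open>\<rho>\<close>, where the quotient is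
  at most \<open>2 * R / \<rho>\<close>. The summand 1 keeps the initial excess of the squares at
  least 1.\<close>

lemma lipschitz_invariant_graph:
  fixes I :: "'i set" and W \<phi> :: "'i \<Rightarrow> 'b \<Rightarrow> 'a::euclidean_space" and a \<gamma> :: "'b \<Rightarrow> real"
  assumes finI: "finite I" and ev: "\<And>i. i \<in> I \<Longrightarrow> evolves (W i) (\<phi> i)"
    and bdd: "\<And>z. z \<in> K \<Longrightarrow> L2_set (\<lambda>i. norm (W i z)) I \<le> R" and pos: "\<rho> > 0" "gap > 0" "D \<ge> 0"
    and num: "\<And>x y. x \<in> K \<Longrightarrow> y \<in> K \<Longrightarrow> norm (x - y) \<le> \<rho> \<Longrightarrow>
      (\<Sum>i\<in>I. (W i x - W i y) \<bullet> (\<phi> i x - \<phi> i y)) \<ge>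
        a x * (L2_set (\<lambda>i. norm (W i x - W i y)) I)\<^sup>2 - D * norm (x - y) * L2_set (\<lambda>i. norm (W i x - W i y)) I"
    and numG: "\<And>x y. x \<in> K \<Longrightarrow> y \<in> K \<Longrightarrow> norm (x - y) \<le> \<rho> \<Longrightarrow>
      (x - y) \<bullet> (G x - G y) \<le> \<gamma> x * (norm (x - y))\<^sup>2"
    and rate: "\<And>z. z \<in> K \<Longrightarrow> a z \<ge> \<gamma> z + gap" and \<gamma>: "\<And>z. z \<in> K \<Longrightarrow> \<gamma> z \<ge> 0"
    and cont: "continuous_on K \<gamma>"
    and x: "x \<in> K" and y: "y \<in> K"
  shows "L2_set (\<lambda>i. norm (W i x - W i y)) I \<le> (D / gap + 2 * R / \<rho> + 1) * norm (x - y)"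
proof -
  define s0 where "s0 = norm (x - y)"
  define S where "S t = L2_set (\<lambda>i. norm (W i (\<theta> x t) - W i (\<theta> y t))) I" for t
  define \<Delta> where "\<Delta> t = norm (\<theta> x t - \<theta> y t)" for t
  have xyK: "\<theta> x t \<in> K" "\<theta> y t \<in> K" if "t \<ge> 0" for t using that x y by (auto intro: \<theta>_in)
  have R: "R \<ge> 0" using bdd[OF x] L2_set_nonneg order_trans by blast
  have S0: "S t \<ge> 0" for t by (simp add: S_def)
  have S2R: "S t \<le> 2 * R" if "t \<ge> 0" for t
  proof -
    have "S t \<le> L2_set (\<lambda>i. norm (W i (\<theta> x t)) + norm (W i (\<theta> y t))) I"
      unfolding S_def by (rule L2_set_mono) (auto intro: norm_triangle_ineq4)
    also have "\<dots> \<le> L2_set (\<lambda>i. norm (W i (\<theta> x t))) I + L2_set (\<lambda>i. norm (W i (\<theta> y t))) I"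
      by (rule L2_set_triangle_ineq)
    also have "\<dots> \<le> R + R" by (intro add_mono bdd xyK that)
    finally show ?thesis by simp
  qed
  have goal_eq: "L2_set (\<lambda>i. norm (W i x - W i y)) I = S 0" using x y by (simp add: S_def \<theta>_0)
  have M0: "D / gap \<ge> 0" "2 * R / \<rho> \<ge> 0" using pos R by auto
  define M where "M = D / gap + 2 * R / \<rho> + 1"
  show ?thesis unfolding goal_eq s0_def[symmetric] M_def[symmetric]
  proof (cases "s0 < \<rho> \<and> s0 > 0")
    case False
    show "S 0 \<le> M * s0"
    proof (cases "s0 > 0")
      case True
      hence "s0 \<ge> \<rho>" using False by auto
      hence "2 * R \<le> 2 * R / \<rho> * s0" using pos R by (simp add: field_simps mult_left_mono)
      also have "\<dots> \<le> M * s0" using M0 True unfolding M_def by (intro mult_right_mono) auto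
      finally show ?thesis using S2R[of 0] by simp
    next
      case False
      hence "x = y" by (simp add: s0_def)
      thus ?thesis by (simp add: S_def s0_def L2_set_def)
    qed
  next
    case True
    show "S 0 \<le> M * s0"
    proof (rule ccontr)
      assume "\<not> S 0 \<le> M * s0"
      hence "M < S 0 / s0" using True by (simp add: field_simps)
      moreover have M1: "M \<ge> 1" "M \<ge> D / gap + 1" "M \<ge> 2 * R / \<rho>" using M0 by (auto simp: M_def)
      ultimately have Q0M: "M\<^sup>2 < (S 0 / s0)\<^sup>2" by (intro power_strict_mono) auto
      \<comment> \<open>The witness is \<open>e = exp (- \<Lambda> T)\<close>. The existential keeps
        the primitive \<open>\<Lambda>\<close>, which depends on \<open>T\<close>, local to this
        step.\<close>
      have key: "\<exists>e. 0 < e \<and> e \<le> 1 \<and> \<Delta> T \<le> s0 / e \<and>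
          (e / s0 * S T)\<^sup>2 - (D / gap)\<^sup>2 \<ge> exp (gap * T) * ((S 0 / s0)\<^sup>2 - (D / gap)\<^sup>2)"
        if T: "T \<ge> 0" and near: "\<And>s. s \<in> {0..T} \<Longrightarrow> \<Delta> s \<le> \<rho>" for T
      proof -
        have "continuous_on {0..T} (\<lambda>t. \<gamma> (\<theta> x t))"
          by (rule continuous_on_compose2[OF cont continuous_\<theta>[OF x] orbit_subset[OF x]])
        then obtain \<Lambda> where \<Lambda>0: "\<Lambda> 0 = 0" and
          d\<Lambda>: "\<And>t. t \<in> {0..T} \<Longrightarrow> (\<Lambda> has_real_derivative \<gamma> (\<theta> x t)) (at t within {0..T})"
          by (rule continuous_has_antiderivative) blast
        define e where "e t = exp (- \<Lambda> t)" for t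
        have e: "e t > 0" for t by (simp add: e_def)
        have \<Lambda>T: "\<Lambda> T \<ge> 0"
          using gronwall_lower[of T \<Lambda> "\<lambda>t. \<gamma> (\<theta> x t)" "\<lambda>_. 0" "\<lambda>_. 0"] d\<Lambda> \<Lambda>0 \<gamma> T xyK by simp
        have dist_t: "\<Delta> t \<le> s0 / e t" if t: "t \<in> {0..T}" for t
        proof -
          have "norm (\<theta> x t - \<theta> y t) \<le> exp (\<Lambda> t - \<Lambda> 0) * norm (x - y)"
          proof (rule orbit_dist_le[OF x y _ _ d\<Lambda>])
            show "(\<theta> x s - \<theta> y s) \<bullet> (G (\<theta> x s) - G (\<theta> y s)) \<le> \<gamma> (\<theta> x s) * (norm (\<theta> x s - \<theta> y s))\<^sup>2"
              if "s \<in> {0..t}" for s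
              using that t near[of s] by (intro numG xyK) (auto simp: \<Delta>_def)
          qed (use t in auto)
          thus ?thesis by (simp add: \<Delta>_def s0_def e_def \<Lambda>0 exp_minus field_simps)
        qed
        define Q where "Q t = (e t / s0)\<^sup>2 * (\<Sum>i\<in>I. (norm (W i (\<theta> x t) - W i (\<theta> y t)))\<^sup>2)" for t
        define P where "P t = (\<Sum>i\<in>I. (W i (\<theta> x t) - W i (\<theta> y t)) \<bullet> (\<phi> i (\<theta> x t) - \<phi> i (\<theta> y t)))" for t
        have QS: "Q t = (e t / s0 * S t)\<^sup>2" "sqrt (Q t) = e t / s0 * S t" for t
        proof -
          show 1: "Q t = (e t / s0 * S t)\<^sup>2"
            by (simp add: Q_def S_def L2_set_def sum_nonneg power_mult_distrib power_divide)
          show "sqrt (Q t) = e t / s0 * S t" unfolding 1 using e[of t] True S0[of t] by simp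
        qed
        have "Q T - (D / gap)\<^sup>2 \<ge> exp (gap * T) * (Q 0 - (D / gap)\<^sup>2)"
        proof (rule forced_growth[OF T pos(2), where Q' = "\<lambda>t. 2 * (e t / s0)\<^sup>2 * P t - 2 * \<gamma> (\<theta> x t) * Q t"])
          fix t assume t: "t \<in> {0..T}"
          show "Q t \<ge> 0" by (simp add: QS)
          have 1: "((\<lambda>t. \<Sum>i\<in>I. (norm (W i (\<theta> x t) - W i (\<theta> y t)))\<^sup>2) has_real_derivative 2 * P t) (at t within {0..T})"
            unfolding P_def sum_distrib_left by (intro DERIV_sum has_real_derivative_inner_self has_vector_derivative_diff evolvesD[OF ev] x y t)
          have 2: "((\<lambda>t. (e t / s0)\<^sup>2) has_real_derivative - 2 * \<gamma> (\<theta> x t) * (e t / s0)\<^sup>2) (at t within {0..T})"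
            unfolding e_def using d\<Lambda>[OF t] True
            by (auto intro!: derivative_eq_intros simp: power2_eq_square field_simps)
          show "(Q has_real_derivative 2 * (e t / s0)\<^sup>2 * P t - 2 * \<gamma> (\<theta> x t) * Q t) (at t within {0..T})"
            unfolding Q_def[abs_def]
            by (rule DERIV_cong[OF DERIV_mult[OF 2 1]]) (simp add: algebra_simps)
          have t0: "t \<ge> 0" using t by simp
          define X where "X = e t / s0 * S t"
          have X: "X \<ge> 0" unfolding X_def using e[of t] True S0[of t] by auto
          have "P t \<ge> a (\<theta> x t) * (S t)\<^sup>2 - D * \<Delta> t * S t"
            unfolding P_def S_def \<Delta>_def using near[OF t] by (intro num xyK t0) (simp add: \<Delta>_def)
          moreover have "D * \<Delta> t * S t \<le> D * (s0 / e t) * S t"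
            using dist_t[OF t] pos S0[of t] by (intro mult_right_mono mult_left_mono) auto
          ultimately have "P t \<ge> a (\<theta> x t) * (S t)\<^sup>2 - D * (s0 / e t) * S t" by linarith
          hence "(e t / s0)\<^sup>2 * P t \<ge> (e t / s0)\<^sup>2 * (a (\<theta> x t) * (S t)\<^sup>2 - D * (s0 / e t) * S t)"
            by (rule mult_left_mono) simp
          also have "(e t / s0)\<^sup>2 * (a (\<theta> x t) * (S t)\<^sup>2 - D * (s0 / e t) * S t) = a (\<theta> x t) * X\<^sup>2 - D * X"
            using e[of t] True by (simp add: X_def power2_eq_square field_simps)
          finally have 3: "(e t / s0)\<^sup>2 * P t \<ge> a (\<theta> x t) * X\<^sup>2 - D * X" .
          have 4: "a (\<theta> x t) * X\<^sup>2 \<ge> (\<gamma> (\<theta> x t) + gap) * X\<^sup>2"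
            using rate[OF xyK(1)[OF t0]] by (intro mult_right_mono) auto
          have "2 * (gap * X\<^sup>2 - D * X) \<le> 2 * (e t / s0)\<^sup>2 * P t - 2 * \<gamma> (\<theta> x t) * X\<^sup>2"
            using 3 4 by (simp add: distrib_right)
          thus "2 * (gap * Q t - D * sqrt (Q t)) \<le> 2 * (e t / s0)\<^sup>2 * P t - 2 * \<gamma> (\<theta> x t) * Q t"
            unfolding QS(2) X_def[symmetric] unfolding QS(1) X_def[symmetric] .
        qed
        moreover have "Q 0 = (S 0 / s0)\<^sup>2" unfolding QS by (simp add: e_def \<Lambda>0)
        ultimately show ?thesis
          using e[of T] \<Lambda>T dist_t[of T] T unfolding QS by (intro exI[of _ "e T"]) (auto simp: e_def)
      qed
      have ge1: "(S 0 / s0)\<^sup>2 - (D / gap)\<^sup>2 \<ge> 1"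
      proof -
        have "(D / gap + 1)\<^sup>2 \<le> M\<^sup>2" using M1 M0 by (intro power_mono) auto
        thus ?thesis using Q0M M0 by (simp add: power2_sum)
      qed
      show False
      proof (cases "\<forall>t\<ge>0. \<Delta> t \<le> \<rho>")
        case all: True
        \<comment> \<open>At this time \<open>exp (gap * T) \<ge> 1 + gap * T\<close> exceeds
          \<open>(2 * R / s0)\<^sup>2\<close>, and the initial excess is at least 1.\<close>
        define T where "T = (2 * R / s0)\<^sup>2 / gap"
        have T: "T \<ge> 0" using pos by (simp add: T_def)
        obtain e where e: "0 < e" "e \<le> 1" and
          ge: "(e / s0 * S T)\<^sup>2 - (D / gap)\<^sup>2 \<ge> exp (gap * T) * ((S 0 / s0)\<^sup>2 - (D / gap)\<^sup>2)"
          using key[OF T] all by auto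
        have "exp (gap * T) * 1 \<le> exp (gap * T) * ((S 0 / s0)\<^sup>2 - (D / gap)\<^sup>2)"
          using ge1 by (intro mult_left_mono) auto
        moreover have "exp (gap * T) \<ge> 1 + gap * T" by (rule exp_ge_add_one_self)
        moreover have "e / s0 * S T \<le> 1 / s0 * (2 * R)"
          using e True S2R[OF T] S0[of T] by (intro mult_mono divide_right_mono) auto
        hence "(e / s0 * S T)\<^sup>2 \<le> (2 * R / s0)\<^sup>2"
          using e True S0[of T] by (intro power_mono) auto
        moreover have "gap * T = (2 * R / s0)\<^sup>2" using pos by (simp add: T_def)
        moreover have "(D / gap)\<^sup>2 \<ge> 0" by simp
        ultimately show False using ge by linarith
      next
        case False
        then obtain t where t: "t \<ge> 0" "\<Delta> t > \<rho>" by auto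
        have "continuous_on {0..t} \<Delta>"
          unfolding \<Delta>_def by (intro continuous_intros continuous_\<theta> x y)
        moreover have "\<Delta> 0 < \<rho>" using True x y by (simp add: \<Delta>_def s0_def \<theta>_0)
        ultimately obtain T where T: "T \<in> {0..t}" "\<Delta> T = \<rho>" "\<And>s. s \<in> {0..T} \<Longrightarrow> \<Delta> s \<le> \<rho>"
          using first_hitting_time t by blast
        hence T0: "T \<ge> 0" by simp
        obtain e where e: "0 < e" "\<rho> \<le> s0 / e" and
          ge: "(e / s0 * S T)\<^sup>2 - (D / gap)\<^sup>2 \<ge> exp (gap * T) * ((S 0 / s0)\<^sup>2 - (D / gap)\<^sup>2)"
          using key[OF T0 T(3)] T(2) by auto
        have "e / s0 \<le> 1 / \<rho>" using e pos True by (simp add: field_simps)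
        hence "e / s0 * S T \<le> 1 / \<rho> * (2 * R)"
          using e True S2R[OF T0] S0[of T] pos by (intro mult_mono) auto
        also have "\<dots> \<le> M" using M1 by simp
        finally have b1: "(e / s0 * S T)\<^sup>2 \<le> M\<^sup>2" using e True S0[of T] by (intro power_mono) auto
        have b2: "1 * ((S 0 / s0)\<^sup>2 - (D / gap)\<^sup>2) \<le> exp (gap * T) * ((S 0 / s0)\<^sup>2 - (D / gap)\<^sup>2)"
          using ge1 pos T0 by (intro mult_right_mono) auto
        have "p \<le> m \<Longrightarrow> 1 * (q - c) \<le> E \<Longrightarrow> E \<le> p - c \<Longrightarrow> m < q \<Longrightarrow> False" for p m q c E :: real
          by simp
        from this[OF b1 b2 ge Q0M] show False .
      qed
    qed
  qed
qed

end

section \<open>Linearisation relative to a family\<close>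

lemma strict_lin_cong:
  assumes "strict_lin K L u" "\<And>z. z \<in> K \<Longrightarrow> u z = u' z"
    "\<And>z x y. z \<in> K \<Longrightarrow> x \<in> K \<Longrightarrow> y \<in> K \<Longrightarrow> L z x y = L' z x y"
  shows "strict_lin K L' u'"
  unfolding strict_lin_def
proof (intro allI impI)
  fix C and \<omega> :: real assume C: "compact C" "C \<subseteq> K" "\<omega> > 0"
  obtain \<delta> where "\<delta> > 0" "\<And>z x y. z \<in> C \<Longrightarrow> x \<in> K \<Longrightarrow> y \<in> K \<Longrightarrow> dist z x < \<delta> \<Longrightarrow> dist z y < \<delta> \<Longrightarrow>
       norm (u x - u y - L z x y) \<le> \<omega> * norm (x - y)"
    by (rule strict_linD[OF assms(1) C]) blast
  thus "\<exists>\<delta>>0. \<forall>z\<in>C. \<forall>x\<in>K \<inter> ball z \<delta>. \<forall>y\<in>K \<inter> ball z \<delta>. norm (u' x - u' y - L' z x y) \<le> \<omega> * norm (x - y)"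
    using assms(2,3) C(2) by (intro exI[of _ \<delta>]) (auto simp: subset_iff)
qed

lemma strict_lin_add:
  assumes "strict_lin K L u" "strict_lin K L' w"
  shows "strict_lin K (\<lambda>z x y. L z x y + L' z x y) (\<lambda>z. u z + w z)"
  unfolding strict_lin_def
proof (intro allI impI)
  fix C and \<omega> :: real assume C: "compact C" "C \<subseteq> K" "\<omega> > 0"
  hence w2: "\<omega> / 2 > 0" by simp
  obtain d1 where d1: "d1 > 0" "\<And>z x y. z \<in> C \<Longrightarrow> x \<in> K \<Longrightarrow> y \<in> K \<Longrightarrow> dist z x < d1 \<Longrightarrow> dist z y < d1 \<Longrightarrow>
       norm (u x - u y - L z x y) \<le> \<omega> / 2 * norm (x - y)"
    by (rule strict_linD[OF assms(1) C(1,2) w2]) blast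
  obtain d2 where d2: "d2 > 0" "\<And>z x y. z \<in> C \<Longrightarrow> x \<in> K \<Longrightarrow> y \<in> K \<Longrightarrow> dist z x < d2 \<Longrightarrow> dist z y < d2 \<Longrightarrow>
       norm (w x - w y - L' z x y) \<le> \<omega> / 2 * norm (x - y)"
    by (rule strict_linD[OF assms(2) C(1,2) w2]) blast
  have "norm (u x + w x - (u y + w y) - (L z x y + L' z x y)) \<le> \<omega> * norm (x - y)"
    if "z \<in> C" "x \<in> K" "y \<in> K" "dist z x < min d1 d2" "dist z y < min d1 d2" for z x y
  proof -
    have "u x + w x - (u y + w y) - (L z x y + L' z x y) = (u x - u y - L z x y) + (w x - w y - L' z x y)" by simp
    also have "norm \<dots> \<le> \<omega> / 2 * norm (x - y) + \<omega> / 2 * norm (x - y)"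
      using that by (intro order_trans[OF norm_triangle_ineq] add_mono d1 d2) auto
    finally show ?thesis by simp
  qed
  thus "\<exists>\<delta>>0. \<forall>z\<in>C. \<forall>x\<in>K \<inter> ball z \<delta>. \<forall>y\<in>K \<inter> ball z \<delta>.
      norm (u x + w x - (u y + w y) - (L z x y + L' z x y)) \<le> \<omega> * norm (x - y)"
    using d1 d2 by (intro exI[of _ "min d1 d2"]) auto
qed

lemma strict_lin_linear:
  assumes T: "bounded_linear T" and u: "strict_lin K L u"
  shows "strict_lin K (\<lambda>z x y. T (L z x y)) (\<lambda>z. T (u z))"
  unfolding strict_lin_def
proof (intro allI impI)
  fix C and \<omega> :: real assume C: "compact C" "C \<subseteq> K" "\<omega> > 0"
  interpret T: bounded_linear T by (rule T)
  obtain B where B: "B > 0" "\<And>x. norm (T x) \<le> norm x * B" using T.pos_bounded by blast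
  have wB: "\<omega> / B > 0" using B C by simp
  obtain d where d: "d > 0" "\<And>z x y. z \<in> C \<Longrightarrow> x \<in> K \<Longrightarrow> y \<in> K \<Longrightarrow> dist z x < d \<Longrightarrow> dist z y < d \<Longrightarrow>
       norm (u x - u y - L z x y) \<le> \<omega> / B * norm (x - y)"
    by (rule strict_linD[OF u C(1,2) wB]) blast
  have "norm (T (u x) - T (u y) - T (L z x y)) \<le> \<omega> * norm (x - y)"
    if "z \<in> C" "x \<in> K" "y \<in> K" "dist z x < d" "dist z y < d" for z x y
  proof -
    have "T (u x) - T (u y) - T (L z x y) = T (u x - u y - L z x y)" by (simp add: T.diff)
    also have "norm \<dots> \<le> norm (u x - u y - L z x y) * B" by (rule B)
    also have "\<dots> \<le> \<omega> / B * norm (x - y) * B" using d(2)[OF that] B by (intro mult_right_mono) auto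
    also have "\<dots> = \<omega> * norm (x - y)" using B by simp
    finally show ?thesis .
  qed
  thus "\<exists>\<delta>>0. \<forall>z\<in>C. \<forall>x\<in>K \<inter> ball z \<delta>. \<forall>y\<in>K \<inter> ball z \<delta>. norm (T (u x) - T (u y) - T (L z x y)) \<le> \<omega> * norm (x - y)"
    using d by (intro exI[of _ d]) auto
qed

section \<open>Bounded Lipschitz functions and the product rule\<close>

definition BL :: "'b::real_normed_vector set \<Rightarrow> ('b \<Rightarrow> 'a::real_normed_vector) \<Rightarrow> bool" where
  "BL K u \<longleftrightarrow> (\<exists>B\<ge>0. \<forall>x\<in>K. norm (u x) \<le> B \<and> (\<forall>y\<in>K. norm (u x - u y) \<le> B * norm (x - y)))"

lemma BL_E:
  assumes "BL K u"
  obtains B where "B \<ge> 0" "\<And>x. x \<in> K \<Longrightarrow> norm (u x) \<le> B"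
    "\<And>x y. x \<in> K \<Longrightarrow> y \<in> K \<Longrightarrow> norm (u x - u y) \<le> B * norm (x - y)"
  using assms unfolding BL_def by blast

lemma BL_I:
  assumes "\<And>x. x \<in> K \<Longrightarrow> norm (u x) \<le> A" "\<And>x y. x \<in> K \<Longrightarrow> y \<in> K \<Longrightarrow> norm (u x - u y) \<le> B * norm (x - y)"
  shows "BL K u"
  unfolding BL_def
proof (intro exI[of _ "\<bar>A\<bar> + \<bar>B\<bar>"] conjI ballI)
  fix x assume x: "x \<in> K"
  show "norm (u x) \<le> \<bar>A\<bar> + \<bar>B\<bar>" using assms(1)[OF x] by linarith
  fix y assume y: "y \<in> K"
  have "B * norm (x - y) \<le> (\<bar>A\<bar> + \<bar>B\<bar>) * norm (x - y)" by (intro mult_right_mono) auto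
  thus "norm (u x - u y) \<le> (\<bar>A\<bar> + \<bar>B\<bar>) * norm (x - y)" using assms(2)[OF x y] by linarith
qed auto

lemma BL_CB:
  fixes u :: "'b::euclidean_space \<Rightarrow> 'a::euclidean_space"
  assumes "convex K" "CB (Suc N) K u" shows "BL K u"
proof -
  obtain L where "L \<ge> 0" and L: "\<And>x y. x \<in> K \<Longrightarrow> y \<in> K \<Longrightarrow> norm (u x - u y) \<le> L * norm (x - y)"
    by (rule CB_lipschitz[OF assms]) blast
  obtain B where "\<And>x. x \<in> K \<Longrightarrow> norm (u x) \<le> B" using CB_bounded[OF assms(2)] by (auto simp: bounded_iff)
  thus ?thesis using L by (rule BL_I)
qed

lemma BL_add: assumes "BL K u" "BL K w" shows "BL K (\<lambda>z. u z + w z)"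
proof -
  obtain A where A: "A \<ge> 0" "\<And>x. x \<in> K \<Longrightarrow> norm (u x) \<le> A"
    "\<And>x y. x \<in> K \<Longrightarrow> y \<in> K \<Longrightarrow> norm (u x - u y) \<le> A * norm (x - y)" using assms(1) by (rule BL_E) blast
  obtain B where B: "B \<ge> 0" "\<And>x. x \<in> K \<Longrightarrow> norm (w x) \<le> B"
    "\<And>x y. x \<in> K \<Longrightarrow> y \<in> K \<Longrightarrow> norm (w x - w y) \<le> B * norm (x - y)" using assms(2) by (rule BL_E) blast
  show ?thesis
  proof (rule BL_I)
    fix x assume x: "x \<in> K"
    show "norm (u x + w x) \<le> A + B" by (intro norm_triangle_mono A B x)
    fix y assume y: "y \<in> K"
    show "norm (u x + w x - (u y + w y)) \<le> (A + B) * norm (x - y)"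
      unfolding add_diff_add distrib_right by (intro norm_triangle_mono A B x y)
  qed
qed

lemma BL_linear: assumes T: "bounded_linear T" and u: "BL K u" shows "BL K (\<lambda>z. T (u z))"
proof -
  interpret T: bounded_linear T by (rule T)
  obtain A where A: "A \<ge> 0" "\<And>x. x \<in> K \<Longrightarrow> norm (u x) \<le> A"
    "\<And>x y. x \<in> K \<Longrightarrow> y \<in> K \<Longrightarrow> norm (u x - u y) \<le> A * norm (x - y)" using u by (rule BL_E) blast
  obtain B where B: "B > 0" "\<And>x. norm (T x) \<le> norm x * B" using T.pos_bounded by blast
  show ?thesis
  proof (rule BL_I)
    fix x assume x: "x \<in> K"
    show "norm (T (u x)) \<le> A * B" using B A(2)[OF x] by (intro order_trans[OF B(2)] mult_right_mono) auto
    fix y assume y: "y \<in> K"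
    have "norm (T (u x) - T (u y)) \<le> norm (u x - u y) * B" unfolding T.diff[symmetric] by (rule B)
    also have "\<dots> \<le> A * norm (x - y) * B" using B A(3)[OF x y] by (intro mult_right_mono) auto
    finally show "norm (T (u x) - T (u y)) \<le> A * B * norm (x - y)" by (simp add: mult_ac)
  qed
qed

lemma BL_const: "BL K (\<lambda>_. c)"
  by (rule BL_I[of _ _ "norm c" 0]) auto

lemma BL_sum: "(\<And>i. i \<in> A \<Longrightarrow> BL K (u i)) \<Longrightarrow> BL K (\<lambda>z. \<Sum>i\<in>A. u i z)"
  by (induction A rule: infinite_finite_induct) (auto intro: BL_const BL_add)

lemma BL_scaleR:
  fixes u :: "'b::real_normed_vector \<Rightarrow> real"
  assumes "BL K u" "BL K w" shows "BL K (\<lambda>z. u z *\<^sub>R w z)"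
proof -
  obtain A where A: "A \<ge> 0" "\<And>x. x \<in> K \<Longrightarrow> norm (u x) \<le> A"
    "\<And>x y. x \<in> K \<Longrightarrow> y \<in> K \<Longrightarrow> norm (u x - u y) \<le> A * norm (x - y)" using assms(1) by (rule BL_E) blast
  obtain B where B: "B \<ge> 0" "\<And>x. x \<in> K \<Longrightarrow> norm (w x) \<le> B"
    "\<And>x y. x \<in> K \<Longrightarrow> y \<in> K \<Longrightarrow> norm (w x - w y) \<le> B * norm (x - y)" using assms(2) by (rule BL_E) blast
  show ?thesis
  proof (rule BL_I)
    fix x assume x: "x \<in> K"
    show "norm (u x *\<^sub>R w x) \<le> A * B"
      using A(1) A(2)[OF x] B(2)[OF x] by (auto intro!: mult_mono)
    fix y assume y: "y \<in> K"
    have "u x *\<^sub>R w x - u y *\<^sub>R w y = u x *\<^sub>R (w x - w y) + (u x - u y) *\<^sub>R w y"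
      by (simp add: scaleR_diff_right scaleR_diff_left)
    also have "norm \<dots> \<le> A * (B * norm (x - y)) + A * norm (x - y) * B"
      unfolding norm_scaleR[symmetric] using A(1) A(2)[OF x] A(3)[OF x y] B(2)[OF y] B(3)[OF x y]
      by (intro norm_triangle_mono) (auto intro!: mult_mono)
    finally show "norm (u x *\<^sub>R w x - u y *\<^sub>R w y) \<le> (2 * A * B) * norm (x - y)" by (simp add: mult_ac)
  qed
qed

text \<open>The product rule with factors that are merely Lipschitz. Mixed terms such as
  \<open>(u x - u z) *\<^sub>R (w x - w y)\<close> are of second order: one factor is small by
  nearness to \<open>z\<close>, the other proportional to \<open>norm (x - y)\<close>. For this the
  radius is also kept below \<open>\<epsilon>\<close>.\<close>

lemma strict_lin_scaleR:
  fixes u :: "'b::euclidean_space \<Rightarrow> real"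
  assumes u: "strict_lin K L u" and w: "strict_lin K L' w" and BL: "BL K u" "BL K w"
  shows "strict_lin K (\<lambda>z x y. u z *\<^sub>R L' z x y + L z x y *\<^sub>R w z) (\<lambda>z. u z *\<^sub>R w z)"
  unfolding strict_lin_def
proof (intro allI impI)
  fix C and \<omega> :: real assume C: "compact C" "C \<subseteq> K" "\<omega> > 0"
  obtain A where A: "A \<ge> 0" "\<And>x. x \<in> K \<Longrightarrow> norm (u x) \<le> A"
    "\<And>x y. x \<in> K \<Longrightarrow> y \<in> K \<Longrightarrow> norm (u x - u y) \<le> A * norm (x - y)" using BL(1) by (rule BL_E) blast
  obtain B where B: "B \<ge> 0" "\<And>x. x \<in> K \<Longrightarrow> norm (w x) \<le> B"
    "\<And>x y. x \<in> K \<Longrightarrow> y \<in> K \<Longrightarrow> norm (w x - w y) \<le> B * norm (x - y)" using BL(2) by (rule BL_E) blast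
  define D where "D = A + B + 2 * A * B + 1"
  have D: "D > 0" using A B by (simp add: D_def add_nonneg_pos)
  define \<epsilon> where "\<epsilon> = \<omega> / D"
  have \<epsilon>: "\<epsilon> > 0" using C D by (simp add: \<epsilon>_def)
  obtain d1 where d1: "d1 > 0" "\<And>z x y. z \<in> C \<Longrightarrow> x \<in> K \<Longrightarrow> y \<in> K \<Longrightarrow> dist z x < d1 \<Longrightarrow> dist z y < d1 \<Longrightarrow>
       norm (u x - u y - L z x y) \<le> \<epsilon> * norm (x - y)"
    by (rule strict_linD[OF u C(1,2) \<epsilon>]) blast
  obtain d2 where d2: "d2 > 0" "\<And>z x y. z \<in> C \<Longrightarrow> x \<in> K \<Longrightarrow> y \<in> K \<Longrightarrow> dist z x < d2 \<Longrightarrow> dist z y < d2 \<Longrightarrow>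
       norm (w x - w y - L' z x y) \<le> \<epsilon> * norm (x - y)"
    by (rule strict_linD[OF w C(1,2) \<epsilon>]) blast
  define d where "d = min \<epsilon> (min d1 d2)"
  have d: "d > 0" "d \<le> \<epsilon>" "d \<le> d1" "d \<le> d2" using \<epsilon> d1 d2 by (auto simp: d_def)
  have "norm (u x *\<^sub>R w x - u y *\<^sub>R w y - (u z *\<^sub>R L' z x y + L z x y *\<^sub>R w z)) \<le> \<omega> * norm (x - y)"
    if z: "z \<in> C" and x: "x \<in> K" and y: "y \<in> K" and ds: "dist z x < d" "dist z y < d" for z x y
  proof -
    have zK: "z \<in> K" using z C by auto
    define n where "n = norm (x - y)"
    have n: "n \<ge> 0" by (simp add: n_def)
    have uxz: "\<bar>u x - u z\<bar> \<le> A * \<epsilon>"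
      using A(3)[OF x zK] ds d A(1) mult_left_mono[of "norm (x - z)" \<epsilon> A] by (simp add: dist_norm norm_minus_commute)
    have wyz: "norm (w y - w z) \<le> B * \<epsilon>"
      using B(3)[OF y zK] ds d B(1) mult_left_mono[of "norm (y - z)" \<epsilon> B] by (simp add: dist_norm norm_minus_commute)
    have 1: "norm ((u x - u z) *\<^sub>R (w x - w y)) \<le> A * \<epsilon> * (B * n)"
      unfolding norm_scaleR n_def using uxz B(3)[OF x y] A(1) \<epsilon> by (intro mult_mono) auto
    have 2: "norm (u z *\<^sub>R (w x - w y - L' z x y)) \<le> A * (\<epsilon> * n)"
      unfolding norm_scaleR n_def using A(2)[OF zK] d2(2)[OF z x y] ds d A(1) by (intro mult_mono) auto
    have 3: "norm ((u x - u y) *\<^sub>R (w y - w z)) \<le> A * n * (B * \<epsilon>)"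
      unfolding norm_scaleR n_def using wyz A(3)[OF x y] A(1) by (intro mult_mono) auto
    have 4: "norm ((u x - u y - L z x y) *\<^sub>R w z) \<le> \<epsilon> * n * B"
      unfolding norm_scaleR n_def using B(2)[OF zK] d1(2)[OF z x y] ds d \<epsilon> by (intro mult_mono) auto
    have "u x *\<^sub>R w x - u y *\<^sub>R w y - (u z *\<^sub>R L' z x y + L z x y *\<^sub>R w z) =
       ((u x - u z) *\<^sub>R (w x - w y) + u z *\<^sub>R (w x - w y - L' z x y)) +
       ((u x - u y) *\<^sub>R (w y - w z) + (u x - u y - L z x y) *\<^sub>R w z)"
      by (simp add: algebra_simps)
    also have "norm \<dots> \<le> (A * \<epsilon> * (B * n) + A * (\<epsilon> * n)) + (A * n * (B * \<epsilon>) + \<epsilon> * n * B)"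
      by (intro norm_triangle_mono 1 2 3 4)
    also have "\<dots> \<le> \<epsilon> * D * n" using \<epsilon> n by (simp add: D_def algebra_simps)
    also have "\<epsilon> * D = \<omega>" using D by (simp add: \<epsilon>_def)
    finally show ?thesis by (simp add: n_def)
  qed
  thus "\<exists>\<delta>>0. \<forall>z\<in>C. \<forall>x\<in>K \<inter> ball z \<delta>. \<forall>y\<in>K \<inter> ball z \<delta>.
      norm (u x *\<^sub>R w x - u y *\<^sub>R w y - (u z *\<^sub>R L' z x y + L z x y *\<^sub>R w z)) \<le> \<omega> * norm (x - y)"
    using d(1) by (intro exI[of _ d]) auto
qed

text \<open>\<open>W\<close> is a family whose differentiability is still unknown. The linearisation of \<open>u\<close> is split into a part \<open>\<Lambda>\<close>
  acting on increments of \<open>W\<close> and an unspecified bounded part \<open>N\<close> acting on increments of the base point.\<close>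
definition lin_along :: "'b::euclidean_space set \<Rightarrow> ('i \<Rightarrow> 'b \<Rightarrow> 'e::real_normed_vector) \<Rightarrow>
    ('b \<Rightarrow> 'a::real_normed_vector) \<Rightarrow> ('b \<Rightarrow> ('i \<Rightarrow> 'e) \<Rightarrow> 'a) \<Rightarrow> bool" where
  "lin_along K W u \<Lambda> \<longleftrightarrow> (\<exists>N B. (\<forall>z\<in>K. linear (N z)) \<and> (\<forall>z\<in>K. \<forall>v. norm (N z v) \<le> B * norm v) \<and>
     strict_lin K (\<lambda>z x y. \<Lambda> z (\<lambda>i. W i x - W i y) + N z (x - y)) u)"

lemma lin_alongE:
  assumes "lin_along K W u \<Lambda>"
  obtains N B where "\<And>z. z \<in> K \<Longrightarrow> linear (N z)" "\<And>z v. z \<in> K \<Longrightarrow> norm (N z v) \<le> B * norm v"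
     "strict_lin K (\<lambda>z x y. \<Lambda> z (\<lambda>i. W i x - W i y) + N z (x - y)) u"
  using assms unfolding lin_along_def by blast

lemma lin_alongI:
  assumes "\<And>z. z \<in> K \<Longrightarrow> linear (N z)" "\<And>z v. z \<in> K \<Longrightarrow> norm (N z v) \<le> B * norm v"
     "strict_lin K (\<lambda>z x y. \<Lambda> z (\<lambda>i. W i x - W i y) + N z (x - y)) u"
   shows "lin_along K W u \<Lambda>"
  using assms unfolding lin_along_def by blast

lemma lin_along_cong:
  assumes "lin_along K W u \<Lambda>" "\<And>z. z \<in> K \<Longrightarrow> u z = u' z" "\<And>z w. z \<in> K \<Longrightarrow> \<Lambda> z w = \<Lambda>' z w"
  shows "lin_along K W u' \<Lambda>'"
  using assms(1)
proof (rule lin_alongE)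
  fix N B assume "\<And>z. z \<in> K \<Longrightarrow> linear (N z)" "\<And>z v. z \<in> K \<Longrightarrow> norm (N z v) \<le> B * norm v"
     and s: "strict_lin K (\<lambda>z x y. \<Lambda> z (\<lambda>i. W i x - W i y) + N z (x - y)) u"
  thus ?thesis using assms(2,3) by (intro lin_alongI[of K N B] strict_lin_cong[OF s]) auto
qed

lemma lin_along_C1:
  fixes u :: "'b::euclidean_space \<Rightarrow> 'a::euclidean_space"
  assumes "open K" "CB (Suc N) K u" shows "lin_along K W u (\<lambda>_ _. 0)"
proof -
  obtain L where "L \<ge> 0" and L: "\<And>z v. z \<in> K \<Longrightarrow> norm (Dd v u z) \<le> L * norm v"
    by (rule CB_Dd_bound[OF assms(2)]) blast
  show ?thesis
  proof (rule lin_alongI[where N = "\<lambda>z v. Dd v u z", OF _ L])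
    show "linear (\<lambda>v. Dd v u z)" if "z \<in> K" for z by (rule linear_Dd[OF CB_differentiable[OF assms(2) that]])
    show "strict_lin K (\<lambda>z x y. 0 + Dd (x - y) u z) u"
      using C1_strict_lin[OF assms(1) CB_1_C1[OF assms(2)]] by simp
  qed
qed

lemma strict_lin_self: "strict_lin K (\<lambda>z x y. u x - u y) u"
  unfolding strict_lin_def by (auto intro: exI[of _ 1])

lemma lin_along_W: "lin_along K W (W i) (\<lambda>z w. w i)"
  by (rule lin_alongI[of K "\<lambda>_ _. 0" 0]) (auto simp: module_hom_zero strict_lin_self)

lemma lin_along_const: "lin_along K W (\<lambda>_. c) (\<lambda>_ _. 0)"
  by (rule lin_alongI[of K "\<lambda>_ _. 0" 0]) (auto simp: module_hom_zero strict_lin_def intro: exI[of _ 1])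

lemma lin_along_add:
  assumes "lin_along K W u \<Lambda>" "lin_along K W w \<Lambda>'"
  shows "lin_along K W (\<lambda>z. u z + w z) (\<lambda>z q. \<Lambda> z q + \<Lambda>' z q)"
proof -
  obtain N B where N: "\<And>z. z \<in> K \<Longrightarrow> linear (N z)" "\<And>z v. z \<in> K \<Longrightarrow> norm (N z v) \<le> B * norm v"
     "strict_lin K (\<lambda>z x y. \<Lambda> z (\<lambda>i. W i x - W i y) + N z (x - y)) u" using assms(1) by (rule lin_alongE) blast
  obtain N' B' where N': "\<And>z. z \<in> K \<Longrightarrow> linear (N' z)" "\<And>z v. z \<in> K \<Longrightarrow> norm (N' z v) \<le> B' * norm v"
     "strict_lin K (\<lambda>z x y. \<Lambda>' z (\<lambda>i. W i x - W i y) + N' z (x - y)) w" using assms(2) by (rule lin_alongE) blast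
  show ?thesis
  proof (rule lin_alongI)
    show "linear (\<lambda>v. N z v + N' z v)" if "z \<in> K" for z by (intro linear_compose_add N N' that)
    show "norm (N z v + N' z v) \<le> (B + B') * norm v" if "z \<in> K" for z v
      unfolding distrib_right by (intro norm_triangle_mono N N' that)
    show "strict_lin K (\<lambda>z x y. \<Lambda> z (\<lambda>i. W i x - W i y) + \<Lambda>' z (\<lambda>i. W i x - W i y) + (N z (x - y) + N' z (x - y)))
        (\<lambda>z. u z + w z)"
      using strict_lin_add[OF N(3) N'(3)] by (rule strict_lin_cong) auto
  qed
qed

lemma lin_along_linear:
  assumes T: "bounded_linear T" and "lin_along K W u \<Lambda>"
  shows "lin_along K W (\<lambda>z. T (u z)) (\<lambda>z q. T (\<Lambda> z q))"
proof -
  interpret T: bounded_linear T by (rule T)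
  obtain C where C: "C > 0" "\<And>x. norm (T x) \<le> norm x * C" using T.pos_bounded by blast
  obtain N B where N: "\<And>z. z \<in> K \<Longrightarrow> linear (N z)" "\<And>z v. z \<in> K \<Longrightarrow> norm (N z v) \<le> B * norm v"
     "strict_lin K (\<lambda>z x y. \<Lambda> z (\<lambda>i. W i x - W i y) + N z (x - y)) u" using assms(2) by (rule lin_alongE) blast
  show ?thesis
  proof (rule lin_alongI)
    show "linear (\<lambda>v. T (N z v))" if "z \<in> K" for z
      using linear_compose[OF N(1)[OF that] T.linear] by (simp add: o_def)
    show "norm (T (N z v)) \<le> (B * C) * norm v" if "z \<in> K" for z v
    proof -
      have "norm (N z v) * C \<le> B * norm v * C" using N(2)[OF that] C by (intro mult_right_mono) auto
      thus ?thesis using C(2)[of "N z v"] by (simp add: mult_ac)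
    qed
    show "strict_lin K (\<lambda>z x y. T (\<Lambda> z (\<lambda>i. W i x - W i y)) + T (N z (x - y))) (\<lambda>z. T (u z))"
      using strict_lin_linear[OF T N(3)] by (rule strict_lin_cong) (auto simp: T.add)
  qed
qed

lemma lin_along_diff:
  assumes "lin_along K W u \<Lambda>" "lin_along K W w \<Lambda>'"
  shows "lin_along K W (\<lambda>z. u z - w z) (\<lambda>z q. \<Lambda> z q - \<Lambda>' z q)"
  using lin_along_add[OF assms(1) lin_along_linear[OF bounded_linear_minus[OF bounded_linear_ident] assms(2)]]
  by simp

lemma lin_along_sum:
  "(\<And>i. i \<in> A \<Longrightarrow> lin_along K W (u i) (\<Lambda> i)) \<Longrightarrow> lin_along K W (\<lambda>z. \<Sum>i\<in>A. u i z) (\<lambda>z q. \<Sum>i\<in>A. \<Lambda> i z q)"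
  by (induction A rule: infinite_finite_induct) (auto intro: lin_along_const lin_along_add)

lemma lin_along_scaleR:
  fixes u :: "'b::euclidean_space \<Rightarrow> real"
  assumes "lin_along K W u \<Lambda>" "lin_along K W w \<Lambda>'" "BL K u" "BL K w"
  shows "lin_along K W (\<lambda>z. u z *\<^sub>R w z) (\<lambda>z q. u z *\<^sub>R \<Lambda>' z q + \<Lambda> z q *\<^sub>R w z)"
proof -
  obtain N B where N: "\<And>z. z \<in> K \<Longrightarrow> linear (N z)" "\<And>z v. z \<in> K \<Longrightarrow> norm (N z v) \<le> B * norm v"
     "strict_lin K (\<lambda>z x y. \<Lambda> z (\<lambda>i. W i x - W i y) + N z (x - y)) u" using assms(1) by (rule lin_alongE) blast
  obtain N' B' where N': "\<And>z. z \<in> K \<Longrightarrow> linear (N' z)" "\<And>z v. z \<in> K \<Longrightarrow> norm (N' z v) \<le> B' * norm v"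
     "strict_lin K (\<lambda>z x y. \<Lambda>' z (\<lambda>i. W i x - W i y) + N' z (x - y)) w" using assms(2) by (rule lin_alongE) blast
  obtain A where A: "A \<ge> 0" "\<And>x. x \<in> K \<Longrightarrow> norm (u x) \<le> A" using assms(3) by (rule BL_E) blast
  obtain A' where A': "A' \<ge> 0" "\<And>x. x \<in> K \<Longrightarrow> norm (w x) \<le> A'" using assms(4) by (rule BL_E) blast
  show ?thesis
  proof (rule lin_alongI)
    show "linear (\<lambda>v. u z *\<^sub>R N' z v + N z v *\<^sub>R w z)" if "z \<in> K" for z
    proof -
      interpret N: linear "N z" by (rule N(1)[OF that])
      interpret N': linear "N' z" by (rule N'(1)[OF that])
      show ?thesis by unfold_locales (auto simp: N.add N'.add N.scale N'.scale algebra_simps)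
    qed
    show "norm (u z *\<^sub>R N' z v + N z v *\<^sub>R w z) \<le> (A * B' + B * A') * norm v" if z: "z \<in> K" for z v
    proof -
      have "norm (u z *\<^sub>R N' z v) \<le> A * (B' * norm v)"
        unfolding norm_scaleR using A(1) A(2)[OF z] N'(2)[OF z] by (intro mult_mono) auto
      moreover have "norm (N z v *\<^sub>R w z) \<le> (B * norm v) * A'"
        unfolding norm_scaleR using A'(2)[OF z] N(2)[OF z] order_trans[OF norm_ge_zero N(2)[OF z]]
        by (intro mult_mono) auto
      ultimately have "norm (u z *\<^sub>R N' z v + N z v *\<^sub>R w z) \<le> A * (B' * norm v) + (B * norm v) * A'"
        by (rule norm_triangle_mono)
      thus ?thesis by (simp add: algebra_simps)
    qed
    show "strict_lin K (\<lambda>z x y. u z *\<^sub>R \<Lambda>' z (\<lambda>i. W i x - W i y) + \<Lambda> z (\<lambda>i. W i x - W i y) *\<^sub>R w z +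
         (u z *\<^sub>R N' z (x - y) + N z (x - y) *\<^sub>R w z)) (\<lambda>z. u z *\<^sub>R w z)"
      using strict_lin_scaleR[OF N(3) N'(3) assms(3,4)] by (rule strict_lin_cong) (auto simp: algebra_simps)
  qed
qed

text \<open>The coarse companion of \<open>lin_along\<close>, for the stage where \<open>W\<close>
  is only bounded. Increments of \<open>W\<close> cannot be counted as errors there, so
  \<open>M\<close> must reproduce them exactly, for all pairs in \<open>K\<close>; coefficients are
  evaluated at \<open>x\<close> or at \<open>y\<close>, whichever the exact product rule
  dictates.\<close>

definition lip_along :: "'b::real_normed_vector set \<Rightarrow> ('i \<Rightarrow> 'b \<Rightarrow> 'e::real_normed_vector) \<Rightarrow>
    ('b \<Rightarrow> 'a::real_normed_vector) \<Rightarrow> ('b \<Rightarrow> 'b \<Rightarrow> ('i \<Rightarrow> 'e) \<Rightarrow> 'a) \<Rightarrow> bool" where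
  "lip_along K W u M \<longleftrightarrow> (\<exists>C\<ge>0. \<forall>x\<in>K. \<forall>y\<in>K. norm (u x - u y - M x y (\<lambda>i. W i x - W i y)) \<le> C * norm (x - y))"

lemma lip_alongE:
  assumes "lip_along K W u M"
  obtains C where "C \<ge> 0" "\<And>x y. x \<in> K \<Longrightarrow> y \<in> K \<Longrightarrow> norm (u x - u y - M x y (\<lambda>i. W i x - W i y)) \<le> C * norm (x - y)"
  using assms unfolding lip_along_def by blast

lemma lip_along_cong:
  assumes "lip_along K W u M" "\<And>z. z \<in> K \<Longrightarrow> u z = u' z"
    "\<And>x y w. x \<in> K \<Longrightarrow> y \<in> K \<Longrightarrow> M x y w = M' x y w"
  shows "lip_along K W u' M'"
proof -
  obtain C where "C \<ge> 0" "\<And>x y. x \<in> K \<Longrightarrow> y \<in> K \<Longrightarrow> norm (u x - u y - M x y (\<lambda>i. W i x - W i y)) \<le> C * norm (x - y)"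
    using assms(1) by (rule lip_alongE) blast
  thus ?thesis unfolding lip_along_def using assms(2,3) by (intro exI[of _ C]) auto
qed

lemma lip_along_BL: "BL K u \<Longrightarrow> lip_along K W u (\<lambda>_ _ _. 0)"
  unfolding lip_along_def BL_def by auto

lemma lip_along_W: "lip_along K W (W i) (\<lambda>_ _ w. w i)"
  unfolding lip_along_def by (intro exI[of _ 0]) auto

lemma lip_along_add:
  assumes "lip_along K W u M" "lip_along K W w M'"
  shows "lip_along K W (\<lambda>z. u z + w z) (\<lambda>x y q. M x y q + M' x y q)"
proof -
  obtain C where C: "C \<ge> 0" "\<And>x y. x \<in> K \<Longrightarrow> y \<in> K \<Longrightarrow> norm (u x - u y - M x y (\<lambda>i. W i x - W i y)) \<le> C * norm (x - y)"
    using assms(1) by (rule lip_alongE) blast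
  obtain D where D: "D \<ge> 0" "\<And>x y. x \<in> K \<Longrightarrow> y \<in> K \<Longrightarrow> norm (w x - w y - M' x y (\<lambda>i. W i x - W i y)) \<le> D * norm (x - y)"
    using assms(2) by (rule lip_alongE) blast
  have "norm (u x + w x - (u y + w y) - (M x y (\<lambda>i. W i x - W i y) + M' x y (\<lambda>i. W i x - W i y))) \<le> (C + D) * norm (x - y)"
    if "x \<in> K" "y \<in> K" for x y
  proof -
    have "u x + w x - (u y + w y) - (M x y (\<lambda>i. W i x - W i y) + M' x y (\<lambda>i. W i x - W i y)) =
      (u x - u y - M x y (\<lambda>i. W i x - W i y)) + (w x - w y - M' x y (\<lambda>i. W i x - W i y))" by simp
    also have "norm \<dots> \<le> C * norm (x - y) + D * norm (x - y)" by (intro norm_triangle_mono C D that)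
    finally show ?thesis by (simp add: distrib_right)
  qed
  thus ?thesis unfolding lip_along_def using C D by (intro exI[of _ "C + D"]) auto
qed

lemma lip_along_linear:
  assumes T: "bounded_linear T" and "lip_along K W u M"
  shows "lip_along K W (\<lambda>z. T (u z)) (\<lambda>x y q. T (M x y q))"
proof -
  interpret T: bounded_linear T by (rule T)
  obtain B where B: "B > 0" "\<And>x. norm (T x) \<le> norm x * B" using T.pos_bounded by blast
  obtain C where C: "C \<ge> 0" "\<And>x y. x \<in> K \<Longrightarrow> y \<in> K \<Longrightarrow> norm (u x - u y - M x y (\<lambda>i. W i x - W i y)) \<le> C * norm (x - y)"
    using assms(2) by (rule lip_alongE) blast
  have "norm (T (u x) - T (u y) - T (M x y (\<lambda>i. W i x - W i y))) \<le> (C * B) * norm (x - y)"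
    if "x \<in> K" "y \<in> K" for x y
  proof -
    have "norm (T (u x - u y - M x y (\<lambda>i. W i x - W i y))) \<le> C * norm (x - y) * B"
      using C(2)[OF that] B by (intro order_trans[OF B(2)] mult_right_mono) auto
    thus ?thesis by (simp add: T.diff mult_ac)
  qed
  thus ?thesis unfolding lip_along_def using B C by (intro exI[of _ "C * B"]) auto
qed

lemma lip_along_diff:
  assumes "lip_along K W u M" "lip_along K W w M'"
  shows "lip_along K W (\<lambda>z. u z - w z) (\<lambda>x y q. M x y q - M' x y q)"
  using lip_along_add[OF assms(1) lip_along_linear[OF bounded_linear_minus[OF bounded_linear_ident] assms(2)]]
  by simp

lemma lip_along_sum:
  "(\<And>i. i \<in> A \<Longrightarrow> lip_along K W (u i) (M i)) \<Longrightarrow> lip_along K W (\<lambda>z. \<Sum>i\<in>A. u i z) (\<lambda>x y q. \<Sum>i\<in>A. M i x y q)"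
  by (induction A rule: infinite_finite_induct) (auto intro: lip_along_BL BL_const lip_along_add)

text \<open>Rests on the exact splitting into \<open>u y *\<^sub>R (w x - w y)\<close> and
  \<open>(u x - u y) *\<^sub>R w x\<close>, after which bounds for the factors control the
  remainders. This asymmetry is why \<open>A\<close> is later taken at \<open>x\<close> and the
  coefficients of \<open>TB\<close> at \<open>y\<close>.\<close>

lemma lip_along_scaleR:
  fixes u :: "'b::real_normed_vector \<Rightarrow> real"
  assumes "lip_along K W u M" "lip_along K W w M'" and bdd: "bounded (u ` K)" "bounded (w ` K)"
  shows "lip_along K W (\<lambda>z. u z *\<^sub>R w z) (\<lambda>x y q. u y *\<^sub>R M' x y q + M x y q *\<^sub>R w x)"
proof -
  obtain C where C: "C \<ge> 0" "\<And>x y. x \<in> K \<Longrightarrow> y \<in> K \<Longrightarrow> norm (u x - u y - M x y (\<lambda>i. W i x - W i y)) \<le> C * norm (x - y)"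
    using assms(1) by (rule lip_alongE) blast
  obtain D where D: "D \<ge> 0" "\<And>x y. x \<in> K \<Longrightarrow> y \<in> K \<Longrightarrow> norm (w x - w y - M' x y (\<lambda>i. W i x - W i y)) \<le> D * norm (x - y)"
    using assms(2) by (rule lip_alongE) blast
  obtain A B where A: "\<And>x. x \<in> K \<Longrightarrow> norm (u x) \<le> A" and B: "\<And>x. x \<in> K \<Longrightarrow> norm (w x) \<le> B"
    using bdd unfolding bounded_iff by auto
  have "norm (u x *\<^sub>R w x - u y *\<^sub>R w y - (u y *\<^sub>R M' x y (\<lambda>i. W i x - W i y) + M x y (\<lambda>i. W i x - W i y) *\<^sub>R w x))
     \<le> (\<bar>A\<bar> * D + C * \<bar>B\<bar>) * norm (x - y)"
    if x: "x \<in> K" and y: "y \<in> K" for x y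
  proof -
    have "u x *\<^sub>R w x - u y *\<^sub>R w y - (u y *\<^sub>R M' x y (\<lambda>i. W i x - W i y) + M x y (\<lambda>i. W i x - W i y) *\<^sub>R w x) =
      u y *\<^sub>R (w x - w y - M' x y (\<lambda>i. W i x - W i y)) + (u x - u y - M x y (\<lambda>i. W i x - W i y)) *\<^sub>R w x"
      by (simp add: algebra_simps)
    also have "norm \<dots> \<le> \<bar>A\<bar> * (D * norm (x - y)) + C * norm (x - y) * \<bar>B\<bar>"
    proof (rule norm_triangle_mono)
      show "norm (u y *\<^sub>R (w x - w y - M' x y (\<lambda>i. W i x - W i y))) \<le> \<bar>A\<bar> * (D * norm (x - y))"
        unfolding norm_scaleR using A[OF y] D(2)[OF x y] by (intro mult_mono) auto
      show "norm ((u x - u y - M x y (\<lambda>i. W i x - W i y)) *\<^sub>R w x) \<le> C * norm (x - y) * \<bar>B\<bar>"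
        unfolding norm_scaleR using B[OF x] C(2)[OF x y] C(1) by (intro mult_mono) auto
    qed
    finally show ?thesis by (simp add: algebra_simps)
  qed
  thus ?thesis unfolding lip_along_def using C D by (intro exI[of _ "\<bar>A\<bar> * D + C * \<bar>B\<bar>"]) auto
qed

section \<open>Tensors\<close>

definition blists :: "nat \<Rightarrow> 'b::euclidean_space list set" where
  "blists k = {vs. set vs \<subseteq> Basis \<and> length vs = k}"

lemma finite_blists: "finite (blists k)"
  unfolding blists_def by (rule finite_lists_length_eq) simp

lemma blists_0: "blists 0 = {[]}"
  by (auto simp: blists_def)

lemma blists_Suc: "blists (Suc k) = (\<lambda>(v, vs). v # vs) ` (Basis \<times> blists k)"
proof
  show "blists (Suc k) \<subseteq> (\<lambda>(v, vs). v # vs) ` (Basis \<times> blists k)"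
  proof
    fix ws :: "'b list" assume "ws \<in> blists (Suc k)"
    then obtain v vs where "ws = v # vs" "v \<in> Basis" "vs \<in> blists k" by (cases ws) (auto simp: blists_def)
    thus "ws \<in> (\<lambda>(v, vs). v # vs) ` (Basis \<times> blists k)" by force
  qed
qed (auto simp: blists_def)

lemma sum_blists_Suc:
  "(\<Sum>ws\<in>blists (Suc k). f ws) = (\<Sum>vs\<in>blists k. \<Sum>v\<in>Basis. f (v # vs))"
proof -
  have "inj_on (\<lambda>(v, vs). v # vs) (Basis \<times> blists k :: ('b \<times> 'b list) set)" by (auto simp: inj_on_def)
  hence "(\<Sum>ws\<in>blists (Suc k). f ws) = (\<Sum>(v, vs)\<in>Basis \<times> blists k. f (v # vs))"
    unfolding blists_Suc by (subst sum.reindex) (auto simp: case_prod_unfold)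
  also have "\<dots> = (\<Sum>v\<in>Basis. \<Sum>vs\<in>blists k. f (v # vs))" by (simp add: sum.cartesian_product)
  finally show ?thesis by (subst sum.swap)
qed

lemma blists_update: "vs \<in> blists k \<Longrightarrow> b \<in> Basis \<Longrightarrow> vs[i := b] \<in> blists k"
  using set_update_subset_insert[of vs i b] by (auto simp: blists_def)

lemma blists_nth: "vs \<in> blists k \<Longrightarrow> i < k \<Longrightarrow> vs ! i \<in> Basis"
  by (auto simp: blists_def)

text \<open>The derivation \<open>w(v\<^sub>1,\<dots>,v\<^sub>k) \<mapsto> \<Sum>\<^sub>i w(v\<^sub>1,\<dots>,\<beta> v\<^sub>i,\<dots>,v\<^sub>k)\<close> on \<open>k\<close>-tensors, written in the coordinates
  of \<open>Basis\<close>.\<close>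
definition TB :: "('b::euclidean_space \<Rightarrow> 'b) \<Rightarrow> ('b list \<Rightarrow> 'a::real_vector) \<Rightarrow> 'b list \<Rightarrow> 'a" where
  "TB \<beta> w vs = (\<Sum>i<length vs. \<Sum>b\<in>Basis. (\<beta> (vs ! i) \<bullet> b) *\<^sub>R w (vs[i := b]))"

lemma TB_Nil: "TB \<beta> w [] = 0"
  by (simp add: TB_def)

lemma TB_Cons: "TB \<beta> w (v # vs) = (\<Sum>b\<in>Basis. (\<beta> v \<bullet> b) *\<^sub>R w (b # vs)) + TB \<beta> (\<lambda>us. w (v # us)) vs"
  unfolding TB_def by (simp add: sum.lessThan_Suc_shift del: sum.lessThan_Suc)

text \<open>For a fixed coordinate \<open>e\<close> of the values, the numbers
  \<open>w v \<bullet> e\<close> are the coordinates of a vector \<open>p e\<close> of the base. The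
  hypothesis applies to each \<open>p e\<close>, and summing over \<open>e\<close> restores the
  Hilbert-Schmidt norm.\<close>

lemma numerical_range_one_slot:
  fixes w :: "'b::euclidean_space \<Rightarrow> 'a::euclidean_space"
  assumes "\<And>p. (\<Sum>v\<in>Basis. (p \<bullet> v) * (\<beta> v \<bullet> p)) \<le> \<gamma> * (norm p)\<^sup>2"
  shows "(\<Sum>v\<in>Basis. w v \<bullet> (\<Sum>b\<in>Basis. (\<beta> v \<bullet> b) *\<^sub>R w b)) \<le> \<gamma> * (\<Sum>v\<in>Basis. (norm (w v))\<^sup>2)"
proof -
  define p where "p e = (\<Sum>v\<in>Basis. (w v \<bullet> e) *\<^sub>R v)" for e
  have pv: "p e \<bullet> v = w v \<bullet> e" if "v \<in> Basis" for e v
    unfolding p_def using that by (rule inner_sum_left_Basis)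
  have np: "(norm (p e))\<^sup>2 = (\<Sum>v\<in>Basis. (w v \<bullet> e)\<^sup>2)" for e
    unfolding power2_norm_eq_inner
    by (subst euclidean_inner, rule sum.cong) (auto simp: pv power2_eq_square)
  have "(\<Sum>v\<in>Basis. w v \<bullet> (\<Sum>b\<in>Basis. (\<beta> v \<bullet> b) *\<^sub>R w b)) =
      (\<Sum>v\<in>Basis. \<Sum>e\<in>Basis. \<Sum>b\<in>Basis. (w v \<bullet> e) * ((\<beta> v \<bullet> b) * (w b \<bullet> e)))"
  proof (rule sum.cong[OF refl])
    fix v :: 'b
    have "w v \<bullet> (\<Sum>b\<in>Basis. (\<beta> v \<bullet> b) *\<^sub>R w b) = (\<Sum>e\<in>Basis. (w v \<bullet> e) * ((\<Sum>b\<in>Basis. (\<beta> v \<bullet> b) *\<^sub>R w b) \<bullet> e))"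
      by (rule euclidean_inner)
    thus "w v \<bullet> (\<Sum>b\<in>Basis. (\<beta> v \<bullet> b) *\<^sub>R w b) = (\<Sum>e\<in>Basis. \<Sum>b\<in>Basis. (w v \<bullet> e) * ((\<beta> v \<bullet> b) * (w b \<bullet> e)))"
      by (simp add: inner_sum_left sum_distrib_left)
  qed
  also have "\<dots> = (\<Sum>e\<in>Basis. \<Sum>v\<in>Basis. (p e \<bullet> v) * (\<beta> v \<bullet> p e))"
  proof (subst sum.swap, intro sum.cong refl)
    fix e :: 'a and v :: 'b assume v: "v \<in> Basis"
    have "\<beta> v \<bullet> p e = (\<Sum>b\<in>Basis. (\<beta> v \<bullet> b) * (p e \<bullet> b))" by (rule euclidean_inner)
    also have "\<dots> = (\<Sum>b\<in>Basis. (\<beta> v \<bullet> b) * (w b \<bullet> e))" by (intro sum.cong refl) (simp add: pv)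
    finally show "(\<Sum>b\<in>Basis. (w v \<bullet> e) * ((\<beta> v \<bullet> b) * (w b \<bullet> e))) = (p e \<bullet> v) * (\<beta> v \<bullet> p e)"
      by (simp add: pv[OF v] sum_distrib_left)
  qed
  also have "\<dots> \<le> (\<Sum>e\<in>Basis. \<gamma> * (norm (p e))\<^sup>2)" by (rule sum_mono) (rule assms)
  also have "\<dots> = \<gamma> * (\<Sum>v\<in>Basis. \<Sum>e\<in>Basis. (w v \<bullet> e)\<^sup>2)"
    unfolding np sum_distrib_left[symmetric] by (subst sum.swap) simp
  also have "(\<Sum>v\<in>Basis. \<Sum>e\<in>Basis. (w v \<bullet> e)\<^sup>2) = (\<Sum>v\<in>Basis. (norm (w v))\<^sup>2)"
    by (intro sum.cong refl)
      (subst power2_norm_eq_inner, subst euclidean_inner, simp add: power2_eq_square)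
  finally show ?thesis .
qed

text \<open>One slot moves while the others are frozen, so in the Hilbert-Schmidt norm each slot
  costs at most \<open>\<gamma>\<close>, without combinatorial or dimensional constants. This is the
  reason for treating the coordinates of \<open>D^k h\<close> jointly in that norm.\<close>

lemma TB_numerical_range:
  fixes w :: "'b::euclidean_space list \<Rightarrow> 'a::euclidean_space"
  assumes "\<And>p. (\<Sum>v\<in>Basis. (p \<bullet> v) * (\<beta> v \<bullet> p)) \<le> \<gamma> * (norm p)\<^sup>2"
  shows "(\<Sum>vs\<in>blists k. w vs \<bullet> TB \<beta> w vs) \<le> real k * \<gamma> * (\<Sum>vs\<in>blists k. (norm (w vs))\<^sup>2)"
proof (induction k arbitrary: w)
  case 0
  thus ?case by (simp add: blists_0 TB_Nil)
next
  case (Suc k)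
  have "(\<Sum>vs\<in>blists (Suc k). w vs \<bullet> TB \<beta> w vs) =
     (\<Sum>vs\<in>blists k. \<Sum>v\<in>Basis. w (v # vs) \<bullet> (\<Sum>b\<in>Basis. (\<beta> v \<bullet> b) *\<^sub>R w (b # vs))) +
     (\<Sum>v\<in>Basis. \<Sum>vs\<in>blists k. w (v # vs) \<bullet> TB \<beta> (\<lambda>us. w (v # us)) vs)"
    unfolding sum_blists_Suc TB_Cons by (simp add: inner_add_right sum.distrib, rule sum.swap)
  also have "\<dots> \<le> (\<Sum>vs\<in>blists k. \<gamma> * (\<Sum>v\<in>Basis. (norm (w (v # vs)))\<^sup>2)) +
     (\<Sum>v\<in>Basis. real k * \<gamma> * (\<Sum>vs\<in>blists k. (norm (w (v # vs)))\<^sup>2))"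
    by (intro add_mono sum_mono numerical_range_one_slot assms Suc)
  also have "(\<Sum>v\<in>Basis. real k * \<gamma> * (\<Sum>vs\<in>blists k. (norm (w (v # vs)))\<^sup>2)) =
      (\<Sum>vs\<in>blists k. real k * \<gamma> * (\<Sum>v\<in>Basis. (norm (w (v # vs)))\<^sup>2))"
    unfolding sum_distrib_left by (rule sum.swap)
  also have "(\<Sum>vs\<in>blists k. \<gamma> * (\<Sum>v\<in>Basis. (norm (w (v # vs)))\<^sup>2)) + \<dots> =
      real (Suc k) * \<gamma> * (\<Sum>vs\<in>blists (Suc k). (norm (w vs))\<^sup>2)"
    unfolding sum_blists_Suc by (simp add: sum_distrib_left sum.distrib[symmetric] algebra_simps)
  finally show ?case .
qed

lemma lipschitz_Dd_bound:
  fixes u :: "'b::euclidean_space \<Rightarrow> 'a::real_normed_vector"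
  assumes "open K" and z: "z \<in> K" and u: "u differentiable (at z)"
    and L: "\<And>x y. x \<in> K \<Longrightarrow> y \<in> K \<Longrightarrow> norm (u x - u y) \<le> L * norm (x - y)"
  shows "norm (Dd v u z) \<le> L * norm v"
proof -
  define \<epsilon> where "\<epsilon> n = inverse (real (Suc n))" for n
  have \<epsilon>: "\<epsilon> n > 0" "\<epsilon> \<longlonglongrightarrow> 0" for n
    unfolding \<epsilon>_def by (simp, rule LIMSEQ_inverse_real_of_nat)
  have "(\<lambda>n. norm ((1 / \<epsilon> n) *\<^sub>R (u (z + \<epsilon> n *\<^sub>R v) - u z))) \<longlonglongrightarrow> norm (Dd v u z)"
    by (intro tendsto_norm difference_quotient_tendsto u \<epsilon>)
  moreover have "(\<lambda>n. z + \<epsilon> n *\<^sub>R v) \<longlonglongrightarrow> z + 0 *\<^sub>R v" by (intro tendsto_intros \<epsilon>)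
  hence "\<forall>\<^sub>F n in sequentially. z + \<epsilon> n *\<^sub>R v \<in> K"
    using assms(1) z by (simp add: topological_tendstoD)
  hence "\<forall>\<^sub>F n in sequentially. norm ((1 / \<epsilon> n) *\<^sub>R (u (z + \<epsilon> n *\<^sub>R v) - u z)) \<le> L * norm v"
  proof eventually_elim
    case (elim n)
    have "norm ((1 / \<epsilon> n) *\<^sub>R (u (z + \<epsilon> n *\<^sub>R v) - u z)) = (1 / \<epsilon> n) * norm (u (z + \<epsilon> n *\<^sub>R v) - u z)"
      using \<epsilon>(1)[of n] by simp
    also have "\<dots> \<le> (1 / \<epsilon> n) * (L * norm (z + \<epsilon> n *\<^sub>R v - z))"
      using \<epsilon>(1)[of n] L[OF elim z] by (intro mult_left_mono) auto
    also have "\<dots> = L * norm v" using \<epsilon>(1)[of n] by simp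
    finally show ?case .
  qed
  ultimately show ?thesis by (rule tendsto_upperbound) simp
qed

context semiflow
begin

text \<open>The two passes for one order \<open>k\<close>: the coarse increments \<open>lip\<close>
  give a Lipschitz bound for \<open>W\<close>, which discharges the premise of \<open>lin\<close>,
  and the linearisations then give strict differentiability. Of the rate \<open>a\<close> the
  \<open>k\<close> tensor slots take \<open>k * \<gamma>\<close> and the base expansion one more
  \<open>\<gamma>\<close>, hence the factor \<open>k + 1\<close> in \<open>rate\<close>.\<close>

lemma tensor_regularity:
  fixes W \<phi> :: "'b list \<Rightarrow> 'b \<Rightarrow> 'a::euclidean_space" and A :: "'a \<Rightarrow> 'b \<Rightarrow> 'a" and B :: "'b \<Rightarrow> 'b \<Rightarrow> 'b"
    and a \<gamma> :: "'b \<Rightarrow> real"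
  assumes ev: "\<And>vs. vs \<in> blists k \<Longrightarrow> evolves (W vs) (\<phi> vs)"
    and bdd: "\<And>vs. vs \<in> blists k \<Longrightarrow> bounded (W vs ` K)"
    and lip: "\<And>vs. vs \<in> blists k \<Longrightarrow> lip_along K W (\<phi> vs)
        (\<lambda>x y w. (\<Sum>e\<in>Basis. (w vs \<bullet> e) *\<^sub>R A e x) - TB (\<lambda>v. B v y) w vs)"
    and lin: "\<And>vs. (\<And>us. us \<in> blists k \<Longrightarrow> BL K (W us)) \<Longrightarrow> vs \<in> blists k \<Longrightarrow> lin_along K W (\<phi> vs)
        (\<lambda>z w. (\<Sum>e\<in>Basis. (w vs \<bullet> e) *\<^sub>R A e z) - TB (\<lambda>v. B v z) w vs)"
    and G: "C1 K G" and DG: "\<And>v z. v \<in> Basis \<Longrightarrow> z \<in> K \<Longrightarrow> Dd v G z = B v z"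
    and numA: "\<And>z p. z \<in> K \<Longrightarrow> p \<bullet> (\<Sum>e\<in>Basis. (p \<bullet> e) *\<^sub>R A e z) \<ge> a z * (norm p)\<^sup>2"
    and pos: "\<rho> > 0" "gap > 0" "s \<ge> 0" "real (k + 1) * s \<le> gap / 2"
    and numB: "\<And>x y p. x \<in> K \<Longrightarrow> y \<in> K \<Longrightarrow> norm (x - y) \<le> \<rho> \<Longrightarrow>
        (\<Sum>v\<in>Basis. (p \<bullet> v) * (B v y \<bullet> p)) \<le> (\<gamma> x + s) * (norm p)\<^sup>2"
    and numB0: "\<And>z p. z \<in> K \<Longrightarrow> (\<Sum>v\<in>Basis. (p \<bullet> v) * (B v z \<bullet> p)) \<le> \<gamma> z * (norm p)\<^sup>2"
    and numG: "\<And>x y. x \<in> K \<Longrightarrow> y \<in> K \<Longrightarrow> norm (x - y) \<le> \<rho> \<Longrightarrow>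
        (x - y) \<bullet> (G x - G y) \<le> (\<gamma> x + s) * (norm (x - y))\<^sup>2"
    and rate: "\<And>z. z \<in> K \<Longrightarrow> a z \<ge> real (k + 1) * \<gamma> z + gap"
    and \<gamma>: "\<And>z. z \<in> K \<Longrightarrow> \<gamma> z \<ge> 0" "continuous_on K \<gamma>"
    and vs: "vs \<in> blists k"
  shows "CB 1 K (W vs)"
proof -
  define S where "S w = L2_set (\<lambda>vs. norm (w vs)) (blists k)" for w :: "'b list \<Rightarrow> 'a"
  have S: "S w \<ge> 0" "(\<Sum>vs\<in>blists k. (norm (w vs))\<^sup>2) = (S w)\<^sup>2" for w
    unfolding S_def L2_set_def by (auto simp: sum_nonneg)
  have wS: "norm (w vs) \<le> S w" if "vs \<in> blists k" for w vs
    unfolding S_def using member_le_L2_set[OF finite_blists that, of "\<lambda>vs. norm (w vs)"] by simp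
  have errS: "\<bar>\<Sum>vs\<in>blists k. w vs \<bullet> E vs\<bar> \<le> (\<Sum>vs\<in>blists k. C vs) * n * S w"
    if "\<And>vs. vs \<in> blists k \<Longrightarrow> norm (E vs) \<le> C vs * n" for w E :: "'b list \<Rightarrow> 'a" and C and n :: real
  proof -
    have "\<bar>\<Sum>vs\<in>blists k. w vs \<bullet> E vs\<bar> \<le> (\<Sum>vs\<in>blists k. S w * (C vs * n))"
      using S(1) by (intro order_trans[OF sum_abs] sum_mono order_trans[OF Cauchy_Schwarz_ineq2] mult_mono that wS) auto
    thus ?thesis by (simp add: sum_distrib_left sum_distrib_right mult_ac)
  qed
  have numW: "(\<Sum>vs\<in>blists k. w vs \<bullet> ((\<Sum>e\<in>Basis. (w vs \<bullet> e) *\<^sub>R A e z) - TB \<beta> w vs)) \<ge>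
       (a z - real k * g) * (S w)\<^sup>2"
    if z: "z \<in> K" and \<beta>: "\<And>p. (\<Sum>v\<in>Basis. (p \<bullet> v) * (\<beta> v \<bullet> p)) \<le> g * (norm p)\<^sup>2" for w z \<beta> g
  proof -
    have "(\<Sum>vs\<in>blists k. w vs \<bullet> (\<Sum>e\<in>Basis. (w vs \<bullet> e) *\<^sub>R A e z)) \<ge> (\<Sum>vs\<in>blists k. a z * (norm (w vs))\<^sup>2)"
      by (intro sum_mono numA z)
    moreover have "(\<Sum>vs\<in>blists k. w vs \<bullet> TB \<beta> w vs) \<le> real k * g * (S w)\<^sup>2"
      using TB_numerical_range[where \<gamma> = g and w = w and k = k, OF \<beta>] unfolding S(2) .
    ultimately show ?thesis
      unfolding inner_diff_right sum_subtractf left_diff_distrib by (simp add: sum_distrib_left[symmetric] S(2))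
  qed
  have "\<forall>vs\<in>blists k. \<exists>R. \<forall>z\<in>K. norm (W vs z) \<le> R" using bdd by (auto simp: bounded_iff)
  then obtain R where R: "\<And>vs z. vs \<in> blists k \<Longrightarrow> z \<in> K \<Longrightarrow> norm (W vs z) \<le> R vs" by metis
  have bddS: "L2_set (\<lambda>i. norm (W i z)) (blists k) \<le> (\<Sum>vs\<in>blists k. R vs)" if "z \<in> K" for z
    by (rule order_trans[OF L2_set_le_sum]) (auto intro!: sum_mono R that)
  have "\<forall>vs\<in>blists k. \<exists>C\<ge>0. \<forall>x\<in>K. \<forall>y\<in>K. norm (\<phi> vs x - \<phi> vs y - ((\<Sum>e\<in>Basis. ((W vs x - W vs y) \<bullet> e) *\<^sub>R A e x)
      - TB (\<lambda>v. B v y) (\<lambda>i. W i x - W i y) vs)) \<le> C * norm (x - y)"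
    using lip unfolding lip_along_def by auto
  then obtain C where C: "\<And>vs. vs \<in> blists k \<Longrightarrow> C vs \<ge> 0" "\<And>vs x y. vs \<in> blists k \<Longrightarrow> x \<in> K \<Longrightarrow> y \<in> K \<Longrightarrow>
      norm (\<phi> vs x - \<phi> vs y - ((\<Sum>e\<in>Basis. ((W vs x - W vs y) \<bullet> e) *\<^sub>R A e x)
      - TB (\<lambda>v. B v y) (\<lambda>i. W i x - W i y) vs)) \<le> C vs * norm (x - y)"
    unfolding bchoice_iff by auto
  define D where "D = (\<Sum>vs\<in>blists k. C vs)"
  have D: "D \<ge> 0" unfolding D_def using C(1) by (intro sum_nonneg) auto
  define M0 where "M0 = D / (gap/2) + 2 * (\<Sum>vs\<in>blists k. R vs) / \<rho> + 1"
  have lipW: "L2_set (\<lambda>i. norm (W i x - W i y)) (blists k) \<le> M0 * norm (x - y)" if x: "x \<in> K" and y: "y \<in> K" for x y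
    unfolding M0_def
  \<comment> \<open>Comparing two different points costs \<open>s\<close> for each slot and for the
    base, at most \<open>gap / 2\<close> altogether, so that \<open>gap / 2\<close> is left
    over.\<close>
  proof (rule lipschitz_invariant_graph[where a = "\<lambda>z. a z - real k * (\<gamma> z + s)" and \<gamma> = "\<lambda>z. \<gamma> z + s",
        OF finite_blists ev bddS pos(1) _ D _ numG])
    fix x y assume x: "x \<in> K" and y: "y \<in> K" and n: "norm (x - y) \<le> \<rho>"
    define w where "w vs = W vs x - W vs y" for vs
    define E where "E vs = \<phi> vs x - \<phi> vs y - ((\<Sum>e\<in>Basis. (w vs \<bullet> e) *\<^sub>R A e x) - TB (\<lambda>v. B v y) w vs)" for vs
    have "norm (E vs) \<le> C vs * norm (x - y)" if "vs \<in> blists k" for vs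
      using C(2)[OF that x y] unfolding E_def w_def[abs_def] .
    hence 1: "\<bar>\<Sum>vs\<in>blists k. w vs \<bullet> E vs\<bar> \<le> D * norm (x - y) * S w" unfolding D_def by (rule errS)
    have "(\<Sum>vs\<in>blists k. w vs \<bullet> (\<phi> vs x - \<phi> vs y)) =
       (\<Sum>vs\<in>blists k. w vs \<bullet> ((\<Sum>e\<in>Basis. (w vs \<bullet> e) *\<^sub>R A e x) - TB (\<lambda>v. B v y) w vs)) + (\<Sum>vs\<in>blists k. w vs \<bullet> E vs)"
      by (simp add: E_def inner_diff_right sum_subtractf)
    moreover have "(\<Sum>vs\<in>blists k. w vs \<bullet> ((\<Sum>e\<in>Basis. (w vs \<bullet> e) *\<^sub>R A e x) - TB (\<lambda>v. B v y) w vs)) \<ge>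
       (a x - real k * (\<gamma> x + s)) * (S w)\<^sup>2"
      by (rule numW[OF x numB[OF x y n]])
    ultimately show "(\<Sum>i\<in>blists k. (W i x - W i y) \<bullet> (\<phi> i x - \<phi> i y)) \<ge>
        (a x - real k * (\<gamma> x + s)) * (L2_set (\<lambda>i. norm (W i x - W i y)) (blists k))\<^sup>2 -
        D * norm (x - y) * L2_set (\<lambda>i. norm (W i x - W i y)) (blists k)"
      using 1 unfolding w_def S_def by linarith
  next
    fix z assume z: "z \<in> K"
    show "\<gamma> z + s + gap / 2 \<le> a z - real k * (\<gamma> z + s)"
      using rate[OF z] pos(4) by (simp add: algebra_simps)
    show "0 \<le> \<gamma> z + s" using \<gamma>(1)[OF z] pos by simp
  qed (use pos x y \<gamma>(2) in \<open>auto intro: continuous_intros\<close>)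
  have BLW: "BL K (W us)" if us: "us \<in> blists k" for us
  proof (rule BL_I[OF R[OF us]])
    fix x y assume xy: "x \<in> K" "y \<in> K"
    show "norm (W us x - W us y) \<le> M0 * norm (x - y)"
      using wS[OF us, of "\<lambda>us. W us x - W us y"] lipW[OF xy] unfolding S_def by (rule order_trans)
  qed
  have "\<forall>vs\<in>blists k. \<exists>N Bd. (\<forall>z\<in>K. linear (N z)) \<and> (\<forall>z\<in>K. \<forall>v. norm (N z v) \<le> Bd * norm v) \<and>
     strict_lin K (\<lambda>z x y. (\<Sum>e\<in>Basis. ((W vs x - W vs y) \<bullet> e) *\<^sub>R A e z) - TB (\<lambda>v. B v z) (\<lambda>i. W i x - W i y) vs
       + N z (x - y)) (\<phi> vs)"
    using lin[OF BLW] unfolding lin_along_def by blast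
  then obtain N Bd where N0: "\<forall>vs\<in>blists k. (\<forall>z\<in>K. linear (N vs z)) \<and> (\<forall>z\<in>K. \<forall>v. norm (N vs z v) \<le> Bd vs * norm v) \<and>
     strict_lin K (\<lambda>z x y. (\<Sum>e\<in>Basis. ((W vs x - W vs y) \<bullet> e) *\<^sub>R A e z) - TB (\<lambda>v. B v z) (\<lambda>i. W i x - W i y) vs
       + N vs z (x - y)) (\<phi> vs)"
    unfolding bchoice_iff by (elim exE)
  have N: "linear (N vs z)" "norm (N vs z v) \<le> Bd vs * norm v" if "vs \<in> blists k" "z \<in> K" for vs z v
    using N0 that by blast+
  have N3: "strict_lin K (\<lambda>z x y. (\<Sum>e\<in>Basis. ((W vs x - W vs y) \<bullet> e) *\<^sub>R A e z)
        - TB (\<lambda>v. B v z) (\<lambda>i. W i x - W i y) vs + N vs z (x - y)) (\<phi> vs)" if "vs \<in> blists k" for vs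
    using N0 that by blast
  define F0 where "F0 = \<bar>\<Sum>vs\<in>blists k. Bd vs\<bar>"
  \<comment> \<open>A Lipschitz constant may be enlarged at will. With \<open>M\<close> this large
    the coupling \<open>F0 / M\<close>, through which base increments drive \<open>W\<close>, is at
    most \<open>gap / 2\<close>.\<close>
  define M where "M = \<bar>M0\<bar> + 2 * F0 / gap + 1"
  have M: "M > 0" "M0 \<le> M" using pos by (auto simp: M_def F0_def add_nonneg_pos intro: order_trans[OF abs_ge_self])
  have FM: "F0 / M \<le> gap / 2"
  proof -
    have "2 * F0 / gap \<le> M" by (simp add: M_def)
    thus ?thesis using M pos by (simp add: field_simps)
  qed
  define L\<phi> where "L\<phi> z w v vs = (\<Sum>e\<in>Basis. (w vs \<bullet> e) *\<^sub>R A e z) - TB (\<lambda>v. B v z) w vs + N vs z v"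
    for z w v vs
  have lipM: "L2_set (\<lambda>i. norm (W i x - W i y)) (blists k) \<le> M * norm (x - y)" if "x \<in> K" "y \<in> K" for x y
    using lipW[OF that] M(2) by (meson mult_right_mono norm_ge_zero order_trans)
  have "strictly_diff_at K (W vs) z" if z: "z \<in> K" for z
  \<comment> \<open>The coupling \<open>g\<close> vanishes: \<open>G\<close> is already
    \<open>C^1\<close> here, so its linearisation does not involve increments of
    \<open>W\<close>.\<close>
  proof (rule strictly_diff_invariant_graph[where a = "\<lambda>z. a z - real k * \<gamma> z" and l = \<gamma> and F = "\<lambda>_. F0 / M"
        and g = "\<lambda>_. 0" and gap = "gap / 2" and L\<phi> = L\<phi> and LG = "\<lambda>z w v. Dd v G z",
        OF finite_blists M(1) _ ev lipM])
    show "strict_lin K (\<lambda>z x y. L\<phi> z (\<lambda>i. W i x - W i y) (x - y) i) (\<phi> i)" if "i \<in> blists k" for i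
      unfolding L\<phi>_def by (rule N3[OF that])
    show "strict_lin K (\<lambda>z x y. Dd (x - y) G z) G" by (rule C1_strict_lin[OF openK G])
  next
    fix z :: 'b and i :: "'b list" and c :: "'b \<Rightarrow> real" and w :: "'b \<Rightarrow> 'b list \<Rightarrow> 'a" and v :: "'b \<Rightarrow> 'b"
      and J :: "'b set" assume z: "z \<in> K" and i: "i \<in> blists k" and J: "finite J"
    interpret N: linear "N i z" by (rule N(1)[OF i z])
    have 1: "(\<Sum>e\<in>Basis. ((\<Sum>j\<in>J. c j *\<^sub>R w j i) \<bullet> e) *\<^sub>R A e z) = (\<Sum>j\<in>J. c j *\<^sub>R (\<Sum>e\<in>Basis. (w j i \<bullet> e) *\<^sub>R A e z))"
      by (simp add: inner_sum_left scaleR_sum_left scaleR_sum_right, rule sum.swap)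
    have 2: "TB (\<lambda>v. B v z) (\<lambda>i. \<Sum>j\<in>J. c j *\<^sub>R w j i) i = (\<Sum>j\<in>J. c j *\<^sub>R TB (\<lambda>v. B v z) (w j) i)"
    proof -
      have "(\<Sum>b\<in>Basis. (B (i ! m) z \<bullet> b) *\<^sub>R (\<Sum>j\<in>J. c j *\<^sub>R w j (i[m := b]))) =
          (\<Sum>j\<in>J. c j *\<^sub>R (\<Sum>b\<in>Basis. (B (i ! m) z \<bullet> b) *\<^sub>R w j (i[m := b])))" for m
        unfolding scaleR_sum_right by (subst sum.swap) (simp add: mult.commute)
      thus ?thesis unfolding TB_def by (simp add: scaleR_sum_right) (rule sum.swap)
    qed
    show "L\<phi> z (\<lambda>i. \<Sum>j\<in>J. c j *\<^sub>R w j i) (\<Sum>j\<in>J. c j *\<^sub>R v j) i = (\<Sum>j\<in>J. c j *\<^sub>R L\<phi> z (w j) (v j) i)"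
      unfolding L\<phi>_def 1 2 by (simp add: N.sum N.scale scaleR_add_right scaleR_diff_right sum.distrib sum_subtractf)
  next
    fix z :: 'b and c :: "'b \<Rightarrow> real" and v :: "'b \<Rightarrow> 'b" and w :: "'b \<Rightarrow> 'b list \<Rightarrow> 'a"
      and J :: "'b set" assume z: "z \<in> K" and J: "finite J"
    interpret G: linear "\<lambda>v. Dd v G z" by (rule linear_Dd[OF C1D[OF G z]])
    show "Dd (\<Sum>j\<in>J. c j *\<^sub>R v j) G z = (\<Sum>j\<in>J. c j *\<^sub>R Dd (v j) G z)" by (simp add: G.sum G.scale)
  next
    fix z w v assume z: "z \<in> K"
    have "\<bar>\<Sum>vs\<in>blists k. w vs \<bullet> N vs z v\<bar> \<le> (\<Sum>vs\<in>blists k. Bd vs) * norm v * S w"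
      by (rule errS) (rule N(2)[OF _ z])
    also have "\<dots> \<le> F0 * norm v * S w" using S(1) by (intro mult_right_mono) (auto simp: F0_def)
    finally have "\<bar>\<Sum>vs\<in>blists k. w vs \<bullet> N vs z v\<bar> \<le> F0 * norm v * S w" .
    moreover have "(\<Sum>vs\<in>blists k. w vs \<bullet> ((\<Sum>e\<in>Basis. (w vs \<bullet> e) *\<^sub>R A e z) - TB (\<lambda>v. B v z) w vs)) \<ge>
       (a z - real k * \<gamma> z) * (S w)\<^sup>2"
      by (rule numW[OF z numB0[OF z]])
    ultimately have "(\<Sum>vs\<in>blists k. w vs \<bullet> L\<phi> z w v vs) \<ge> (a z - real k * \<gamma> z) * (S w)\<^sup>2 - F0 * norm v * S w"
      unfolding L\<phi>_def by (simp add: inner_add_right sum.distrib)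
    thus "(\<Sum>i\<in>blists k. w i \<bullet> L\<phi> z w v i) \<ge> (a z - real k * \<gamma> z) * (L2_set (\<lambda>i. norm (w i)) (blists k))\<^sup>2
        - F0 / M * M * L2_set (\<lambda>i. norm (w i)) (blists k) * norm v"
      using M unfolding S_def by (simp add: mult_ac)
  next
    fix z v and w :: "'b list \<Rightarrow> 'a" assume z: "z \<in> K"
    have "v \<bullet> Dd v G z = (\<Sum>b\<in>Basis. (v \<bullet> b) * (B b z \<bullet> v))"
      by (subst Dd_eq_sum_Basis[OF C1D[OF G z]]) (simp add: inner_sum_right DG[OF _ z] inner_commute)
    thus "v \<bullet> Dd v G z \<le> \<gamma> z * (norm v)\<^sup>2 + 0 / M * L2_set (\<lambda>i. norm (w i)) (blists k) * norm v"
      using numB0[OF z, of v] by simp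
  next
    fix z assume z: "z \<in> K"
    show "\<gamma> z + F0 / M + 0 + gap / 2 \<le> a z - real k * \<gamma> z"
    proof -
      have "real (k + 1) * \<gamma> z = real k * \<gamma> z + \<gamma> z" by (simp add: distrib_right)
      thus ?thesis using rate[OF z] FM by linarith
    qed
    show "0 \<le> F0 / M" using M by (simp add: F0_def)
  qed (use pos \<gamma> z vs in auto)
  hence C1W: "C1 K (W vs)" by (rule strictly_diff_imp_C1[OF openK])
  show ?thesis
  proof (rule C1_CB_1[OF C1W bdd[OF vs]])
    fix b :: 'b assume "b \<in> Basis"
    have "norm (Dd b (W vs) z) \<le> M * norm b" if z: "z \<in> K" for z
    proof (rule lipschitz_Dd_bound[OF openK z C1D[OF C1W z]])
      fix x y assume "x \<in> K" "y \<in> K"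
      thus "norm (W vs x - W vs y) \<le> M * norm (x - y)"
        using lipM wS[OF vs, of "\<lambda>vs. W vs x - W vs y"] unfolding S_def by (meson order_trans)
    qed
    thus "bounded (Dd b (W vs) ` K)" by (auto simp: bounded_iff)
  qed
qed

end

section \<open>The invariant graph\<close>

locale cone_system =
  fixes f :: "'a::euclidean_space \<times> 'b::euclidean_space \<Rightarrow> 'a" and g :: "'a \<times> 'b \<Rightarrow> 'b"
    and Df :: "'a \<times> 'b \<Rightarrow> ('a \<times> 'b) list \<Rightarrow> 'a" and Dg :: "'a \<times> 'b \<Rightarrow> ('a \<times> 'b) list \<Rightarrow> 'b"
    and U \<Gamma> :: "('a \<times> 'b) set" and r :: nat and d c1 cr :: real and \<alpha> ell :: "'a \<times> 'b \<Rightarrow> real"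
  assumes r: "r \<ge> 2"
    and openU: "open U" and convexU: "convex U"
    and cone_box: "\<forall>x\<in>U. cone x \<inter> U \<subseteq> boxB d x"
    and Df: "higher_derivs r U f Df" and Dg: "higher_derivs r U g Dg"
    and fb: "\<forall>j\<in>{1..r}. deriv_bounded_on U Df j" and gb: "\<forall>j\<in>{1..r}. deriv_bounded_on U Dg j"
    and ell: "continuous_on U ell" "\<forall>x\<in>U. ell x \<ge> 0"
    and c: "c1 > 0" "cr > 0"
    and mon: "\<forall>x\<in>U. \<forall>a'. inner a' (Df x [(a', 0)]) \<ge> \<alpha> x * (norm a')\<^sup>2"
    and dis: "\<forall>x\<in>U. \<forall>z'. inner z' (Dg x [(0, z')]) \<le> ell x * (norm z')\<^sup>2"
    and gap1: "\<forall>x\<in>U. \<alpha> x \<ge> ell x + onorm (\<lambda>z'. Df x [(0, z')]) + onorm (\<lambda>a'. Dg x [(a', 0)]) + c1"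
    and gapr: "\<forall>x\<in>U. \<alpha> x \<ge> real r * ell x + real (r + 1) * onorm (\<lambda>a'. Dg x [(a', 0)]) + cr"
    and inv: "pos_invariant (\<lambda>x. (f x, g x)) U \<Gamma>" and proj: "snd ` \<Gamma> = snd ` U"

lemma higher_derivs_step:
  assumes "higher_derivs r U u Du" "open U" "x \<in> U" "length vs < r"
  shows "((\<lambda>y. Du y vs) has_derivative (\<lambda>v. Du x (v # vs))) (at x)"
  using assms unfolding higher_derivs_def by (metis at_within_open)

lemma higher_derivs_first:
  assumes "higher_derivs r U u Du" "open U" "x \<in> U" "0 < r"
  shows "(u has_derivative (\<lambda>v. Du x [v])) (at x)"
proof -
  have "((\<lambda>y. Du y []) has_derivative (\<lambda>v. Du x [v])) (at x)"
    using assms by (intro higher_derivs_step) auto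
  thus ?thesis
    by (rule has_derivative_transform_within_open[OF _ assms(2,3)]) (use assms(1) in \<open>auto simp: higher_derivs_def\<close>)
qed

lemma higher_derivs_bounds:
  fixes u :: "'x::euclidean_space \<Rightarrow> 'y::euclidean_space"
  assumes hd: "higher_derivs r U u Du" "open U" "convex U" "2 \<le> r" and b: "\<forall>j\<in>{1..r}. deriv_bounded_on U Du j"
  obtains B where "B \<ge> 0" "\<And>x v. x \<in> U \<Longrightarrow> norm (Du x [v]) \<le> B * norm v"
    "\<And>x y v. x \<in> U \<Longrightarrow> y \<in> U \<Longrightarrow> norm (Du x [v] - Du y [v]) \<le> B * norm (x - y) * norm v"
    "\<And>x y. x \<in> U \<Longrightarrow> y \<in> U \<Longrightarrow> norm (u x - u y) \<le> B * norm (x - y)"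
proof -
  have "deriv_bounded_on U Du 1" "deriv_bounded_on U Du 2" using b hd(4) by auto
  then obtain B1 B2 where B1: "\<forall>x\<in>U. \<forall>vs. length vs = 1 \<longrightarrow> norm (Du x vs) \<le> B1 * prod_list (map norm vs)"
    and B2: "\<forall>x\<in>U. \<forall>vs. length vs = 2 \<longrightarrow> norm (Du x vs) \<le> B2 * prod_list (map norm vs)"
    unfolding deriv_bounded_on_def by blast
  define B where "B = \<bar>B1\<bar> + \<bar>B2\<bar>"
  have B: "B1 \<le> B" "B2 \<le> B" "B \<ge> 0" by (auto simp: B_def)
  have 1: "norm (Du x [v]) \<le> B * norm v" if "x \<in> U" for x v
    using B1[rule_format, OF that, of "[v]"] mult_right_mono[OF B(1), of "norm v"] by simp
  have 2: "norm (Du x [w, v]) \<le> B * norm v * norm w" if "x \<in> U" for x v w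
    using B2[rule_format, OF that, of "[w, v]"] mult_right_mono[OF B(2), of "norm v * norm w"] by (simp add: mult_ac)
  show ?thesis
  proof (rule that[OF B(3) 1])
    fix x y v assume xy: "x \<in> U" "y \<in> U"
    have "norm (Du x [v] - Du y [v]) \<le> B * norm v * norm (x - y)"
    proof (rule differentiable_bound[OF hd(3)])
      fix z assume z: "z \<in> U"
      show "((\<lambda>x. Du x [v]) has_derivative (\<lambda>w. Du z [w, v])) (at z within U)"
        using higher_derivs_step[OF hd(1,2) z, of "[v]"] hd(4) by (auto intro: has_derivative_at_withinI)
      show "onorm (\<lambda>w. Du z [w, v]) \<le> B * norm v"
        using B 2[OF z] by (intro onorm_le) auto
    qed (use xy in auto)
    thus "norm (Du x [v] - Du y [v]) \<le> B * norm (x - y) * norm v" by (simp add: mult_ac)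
    show "norm (u x - u y) \<le> B * norm (x - y)"
    proof (rule differentiable_bound[OF hd(3)])
      fix z assume z: "z \<in> U"
      show "(u has_derivative (\<lambda>w. Du z [w])) (at z within U)"
        using higher_derivs_first[OF hd(1,2) z] hd(4) by (auto intro: has_derivative_at_withinI)
      show "onorm (\<lambda>w. Du z [w]) \<le> B" using B 1[OF z] by (intro onorm_le) auto
    qed (use xy in auto)
  qed
qed

context cone_system
begin

definition "\<mu> p = onorm (\<lambda>a'. Dg p [(a', 0)])"
definition "Fn p = onorm (\<lambda>z'. Df p [(0, z')])"

lemma f_deriv: "x \<in> U \<Longrightarrow> (f has_derivative (\<lambda>v. Df x [v])) (at x)"
  and g_deriv: "x \<in> U \<Longrightarrow> (g has_derivative (\<lambda>v. Dg x [v])) (at x)"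
  using higher_derivs_first[OF Df openU] higher_derivs_first[OF Dg openU] r by auto

lemma linear_Df: "x \<in> U \<Longrightarrow> linear (\<lambda>v. Df x [v])" and linear_Dg: "x \<in> U \<Longrightarrow> linear (\<lambda>v. Dg x [v])"
  using f_deriv g_deriv has_derivative_linear by blast+

text \<open>One common bound is fixed by choice, so that \<open>\<rho>\<close> and the Lipschitz
  constant of the semiflow can be expressed through it.\<close>

definition "B0 = (SOME B. B \<ge> 0 \<and>
  (\<forall>x\<in>U. \<forall>v. norm (Df x [v]) \<le> B * norm v \<and> norm (Dg x [v]) \<le> B * norm v) \<and>
  (\<forall>x\<in>U. \<forall>y\<in>U. \<forall>v. norm (Df x [v] - Df y [v]) \<le> B * norm (x - y) * norm v \<and>
      norm (Dg x [v] - Dg y [v]) \<le> B * norm (x - y) * norm v) \<and>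
  (\<forall>x\<in>U. \<forall>y\<in>U. norm (f x - f y) \<le> B * norm (x - y) \<and> norm (g x - g y) \<le> B * norm (x - y)))"

lemma B0:
  shows B0_nonneg: "B0 \<ge> 0"
    and Df_bound: "x \<in> U \<Longrightarrow> norm (Df x [v]) \<le> B0 * norm v"
    and Dg_bound: "x \<in> U \<Longrightarrow> norm (Dg x [v]) \<le> B0 * norm v"
    and Df_lip: "x \<in> U \<Longrightarrow> y \<in> U \<Longrightarrow> norm (Df x [v] - Df y [v]) \<le> B0 * norm (x - y) * norm v"
    and Dg_lip: "x \<in> U \<Longrightarrow> y \<in> U \<Longrightarrow> norm (Dg x [v] - Dg y [v]) \<le> B0 * norm (x - y) * norm v"
    and f_lip: "x \<in> U \<Longrightarrow> y \<in> U \<Longrightarrow> norm (f x - f y) \<le> B0 * norm (x - y)"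
    and g_lip: "x \<in> U \<Longrightarrow> y \<in> U \<Longrightarrow> norm (g x - g y) \<le> B0 * norm (x - y)"
proof -
  obtain A where A: "A \<ge> 0" "\<And>x v. x \<in> U \<Longrightarrow> norm (Df x [v]) \<le> A * norm v"
    "\<And>x y v. x \<in> U \<Longrightarrow> y \<in> U \<Longrightarrow> norm (Df x [v] - Df y [v]) \<le> A * norm (x - y) * norm v"
    "\<And>x y. x \<in> U \<Longrightarrow> y \<in> U \<Longrightarrow> norm (f x - f y) \<le> A * norm (x - y)"
    by (rule higher_derivs_bounds[OF Df openU convexU r fb]) blast
  obtain B where B: "B \<ge> 0" "\<And>x v. x \<in> U \<Longrightarrow> norm (Dg x [v]) \<le> B * norm v"
    "\<And>x y v. x \<in> U \<Longrightarrow> y \<in> U \<Longrightarrow> norm (Dg x [v] - Dg y [v]) \<le> B * norm (x - y) * norm v"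
    "\<And>x y. x \<in> U \<Longrightarrow> y \<in> U \<Longrightarrow> norm (g x - g y) \<le> B * norm (x - y)"
    by (rule higher_derivs_bounds[OF Dg openU convexU r gb]) blast
  have w: "A * n \<le> (A + B) * n" "B * n \<le> (A + B) * n" if "n \<ge> 0" for n using A B that by (auto intro: mult_right_mono)
  have w3: "A * n * m \<le> (A + B) * n * m" "B * n * m \<le> (A + B) * n * m" if "n \<ge> 0" "m \<ge> 0" for n m
    using mult_right_mono[OF w(1)[OF that(1)] that(2)] mult_right_mono[OF w(2)[OF that(1)] that(2)] by auto
  have "\<exists>B\<ge>0. (\<forall>x\<in>U. \<forall>v. norm (Df x [v]) \<le> B * norm v \<and> norm (Dg x [v]) \<le> B * norm v) \<and>
    (\<forall>x\<in>U. \<forall>y\<in>U. \<forall>v. norm (Df x [v] - Df y [v]) \<le> B * norm (x - y) * norm v \<and>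
      norm (Dg x [v] - Dg y [v]) \<le> B * norm (x - y) * norm v) \<and>
    (\<forall>x\<in>U. \<forall>y\<in>U. norm (f x - f y) \<le> B * norm (x - y) \<and> norm (g x - g y) \<le> B * norm (x - y))"
    using A(1) B(1)
    by (intro exI[of _ "A + B"] conjI ballI allI order_trans[OF A(2) w(1)] order_trans[OF B(2) w(2)]
        order_trans[OF A(3) w3(1)] order_trans[OF B(3) w3(2)] order_trans[OF A(4) w(1)] order_trans[OF B(4) w(2)]) auto
  note * = someI_ex[OF this, folded B0_def]
  show "B0 \<ge> 0"
    "x \<in> U \<Longrightarrow> norm (Df x [v]) \<le> B0 * norm v"
    "x \<in> U \<Longrightarrow> norm (Dg x [v]) \<le> B0 * norm v"
    "x \<in> U \<Longrightarrow> y \<in> U \<Longrightarrow> norm (Df x [v] - Df y [v]) \<le> B0 * norm (x - y) * norm v"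
    "x \<in> U \<Longrightarrow> y \<in> U \<Longrightarrow> norm (Dg x [v] - Dg y [v]) \<le> B0 * norm (x - y) * norm v"
    "x \<in> U \<Longrightarrow> y \<in> U \<Longrightarrow> norm (f x - f y) \<le> B0 * norm (x - y)"
    "x \<in> U \<Longrightarrow> y \<in> U \<Longrightarrow> norm (g x - g y) \<le> B0 * norm (x - y)"
    using * by blast+
qed

lemma bl_Pair: "bounded_linear (\<lambda>a::'a. (a, 0::'b))" "bounded_linear (\<lambda>z::'b. (0::'a, z))"
  by (auto intro!: bounded_linear_Pair bounded_linear_ident bounded_linear_zero)

lemma bl_partial:
  assumes "x \<in> U"
  shows "bounded_linear (\<lambda>a'. Dg x [(a', 0)])" "bounded_linear (\<lambda>z'. Df x [(0, z')])"
  using bounded_linear_compose[OF has_derivative_bounded_linear[OF g_deriv[OF assms]] bl_Pair(1)]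
    bounded_linear_compose[OF has_derivative_bounded_linear[OF f_deriv[OF assms]] bl_Pair(2)] by auto

lemma \<mu>_nonneg: "x \<in> U \<Longrightarrow> \<mu> x \<ge> 0" and Fn_nonneg: "x \<in> U \<Longrightarrow> Fn x \<ge> 0"
  unfolding \<mu>_def Fn_def using bl_partial onorm_pos_le by blast+

lemma \<mu>: "x \<in> U \<Longrightarrow> norm (Dg x [(a, 0)]) \<le> \<mu> x * norm a"
  and Fn: "x \<in> U \<Longrightarrow> norm (Df x [(0, z)]) \<le> Fn x * norm z"
  unfolding \<mu>_def Fn_def using onorm[OF bl_partial(1)] onorm[OF bl_partial(2)] by auto

lemma Fn_le: "x \<in> U \<Longrightarrow> Fn x \<le> B0"
  unfolding Fn_def
proof (rule onorm_le)
  show "x \<in> U \<Longrightarrow> norm (Df x [(0, z)]) \<le> B0 * norm z" for z using Df_bound[of x "(0, z)"] by simp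
qed

lemma \<mu>_lip:
  assumes "x \<in> U" "y \<in> U" shows "\<mu> x \<le> \<mu> y + B0 * norm (x - y)"
  unfolding \<mu>_def[of x]
proof (rule onorm_le)
  fix a
  have "norm (Dg x [(a, 0)]) \<le> norm (Dg y [(a, 0)]) + norm (Dg x [(a, 0)] - Dg y [(a, 0)])"
    by (metis add.commute norm_triangle_sub)
  also have "\<dots> \<le> \<mu> y * norm a + B0 * norm (x - y) * norm (a, 0::'b)"
    by (intro add_mono \<mu> Dg_lip assms)
  finally show "norm (Dg x [(a, 0)]) \<le> (\<mu> y + B0 * norm (x - y)) * norm a" by (simp add: distrib_right)
qed

text \<open>Growth rates are integrated along orbits, and \<open>\<mu>\<close> is part of these
  rates.\<close>

lemma \<mu>_continuous: "continuous_on U \<mu>"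
  unfolding continuous_on_iff
proof (intro ballI allI impI)
  fix x and e :: real assume x: "x \<in> U" and e: "e > 0"
  show "\<exists>d>0. \<forall>y\<in>U. dist y x < d \<longrightarrow> dist (\<mu> y) (\<mu> x) < e"
  proof (intro exI[of _ "e / (B0 + 1)"] conjI ballI impI)
    show "e / (B0 + 1) > 0" using e B0_nonneg by simp
    fix y assume y: "y \<in> U" "dist y x < e / (B0 + 1)"
    have "(B0 + 1) * norm (y - x) < e" using y B0_nonneg by (simp add: dist_norm field_simps)
    moreover have "B0 * norm (y - x) \<le> (B0 + 1) * norm (y - x)" by (intro mult_right_mono) auto
    ultimately have "B0 * norm (y - x) < e" by linarith
    thus "dist (\<mu> y) (\<mu> x) < e"
      using \<mu>_lip[OF x y(1)] \<mu>_lip[OF y(1) x] by (simp add: dist_real_def norm_minus_commute)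
  qed
qed

lemma Df_split: "x \<in> U \<Longrightarrow> Df x [(a, z)] = Df x [(a, 0)] + Df x [(0, z)]"
  and Dg_split: "x \<in> U \<Longrightarrow> Dg x [(a, z)] = Dg x [(a, 0)] + Dg x [(0, z)]"
  using linear_add[OF linear_Df, of x "(a, 0)" "(0, z)"] linear_add[OF linear_Dg, of x "(a, 0)" "(0, z)"] by auto

lemma Df_numeric: "x \<in> U \<Longrightarrow> a \<bullet> Df x [(a, z)] \<ge> \<alpha> x * (norm a)\<^sup>2 - Fn x * norm a * norm z"
proof -
  assume x: "x \<in> U"
  have "\<bar>a \<bullet> Df x [(0, z)]\<bar> \<le> norm a * (Fn x * norm z)"
    using Fn[OF x] by (intro order_trans[OF Cauchy_Schwarz_ineq2] mult_left_mono) auto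
  hence "a \<bullet> Df x [(0, z)] \<ge> - (Fn x * norm a * norm z)" by (simp add: abs_le_iff mult_ac)
  moreover have "a \<bullet> Df x [(a, 0)] \<ge> \<alpha> x * (norm a)\<^sup>2" using mon x by blast
  ultimately show ?thesis unfolding Df_split[OF x, of a z] inner_add_right by linarith
qed

lemma Dg_numeric: "x \<in> U \<Longrightarrow> z \<bullet> Dg x [(a, z)] \<le> ell x * (norm z)\<^sup>2 + \<mu> x * norm a * norm z"
proof -
  assume x: "x \<in> U"
  have "\<bar>z \<bullet> Dg x [(a, 0)]\<bar> \<le> norm z * (\<mu> x * norm a)"
    using \<mu>[OF x] by (intro order_trans[OF Cauchy_Schwarz_ineq2] mult_left_mono) auto
  hence "z \<bullet> Dg x [(a, 0)] \<le> \<mu> x * norm a * norm z" by (simp add: abs_le_iff mult_ac)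
  moreover have "z \<bullet> Dg x [(0, z)] \<le> ell x * (norm z)\<^sup>2" using dis x by blast
  ultimately show ?thesis unfolding Dg_split[OF x, of a z] inner_add_right by linarith
qed

lemma gap1': "x \<in> U \<Longrightarrow> \<alpha> x \<ge> ell x + Fn x + \<mu> x + c1"
  using gap1 by (simp add: \<mu>_def Fn_def)

text \<open>Applying the mean value theorem to a combination of the two components makes
  \<open>\<alpha>\<close>, \<open>ell\<close>, \<open>Fn\<close> and \<open>\<mu>\<close> appear at one common intermediate point.\<close>
lemma mean_value_combination:
  assumes p: "p \<in> U" "p' \<in> U" and st: "s \<ge> 0" "t \<ge> 0"
  defines "q \<equiv> norm (fst (p' - p))" and "\<zeta> \<equiv> norm (snd (p' - p))"
  shows "\<exists>m\<in>U. s * (fst (p' - p) \<bullet> (f p' - f p)) - t * (snd (p' - p) \<bullet> (g p' - g p)) \<ge>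
     s * (\<alpha> m * q\<^sup>2 - Fn m * q * \<zeta>) - t * (ell m * \<zeta>\<^sup>2 + \<mu> m * q * \<zeta>)"
proof -
  define \<Delta> where "\<Delta> = p' - p"
  define \<psi> where "\<psi> \<tau> = s * (fst \<Delta> \<bullet> f (p + \<tau> *\<^sub>R \<Delta>)) - t * (snd \<Delta> \<bullet> g (p + \<tau> *\<^sub>R \<Delta>))" for \<tau> :: real
  have inU: "p + \<tau> *\<^sub>R \<Delta> \<in> U" if "0 \<le> \<tau>" "\<tau> \<le> 1" for \<tau>
  proof -
    have "p + \<tau> *\<^sub>R \<Delta> = (1 - \<tau>) *\<^sub>R p + \<tau> *\<^sub>R p'" by (simp add: \<Delta>_def algebra_simps)
    thus ?thesis using convexU p that by (auto simp: convex_alt)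
  qed
  define \<psi>' where "\<psi>' \<tau> h = s * (fst \<Delta> \<bullet> Df (p + \<tau> *\<^sub>R \<Delta>) [h *\<^sub>R \<Delta>]) - t * (snd \<Delta> \<bullet> Dg (p + \<tau> *\<^sub>R \<Delta>) [h *\<^sub>R \<Delta>])"
    for \<tau> h :: real
  have "\<exists>\<tau>\<in>{0<..<1}. \<psi> 1 - \<psi> 0 = \<psi>' \<tau> (1 - 0)"
  proof (rule mvt_simple)
    fix \<tau> :: real assume \<tau>: "0 \<le> \<tau>" "\<tau> \<le> 1"
    have 1: "((\<lambda>\<tau>. p + \<tau> *\<^sub>R \<Delta>) has_derivative (\<lambda>h. h *\<^sub>R \<Delta>)) (at \<tau> within {0..1})"
      by (auto intro!: derivative_eq_intros)
    show "(\<psi> has_derivative \<psi>' \<tau>) (at \<tau> within {0..1})"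
      unfolding \<psi>_def[abs_def] \<psi>'_def[abs_def]
      by (intro has_derivative_diff has_derivative_mult_right has_derivative_inner_right
          has_derivative_compose[OF 1 f_deriv[OF inU[OF \<tau>]]] has_derivative_compose[OF 1 g_deriv[OF inU[OF \<tau>]]])
  qed simp
  then obtain \<tau> where \<tau>: "0 < \<tau>" "\<tau> < 1" "\<psi> 1 - \<psi> 0 = \<psi>' \<tau> 1" by auto
  define m where "m = p + \<tau> *\<^sub>R \<Delta>"
  have m: "m \<in> U" unfolding m_def using \<tau> by (intro inU) auto
  have "\<psi> 1 - \<psi> 0 = s * (fst \<Delta> \<bullet> (f p' - f p)) - t * (snd \<Delta> \<bullet> (g p' - g p))"
    by (simp add: \<psi>_def \<Delta>_def inner_diff_right right_diff_distrib)
  moreover have "\<psi>' \<tau> 1 \<ge> s * (\<alpha> m * q\<^sup>2 - Fn m * q * \<zeta>) - t * (ell m * \<zeta>\<^sup>2 + \<mu> m * q * \<zeta>)"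
    using Df_numeric[OF m, of "fst \<Delta>" "snd \<Delta>"] Dg_numeric[OF m, of "snd \<Delta>" "fst \<Delta>"] st
    unfolding \<psi>'_def m_def[symmetric] q_def \<zeta>_def \<Delta>_def[symmetric]
    by (intro diff_mono mult_left_mono) auto
  ultimately show ?thesis using m \<tau>(3) unfolding \<Delta>_def by (intro bexI[of _ m]) auto
qed

section \<open>Pairs of solutions and the cone\<close>

abbreviation "Fld \<equiv> \<lambda>x. (f x, g x)"

lemma fwd_sol_parts:
  assumes "fwd_sol Fld U x \<phi>" "t \<in> {0..T}"
  shows "\<phi> t \<in> U" "((\<lambda>t. fst (\<phi> t)) has_vector_derivative f (\<phi> t)) (at t within {0..T})"
    "((\<lambda>t. snd (\<phi> t)) has_vector_derivative g (\<phi> t)) (at t within {0..T})"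
proof -
  show "\<phi> t \<in> U" using assms by (auto simp: fwd_sol_def)
  have "(\<phi> has_vector_derivative (f (\<phi> t), g (\<phi> t))) (at t within {0..})"
    using assms by (auto simp: fwd_sol_def)
  hence d: "(\<phi> has_vector_derivative (f (\<phi> t), g (\<phi> t))) (at t within {0..T})"
    by (rule has_vector_derivative_within_subset) auto
  show "((\<lambda>t. fst (\<phi> t)) has_vector_derivative f (\<phi> t)) (at t within {0..T})"
    using bounded_linear.has_vector_derivative[OF bounded_linear_fst d] by simp
  show "((\<lambda>t. snd (\<phi> t)) has_vector_derivative g (\<phi> t)) (at t within {0..T})"
    using bounded_linear.has_vector_derivative[OF bounded_linear_snd d] by simp
qed

lemma norm_sq_prod: "(norm (x::'a \<times> 'b))\<^sup>2 = (norm (fst x))\<^sup>2 + (norm (snd x))\<^sup>2"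
  by (simp add: norm_prod_def)

lemma norm_parts: "norm (fst (x::'a \<times> 'b)) \<le> norm x" "norm (snd x) \<le> norm x"
  using norm_fst_le[of "fst x" "snd x"] norm_snd_le[of "snd x" "fst x"] by simp_all

text \<open>The Lipschitz bound, used once for each component, lets the squared distance shrink at
  rate at most \<open>4 * B0\<close>. Because solutions never meet, their difference is nonzero on
  the boundary of the cone and slopes between them are well defined.\<close>

lemma sol_distinct:
  assumes \<phi>: "fwd_sol Fld U x \<phi>" and \<psi>: "fwd_sol Fld U y \<psi>" and ne: "x \<noteq> y" and T: "T \<ge> 0"
  shows "\<phi> T \<noteq> \<psi> T"
proof -
  define N where "N t = (norm (fst (\<psi> t) - fst (\<phi> t)))\<^sup>2 + (norm (snd (\<psi> t) - snd (\<phi> t)))\<^sup>2" for t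
  define N' where "N' t = 2 * ((fst (\<psi> t) - fst (\<phi> t)) \<bullet> (f (\<psi> t) - f (\<phi> t))) +
      2 * ((snd (\<psi> t) - snd (\<phi> t)) \<bullet> (g (\<psi> t) - g (\<phi> t)))" for t
  have Neq: "N t = (norm (\<psi> t - \<phi> t))\<^sup>2" for t by (simp add: N_def norm_sq_prod)
  have "N T \<ge> exp (- 4 * B0 * T - - 4 * B0 * 0) * N 0"
  proof (rule gronwall_lower[where y' = N' and \<kappa> = "\<lambda>_. - 4 * B0", OF _ _ _ T])
    fix t assume t: "t \<in> {0..T}"
    note p = fwd_sol_parts[OF \<phi> t] fwd_sol_parts[OF \<psi> t]
    show "(N has_real_derivative N' t) (at t within {0..T})"
      unfolding N_def[abs_def] N'_def
      by (intro DERIV_add has_real_derivative_inner_self has_vector_derivative_diff p)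
    show "((*) (- 4 * B0) has_real_derivative - 4 * B0) (at t within {0..T})"
      by (auto intro!: derivative_eq_intros)
    define n where "n = norm (\<psi> t - \<phi> t)"
    have "\<bar>(fst (\<psi> t) - fst (\<phi> t)) \<bullet> (f (\<psi> t) - f (\<phi> t))\<bar> \<le> n * (B0 * n)"
      using f_lip[OF p(4,1)] norm_parts(1)[of "\<psi> t - \<phi> t"] unfolding n_def fst_diff
      by (intro order_trans[OF Cauchy_Schwarz_ineq2] mult_mono) auto
    moreover have "\<bar>(snd (\<psi> t) - snd (\<phi> t)) \<bullet> (g (\<psi> t) - g (\<phi> t))\<bar> \<le> n * (B0 * n)"
      using g_lip[OF p(4,1)] norm_parts(2)[of "\<psi> t - \<phi> t"] unfolding n_def snd_diff
      by (intro order_trans[OF Cauchy_Schwarz_ineq2] mult_mono) auto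
    ultimately show "- 4 * B0 * N t \<le> N' t"
      unfolding N'_def Neq n_def[symmetric] by (simp add: power2_eq_square mult_ac)
  qed
  moreover have "N 0 > 0" using \<phi> \<psi> ne by (simp add: Neq fwd_sol_def)
  ultimately have "N T > 0" by (smt (verit) exp_gt_zero mult_pos_pos)
  thus ?thesis by (auto simp: Neq)
qed

text \<open>Escape from the cone in the form that serves three times: points with the same
  \<open>z\<close> coincide, whence the graph property and the maximality of
  \<open>\<Gamma>\<close>, and different points of the graph lie outside each other's cones, whence
  the strict contraction.\<close>

lemma cone_implies_equal:
  assumes \<phi>: "fwd_sol Fld U x \<phi>" and \<psi>: "fwd_sol Fld U y \<psi>"
    and cone: "norm (fst y - fst x) \<ge> norm (snd y - snd x)"
  shows "x = y"
proof (rule ccontr)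
  assume ne: "x \<noteq> y"
  define a where "a t = fst (\<psi> t) - fst (\<phi> t)" for t
  define z where "z t = snd (\<psi> t) - snd (\<phi> t)" for t
  define \<Delta>f where "\<Delta>f t = f (\<psi> t) - f (\<phi> t)" for t
  define \<Delta>g where "\<Delta>g t = g (\<psi> t) - g (\<phi> t)" for t
  define Q where "Q t = (norm (a t))\<^sup>2" for t
  define Z where "Z t = (norm (z t))\<^sup>2" for t
  have dQ: "(Q has_real_derivative 2 * (a t \<bullet> \<Delta>f t)) (at t within {0..T})"
    and dZ: "(Z has_real_derivative 2 * (z t \<bullet> \<Delta>g t)) (at t within {0..T})" if t: "t \<in> {0..T}" for t T
    unfolding Q_def[abs_def] Z_def[abs_def] a_def[abs_def] z_def[abs_def] \<Delta>f_def \<Delta>g_def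
    by (intro has_real_derivative_inner_self has_vector_derivative_diff fwd_sol_parts[OF \<phi> t] fwd_sol_parts[OF \<psi> t])+
  have inU: "\<phi> t \<in> U" "\<psi> t \<in> U" if "t \<ge> 0" for t using that \<phi> \<psi> by (auto simp: fwd_sol_def)
  have start: "a 0 = fst y - fst x" "z 0 = snd y - snd x" using \<phi> \<psi> by (auto simp: a_def z_def fwd_sol_def)
  \<comment> \<open>Weights 1 and 1 are used on the boundary of the cone, weights 1 and 0 for the
    growth inside it.\<close>
  have combo: "\<exists>m\<in>U. s * (a t \<bullet> \<Delta>f t) - s' * (z t \<bullet> \<Delta>g t) \<ge>
      s * (\<alpha> m * (norm (a t))\<^sup>2 - Fn m * norm (a t) * norm (z t)) - s' * (ell m * (norm (z t))\<^sup>2 + \<mu> m * norm (a t) * norm (z t))"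
    if "t \<ge> 0" "s \<ge> 0" "s' \<ge> 0" for t s s'
    using mean_value_combination[OF inU[OF that(1)] that(2,3)] by (simp add: a_def z_def \<Delta>f_def \<Delta>g_def)
  have D0: "Q 0 - Z 0 \<ge> 0"
    using power_mono[OF cone norm_ge_zero, of 2] by (simp add: Q_def Z_def start)
  have D: "Q t - Z t \<ge> 0" if t: "t \<ge> 0" for t
  proof (rule barrier_nonneg[where y = "\<lambda>t. Q t - Z t" and y' = "\<lambda>t. 2 * (a t \<bullet> \<Delta>f t) - 2 * (z t \<bullet> \<Delta>g t)" and T = t])
    fix s assume s: "s \<in> {0..t}"
    show "((\<lambda>t. Q t - Z t) has_real_derivative 2 * (a s \<bullet> \<Delta>f s) - 2 * (z s \<bullet> \<Delta>g s)) (at s within {0..t})"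
      by (intro DERIV_diff dQ dZ s)
    assume "Q s - Z s = 0"
    hence eq: "norm (z s) = norm (a s)" by (simp add: Q_def Z_def)
    \<comment> \<open>On the boundary both parts have equal norm, so \<open>a s = 0\<close> would
      mean that the solutions have met.\<close>
    have "\<phi> s \<noteq> \<psi> s" using sol_distinct[OF \<phi> \<psi> ne] s by auto
    hence "a s \<noteq> 0" using eq by (auto simp: a_def z_def prod_eq_iff)
    moreover obtain m where m: "m \<in> U" "1 * (a s \<bullet> \<Delta>f s) - 1 * (z s \<bullet> \<Delta>g s) \<ge>
        1 * (\<alpha> m * (norm (a s))\<^sup>2 - Fn m * norm (a s) * norm (z s)) - 1 * (ell m * (norm (z s))\<^sup>2 + \<mu> m * norm (a s) * norm (z s))"
      using combo[of s 1 1] s by auto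
    have "(a s \<bullet> \<Delta>f s) - (z s \<bullet> \<Delta>g s) \<ge> (\<alpha> m - Fn m - ell m - \<mu> m) * (norm (a s))\<^sup>2"
      using m(2) by (simp add: eq power2_eq_square algebra_simps)
    moreover have "(\<alpha> m - Fn m - ell m - \<mu> m) * (norm (a s))\<^sup>2 \<ge> c1 * (norm (a s))\<^sup>2"
      using gap1'[OF m(1)] by (intro mult_right_mono) auto
    moreover have "c1 * (norm (a s))\<^sup>2 > 0" using c \<open>a s \<noteq> 0\<close> by simp
    ultimately show "2 * (a s \<bullet> \<Delta>f s) - 2 * (z s \<bullet> \<Delta>g s) > 0" by linarith
  qed (use t D0 in auto)
  have Q0: "Q 0 > 0"
  proof -
    have "a 0 \<noteq> 0"
    proof
      assume "a 0 = 0"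
      hence "z 0 = 0" using cone start by simp
      thus False using ne start \<open>a 0 = 0\<close> by (simp add: prod_eq_iff)
    qed
    thus ?thesis by (simp add: Q_def)
  qed
  have grow: "Q T \<ge> exp (2 * c1 * T - 2 * c1 * 0) * Q 0" if T: "T \<ge> 0" for T
  proof (rule gronwall_lower[where \<kappa> = "\<lambda>_. 2 * c1", OF dQ _ _ T])
    fix s assume s: "s \<in> {0..T}"
    show "((*) (2 * c1) has_real_derivative 2 * c1) (at s within {0..T})" by (auto intro!: derivative_eq_intros)
    obtain m where m: "m \<in> U" "1 * (a s \<bullet> \<Delta>f s) - 0 * (z s \<bullet> \<Delta>g s) \<ge>
        1 * (\<alpha> m * (norm (a s))\<^sup>2 - Fn m * norm (a s) * norm (z s)) - 0 * (ell m * (norm (z s))\<^sup>2 + \<mu> m * norm (a s) * norm (z s))"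
      using combo[of s 1 0] s by auto
    have "(norm (z s))\<^sup>2 \<le> (norm (a s))\<^sup>2" using D[of s] s by (simp add: Q_def Z_def)
    hence "norm (z s) \<le> norm (a s)" by (rule power2_le_imp_le) simp
    hence "Fn m * norm (a s) * norm (z s) \<le> Fn m * norm (a s) * norm (a s)"
      using Fn_nonneg[OF m(1)] by (intro mult_left_mono) auto
    hence "a s \<bullet> \<Delta>f s \<ge> (\<alpha> m - Fn m) * Q s" using m(2) by (simp add: Q_def power2_eq_square algebra_simps)
    moreover have "(\<alpha> m - Fn m) * Q s \<ge> c1 * Q s"
      using gap1'[OF m(1)] \<mu>_nonneg[OF m(1)] ell m(1) by (intro mult_right_mono) (auto simp: Q_def)
    ultimately show "2 * c1 * Q s \<le> 2 * (a s \<bullet> \<Delta>f s)" by linarith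
  qed
  \<comment> \<open>By \<open>exp x \<ge> 1 + x\<close>, \<open>Q\<close> is at least
    \<open>Q 0 + d\<^sup>2\<close> at this time, more than a box of size \<open>d\<close>
    admits.\<close>
  define T where "T = d\<^sup>2 / (2 * c1 * Q 0)"
  have T: "T \<ge> 0" using c Q0 by (simp add: T_def)
  have "\<psi> T \<in> cone (\<phi> T) \<inter> U" using D[OF T] inU[OF T]
    by (simp add: cone_def Lq_def Q_def Z_def a_def z_def norm_minus_commute)
  hence "norm (a T) \<le> d" using cone_box inU[OF T] by (auto simp: boxB_def a_def)
  hence "Q T \<le> d\<^sup>2" unfolding Q_def by (intro power_mono) auto
  moreover have "exp (2 * c1 * T) * Q 0 \<ge> (1 + 2 * c1 * T) * Q 0"
    using Q0 exp_ge_add_one_self[of "2 * c1 * T"] by (intro mult_right_mono) auto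
  moreover have "(1 + 2 * c1 * T) * Q 0 = Q 0 + d\<^sup>2" using c Q0 by (simp add: T_def field_simps)
  ultimately show False using grow[OF T] Q0 by simp
qed

section \<open>The graph and the induced semiflow\<close>

definition "K = snd ` U"

lemma openK: "open K" unfolding K_def by (rule open_image_snd[OF openU])
lemma convexK: "convex K" unfolding K_def by (rule convex_linear_image[OF linear_snd convexU])

lemma \<Gamma>_U: "\<Gamma> \<subseteq> U" using inv by (simp add: pos_invariant_def)

lemma \<Gamma>_sol: "x \<in> \<Gamma> \<Longrightarrow> \<exists>\<phi>. fwd_sol Fld U x \<phi>"
  and \<Gamma>_stay: "x \<in> \<Gamma> \<Longrightarrow> fwd_sol Fld U x \<phi> \<Longrightarrow> t \<ge> 0 \<Longrightarrow> \<phi> t \<in> \<Gamma>"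
  using inv by (auto simp: pos_invariant_def)

lemma invariant_subset:
  assumes "S \<subseteq> U" "pos_invariant Fld U S" shows "S \<subseteq> \<Gamma>"
proof
  fix x assume x: "x \<in> S"
  hence "snd x \<in> snd ` \<Gamma>" using proj assms(1) by auto
  then obtain y where y: "y \<in> \<Gamma>" "snd y = snd x" by auto
  obtain \<phi> \<psi> where "fwd_sol Fld U x \<phi>" "fwd_sol Fld U y \<psi>"
    using assms(2) x \<Gamma>_sol[OF y(1)] by (auto simp: pos_invariant_def)
  hence "x = y" using y by (intro cone_implies_equal) auto
  thus "x \<in> \<Gamma>" using y by simp
qed

definition "h z = (THE a. (a, z) \<in> \<Gamma>)"
definition "X z = (h z, z)"
definition "sol z = (SOME \<phi>. fwd_sol Fld U (X z) \<phi>)"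
definition "\<theta> z t = snd (sol z t)"

lemma \<Gamma>_unique: assumes "(a, z) \<in> \<Gamma>" "(a', z) \<in> \<Gamma>" shows "a = a'"
proof -
  obtain \<phi> \<psi> where "fwd_sol Fld U (a, z) \<phi>" "fwd_sol Fld U (a', z) \<psi>"
    using \<Gamma>_sol assms by meson
  from cone_implies_equal[OF this] show ?thesis by simp
qed

lemma X_\<Gamma>: assumes "z \<in> K" shows "X z \<in> \<Gamma>"
proof -
  obtain a where a: "(a, z) \<in> \<Gamma>" using assms unfolding K_def proj[symmetric] by auto
  hence "h z = a" unfolding h_def using \<Gamma>_unique by blast
  thus ?thesis using a by (simp add: X_def)
qed

lemma X_U: "z \<in> K \<Longrightarrow> X z \<in> U" using X_\<Gamma> \<Gamma>_U by blast

lemma \<Gamma>_graph: "\<Gamma> = {(h z, z) |z. z \<in> K}"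
proof
  show "\<Gamma> \<subseteq> {(h z, z) |z. z \<in> K}"
  proof
    fix x assume x: "x \<in> \<Gamma>"
    hence z: "snd x \<in> K" using \<Gamma>_U by (auto simp: K_def)
    have "fst x = h (snd x)" using \<Gamma>_unique[of "fst x" "snd x" "h (snd x)"] x X_\<Gamma>[OF z] by (simp add: X_def)
    thus "x \<in> {(h z, z) |z. z \<in> K}" using z by (auto simp: prod_eq_iff)
  qed
qed (use X_\<Gamma> in \<open>auto simp: X_def\<close>)

lemma sol: "z \<in> K \<Longrightarrow> fwd_sol Fld U (X z) (sol z)"
  unfolding sol_def using \<Gamma>_sol[OF X_\<Gamma>] by (rule someI_ex)

text \<open>Invariance keeps the solution on the graph, so its \<open>z\<close> component determines
  it. This reduces the system to an autonomous equation on \<open>K\<close>.\<close>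

lemma sol_graph: assumes "z \<in> K" "t \<ge> 0" shows "\<theta> z t \<in> K" "sol z t = X (\<theta> z t)"
proof -
  have s: "sol z t \<in> \<Gamma>" using \<Gamma>_stay[OF X_\<Gamma> sol] assms by simp
  then obtain z' where "z' \<in> K" "sol z t = (h z', z')" by (subst (asm) \<Gamma>_graph) auto
  thus "\<theta> z t \<in> K" "sol z t = X (\<theta> z t)" by (auto simp: \<theta>_def X_def)
qed

lemma h_strict_contraction:
  assumes z: "z1 \<in> K" "z2 \<in> K" "z1 \<noteq> z2" shows "norm (h z2 - h z1) < norm (z2 - z1)"
proof (rule ccontr)
  assume "\<not> norm (h z2 - h z1) < norm (z2 - z1)"
  hence "X z1 = X z2" using z by (intro cone_implies_equal[OF sol sol]) (auto simp: X_def)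
  thus False using z by (simp add: X_def)
qed

text \<open>Strict contraction alone would bound the norm of \<open>Dh\<close> only by 1, so an
  aperture below 1 is needed. This one satisfies
  \<open>1 / \<rho> = 1 + (c1 / 2) / (B0 + 1)\<close>: as \<open>Fn m \<le> B0\<close>, replacing
  \<open>Fn m\<close> by \<open>Fn m / \<rho>\<close> costs at most half of
  \<open>c1\<close>.\<close>

definition "\<rho> = (B0 + 1) / (B0 + 1 + c1 / 2)"

lemma \<rho>: "0 < \<rho>" "\<rho> < 1"
  using B0_nonneg c by (auto simp: \<rho>_def)

lemma \<rho>_Fn: assumes "m \<in> U" shows "Fn m / \<rho> \<le> Fn m + c1 / 2"
proof -
  have 1: "Fn m / \<rho> = Fn m + Fn m * (c1 / 2) / (B0 + 1)"
    using B0_nonneg c by (simp add: \<rho>_def field_simps)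
  have "Fn m * (c1 / 2) / (B0 + 1) \<le> (B0 + 1) * (c1 / 2) / (B0 + 1)"
    using Fn_le[OF assms] c B0_nonneg by (intro divide_right_mono mult_right_mono) auto
  also have "(B0 + 1) * (c1 / 2) / (B0 + 1) = c1 / 2"
    using B0_nonneg by (intro nonzero_mult_div_cancel_left) auto
  finally show ?thesis using 1 by simp
qed

text \<open>Inside the cone of aperture \<open>\<rho>\<close> the slope grows exponentially, although it stays below 1.\<close>
lemma h_contraction:
  assumes z1: "z1 \<in> K" and z2: "z2 \<in> K" shows "norm (h z2 - h z1) \<le> \<rho> * norm (z2 - z1)"
proof (rule ccontr)
  assume not: "\<not> norm (h z2 - h z1) \<le> \<rho> * norm (z2 - z1)"
  hence ne: "X z1 \<noteq> X z2" by (auto simp: X_def)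
  define \<phi> where "\<phi> = sol z1"
  define \<psi> where "\<psi> = sol z2"
  have \<phi>: "fwd_sol Fld U (X z1) \<phi>" and \<psi>: "fwd_sol Fld U (X z2) \<psi>" unfolding \<phi>_def \<psi>_def by (intro sol z1 z2)+
  define a where "a t = fst (\<psi> t) - fst (\<phi> t)" for t
  define z where "z t = snd (\<psi> t) - snd (\<phi> t)" for t
  define \<Delta>f where "\<Delta>f t = f (\<psi> t) - f (\<phi> t)" for t
  define \<Delta>g where "\<Delta>g t = g (\<psi> t) - g (\<phi> t)" for t
  define Q where "Q t = (norm (a t))\<^sup>2" for t
  define Z where "Z t = (norm (z t))\<^sup>2" for t
  have dQ: "(Q has_real_derivative 2 * (a t \<bullet> \<Delta>f t)) (at t within {0..T})"
    and dZ: "(Z has_real_derivative 2 * (z t \<bullet> \<Delta>g t)) (at t within {0..T})" if t: "t \<in> {0..T}" for t T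
    unfolding Q_def[abs_def] Z_def[abs_def] a_def[abs_def] z_def[abs_def] \<Delta>f_def \<Delta>g_def
    by (intro has_real_derivative_inner_self has_vector_derivative_diff fwd_sol_parts[OF \<phi> t] fwd_sol_parts[OF \<psi> t])+
  have inU: "\<phi> t \<in> U" "\<psi> t \<in> U" if "t \<ge> 0" for t using that \<phi> \<psi> by (auto simp: fwd_sol_def)
  have lt: "norm (a t) < norm (z t)" if t: "t \<ge> 0" for t
  proof -
    have "\<phi> t = X (\<theta> z1 t)" "\<psi> t = X (\<theta> z2 t)" unfolding \<phi>_def \<psi>_def by (intro sol_graph z1 z2 t)+
    moreover have "\<theta> z1 t \<noteq> \<theta> z2 t" using sol_distinct[OF \<phi> \<psi> ne t] calculation by auto
    ultimately show ?thesis
      using h_strict_contraction[of "\<theta> z1 t" "\<theta> z2 t"] sol_graph(1)[OF z1 t] sol_graph(1)[OF z2 t]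
      by (simp add: a_def z_def X_def)
  qed
  have Zpos: "Z t > 0" if "t \<ge> 0" for t
    using lt[OF that] by (auto simp: Z_def)
  define R where "R t = Q t / Z t" for t
  define R' where "R' t = (2 * (a t \<bullet> \<Delta>f t) * Z t - Q t * (2 * (z t \<bullet> \<Delta>g t))) / (Z t * Z t)" for t
  have dR: "(R has_real_derivative R' t) (at t within {0..T})" if t: "t \<in> {0..T}" for t T
    unfolding R_def[abs_def] R'_def using Zpos[of t] t by (intro DERIV_divide dQ dZ t) auto
  have R1: "R t < 1" if t: "t \<ge> 0" for t
  proof -
    have "Q t < Z t" unfolding Q_def Z_def using lt[OF t] by (intro power_strict_mono) auto
    thus ?thesis using Zpos[OF t] by (simp add: R_def)
  qed
  have key: "R' t \<ge> c1 * R t" if t: "t \<ge> 0" and R: "R t \<ge> \<rho>\<^sup>2" for t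
  proof -
    define q where "q = norm (a t)"
    define \<zeta> where "\<zeta> = norm (z t)"
    have q\<zeta>: "Q t = q\<^sup>2" "Z t = \<zeta>\<^sup>2" "0 \<le> q" "q \<le> \<zeta>" "0 < \<zeta>"
      using lt[OF t] Zpos[OF t] by (auto simp: q_def \<zeta>_def Q_def Z_def)
    have "\<rho>\<^sup>2 * \<zeta>\<^sup>2 \<le> q\<^sup>2" using R q\<zeta> by (simp add: R_def field_simps)
    hence "(\<rho> * \<zeta>)\<^sup>2 \<le> q\<^sup>2" by (simp add: power_mult_distrib)
    hence \<rho>q: "\<rho> * \<zeta> \<le> q" using q\<zeta>(3) by (rule power2_le_imp_le)
    hence \<zeta>q: "\<zeta> \<le> q / \<rho>" using \<rho> by (simp add: field_simps)
    \<comment> \<open>With weights \<open>Z t\<close> and \<open>Q t\<close> the combination is half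
      the numerator of \<open>R' t\<close>, so the gap condition is invoked at a single intermediate
      point.\<close>
    obtain m where m: "m \<in> U" "Z t * (a t \<bullet> \<Delta>f t) - Q t * (z t \<bullet> \<Delta>g t) \<ge>
        Z t * (\<alpha> m * q\<^sup>2 - Fn m * q * \<zeta>) - Q t * (ell m * \<zeta>\<^sup>2 + \<mu> m * q * \<zeta>)"
      using mean_value_combination[OF inU[OF t], of "Z t" "Q t"] q\<zeta>
      by (auto simp: a_def z_def \<Delta>f_def \<Delta>g_def q_def \<zeta>_def)
    have 1: "Fn m * (q * \<zeta>\<^sup>2) * \<zeta> \<le> Fn m * (q * \<zeta>\<^sup>2) * (q / \<rho>)"
      using \<zeta>q q\<zeta> Fn_nonneg[OF m(1)] by (intro mult_left_mono) auto
    have 2: "\<mu> m * (q\<^sup>2 * \<zeta>) * q \<le> \<mu> m * (q\<^sup>2 * \<zeta>) * \<zeta>"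
      using q\<zeta> \<mu>_nonneg[OF m(1)] by (intro mult_left_mono) auto
    have 3: "Fn m * (q * \<zeta>\<^sup>2) * (q / \<rho>) = (Fn m / \<rho>) * (q\<^sup>2 * \<zeta>\<^sup>2)" by (simp add: power2_eq_square)
    have 4: "(Fn m / \<rho>) * (q\<^sup>2 * \<zeta>\<^sup>2) \<le> (Fn m + c1 / 2) * (q\<^sup>2 * \<zeta>\<^sup>2)"
      using \<rho>_Fn[OF m(1)] by (intro mult_right_mono) auto
    have 5: "(\<alpha> m - ell m - \<mu> m - Fn m - c1 / 2) * (q\<^sup>2 * \<zeta>\<^sup>2) \<ge> (c1 / 2) * (q\<^sup>2 * \<zeta>\<^sup>2)"
      using gap1'[OF m(1)] by (intro mult_right_mono) auto
    have "Z t * (\<alpha> m * q\<^sup>2 - Fn m * q * \<zeta>) - Q t * (ell m * \<zeta>\<^sup>2 + \<mu> m * q * \<zeta>) =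
       (\<alpha> m - ell m) * (q\<^sup>2 * \<zeta>\<^sup>2) - Fn m * (q * \<zeta>\<^sup>2) * \<zeta> - \<mu> m * (q\<^sup>2 * \<zeta>) * q"
      unfolding q\<zeta> by (simp add: power2_eq_square algebra_simps)
    also have "\<dots> \<ge> (\<alpha> m - ell m) * (q\<^sup>2 * \<zeta>\<^sup>2) - (Fn m + c1 / 2) * (q\<^sup>2 * \<zeta>\<^sup>2) - \<mu> m * (q\<^sup>2 * \<zeta>) * \<zeta>"
      using 1 2 4 unfolding 3 by linarith
    also have "(\<alpha> m - ell m) * (q\<^sup>2 * \<zeta>\<^sup>2) - (Fn m + c1 / 2) * (q\<^sup>2 * \<zeta>\<^sup>2) - \<mu> m * (q\<^sup>2 * \<zeta>) * \<zeta> =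
       (\<alpha> m - ell m - \<mu> m - Fn m - c1 / 2) * (q\<^sup>2 * \<zeta>\<^sup>2)"
      by (simp add: power2_eq_square algebra_simps)
    finally have "Z t * (a t \<bullet> \<Delta>f t) - Q t * (z t \<bullet> \<Delta>g t) \<ge> (c1 / 2) * (q\<^sup>2 * \<zeta>\<^sup>2)"
      using m(2) 5 by linarith
    hence 6: "2 * (a t \<bullet> \<Delta>f t) * Z t - Q t * (2 * (z t \<bullet> \<Delta>g t)) \<ge> c1 * (Q t * Z t)"
      unfolding q\<zeta> by (simp add: algebra_simps)
    have "c1 * R t = c1 * (Q t * Z t) / (Z t * Z t)" using Zpos[OF t] by (simp add: R_def)
    also have "\<dots> \<le> R' t" unfolding R'_def using 6 by (intro divide_right_mono) auto
    finally show ?thesis .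
  qed
  have R0: "R 0 \<ge> \<rho>\<^sup>2"
  proof -
    have "\<rho> * norm (z 0) \<le> norm (a 0)" using not \<phi> \<psi> by (simp add: a_def z_def fwd_sol_def X_def)
    hence "(\<rho> * norm (z 0))\<^sup>2 \<le> Q 0" unfolding Q_def using \<rho> by (intro power_mono) auto
    thus ?thesis using Zpos[of 0] by (simp add: R_def Z_def power_mult_distrib field_simps)
  qed
  have R\<rho>: "R t \<ge> \<rho>\<^sup>2" if t: "t \<ge> 0" for t
  proof -
    have "R t - \<rho>\<^sup>2 \<ge> 0"
    proof (rule barrier_nonneg[where y = "\<lambda>t. R t - \<rho>\<^sup>2" and y' = R' and T = t])
      fix s assume s: "s \<in> {0..t}"
      show "((\<lambda>t. R t - \<rho>\<^sup>2) has_real_derivative R' s) (at s within {0..t})"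
        using DERIV_diff[OF dR[OF s] DERIV_const] by simp
      assume "R s - \<rho>\<^sup>2 = 0"
      hence "R' s \<ge> c1 * \<rho>\<^sup>2" using key[of s] s by simp
      thus "R' s > 0" using c \<rho> by (smt (verit) mult_pos_pos zero_less_power)
    qed (use t R0 in auto)
    thus ?thesis by simp
  qed
  have grow: "R T \<ge> exp (c1 * T - c1 * 0) * R 0" if T: "T \<ge> 0" for T
    by (rule gronwall_lower[where \<kappa> = "\<lambda>_. c1", OF dR _ key[OF _ R\<rho>] T])
       (auto intro!: derivative_eq_intros)
  have R0pos: "R 0 > 0" using R0 \<rho> by (smt (verit) zero_less_power)
  \<comment> \<open>\<open>exp x \<ge> x\<close> makes \<open>R T\<close> at least 1 at this time,
    whereas the strict contraction keeps \<open>R\<close> below 1.\<close>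
  define T where "T = 1 / (c1 * R 0)"
  have T: "T \<ge> 0" using c R0pos by (simp add: T_def)
  have "c1 * T \<le> exp (c1 * T)" using exp_ge_add_one_self[of "c1 * T"] by linarith
  hence "exp (c1 * T) * R 0 \<ge> (c1 * T) * R 0" using R0pos by (intro mult_right_mono) auto
  moreover have "c1 * T * R 0 = 1" using c R0pos by (simp add: T_def)
  ultimately show False using grow[OF T] R1[OF T] by simp
qed

lemma X_lip: "x \<in> K \<Longrightarrow> y \<in> K \<Longrightarrow> norm (X x - X y) \<le> 2 * norm (x - y)"
proof -
  assume xy: "x \<in> K" "y \<in> K"
  have "norm (X x - X y) \<le> norm (h x - h y) + norm (x - y)" unfolding X_def by (simp add: norm_Pair_le)
  moreover have "norm (h x - h y) \<le> 1 * norm (x - y)"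
    using h_contraction[OF xy(2,1)] mult_right_mono[of \<rho> 1 "norm (x - y)"] \<rho> by simp
  ultimately show ?thesis by simp
qed

definition "G z = g (X z)"

sublocale flow: semiflow K \<theta> G "2 * B0"
proof
  show "open K" by (rule openK)
  show "\<theta> z 0 = z" if "z \<in> K" for z using sol[OF that] by (simp add: \<theta>_def fwd_sol_def X_def)
  show "\<theta> z t \<in> K" if "z \<in> K" "t \<ge> 0" for z t using that by (rule sol_graph)
  show "(\<theta> z has_vector_derivative G (\<theta> z t)) (at t within {0..})" if "z \<in> K" "t \<ge> 0" for z t
  proof -
    have "(sol z has_vector_derivative (f (sol z t), g (sol z t))) (at t within {0..})"
      using sol[OF that(1)] that(2) by (simp add: fwd_sol_def)
    from bounded_linear.has_vector_derivative[OF bounded_linear_snd this]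
    have "((\<lambda>t. snd (sol z t)) has_vector_derivative g (sol z t)) (at t within {0..})" by simp
    moreover have "\<theta> z = (\<lambda>t. snd (sol z t))" by (rule ext) (simp add: \<theta>_def)
    moreover have "G (\<theta> z t) = g (sol z t)" by (simp add: G_def sol_graph(2)[OF that])
    ultimately show ?thesis by simp
  qed
  show "2 * B0 \<ge> 0" using B0_nonneg by simp
  show "norm (G x - G y) \<le> 2 * B0 * norm (x - y)" if "x \<in> K" "y \<in> K" for x y
  proof -
    have "norm (G x - G y) \<le> B0 * norm (X x - X y)" unfolding G_def by (intro g_lip X_U that)
    also have "\<dots> \<le> B0 * (2 * norm (x - y))" by (intro mult_left_mono X_lip that B0_nonneg)
    finally show ?thesis by simp
  qed
qed

lemma h_evolves: "flow.evolves h (\<lambda>z. f (X z))"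
  unfolding flow.evolves_def
proof (intro ballI allI impI)
  fix z and t :: real assume z: "z \<in> K" "t \<ge> 0"
  have "(sol z has_vector_derivative (f (sol z t), g (sol z t))) (at t within {0..})"
    using sol[OF z(1)] z(2) by (simp add: fwd_sol_def)
  from bounded_linear.has_vector_derivative[OF bounded_linear_fst this]
  have "((\<lambda>t. fst (sol z t)) has_vector_derivative f (X (\<theta> z t))) (at t within {0..})"
    by (simp add: sol_graph(2)[OF z])
  thus "((\<lambda>t. h (\<theta> z t)) has_vector_derivative f (X (\<theta> z t))) (at t within {0..})"
    by (rule has_vector_derivative_transform[rotated 2]) (use z sol_graph(2)[OF z(1)] in \<open>auto simp: X_def\<close>)
qed

end

section \<open>First derivative of the graph\<close>

lemma lipschitz_derivative_remainder:
  fixes u :: "'x::euclidean_space \<Rightarrow> 'y::euclidean_space"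
  assumes U: "convex U" and B: "B \<ge> 0"
    and u: "\<And>x. x \<in> U \<Longrightarrow> (u has_derivative D x) (at x)"
    and lip: "\<And>x y v. x \<in> U \<Longrightarrow> y \<in> U \<Longrightarrow> norm (D x v - D y v) \<le> B * norm (x - y) * norm v"
    and p: "p0 \<in> U" "p \<in> U" "p' \<in> U" "norm (p - p0) \<le> e" "norm (p' - p0) \<le> e"
  shows "norm (u p - u p' - D p0 (p - p')) \<le> B * e * norm (p - p')"
proof -
  have lin: "bounded_linear (D p0)" using u[OF p(1)] by (rule has_derivative_bounded_linear)
  define w where "w x = u x - D p0 x" for x
  have e: "e \<ge> 0" using p(4) norm_ge_zero order_trans by blast
  have "norm (w p - w p') \<le> B * e * norm (p - p')"
  proof (rule differentiable_bound[where S = "U \<inter> cball p0 e" and f' = "\<lambda>x v. D x v - D p0 v"])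
    show "convex (U \<inter> cball p0 e)" by (intro convex_Int U convex_cball)
    fix x assume x: "x \<in> U \<inter> cball p0 e"
    show "(w has_derivative (\<lambda>v. D x v - D p0 v)) (at x within U \<inter> cball p0 e)"
      unfolding w_def[abs_def] using u[of x] x lin
      by (intro has_derivative_diff bounded_linear_imp_has_derivative) (auto intro: has_derivative_at_withinI)
    have "norm (D x v - D p0 v) \<le> B * e * norm v" for v
    proof -
      have "B * norm (x - p0) * norm v \<le> B * e * norm v"
        using x B by (intro mult_right_mono mult_left_mono) (auto simp: dist_norm norm_minus_commute)
      thus ?thesis using lip[of x p0 v] x p(1) by auto
    qed
    thus "onorm (\<lambda>v. D x v - D p0 v) \<le> B * e" by (intro onorm_le)
  qed (use p in \<open>auto simp: dist_norm norm_minus_commute\<close>)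
  moreover have "w p - w p' = u p - u p' - D p0 (p - p')"
    using linear_diff[OF bounded_linear.linear[OF lin], of p p'] by (simp add: w_def)
  ultimately show ?thesis by simp
qed

text \<open>Both encodings put the newest direction in front, so \<open>nder bs\<close> of a first
  partial derivative is \<open>Du\<close> at \<open>bs @ [e]\<close>. One derivative is spent on
  \<open>e\<close>, hence \<open>r - 1\<close>.\<close>

lemma higher_derivs_CB:
  fixes u :: "'x::euclidean_space \<Rightarrow> 'y::euclidean_space"
  assumes hd: "higher_derivs r U u Du" "open U" "1 \<le> r" and b: "\<forall>j\<in>{1..r}. deriv_bounded_on U Du j"
    and e: "e \<in> Basis"
  shows "CB (r - 1) U (\<lambda>x. Du x [e])"
proof -
  have n: "\<forall>x\<in>U. nder bs (\<lambda>x. Du x [e]) x = Du x (bs @ [e])" if "length bs \<le> r - 1" for bs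
    using that
  proof (induction bs)
    case (Cons b bs)
    show ?case
    proof
      fix x assume x: "x \<in> U"
      have "nder (b # bs) (\<lambda>x. Du x [e]) x = Dd b (\<lambda>x. Du x (bs @ [e])) x"
        unfolding nder.simps by (rule Dd_cong(1)[OF hd(2) x]) (use Cons in auto)
      also have "\<dots> = Du x (b # bs @ [e])"
        by (rule Dd_eq, rule higher_derivs_step[OF hd(1,2) x]) (use Cons.prems in auto)
      finally show "nder (b # bs) (\<lambda>x. Du x [e]) x = Du x ((b # bs) @ [e])" by simp
    qed
  qed simp
  show ?thesis
    unfolding CB_def
  proof (intro allI impI)
    fix bs :: "'x list" assume bs: "set bs \<subseteq> Basis" "length bs \<le> r - 1"
    note eq = n[OF bs(2), rule_format]
    have diff: "nder bs (\<lambda>x. Du x [e]) differentiable (at x)" if x: "x \<in> U" and l: "length bs < r - 1" for x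
    proof -
      have "(\<lambda>x. Du x (bs @ [e])) differentiable (at x)"
        using higher_derivs_step[OF hd(1,2) x, of "bs @ [e]"] l unfolding differentiable_def by force
      thus ?thesis using Dd_cong(2)[OF hd(2) x eq] by simp
    qed
    have cont: "continuous_on U (nder bs (\<lambda>x. Du x [e]))"
    proof (cases "length bs < r - 1")
      case True
      thus ?thesis using diff by (meson continuous_at_imp_continuous_on differentiable_imp_continuous_within)
    next
      case False
      hence "length (bs @ [e]) = r" using bs hd(3) by simp
      hence "continuous_on U (\<lambda>x. Du x (bs @ [e]))" using hd(1) by (auto simp: higher_derivs_def)
      thus ?thesis by (subst continuous_on_cong[OF refl eq]) auto
    qed
    have "deriv_bounded_on U Du (length (bs @ [e]))" using b bs hd(3) by auto
    then obtain B where B: "\<forall>x\<in>U. \<forall>vs. length vs = length (bs @ [e]) \<longrightarrow> norm (Du x vs) \<le> B * prod_list (map norm vs)"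
      unfolding deriv_bounded_on_def by blast
    have one: "prod_list (map norm vs) = 1" if "set vs \<subseteq> Basis" for vs :: "'x list"
      using that by (induction vs) auto
    have "norm (nder bs (\<lambda>x. Du x [e]) x) \<le> B" if x: "x \<in> U" for x
      using B[rule_format, OF x, of "bs @ [e]"] one[of "bs @ [e]"] bs e eq[OF x] by simp
    hence "bounded (nder bs (\<lambda>x. Du x [e]) ` U)" by (auto simp: bounded_iff)
    thus "(length bs < r - 1 \<longrightarrow> (\<forall>z\<in>U. nder bs (\<lambda>x. Du x [e]) differentiable (at z))) \<and>
       continuous_on U (nder bs (\<lambda>x. Du x [e])) \<and> bounded (nder bs (\<lambda>x. Du x [e]) ` U)"
      using diff cont by auto
  qed
qed

lemma Dd_diff: "u differentiable (at z) \<Longrightarrow> w differentiable (at z) \<Longrightarrow>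
    Dd v (\<lambda>z. u z - w z) z = Dd v u z - Dd v w z"
  by (rule Dd_eq) (intro has_derivative_diff has_derivative_Dd)

lemma Dd_add: "u differentiable (at z) \<Longrightarrow> w differentiable (at z) \<Longrightarrow>
    Dd v (\<lambda>z. u z + w z) z = Dd v u z + Dd v w z"
  by (rule Dd_eq) (intro has_derivative_add has_derivative_Dd)

lemma Dd_sum: "(\<And>i. i \<in> A \<Longrightarrow> u i differentiable (at z)) \<Longrightarrow>
    Dd v (\<lambda>z. \<Sum>i\<in>A. u i z) z = (\<Sum>i\<in>A. Dd v (u i) z)"
  by (rule Dd_eq) (intro has_derivative_sum has_derivative_Dd)

lemma Dd_inner_scaleR:
  fixes u :: "'b::real_normed_vector \<Rightarrow> 'c::real_inner"
  assumes "u differentiable (at z)" "w differentiable (at z)"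
  shows "Dd v (\<lambda>z. (u z \<bullet> e) *\<^sub>R w z) z = (u z \<bullet> e) *\<^sub>R Dd v w z + (Dd v u z \<bullet> e) *\<^sub>R w z"
  using assms by (intro Dd_eq has_derivative_scaleR has_derivative_inner_left has_derivative_Dd)

lemma differentiable_inner_scaleR:
  fixes u :: "'b::real_normed_vector \<Rightarrow> 'c::real_inner"
  assumes "u differentiable (at z)" "w differentiable (at z)"
  shows "(\<lambda>z. (u z \<bullet> e) *\<^sub>R w z) differentiable (at z)"
  using has_derivative_scaleR[OF has_derivative_inner_left[OF has_derivative_Dd[OF assms(1)]] has_derivative_Dd[OF assms(2)]]
  by (auto simp: differentiable_def)

lemma differentiable_sum':
  "(\<And>i. i \<in> A \<Longrightarrow> u i differentiable (at z)) \<Longrightarrow> (\<lambda>z. \<Sum>i\<in>A. u i z) differentiable (at z)"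
  by (induction A rule: infinite_finite_induct) auto

context cone_system
begin

lemma continuous_X: "continuous_on K X"
proof -
  have "2-lipschitz_on K X" by (rule lipschitz_onI) (auto simp: dist_norm intro: X_lip)
  thus ?thesis by (rule lipschitz_on_continuous_on)
qed

text \<open>\<open>X\<close> is only Lipschitz at this point, so the chain rule leaves the increment
  \<open>X x - X y\<close>, and with it that of \<open>h\<close>, unevaluated.\<close>

lemma strict_lin_compose_X:
  fixes u :: "'a \<times> 'b \<Rightarrow> 'c::euclidean_space"
  assumes u: "\<And>x. x \<in> U \<Longrightarrow> (u has_derivative D x) (at x)"
    and lip: "\<And>x y v. x \<in> U \<Longrightarrow> y \<in> U \<Longrightarrow> norm (D x v - D y v) \<le> B0 * norm (x - y) * norm v"
  shows "strict_lin K (\<lambda>z x y. D (X z) (X x - X y)) (\<lambda>z. u (X z))"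
  unfolding strict_lin_def
proof (intro allI impI)
  fix C and \<omega> :: real assume C: "compact C" "C \<subseteq> K" "\<omega> > 0"
  \<comment> \<open>\<open>X\<close> is 2-Lipschitz: one factor 2 comes from the distances to
    \<open>X z\<close>, another from \<open>norm (X x - X y)\<close>.\<close>
  define \<delta> where "\<delta> = \<omega> / (4 * (B0 + 1))"
  have \<delta>: "\<delta> > 0" using C B0_nonneg by (simp add: \<delta>_def)
  have "B0 * (2 * \<delta>) * 2 \<le> (B0 + 1) * (2 * \<delta>) * 2" using \<delta> by simp
  also have "\<dots> = \<omega>" using B0_nonneg by (simp add: \<delta>_def field_simps)
  finally have B\<delta>: "B0 * (2 * \<delta>) * 2 \<le> \<omega>" .
  show "\<exists>\<delta>>0. \<forall>z\<in>C. \<forall>x\<in>K \<inter> ball z \<delta>. \<forall>y\<in>K \<inter> ball z \<delta>.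
      norm (u (X x) - u (X y) - D (X z) (X x - X y)) \<le> \<omega> * norm (x - y)"
  proof (intro exI[of _ \<delta>] conjI \<delta> ballI)
    fix z x y assume z: "z \<in> C" and x: "x \<in> K \<inter> ball z \<delta>" and y: "y \<in> K \<inter> ball z \<delta>"
    have K: "z \<in> K" "x \<in> K" "y \<in> K" using z x y C by auto
    have "norm (X x - X z) \<le> 2 * \<delta>" "norm (X y - X z) \<le> 2 * \<delta>"
      using X_lip[OF K(2,1)] X_lip[OF K(3,1)] x y by (auto simp: dist_norm norm_minus_commute)
    hence "norm (u (X x) - u (X y) - D (X z) (X x - X y)) \<le> B0 * (2 * \<delta>) * norm (X x - X y)"
      by (intro lipschitz_derivative_remainder[OF convexU B0_nonneg u lip] X_U K)
    also have "\<dots> \<le> B0 * (2 * \<delta>) * (2 * norm (x - y))"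
      using B0_nonneg \<delta> by (intro mult_left_mono X_lip K) auto
    also have "\<dots> \<le> \<omega> * norm (x - y)" using mult_right_mono[OF B\<delta>, of "norm (x - y)"] by simp
    finally show "norm (u (X x) - u (X y) - D (X z) (X x - X y)) \<le> \<omega> * norm (x - y)" .
  qed
qed

lemma X_diff: "X x - X y = (h x - h y, x - y)" by (simp add: X_def)

text \<open>Bounds the one-sided expansion of the reduced field \<open>G\<close>: along the graph,
  whose slope is below 1, \<open>D\<^sub>ag\<close> adds at most \<open>\<mu>\<close> to
  \<open>ell\<close>.\<close>

definition "\<gamma> z = ell (X z) + \<mu> (X z)"

lemma \<gamma>_continuous: "continuous_on K \<gamma>"
  unfolding \<gamma>_def[abs_def]
  by (intro continuous_on_add continuous_on_compose2[OF ell(1) continuous_X]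
      continuous_on_compose2[OF \<mu>_continuous continuous_X]) (auto intro: X_U)

lemma \<gamma>_nonneg: "z \<in> K \<Longrightarrow> \<gamma> z \<ge> 0"
  unfolding \<gamma>_def using ell(2) X_U[of z] \<mu>_nonneg[of "X z"] by (auto intro!: add_nonneg_nonneg)

lemma Df_linear_sum: "x \<in> U \<Longrightarrow> finite J \<Longrightarrow>
    Df x [(\<Sum>j\<in>J. c j *\<^sub>R w j, \<Sum>j\<in>J. c j *\<^sub>R v j)] = (\<Sum>j\<in>J. c j *\<^sub>R Df x [(w j, v j)])"
  and Dg_linear_sum: "x \<in> U \<Longrightarrow> finite J \<Longrightarrow>
    Dg x [(\<Sum>j\<in>J. c j *\<^sub>R w j, \<Sum>j\<in>J. c j *\<^sub>R v j)] = (\<Sum>j\<in>J. c j *\<^sub>R Dg x [(w j, v j)])"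
proof -
  have eq: "(\<Sum>j\<in>J. c j *\<^sub>R w j, \<Sum>j\<in>J. c j *\<^sub>R v j) = (\<Sum>j\<in>J. c j *\<^sub>R (w j, v j))" if "finite J" for J :: "'j set" and c :: "'j \<Rightarrow> real" and w v
    by (simp add: prod_eq_iff fst_sum snd_sum)
  show "x \<in> U \<Longrightarrow> finite J \<Longrightarrow> Df x [(\<Sum>j\<in>J. c j *\<^sub>R w j, \<Sum>j\<in>J. c j *\<^sub>R v j)] = (\<Sum>j\<in>J. c j *\<^sub>R Df x [(w j, v j)])"
    by (simp add: eq linear_sum[OF linear_Df] linear_cmul[OF linear_Df] del: scaleR_Pair)
  show "x \<in> U \<Longrightarrow> finite J \<Longrightarrow> Dg x [(\<Sum>j\<in>J. c j *\<^sub>R w j, \<Sum>j\<in>J. c j *\<^sub>R v j)] = (\<Sum>j\<in>J. c j *\<^sub>R Dg x [(w j, v j)])"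
    by (simp add: eq linear_sum[OF linear_Dg] linear_cmul[OF linear_Dg] del: scaleR_Pair)
qed

text \<open>A family with a single member, whose Lipschitz constant 1 comes from the contraction.
  The rate condition is exactly the first gap condition along the graph.\<close>

lemma h_C1: "C1 K h"
proof (rule strictly_diff_imp_C1[OF openK])
  fix z assume z: "z \<in> K"
  show "strictly_diff_at K h z"
  proof (rule flow.strictly_diff_invariant_graph[where I = "{()}" and W = "\<lambda>_. h" and \<phi> = "\<lambda>_ z. f (X z)" and M = 1
        and gap = c1 and a = "\<lambda>z. \<alpha> (X z)" and l = "\<lambda>z. ell (X z)" and F = "\<lambda>z. Fn (X z)" and g = "\<lambda>z. \<mu> (X z)"
        and L\<phi> = "\<lambda>z w v i. Df (X z) [(w (), v)]" and LG = "\<lambda>z w v. Dg (X z) [(w (), v)]" and ?i0.0 = "()"])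
    show "L2_set (\<lambda>i. norm (h x - h y)) {()} \<le> 1 * norm (x - y)" if "x \<in> K" "y \<in> K" for x y
      using h_contraction[OF that(2,1)] \<rho> mult_right_mono[of \<rho> 1 "norm (x - y)"] by simp
    show "strict_lin K (\<lambda>z x y. Df (X z) [(h x - h y, x - y)]) (\<lambda>z. f (X z))"
      using strict_lin_compose_X[OF f_deriv Df_lip] by (simp add: X_diff)
    show "strict_lin K (\<lambda>z x y. Dg (X z) [(h x - h y, x - y)]) G"
      using strict_lin_compose_X[OF g_deriv Dg_lip] by (simp add: X_diff G_def[abs_def])
    show "(\<Sum>i\<in>{()}. w i \<bullet> Df (X z) [(w (), v)]) \<ge>
       \<alpha> (X z) * (L2_set (\<lambda>i. norm (w i)) {()})\<^sup>2 - Fn (X z) * 1 * L2_set (\<lambda>i. norm (w i)) {()} * norm v"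
      if "z \<in> K" for z v and w :: "unit \<Rightarrow> 'a"
      using Df_numeric[OF X_U[OF that], of "w ()" v] by simp
    show "v \<bullet> Dg (X z) [(w (), v)] \<le>
       ell (X z) * (norm v)\<^sup>2 + \<mu> (X z) / 1 * L2_set (\<lambda>i. norm (w i)) {()} * norm v"
      if "z \<in> K" for z v and w :: "unit \<Rightarrow> 'a"
      using Dg_numeric[OF X_U[OF that], of v "w ()"] by simp
    show "ell (X z) + Fn (X z) + \<mu> (X z) + c1 \<le> \<alpha> (X z)" if "z \<in> K" for z
      using gap1'[OF X_U[OF that]] .
    show "continuous_on K (\<lambda>z. ell (X z) + \<mu> (X z))" using \<gamma>_continuous by (simp add: \<gamma>_def[abs_def])
  qed (use z c h_evolves in \<open>auto intro: Fn_nonneg \<mu>_nonneg X_U Df_linear_sum Dg_linear_sum\<close>)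
qed

lemma h_diff: "z \<in> K \<Longrightarrow> h differentiable (at z)"
  by (rule C1D[OF h_C1])

lemma Dh_bound: "z \<in> K \<Longrightarrow> norm (Dd v h z) \<le> \<rho> * norm v"
  using h_contraction by (intro lipschitz_Dd_bound[OF openK _ h_diff]) auto

lemma Dh_le: "z \<in> K \<Longrightarrow> norm (Dd v h z) \<le> norm v"
  using Dh_bound[of z v] \<rho> mult_right_mono[of \<rho> 1 "norm v"] by simp

text \<open>Regularity is recorded for the first derivatives because \<open>h\<close> itself may be
  unbounded. Thus \<open>HB N\<close> speaks of the derivatives of \<open>h\<close> of orders 1 to
  \<open>N + 1\<close>.\<close>

definition "HB N \<longleftrightarrow> (\<forall>b\<in>Basis. CB N K (Dd b h))"

lemma HB_0: "HB 0"
  unfolding HB_def CB_0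
proof (intro ballI conjI)
  fix b :: 'b assume "b \<in> Basis"
  show "continuous_on K (Dd b h)" by (rule C1_continuous_Dd[OF h_C1])
  show "bounded (Dd b h ` K)" using Dh_le by (auto simp: bounded_iff)
qed

text \<open>With \<open>X z = (h z, z)\<close>: \<open>XX v\<close> is \<open>DX v\<close>, \<open>FE\<close> and \<open>GE\<close> are \<open>Df \<circ> X\<close> and \<open>Dg \<circ> X\<close>, \<open>Bv v\<close> is \<open>DG v\<close>, and \<open>A\<close> is
  \<open>D\<^sub>af - Dh D\<^sub>ag\<close> along the graph.\<close>
definition "XX v z = (Dd v h z, v)"
definition "FE e z = Df (X z) [e]"
definition "GE e z = Dg (X z) [e]"
definition "Bv v z = Dg (X z) [XX v z]"
definition "A e z = FE (e, 0) z - (\<Sum>b\<in>Basis. (GE (e, 0) z \<bullet> b) *\<^sub>R Dd b h z)"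

lemma X_has_derivative: "z \<in> K \<Longrightarrow> (X has_derivative (\<lambda>v. XX v z)) (at z)"
  unfolding X_def[abs_def] XX_def by (intro has_derivative_Pair has_derivative_Dd h_diff has_derivative_ident)

lemma G_has_derivative: "z \<in> K \<Longrightarrow> (G has_derivative (\<lambda>v. Bv v z)) (at z)"
  unfolding G_def[abs_def] Bv_def
  by (rule has_derivative_compose[OF X_has_derivative g_deriv[OF X_U]])

lemma fX_has_derivative: "z \<in> K \<Longrightarrow> ((\<lambda>z. f (X z)) has_derivative (\<lambda>v. Df (X z) [XX v z])) (at z)"
  by (rule has_derivative_compose[OF X_has_derivative f_deriv[OF X_U]])

lemma Dd_G: "z \<in> K \<Longrightarrow> Dd v G z = Bv v z"
  by (rule Dd_eq[OF G_has_derivative])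

lemma Df_eq_sum: "z \<in> K \<Longrightarrow> Df (X z) [w] = (\<Sum>e\<in>Basis. (w \<bullet> e) *\<^sub>R FE e z)"
  and Dg_eq_sum: "z \<in> K \<Longrightarrow> Dg (X z) [w] = (\<Sum>e\<in>Basis. (w \<bullet> e) *\<^sub>R GE e z)"
proof -
  assume z: "z \<in> K"
  interpret F: linear "\<lambda>v. Df (X z) [v]" by (rule linear_Df[OF X_U[OF z]])
  interpret G: linear "\<lambda>v. Dg (X z) [v]" by (rule linear_Dg[OF X_U[OF z]])
  have "Df (X z) [w] = Df (X z) [(\<Sum>e\<in>Basis. (w \<bullet> e) *\<^sub>R e)]" "Dg (X z) [w] = Dg (X z) [(\<Sum>e\<in>Basis. (w \<bullet> e) *\<^sub>R e)]"
    by (simp_all only: euclidean_representation)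
  thus "Df (X z) [w] = (\<Sum>e\<in>Basis. (w \<bullet> e) *\<^sub>R FE e z)" "Dg (X z) [w] = (\<Sum>e\<in>Basis. (w \<bullet> e) *\<^sub>R GE e z)"
    by (simp_all add: F.sum F.scale G.sum G.scale FE_def GE_def)
qed

lemma Bv_eq: "z \<in> K \<Longrightarrow> Bv v z = (\<Sum>e\<in>Basis. (XX v z \<bullet> e) *\<^sub>R GE e z)"
  unfolding Bv_def by (rule Dg_eq_sum)

lemma CB_XX: "HB N \<Longrightarrow> v \<in> Basis \<Longrightarrow> CB N K (XX v)"
proof -
  assume N: "HB N" and v: "v \<in> Basis"
  have "CB N K (\<lambda>z. (Dd v h z, 0) + (0, v))"
    using N v by (intro CB_add CB_const CB_linear[OF openK bl_Pair(1)] openK) (auto simp: HB_def)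
  thus ?thesis by (simp add: XX_def[abs_def])
qed

lemma CB_compose_X:
  assumes N: "HB N" and M: "M \<le> Suc N" and u: "CB M U u"
  shows "CB M K (\<lambda>z. u (X z))"
proof (rule CB_compose[OF openK openU _ _ u])
  show "X ` K \<subseteq> U" using X_U by auto
  show "X differentiable (at z)" if "z \<in> K" for z using X_has_derivative[OF that] by (auto simp: differentiable_def)
  fix b :: 'b and M' assume b: "b \<in> Basis" and "M = Suc M'"
  hence "CB M' K (XX b)" using CB_mono[OF CB_XX[OF N b]] M by simp
  thus "CB M' K (Dd b X)"
    using CB_cong[OF openK, of "Dd b X" "XX b" M'] Dd_eq[OF X_has_derivative] by simp
qed

lemma CB_FE: "HB N \<Longrightarrow> M \<le> Suc N \<Longrightarrow> M \<le> r - 1 \<Longrightarrow> e \<in> Basis \<Longrightarrow> CB M K (FE e)"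
  and CB_GE: "HB N \<Longrightarrow> M \<le> Suc N \<Longrightarrow> M \<le> r - 1 \<Longrightarrow> e \<in> Basis \<Longrightarrow> CB M K (GE e)"
  unfolding FE_def[abs_def] GE_def[abs_def]
  using CB_mono[OF higher_derivs_CB[OF Df openU _ fb, of e]] CB_mono[OF higher_derivs_CB[OF Dg openU _ gb, of e]] r
  by (auto intro!: CB_compose_X[of N M])

lemma CB_Bv: "HB N \<Longrightarrow> N \<le> r - 1 \<Longrightarrow> v \<in> Basis \<Longrightarrow> CB N K (Bv v)"
  by (subst CB_cong[OF openK Bv_eq], assumption)
     (intro CB_sum openK CB_inner_scaleR CB_XX CB_GE[of N]; simp)

lemma CB_A: "HB N \<Longrightarrow> N \<le> r - 1 \<Longrightarrow> e \<in> Basis \<Longrightarrow> CB N K (A e)"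
  unfolding A_def[abs_def]
  by (intro CB_diff CB_sum CB_inner_scaleR openK CB_FE[of N] CB_GE[of N]; simp add: Basis_prod_def HB_def)

lemma sum_Basis_fst: "(\<Sum>e\<in>Basis. ((a, 0::'b) \<bullet> e) *\<^sub>R u e) = (\<Sum>e\<in>Basis. (a \<bullet> e) *\<^sub>R u (e, 0))"
  for a :: 'a and u :: "'a \<times> 'b \<Rightarrow> 'c::real_vector"
proof -
  have "(Basis :: ('a \<times> 'b) set) = (\<lambda>e. (e, 0)) ` Basis \<union> (\<lambda>e. (0, e)) ` Basis" by (auto simp: Basis_prod_def)
  moreover have "(\<Sum>e\<in>(\<lambda>e. (e, 0)) ` Basis \<union> (\<lambda>e. (0, e)) ` Basis. ((a, 0::'b) \<bullet> e) *\<^sub>R u e) =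
     (\<Sum>e\<in>(\<lambda>e. (e, 0)) ` Basis. ((a, 0::'b) \<bullet> e) *\<^sub>R u e) + (\<Sum>e\<in>(\<lambda>e. (0, e)) ` Basis. ((a, 0::'b) \<bullet> e) *\<^sub>R u e)"
    by (rule sum.union_disjoint) auto
  moreover have "(\<Sum>e\<in>(\<lambda>e. (e, 0)) ` Basis. ((a, 0::'b) \<bullet> e) *\<^sub>R u e) = (\<Sum>e\<in>Basis. (a \<bullet> e) *\<^sub>R u (e, 0))"
    by (subst sum.reindex) (auto simp: inj_on_def)
  moreover have "(\<Sum>e\<in>(\<lambda>e. (0, e)) ` Basis. ((a, 0::'b) \<bullet> e) *\<^sub>R u e) = 0"
    by (rule sum.neutral) auto
  ultimately show ?thesis by simp
qed

lemma A_sum: "(\<Sum>e\<in>Basis. (a \<bullet> e) *\<^sub>R A e z) =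
   (\<Sum>e\<in>Basis. ((a, 0::'b) \<bullet> e) *\<^sub>R FE e z) - (\<Sum>b\<in>Basis. ((\<Sum>e\<in>Basis. ((a, 0::'b) \<bullet> e) *\<^sub>R GE e z) \<bullet> b) *\<^sub>R Dd b h z)"
proof -
  have "(\<Sum>e\<in>Basis. (a \<bullet> e) *\<^sub>R (\<Sum>b\<in>Basis. (GE (e, 0) z \<bullet> b) *\<^sub>R Dd b h z)) =
    (\<Sum>b\<in>Basis. ((\<Sum>e\<in>Basis. (a \<bullet> e) *\<^sub>R GE (e, 0) z) \<bullet> b) *\<^sub>R Dd b h z)"
    unfolding scaleR_sum_right inner_sum_left scaleR_sum_left by (subst sum.swap) simp
  thus ?thesis unfolding sum_Basis_fst A_def by (simp add: scaleR_diff_right sum_subtractf)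
qed

text \<open>The correction \<open>Dh D\<^sub>ag\<close> costs at most \<open>\<mu>\<close>, since
  \<open>Dh\<close> has norm at most 1. This is one of the \<open>r + 1\<close> multiples of the
  norm of \<open>D\<^sub>ag\<close> in the gap condition of order \<open>r\<close>.\<close>

lemma A_numeric:
  assumes z: "z \<in> K"
  shows "p \<bullet> (\<Sum>e\<in>Basis. (p \<bullet> e) *\<^sub>R A e z) \<ge> (\<alpha> (X z) - \<mu> (X z)) * (norm p)\<^sup>2"
proof -
  define q where "q = Dg (X z) [(p, 0)]"
  have eq: "(\<Sum>e\<in>Basis. (p \<bullet> e) *\<^sub>R A e z) = Df (X z) [(p, 0)] - Dd q h z"
    unfolding A_sum q_def Df_eq_sum[OF z] Dg_eq_sum[OF z] by (subst (2) Dd_eq_sum_Basis[OF h_diff[OF z]]) simp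
  have "\<bar>p \<bullet> Dd q h z\<bar> \<le> norm p * (\<mu> (X z) * norm p)"
    using Dh_le[OF z, of q] \<mu>[OF X_U[OF z], of p] unfolding q_def
    by (intro order_trans[OF Cauchy_Schwarz_ineq2] mult_left_mono) auto
  moreover have "p \<bullet> Df (X z) [(p, 0)] \<ge> \<alpha> (X z) * (norm p)\<^sup>2" using mon X_U[OF z] by blast
  ultimately show ?thesis unfolding eq inner_diff_right by (simp add: algebra_simps power2_eq_square abs_le_iff)
qed

lemma Bv_sum_Basis: "z \<in> K \<Longrightarrow> (\<Sum>v\<in>Basis. (p \<bullet> v) * (Bv v z \<bullet> p)) = p \<bullet> Bv p z"
proof -
  assume z: "z \<in> K"
  interpret linear "\<lambda>v. Bv v z" using G_has_derivative[OF z] by (rule has_derivative_linear)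
  have "Bv p z = Bv (\<Sum>v\<in>Basis. (p \<bullet> v) *\<^sub>R v) z" by (simp add: euclidean_representation)
  also have "\<dots> = (\<Sum>v\<in>Basis. (p \<bullet> v) *\<^sub>R Bv v z)" by (simp add: sum scale)
  finally show ?thesis by (simp add: inner_sum_right inner_commute)
qed

lemma cone_numeric:
  assumes x: "x \<in> K" and a: "norm a \<le> norm p"
  shows "p \<bullet> Dg (X x) [(a, p)] \<le> \<gamma> x * (norm p)\<^sup>2"
proof -
  have "p \<bullet> Dg (X x) [(a, p)] \<le> ell (X x) * (norm p)\<^sup>2 + \<mu> (X x) * norm a * norm p"
    by (rule Dg_numeric[OF X_U[OF x]])
  also have "\<mu> (X x) * norm a * norm p \<le> \<mu> (X x) * norm p * norm p"
    using \<mu>_nonneg[OF X_U[OF x]] a by (intro mult_right_mono mult_left_mono) auto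
  finally show ?thesis by (simp add: \<gamma>_def power2_eq_square algebra_simps)
qed

lemma Bv_numeric: "z \<in> K \<Longrightarrow> p \<bullet> Bv p z \<le> \<gamma> z * (norm p)\<^sup>2"
  unfolding Bv_def XX_def by (intro cone_numeric Dh_le)

lemma norm_cone_pair: "norm a \<le> norm p \<Longrightarrow> norm (a::'a, p::'b) \<le> 2 * norm p"
  using norm_Pair_le[of a p] by simp

text \<open>The rate is taken at \<open>x\<close> although \<open>Bv\<close> is taken at
  \<open>y\<close>. In the loss \<open>4 * B0 * e\<close> one factor 2 is the Lipschitz constant of
  \<open>X\<close>, the other comes from \<open>norm (XX p y) \<le> 2 * norm p\<close>.\<close>

lemma Bv_numeric_near:
  assumes x: "x \<in> K" and y: "y \<in> K" and n: "norm (x - y) \<le> e"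
  shows "p \<bullet> Bv p y \<le> (\<gamma> x + 4 * B0 * e) * (norm p)\<^sup>2"
proof -
  have "p \<bullet> Bv p y = p \<bullet> Dg (X x) [XX p y] + p \<bullet> (Dg (X y) [XX p y] - Dg (X x) [XX p y])"
    by (simp add: Bv_def inner_diff_right)
  also have "p \<bullet> Dg (X x) [XX p y] \<le> \<gamma> x * (norm p)\<^sup>2" unfolding XX_def by (intro cone_numeric x Dh_le y)
  also have "p \<bullet> (Dg (X y) [XX p y] - Dg (X x) [XX p y]) \<le> norm p * ((B0 * (2 * e)) * (2 * norm p))"
  proof (rule order_trans[OF norm_cauchy_schwarz], rule mult_left_mono)
    have "norm (Dg (X y) [XX p y] - Dg (X x) [XX p y]) \<le> B0 * norm (X y - X x) * norm (XX p y)"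
      by (intro Dg_lip X_U x y)
    also have "\<dots> \<le> (B0 * (2 * e)) * (2 * norm p)"
    proof (rule mult_mono)
      show "B0 * norm (X y - X x) \<le> B0 * (2 * e)"
        using X_lip[OF y x] n by (intro mult_left_mono B0_nonneg) (simp add: norm_minus_commute)
      show "norm (XX p y) \<le> 2 * norm p" unfolding XX_def by (intro norm_cone_pair Dh_le y)
      show "0 \<le> B0 * (2 * e)" using B0_nonneg order_trans[OF norm_ge_zero n] by simp
    qed simp
    finally show "norm (Dg (X y) [XX p y] - Dg (X x) [XX p y]) \<le> (B0 * (2 * e)) * (2 * norm p)" .
  qed simp
  finally show ?thesis by (simp add: power2_eq_square algebra_simps)
qed

lemma G_numeric_near:
  assumes x: "x \<in> K" and y: "y \<in> K" and n: "norm (x - y) \<le> e"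
  shows "(x - y) \<bullet> (G x - G y) \<le> (\<gamma> x + 4 * B0 * e) * (norm (x - y))\<^sup>2"
proof -
  have e: "e \<ge> 0" using order_trans[OF norm_ge_zero n] .
  have "norm (g (X x) - g (X y) - Dg (X x) [X x - X y]) \<le> B0 * (2 * e) * norm (X x - X y)"
    using X_lip[OF y x] n e by (intro lipschitz_derivative_remainder[OF convexU B0_nonneg g_deriv Dg_lip] X_U x y)
      (auto simp: norm_minus_commute)
  also have "\<dots> \<le> B0 * (2 * e) * (2 * norm (x - y))"
    using B0_nonneg e by (intro mult_left_mono X_lip x y) auto
  finally have 1: "norm (g (X x) - g (X y) - Dg (X x) [X x - X y]) \<le> B0 * (2 * e) * (2 * norm (x - y))" .
  have "(x - y) \<bullet> (G x - G y) = (x - y) \<bullet> Dg (X x) [(h x - h y, x - y)] +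
      (x - y) \<bullet> (g (X x) - g (X y) - Dg (X x) [X x - X y])"
    by (simp add: G_def X_diff inner_diff_right)
  also have "(x - y) \<bullet> Dg (X x) [(h x - h y, x - y)] \<le> \<gamma> x * (norm (x - y))\<^sup>2"
    using h_contraction[OF y x] \<rho> mult_right_mono[of \<rho> 1 "norm (x - y)"] by (intro cone_numeric x) simp
  also have "(x - y) \<bullet> (g (X x) - g (X y) - Dg (X x) [X x - X y]) \<le> norm (x - y) * (B0 * (2 * e) * (2 * norm (x - y)))"
    by (rule order_trans[OF norm_cauchy_schwarz], rule mult_left_mono[OF 1]) simp
  finally show ?thesis by (simp add: power2_eq_square algebra_simps)
qed

lemma G_C1: "C1 K G"
proof (rule C1I[OF G_has_derivative])
  fix b :: 'b assume "b \<in> Basis"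
  thus "continuous_on K (\<lambda>z. Bv b z)" using CB_continuous[OF CB_Bv[OF HB_0]] by auto
qed

text \<open>Substituting \<open>\<gamma> = ell + \<mu>\<close> into the required
  \<open>\<alpha> - \<mu> \<ge> (k + 1) * \<gamma> + cr\<close> gives \<open>k + 1\<close> times
  \<open>ell\<close> and \<open>k + 2\<close> times \<open>\<mu>\<close>. At the last order
  \<open>k = r - 1\<close> these are the coefficients \<open>r\<close> and \<open>r + 1\<close> of
  the gap condition.\<close>

lemma level_CB:
  assumes k: "k + 1 \<le> r"
    and bdd: "\<And>vs. vs \<in> blists k \<Longrightarrow> bounded (nder vs h ` K)"
    and ev: "\<And>vs. vs \<in> blists k \<Longrightarrow> flow.evolves (nder vs h) (\<phi> vs)"
    and lip: "\<And>vs. vs \<in> blists k \<Longrightarrow> lip_along K (\<lambda>vs. nder vs h) (\<phi> vs)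
        (\<lambda>x y w. (\<Sum>e\<in>Basis. (w vs \<bullet> e) *\<^sub>R A e x) - TB (\<lambda>v. Bv v y) w vs)"
    and lin: "\<And>vs. (\<And>us. us \<in> blists k \<Longrightarrow> BL K (nder us h)) \<Longrightarrow> vs \<in> blists k \<Longrightarrow>
       lin_along K (\<lambda>vs. nder vs h) (\<phi> vs)
        (\<lambda>z w. (\<Sum>e\<in>Basis. (w vs \<bullet> e) *\<^sub>R A e z) - TB (\<lambda>v. Bv v z) w vs)"
    and vs: "vs \<in> blists k"
  shows "CB 1 K (nder vs h)"
proof -
  \<comment> \<open>The comparison loss \<open>4 * B0 * e\<close>, incurred \<open>k + 1\<close>
    times, is then at most half of \<open>cr\<close>. Using \<open>B0 + 1\<close> avoids division by
    zero.\<close>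
  define e where "e = cr / (8 * real (k + 1) * (B0 + 1))"
  have e: "e > 0" using c B0_nonneg by (simp add: e_def)
  have se: "real (k + 1) * (4 * B0 * e) \<le> cr / 2"
  proof -
    have "real (k + 1) * (4 * B0 * e) \<le> real (k + 1) * (4 * (B0 + 1) * e)"
      using e by (intro mult_left_mono mult_right_mono) auto
    also have "real (k + 1) * (4 * (B0 + 1) * e) = cr / 2"
    proof -
      have "n > 0 \<Longrightarrow> b > 0 \<Longrightarrow> n * (4 * b * (cr / (8 * n * b))) = cr / 2" for n b :: real by simp
      thus ?thesis unfolding e_def by this (use B0_nonneg in auto)
    qed
    finally show ?thesis .
  qed
  have rate: "\<alpha> (X z) - \<mu> (X z) \<ge> real (k + 1) * \<gamma> z + cr" if z: "z \<in> K" for z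
  proof -
    have "real (k + 1) * ell (X z) \<le> real r * ell (X z)"
      using k ell(2) X_U[OF z] by (intro mult_right_mono) auto
    moreover have "real (k + 2) * \<mu> (X z) \<le> real (r + 1) * \<mu> (X z)"
      using k \<mu>_nonneg[OF X_U[OF z]] by (intro mult_right_mono) auto
    moreover have "\<alpha> (X z) \<ge> real r * ell (X z) + real (r + 1) * \<mu> (X z) + cr"
      using gapr X_U[OF z] by (simp add: \<mu>_def)
    ultimately show ?thesis unfolding \<gamma>_def by (simp add: algebra_simps)
  qed
  show ?thesis
  proof (rule flow.tensor_regularity[where W = "\<lambda>vs. nder vs h" and \<phi> = \<phi> and A = A and B = Bv and k = k
        and a = "\<lambda>z. \<alpha> (X z) - \<mu> (X z)" and \<gamma> = \<gamma> and gap = cr and s = "4 * B0 * e" and \<rho> = e,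
        OF ev bdd lip lin G_C1 Dd_G A_numeric e c(2) _ se _ _ G_numeric_near rate \<gamma>_nonneg \<gamma>_continuous vs])
    show "0 \<le> 4 * B0 * e" using B0_nonneg e by simp
    show "(\<Sum>v\<in>Basis. (p \<bullet> v) * (Bv v y \<bullet> p)) \<le> (\<gamma> x + 4 * B0 * e) * (norm p)\<^sup>2"
      if "x \<in> K" "y \<in> K" "norm (x - y) \<le> e" for x y p
      unfolding Bv_sum_Basis[OF that(2)] by (rule Bv_numeric_near[OF that])
    show "(\<Sum>v\<in>Basis. (p \<bullet> v) * (Bv v z \<bullet> p)) \<le> \<gamma> z * (norm p)\<^sup>2" if "z \<in> K" for z p
      unfolding Bv_sum_Basis[OF that] by (rule Bv_numeric[OF that])
  qed
qed

text \<open>\<open>HB N\<close> covers the derivatives of \<open>h\<close> up to order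
  \<open>N + 1\<close>. Differentiability of those of order exactly \<open>N + 1\<close> adds order
  \<open>N + 2\<close>.\<close>

lemma HB_step:
  assumes HB: "HB N" and C: "\<And>vs. vs \<in> blists (Suc N) \<Longrightarrow> CB 1 K (nder vs h)"
  shows "HB (Suc N)"
  unfolding HB_def
proof
  fix b :: 'b assume b: "b \<in> Basis"
  have N: "CB N K (Dd b h)" using HB b by (simp add: HB_def)
  show "CB (Suc N) K (Dd b h)"
    unfolding CB_def
  proof (intro allI impI)
    fix bs :: "'b list" assume bs: "set bs \<subseteq> Basis" "length bs \<le> Suc N"
    consider "length bs < N" | "length bs = N" | "length bs = Suc N" using bs by linarith
    thus "(length bs < Suc N \<longrightarrow> (\<forall>z\<in>K. nder bs (Dd b h) differentiable (at z))) \<and>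
        continuous_on K (nder bs (Dd b h)) \<and> bounded (nder bs (Dd b h) ` K)"
    proof cases
      case 1
      thus ?thesis using N[unfolded CB_def, rule_format, of bs] bs by auto
    next
      case 2
      have "CB 1 K (nder bs (Dd b h))"
        unfolding nder_snoc[symmetric] by (rule C) (use 2 bs b in \<open>auto simp: blists_def\<close>)
      thus ?thesis using CB_continuous CB_bounded CB_differentiable unfolding One_nat_def by blast
    next
      case 3
      then obtain a as where as: "bs = a # as" by (cases bs) auto
      have "CB 1 K (nder as (Dd b h))"
        unfolding nder_snoc[symmetric] by (rule C) (use 3 as bs b in \<open>auto simp: blists_def\<close>)
      hence "CB 0 K (nder bs (Dd b h))" unfolding One_nat_def CB_Suc using as bs by auto
      thus ?thesis using 3 by (simp add: CB_0)
    qed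
  qed
qed

end

section \<open>Higher derivatives of the graph\<close>

context semiflow
begin

lemma evolves_cong:
  assumes "evolves W \<phi>" "\<And>z. z \<in> K \<Longrightarrow> \<phi> z = \<phi>' z"
  shows "evolves W \<phi>'"
  using assms \<theta>_in unfolding evolves_def by auto

end

context cone_system
begin

abbreviation "W \<equiv> \<lambda>vs. nder vs h"

lemma HB_nder:
  assumes "HB N" "set vs \<subseteq> Basis" "vs \<noteq> []" "length vs \<le> Suc N"
  shows "CB (Suc N - length vs) K (nder vs h)"
  using assms by (intro CB_Suc_nder) (auto simp: HB_def)

lemma fX_C1: "C1 K (\<lambda>z. f (X z))"
proof (rule C1I[OF fX_has_derivative])
  fix b :: 'b assume b: "b \<in> Basis"
  have "CB 0 K (\<lambda>z. \<Sum>e\<in>Basis. (XX b z \<bullet> e) *\<^sub>R FE e z)"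
    by (intro CB_sum CB_inner_scaleR openK CB_XX[OF HB_0 b] CB_FE[OF HB_0]) auto
  thus "continuous_on K (\<lambda>z. Df (X z) [XX b z])"
    by (subst continuous_on_cong[OF refl Df_eq_sum]) (auto dest: CB_continuous)
qed

text \<open>The derivative of \<open>f\<close> along the graph in direction \<open>v\<close>, minus
  \<open>Dh\<close> applied to \<open>DG v\<close>. Writing it as sums of products in coordinates
  makes the product rules for \<open>lip_along\<close> and \<open>lin_along\<close>
  applicable.\<close>

definition "rhs1 v z = (\<Sum>e\<in>Basis. (XX v z \<bullet> e) *\<^sub>R FE e z) - (\<Sum>b\<in>Basis. (Bv v z \<bullet> b) *\<^sub>R Dd b h z)"

lemma evolves_rhs1: "flow.evolves (Dd v h) (rhs1 v)"
proof (rule flow.evolves_cong[OF flow.evolves_Dd[OF h_evolves h_C1 fX_C1 G_C1]])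
  fix z assume z: "z \<in> K"
  show "Dd v (\<lambda>z. f (X z)) z - Dd (Dd v G z) h z = rhs1 v z"
    unfolding rhs1_def Dd_eq[OF fX_has_derivative[OF z]] Df_eq_sum[OF z] Dd_G[OF z]
    by (subst Dd_eq_sum_Basis[OF h_diff[OF z], of "Bv v z"]) simp
qed

lemma BL_CB1: "CB (Suc N) K u \<Longrightarrow> BL K u" for u :: "'b \<Rightarrow> 'c::euclidean_space"
  by (rule BL_CB[OF convexK])

lemma bounded_inner: "bounded (u ` K) \<Longrightarrow> bounded ((\<lambda>z. u z \<bullet> e) ` K)" for u :: "'b \<Rightarrow> 'c::euclidean_space"
  using bounded_linear_image[OF _ bounded_linear_inner_left, of "u ` K" e] by (simp add: image_image)

lemma lip_along_XX: "lip_along K W (XX v) (\<lambda>x y w. (w [v], 0))"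
proof -
  have "lip_along K W (\<lambda>z. (W [v] z, 0) + (0, v)) (\<lambda>x y w. (w [v], 0) + 0)"
    by (intro lip_along_add lip_along_linear[OF bl_Pair(1)] lip_along_W lip_along_BL BL_const)
  thus ?thesis by (rule lip_along_cong) (auto simp: XX_def)
qed

lemma lin_along_XX: "lin_along K W (XX v) (\<lambda>z w. (w [v], 0))"
proof -
  have "lin_along K W (\<lambda>z. (W [v] z, 0) + (0, v)) (\<lambda>z w. (w [v], 0) + 0)"
    by (intro lin_along_add lin_along_linear[OF bl_Pair(1)] lin_along_W lin_along_const)
  thus ?thesis by (rule lin_along_cong) (auto simp: XX_def)
qed

lemma bounded_XX: "v \<in> Basis \<Longrightarrow> bounded (XX v ` K)"
  by (rule CB_bounded[OF CB_XX[OF HB_0]])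

lemma BL_XX: assumes "BL K (Dd v h)" shows "BL K (XX v)"
proof -
  have "BL K (\<lambda>z. (Dd v h z, 0) + (0, v))" by (intro BL_add BL_linear[OF bl_Pair(1)] assms BL_const)
  thus ?thesis by (simp add: XX_def[abs_def])
qed

lemma lip_along_sum_XX:
  fixes E :: "'a \<times> 'b \<Rightarrow> 'b \<Rightarrow> 'c::euclidean_space"
  assumes "v \<in> Basis" "\<And>e. e \<in> Basis \<Longrightarrow> CB 1 K (E e)"
  shows "lip_along K W (\<lambda>z. \<Sum>e\<in>Basis. (XX v z \<bullet> e) *\<^sub>R E e z) (\<lambda>x y w. \<Sum>e\<in>Basis. ((w [v], 0) \<bullet> e) *\<^sub>R E e x)"
proof -
  have "lip_along K W (\<lambda>z. \<Sum>e\<in>Basis. (XX v z \<bullet> e) *\<^sub>R E e z)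
     (\<lambda>x y w. \<Sum>e\<in>Basis. (XX v y \<bullet> e) *\<^sub>R 0 + ((w [v], 0) \<bullet> e) *\<^sub>R E e x)"
    using assms BL_CB1[of 0] CB_bounded[of 1 K]
    by (intro lip_along_sum lip_along_scaleR lip_along_linear[OF bounded_linear_inner_left lip_along_XX]
        lip_along_BL bounded_inner bounded_XX) auto
  thus ?thesis by simp
qed

lemma lin_along_sum_XX:
  fixes E :: "'a \<times> 'b \<Rightarrow> 'b \<Rightarrow> 'c::euclidean_space"
  assumes "BL K (Dd v h)" "\<And>e. e \<in> Basis \<Longrightarrow> CB 1 K (E e)"
  shows "lin_along K W (\<lambda>z. \<Sum>e\<in>Basis. (XX v z \<bullet> e) *\<^sub>R E e z) (\<lambda>z w. \<Sum>e\<in>Basis. ((w [v], 0) \<bullet> e) *\<^sub>R E e z)"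
proof -
  have "lin_along K W (\<lambda>z. \<Sum>e\<in>Basis. (XX v z \<bullet> e) *\<^sub>R E e z)
     (\<lambda>z w. \<Sum>e\<in>Basis. (XX v z \<bullet> e) *\<^sub>R 0 + ((w [v], 0) \<bullet> e) *\<^sub>R E e z)"
    using assms BL_CB1[of 0]
    by (intro lin_along_sum lin_along_scaleR lin_along_linear[OF bounded_linear_inner_left lin_along_XX]
        lin_along_C1[OF openK, of 0] BL_linear[OF bounded_linear_inner_left] BL_XX) auto
  thus ?thesis by simp
qed

lemma TB_single: "TB \<beta> w [v] = (\<Sum>b\<in>Basis. (\<beta> v \<bullet> b) *\<^sub>R w [b])"
  by (simp add: TB_Cons TB_Nil)

text \<open>For \<open>k = 1\<close> the equation is of Riccati type, since \<open>Bv\<close> contains \<open>Dh\<close>; its linearisation nevertheless has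
  the form that holds for \<open>k \<ge> 2\<close>.\<close>
lemma level1_identity:
  "(\<Sum>e\<in>Basis. ((w [v], 0::'b) \<bullet> e) *\<^sub>R FE e x) -
     (\<Sum>b\<in>Basis. (Bv v y \<bullet> b) *\<^sub>R w [b] + ((\<Sum>e\<in>Basis. ((w [v], 0::'b) \<bullet> e) *\<^sub>R GE e x) \<bullet> b) *\<^sub>R Dd b h x) =
   (\<Sum>e\<in>Basis. (w [v] \<bullet> e) *\<^sub>R A e x) - TB (\<lambda>v. Bv v y) w [v]"
  unfolding A_sum TB_single by (simp add: sum.distrib)

text \<open>Order 1 stands apart because the coefficient \<open>Bv\<close> contains the unknown
  \<open>Dh\<close>. Its increments are therefore computed first, in \<open>lipB\<close> and
  \<open>linB\<close>, and then enter the product rule.\<close>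

lemma HB_1: "HB 1"
proof -
  have CBE: "CB 1 K (FE e)" "CB 1 K (GE e)" if "e \<in> Basis" for e
    using that r by (auto intro!: CB_FE[OF HB_0] CB_GE[OF HB_0])
  have "CB 1 K (nder vs h)" if vs: "vs \<in> blists 1" for vs
  proof (rule level_CB[where k = 1 and \<phi> = "\<lambda>vs. rhs1 (hd vs)", OF _ _ _ _ _ vs])
    show "1 + 1 \<le> r" using r by simp
    fix us :: "'b list" assume "us \<in> blists 1"
    then obtain v where v: "us = [v]" "v \<in> Basis" by (auto simp: blists_def length_Suc_conv)
    show "bounded (nder us h ` K)" using CB_bounded HB_0 v by (auto simp: HB_def)
    show "flow.evolves (nder us h) (rhs1 (hd us))" using evolves_rhs1[of v] v by simp
    have Bb: "bounded ((\<lambda>z. Bv v z \<bullet> b) ` K)" for b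
      using CB_bounded[OF CB_Bv[OF HB_0 _ v(2)]] by (intro bounded_inner) simp
    have lipB: "lip_along K W (Bv v) (\<lambda>x y w. \<Sum>e\<in>Basis. ((w [v], 0) \<bullet> e) *\<^sub>R GE e x)"
      using lip_along_sum_XX[OF v(2) CBE(2)] by (rule lip_along_cong) (auto simp: Bv_eq)
    have "lip_along K W (rhs1 v) (\<lambda>x y w. (\<Sum>e\<in>Basis. ((w [v], 0) \<bullet> e) *\<^sub>R FE e x) -
        (\<Sum>b\<in>Basis. (Bv v y \<bullet> b) *\<^sub>R w [b] + ((\<Sum>e\<in>Basis. ((w [v], 0) \<bullet> e) *\<^sub>R GE e x) \<bullet> b) *\<^sub>R W [b] x))"
      unfolding rhs1_def[abs_def]
    proof (rule lip_along_diff[OF lip_along_sum_XX[OF v(2) CBE(1)] lip_along_sum])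
      fix b :: 'b assume b: "b \<in> Basis"
      have "lip_along K W (\<lambda>z. (Bv v z \<bullet> b) *\<^sub>R W [b] z) (\<lambda>x y w. (Bv v y \<bullet> b) *\<^sub>R w [b] +
         ((\<Sum>e\<in>Basis. ((w [v], 0) \<bullet> e) *\<^sub>R GE e x) \<bullet> b) *\<^sub>R W [b] x)"
        using HB_0 b CB_bounded
        by (intro lip_along_scaleR lip_along_linear[OF bounded_linear_inner_left lipB] lip_along_W Bb) (auto simp: HB_def)
      thus "lip_along K W (\<lambda>z. (Bv v z \<bullet> b) *\<^sub>R Dd b h z) (\<lambda>x y w. (Bv v y \<bullet> b) *\<^sub>R w [b] +
         ((\<Sum>e\<in>Basis. ((w [v], 0) \<bullet> e) *\<^sub>R GE e x) \<bullet> b) *\<^sub>R W [b] x)" by simp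
    qed
    thus "lip_along K W (rhs1 (hd us)) (\<lambda>x y w. (\<Sum>e\<in>Basis. (w us \<bullet> e) *\<^sub>R A e x) - TB (\<lambda>v. Bv v y) w us)"
      unfolding v(1) list.sel by (rule lip_along_cong) (simp_all add: level1_identity)
    assume BLW: "\<And>us. us \<in> blists 1 \<Longrightarrow> BL K (nder us h)"
    have BLD: "BL K (Dd b h)" if "b \<in> Basis" for b
      using BLW[of "[b]"] that by (simp add: blists_def)
    have BLB: "BL K (\<lambda>z. Bv v z \<bullet> b)" for b
    proof -
      have "BL K (\<lambda>z. (\<Sum>e\<in>Basis. (XX v z \<bullet> e) *\<^sub>R GE e z) \<bullet> b)"
        using BL_CB1[of 0] CBE(2) BLD v(2)
        by (intro BL_linear[OF bounded_linear_inner_left] BL_sum BL_scaleR BL_XX) auto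
      thus ?thesis unfolding BL_def by (simp add: Bv_eq cong: ball_cong)
    qed
    have linB: "lin_along K W (Bv v) (\<lambda>z w. \<Sum>e\<in>Basis. ((w [v], 0) \<bullet> e) *\<^sub>R GE e z)"
      using lin_along_sum_XX[OF BLD[OF v(2)] CBE(2)] by (rule lin_along_cong) (auto simp: Bv_eq)
    have "lin_along K W (rhs1 v) (\<lambda>z w. (\<Sum>e\<in>Basis. ((w [v], 0) \<bullet> e) *\<^sub>R FE e z) -
        (\<Sum>b\<in>Basis. (Bv v z \<bullet> b) *\<^sub>R w [b] + ((\<Sum>e\<in>Basis. ((w [v], 0) \<bullet> e) *\<^sub>R GE e z) \<bullet> b) *\<^sub>R W [b] z))"
      unfolding rhs1_def[abs_def]
    proof (rule lin_along_diff[OF lin_along_sum_XX[OF BLD[OF v(2)] CBE(1)] lin_along_sum])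
      fix b :: 'b assume b: "b \<in> Basis"
      have "lin_along K W (\<lambda>z. (Bv v z \<bullet> b) *\<^sub>R W [b] z) (\<lambda>z w. (Bv v z \<bullet> b) *\<^sub>R w [b] +
         ((\<Sum>e\<in>Basis. ((w [v], 0) \<bullet> e) *\<^sub>R GE e z) \<bullet> b) *\<^sub>R W [b] z)"
        using BLD[OF b]
        by (intro lin_along_scaleR lin_along_linear[OF bounded_linear_inner_left linB] lin_along_W BLB) auto
      thus "lin_along K W (\<lambda>z. (Bv v z \<bullet> b) *\<^sub>R Dd b h z) (\<lambda>z w. (Bv v z \<bullet> b) *\<^sub>R w [b] +
         ((\<Sum>e\<in>Basis. ((w [v], 0) \<bullet> e) *\<^sub>R GE e z) \<bullet> b) *\<^sub>R W [b] z)" by simp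
    qed
    thus "lin_along K W (rhs1 (hd us)) (\<lambda>z w. (\<Sum>e\<in>Basis. (w us \<bullet> e) *\<^sub>R A e z) - TB (\<lambda>v. Bv v z) w us)"
      unfolding v(1) list.sel by (rule lin_along_cong) (simp_all add: level1_identity)
  qed
  thus ?thesis using HB_step[OF HB_0] by simp
qed

text \<open>\<open>lower_terms vs\<close> collects the terms of the evolution equation for \<open>nder vs h\<close> that only involve
  derivatives of \<open>h\<close> of lower order. The recursion is what one differentiation of the equation leaves over.\<close>
fun lower_terms :: "'b list \<Rightarrow> 'b \<Rightarrow> 'a" where
  "lower_terms [] = (\<lambda>z. 0)"
| "lower_terms [v] = (\<lambda>z. 0)"
| "lower_terms [v2, v1] = (\<lambda>z. (\<Sum>e\<in>Basis. (XX v1 z \<bullet> e) *\<^sub>R Dd v2 (FE e) z) -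
     (\<Sum>b\<in>Basis. ((\<Sum>e\<in>Basis. (XX v1 z \<bullet> e) *\<^sub>R Dd v2 (GE e) z) \<bullet> b) *\<^sub>R Dd b h z))"
| "lower_terms (v # u # w # vs) = (\<lambda>z. Dd v (lower_terms (u # w # vs)) z +
     (\<Sum>e\<in>Basis. (nder (u # w # vs) h z \<bullet> e) *\<^sub>R Dd v (A e) z) -
     TB (\<lambda>b. Dd v (Bv b) z) (\<lambda>us. nder us h z) (u # w # vs))"

definition "rhs vs z = (\<Sum>e\<in>Basis. (nder vs h z \<bullet> e) *\<^sub>R A e z) - TB (\<lambda>b. Bv b z) (\<lambda>us. nder us h z) vs + lower_terms vs z"

lemma CB_Dd: "CB (Suc N) S u \<Longrightarrow> b \<in> Basis \<Longrightarrow> CB N S (Dd b u)"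
  by (simp add: CB_Suc)

lemma CB_TB:
  assumes "\<And>b. b \<in> Basis \<Longrightarrow> CB N K (\<beta> b)" "\<And>us. us \<in> blists (length vs) \<Longrightarrow> CB N K (w us)" "set vs \<subseteq> Basis"
  shows "CB N K (\<lambda>z. TB (\<lambda>b. \<beta> b z) (\<lambda>us. w us z) vs)"
proof -
  have vs: "vs \<in> blists (length vs)" using assms(3) by (simp add: blists_def)
  show ?thesis unfolding TB_def
    by (intro CB_sum openK CB_inner_scaleR assms(1,2) blists_update[OF vs] blists_nth[OF vs]) auto
qed

text \<open>For lists of length \<open>j + 2\<close> the terms contain derivatives of
  \<open>f\<close> and \<open>g\<close> up to order \<open>j + 2\<close>, which leaves
  \<open>r - 2 - j\<close> further ones; the derivatives of \<open>h\<close> that occur are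
  controlled by \<open>HB N\<close>. Each differentiation in the recursion costs one order.\<close>

lemma CB_lower_terms:
  assumes HB: "HB N" "N \<ge> 1" "N \<le> r - 1"
  shows "length vs = j + 2 \<Longrightarrow> set vs \<subseteq> Basis \<Longrightarrow> j \<le> min (r - 2) N \<Longrightarrow> CB (min (r - 2) N - j) K (lower_terms vs)"
proof (induction vs arbitrary: j rule: lower_terms.induct)
  case (3 v2 v1)
  hence j: "j = 0" and v: "v1 \<in> Basis" "v2 \<in> Basis" by auto
  define M where "M = min (r - 2) N"
  have M: "Suc M \<le> Suc N" "Suc M \<le> r - 1" "M \<le> N" using r by (auto simp: M_def)
  have D: "CB M K (Dd v2 (FE e))" "CB M K (Dd v2 (GE e))" if "e \<in> Basis" for e
    using CB_FE[OF HB(1) M(1,2) that] CB_GE[OF HB(1) M(1,2) that] v by (auto intro: CB_Dd)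
  have XXM: "CB M K (XX v1)" using CB_mono[OF CB_XX[OF HB(1) v(1)] M(3)] .
  have hM: "CB M K (Dd b h)" if "b \<in> Basis" for b using HB(1) that CB_mono[OF _ M(3)] by (auto simp: HB_def)
  have "CB M K (lower_terms [v2, v1])"
    unfolding lower_terms.simps by (intro CB_diff CB_sum openK CB_inner_scaleR XXM D hM)
  thus ?case by (simp add: M_def[symmetric] j)
next
  case (4 v u w vs)
  then obtain i where i: "j = Suc i" by (cases j) auto
  define M where "M = min (r - 2) N"
  have v: "v \<in> Basis" "set (u # w # vs) \<subseteq> Basis" using 4 by auto
  have len: "length (u # w # vs) = i + 2" using 4 i by simp
  have Mj: "M - i = Suc (M - j)" "M - j \<le> N - 1" using 4(4) i HB by (auto simp: M_def)
  have "CB (M - i) K (lower_terms (u # w # vs))"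
    unfolding M_def using 4(4) i by (intro 4(1) len v) auto
  hence 1: "CB (M - j) K (Dd v (lower_terms (u # w # vs)))" unfolding Mj by (rule CB_Dd[OF _ v(1)])
  have N: "N = Suc (N - 1)" using HB by simp
  have 2: "CB (M - j) K (Dd v (A e))" if "e \<in> Basis" for e
    using CB_Dd[of "N - 1" K "A e" v] CB_A[OF HB(1,3) that] v N CB_mono[OF _ Mj(2)] by metis
  have 3: "CB (M - j) K (Dd v (Bv b))" if "b \<in> Basis" for b
    using CB_Dd[of "N - 1" K "Bv b" v] CB_Bv[OF HB(1,3) that] v N CB_mono[OF _ Mj(2)] by metis
  have 4: "CB (M - j) K (nder us h)" if "us \<in> blists (length (u # w # vs))" for us
  proof (rule CB_mono[OF HB_nder[OF HB(1)]])
    show "set us \<subseteq> Basis" "us \<noteq> []" using that by (auto simp: blists_def)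
    have l: "length us = i + 2" using that len by (simp add: blists_def)
    show "length us \<le> Suc N" using l 4(4) i by simp
    show "M - j \<le> Suc N - length us" using l i by (auto simp: M_def)
  qed
  have uwv: "u # w # vs \<in> blists (length (u # w # vs))" using v by (simp add: blists_def)
  have "CB (M - j) K (lower_terms (v # u # w # vs))"
    unfolding lower_terms.simps
    by (intro CB_diff CB_add CB_sum openK CB_inner_scaleR CB_TB 1 2 3 4 uwv v)
  thus ?case by (simp add: M_def)
qed auto

lemma CB_rhs:
  assumes "HB k" "k \<ge> 2" "k \<le> r - 1" "vs \<in> blists k"
  shows "CB 1 K (rhs vs)"
proof -
  have bl: "set vs \<subseteq> Basis" "length vs = k" using assms(4) by (auto simp: blists_def)
  have mono: "CB k K u \<Longrightarrow> CB 1 K u" for u :: "'b \<Rightarrow> 'c::euclidean_space" using CB_mono[of k K u 1] assms(2) by simp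
  have nd: "CB 1 K (nder us h)" if "us \<in> blists k" for us
    using HB_nder[OF assms(1), of us] that assms(2) by (cases us) (auto simp: blists_def)
  have "CB (min (r - 2) k - (k - 2)) K (lower_terms vs)"
    using assms bl by (intro CB_lower_terms) auto
  \<comment> \<open>The vector field leaves \<open>r - k \<ge> 1\<close> derivatives because
    \<open>k \<le> r - 1\<close>, and \<open>HB k\<close> leaves 2.\<close>
  moreover have "1 \<le> min (r - 2) k - (k - 2)" using assms by auto
  ultimately have b: "CB 1 K (lower_terms vs)" by (rule CB_mono)
  show ?thesis unfolding rhs_def[abs_def]
    using assms(4) bl
    by (intro CB_add CB_diff CB_sum openK CB_inner_scaleR CB_TB b nd mono[OF CB_A[OF assms(1,3)]] mono[OF CB_Bv[OF assms(1,3)]])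
       auto
qed

lemma TB_Dd:
  assumes "\<And>b. b \<in> Basis \<Longrightarrow> \<beta> b differentiable (at z)" "\<And>us. us \<in> blists (length vs) \<Longrightarrow> w us differentiable (at z)"
    "set vs \<subseteq> Basis"
  shows "(\<lambda>z. TB (\<lambda>b. \<beta> b z) (\<lambda>us. w us z) vs) differentiable (at z)"
    "Dd v (\<lambda>z. TB (\<lambda>b. \<beta> b z) (\<lambda>us. w us z) vs) z =
       TB (\<lambda>b. \<beta> b z) (\<lambda>us. Dd v (w us) z) vs + TB (\<lambda>b. Dd v (\<beta> b) z) (\<lambda>us. w us z) vs"
proof -
  have vs: "vs \<in> blists (length vs)" using assms(3) by (simp add: blists_def)
  have d: "(\<lambda>z. (\<beta> (vs ! i) z \<bullet> b) *\<^sub>R w (vs[i := b]) z) differentiable (at z)"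
    "Dd v (\<lambda>z. (\<beta> (vs ! i) z \<bullet> b) *\<^sub>R w (vs[i := b]) z) z =
      (\<beta> (vs ! i) z \<bullet> b) *\<^sub>R Dd v (w (vs[i := b])) z + (Dd v (\<beta> (vs ! i)) z \<bullet> b) *\<^sub>R w (vs[i := b]) z"
    if "i < length vs" "b \<in> Basis" for i b
    by (intro differentiable_inner_scaleR Dd_inner_scaleR assms(1,2) blists_update[OF vs] blists_nth[OF vs] that)+
  have d2: "(\<lambda>z. \<Sum>b\<in>Basis. (\<beta> (vs ! i) z \<bullet> b) *\<^sub>R w (vs[i := b]) z) differentiable (at z)"
    "Dd v (\<lambda>z. \<Sum>b\<in>Basis. (\<beta> (vs ! i) z \<bullet> b) *\<^sub>R w (vs[i := b]) z) z =
      (\<Sum>b\<in>Basis. (\<beta> (vs ! i) z \<bullet> b) *\<^sub>R Dd v (w (vs[i := b])) z + (Dd v (\<beta> (vs ! i)) z \<bullet> b) *\<^sub>R w (vs[i := b]) z)"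
    if "i < length vs" for i
    using d[OF that] by (auto intro!: differentiable_sum' sum.cong simp: Dd_sum)
  show "(\<lambda>z. TB (\<lambda>b. \<beta> b z) (\<lambda>us. w us z) vs) differentiable (at z)"
    unfolding TB_def using d2 by (auto intro!: differentiable_sum')
  show "Dd v (\<lambda>z. TB (\<lambda>b. \<beta> b z) (\<lambda>us. w us z) vs) z =
       TB (\<lambda>b. \<beta> b z) (\<lambda>us. Dd v (w us) z) vs + TB (\<lambda>b. Dd v (\<beta> b) z) (\<lambda>us. w us z) vs"
    unfolding TB_def sum.distrib[symmetric] using d2 by (subst Dd_sum) (auto intro!: sum.cong)
qed

text \<open>Differentiates the equation of order 1 once. The part of \<open>Dd v2 (Bv v1)\<close>
  with second derivatives of \<open>h\<close> combines with \<open>D\<^sub>af\<close> into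
  \<open>A\<close>, and the commutator term supplies the slot of \<open>v2\<close>. From here on the
  equation is linear in the highest derivatives.\<close>

lemma evolves_level2:
  assumes v: "v1 \<in> Basis" "v2 \<in> Basis"
  shows "flow.evolves (nder [v2, v1] h) (rhs [v2, v1])"
proof -
  have r1: "1 \<le> r - 1" using r by simp
  have CBE: "CB 1 K (FE e)" "CB 1 K (GE e)" if "e \<in> Basis" for e
    using that r by (auto intro!: CB_FE[OF HB_1] CB_GE[OF HB_1])
  have CBh: "CB 1 K (Dd b h)" if "b \<in> Basis" for b using HB_1 that by (simp add: HB_def)
  have CBX: "CB 1 K (XX v1)" and CBB: "CB 1 K (Bv v1)" by (rule CB_XX[OF HB_1 v(1)], rule CB_Bv[OF HB_1 r1 v(1)])
  have "CB 1 K (rhs1 v1)"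
    unfolding rhs1_def[abs_def] by (intro CB_diff CB_sum openK CB_inner_scaleR CBE CBh CBX CBB)
  hence \<phi>1: "C1 K (rhs1 v1)" unfolding One_nat_def by (rule CB_1_C1)
  have h1: "C1 K (Dd b h)" if "b \<in> Basis" for b using CBh[OF that] unfolding One_nat_def by (rule CB_1_C1)
  have df: "u differentiable (at z)" if "CB 1 K u" "z \<in> K" for u :: "'b \<Rightarrow> 'c::euclidean_space" and z
    using that CB_differentiable[of 0 K u z] by simp
  have "flow.evolves (Dd v2 (Dd v1 h)) (rhs [v2, v1])"
  proof (rule flow.evolves_cong[OF flow.evolves_Dd[OF evolves_rhs1 h1[OF v(1)] \<phi>1 G_C1]])
    fix z assume z: "z \<in> K"
    define a where "a = Dd v2 (Dd v1 h) z"
    have dE: "FE e differentiable (at z)" "GE e differentiable (at z)" if "e \<in> Basis" for e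
      using CBE[OF that] z by (auto intro: df)
    have dh: "Dd b h differentiable (at z)" if "b \<in> Basis" for b using CBh[OF that] z by (rule df)
    have dX: "XX v1 differentiable (at z)" and dB: "Bv v1 differentiable (at z)" using CBX CBB z by (auto intro: df)
    have DX: "Dd v2 (XX v1) z = (a, 0)"
      unfolding XX_def[abs_def] a_def by (rule Dd_eq) (intro has_derivative_Pair has_derivative_Dd dh v has_derivative_const)
    have DB: "Dd v2 (Bv v1) z = (\<Sum>e\<in>Basis. (XX v1 z \<bullet> e) *\<^sub>R Dd v2 (GE e) z) + (\<Sum>e\<in>Basis. ((a, 0) \<bullet> e) *\<^sub>R GE e z)"
    proof -
      have "Dd v2 (Bv v1) z = Dd v2 (\<lambda>z. \<Sum>e\<in>Basis. (XX v1 z \<bullet> e) *\<^sub>R GE e z) z"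
        by (rule Dd_cong(1)[OF openK z Bv_eq])
      also have "\<dots> = (\<Sum>e\<in>Basis. Dd v2 (\<lambda>z. (XX v1 z \<bullet> e) *\<^sub>R GE e z) z)"
        by (intro Dd_sum differentiable_inner_scaleR dX dE)
      also have "\<dots> = (\<Sum>e\<in>Basis. (XX v1 z \<bullet> e) *\<^sub>R Dd v2 (GE e) z + ((a, 0) \<bullet> e) *\<^sub>R GE e z)"
        by (intro sum.cong refl) (simp add: Dd_inner_scaleR dX dE DX)
      finally show ?thesis by (simp add: sum.distrib)
    qed
    have "Dd v2 (rhs1 v1) z = Dd v2 (\<lambda>z. \<Sum>e\<in>Basis. (XX v1 z \<bullet> e) *\<^sub>R FE e z) z -
        Dd v2 (\<lambda>z. \<Sum>b\<in>Basis. (Bv v1 z \<bullet> b) *\<^sub>R Dd b h z) z"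
      unfolding rhs1_def[abs_def] by (intro Dd_diff differentiable_sum' differentiable_inner_scaleR dX dB dE dh)
    also have "Dd v2 (\<lambda>z. \<Sum>e\<in>Basis. (XX v1 z \<bullet> e) *\<^sub>R FE e z) z = (\<Sum>e\<in>Basis. Dd v2 (\<lambda>z. (XX v1 z \<bullet> e) *\<^sub>R FE e z) z)"
      by (intro Dd_sum differentiable_inner_scaleR dX dE)
    also have "\<dots> = (\<Sum>e\<in>Basis. (XX v1 z \<bullet> e) *\<^sub>R Dd v2 (FE e) z + ((a, 0) \<bullet> e) *\<^sub>R FE e z)"
      by (intro sum.cong refl) (simp add: Dd_inner_scaleR dX dE DX)
    also have "Dd v2 (\<lambda>z. \<Sum>b\<in>Basis. (Bv v1 z \<bullet> b) *\<^sub>R Dd b h z) z = (\<Sum>b\<in>Basis. Dd v2 (\<lambda>z. (Bv v1 z \<bullet> b) *\<^sub>R Dd b h z) z)"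
      by (intro Dd_sum differentiable_inner_scaleR dB dh)
    also have "\<dots> = (\<Sum>b\<in>Basis. (Bv v1 z \<bullet> b) *\<^sub>R Dd v2 (Dd b h) z + (Dd v2 (Bv v1) z \<bullet> b) *\<^sub>R Dd b h z)"
      by (intro sum.cong refl) (simp add: Dd_inner_scaleR dB dh)
    finally have 1: "Dd v2 (rhs1 v1) z = (\<Sum>e\<in>Basis. (XX v1 z \<bullet> e) *\<^sub>R Dd v2 (FE e) z) + (\<Sum>e\<in>Basis. ((a, 0) \<bullet> e) *\<^sub>R FE e z) -
       ((\<Sum>b\<in>Basis. (Bv v1 z \<bullet> b) *\<^sub>R Dd v2 (Dd b h) z) +
        ((\<Sum>b\<in>Basis. ((\<Sum>e\<in>Basis. (XX v1 z \<bullet> e) *\<^sub>R Dd v2 (GE e) z) \<bullet> b) *\<^sub>R Dd b h z) +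
         (\<Sum>b\<in>Basis. ((\<Sum>e\<in>Basis. ((a, 0) \<bullet> e) *\<^sub>R GE e z) \<bullet> b) *\<^sub>R Dd b h z)))"
      unfolding DB by (simp only: sum.distrib inner_add_left scaleR_add_left)
    have 2: "Dd (Dd v2 G z) (Dd v1 h) z = (\<Sum>b\<in>Basis. (Bv v2 z \<bullet> b) *\<^sub>R Dd b (Dd v1 h) z)"
      unfolding Dd_G[OF z] by (rule Dd_eq_sum_Basis[OF dh[OF v(1)]])
    have 3: "TB (\<lambda>b. Bv b z) (\<lambda>us. nder us h z) [v2, v1] =
       (\<Sum>b\<in>Basis. (Bv v2 z \<bullet> b) *\<^sub>R Dd b (Dd v1 h) z) + (\<Sum>b\<in>Basis. (Bv v1 z \<bullet> b) *\<^sub>R Dd v2 (Dd b h) z)"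
      by (simp add: TB_Cons TB_Nil)
    have 4: "nder [v2, v1] h z = a" by (simp add: a_def)
    show "Dd v2 (rhs1 v1) z - Dd (Dd v2 G z) (Dd v1 h) z = rhs [v2, v1] z"
      unfolding rhs_def 1 2 3 4 A_sum lower_terms.simps by (simp only: algebra_simps)
  qed
  thus ?thesis by simp
qed

text \<open>Under differentiation the existing slots of \<open>TB\<close> keep their form, and the
  commutator term is exactly the slot of the new direction in \<open>TB_Cons\<close>. Whatever falls
  on the coefficients goes into \<open>lower_terms\<close>.\<close>

lemma evolves_step:
  assumes HB: "HB k" "k \<ge> 2" "k \<le> r - 1" and vs: "vs \<in> blists k" and v: "v \<in> Basis"
    and ev: "flow.evolves (nder vs h) (rhs vs)"
  shows "flow.evolves (nder (v # vs) h) (rhs (v # vs))"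
proof -
  have bl: "set vs \<subseteq> Basis" "length vs = k" using vs by (auto simp: blists_def)
  have nd: "CB 1 K (nder us h)" if "us \<in> blists k" for us
    using HB_nder[OF HB(1), of us] that HB(2) by (cases us) (auto simp: blists_def)
  have df: "u differentiable (at z)" if "CB (Suc N) K u" "z \<in> K" for u :: "'b \<Rightarrow> 'c::euclidean_space" and z N
    using that by (rule CB_differentiable)
  obtain k' where k': "k = Suc k'" using HB(2) by (cases k) auto
  have hvs: "C1 K (nder vs h)" using nd[OF vs] unfolding One_nat_def by (rule CB_1_C1)
  have pvs: "C1 K (rhs vs)" using CB_rhs[OF HB vs] unfolding One_nat_def by (rule CB_1_C1)
  have bbvs: "CB 1 K (lower_terms vs)"
  proof -
    have "CB (min (r - 2) k - (k - 2)) K (lower_terms vs)" using HB bl by (intro CB_lower_terms) auto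
    moreover have "1 \<le> min (r - 2) k - (k - 2)" using HB by auto
    ultimately show ?thesis by (rule CB_mono)
  qed
  obtain u w vs' where uw: "vs = u # w # vs'" using bl HB(2) by (metis Suc_le_length_iff numeral_2_eq_2)
  have "flow.evolves (Dd v (nder vs h)) (rhs (v # vs))"
  proof (rule flow.evolves_cong[OF flow.evolves_Dd[OF ev hvs pvs G_C1]])
    fix z assume z: "z \<in> K"
    have dA: "A e differentiable (at z)" if "e \<in> Basis" for e
      using CB_A[OF HB(1,3) that] z unfolding k' by (rule df)
    have dB: "Bv b differentiable (at z)" if "b \<in> Basis" for b
      using CB_Bv[OF HB(1,3) that] z unfolding k' by (rule df)
    have dn: "nder us h differentiable (at z)" if "us \<in> blists (length vs)" for us
      using nd[of us] that z df[of 0] bl by simp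
    have dv: "nder vs h differentiable (at z)" using dn[of vs] vs bl by simp
    have db: "lower_terms vs differentiable (at z)" using bbvs z df[of 0] by simp
    note T = TB_Dd[OF dB dn bl(1)]
    have dS: "(\<lambda>z. \<Sum>e\<in>Basis. (nder vs h z \<bullet> e) *\<^sub>R A e z) differentiable (at z)"
      by (intro differentiable_sum' differentiable_inner_scaleR dv dA)
    have "Dd v (rhs vs) z = Dd v (\<lambda>z. (\<Sum>e\<in>Basis. (nder vs h z \<bullet> e) *\<^sub>R A e z) - TB (\<lambda>b. Bv b z) (\<lambda>us. nder us h z) vs) z
        + Dd v (lower_terms vs) z"
      unfolding rhs_def[abs_def] by (intro Dd_add differentiable_diff dS T(1) db)
    also have "Dd v (\<lambda>z. (\<Sum>e\<in>Basis. (nder vs h z \<bullet> e) *\<^sub>R A e z) - TB (\<lambda>b. Bv b z) (\<lambda>us. nder us h z) vs) z =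
        Dd v (\<lambda>z. \<Sum>e\<in>Basis. (nder vs h z \<bullet> e) *\<^sub>R A e z) z - Dd v (\<lambda>z. TB (\<lambda>b. Bv b z) (\<lambda>us. nder us h z) vs) z"
      by (intro Dd_diff dS T(1))
    also have "Dd v (\<lambda>z. \<Sum>e\<in>Basis. (nder vs h z \<bullet> e) *\<^sub>R A e z) z = (\<Sum>e\<in>Basis. Dd v (\<lambda>z. (nder vs h z \<bullet> e) *\<^sub>R A e z) z)"
      by (intro Dd_sum differentiable_inner_scaleR dv dA)
    also have "\<dots> = (\<Sum>e\<in>Basis. (nder vs h z \<bullet> e) *\<^sub>R Dd v (A e) z + (nder (v # vs) h z \<bullet> e) *\<^sub>R A e z)"
      by (intro sum.cong refl) (simp add: Dd_inner_scaleR dv dA)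
    finally have 1: "Dd v (rhs vs) z = (\<Sum>e\<in>Basis. (nder vs h z \<bullet> e) *\<^sub>R Dd v (A e) z) + (\<Sum>e\<in>Basis. (nder (v # vs) h z \<bullet> e) *\<^sub>R A e z)
       - (TB (\<lambda>b. Bv b z) (\<lambda>us. nder (v # us) h z) vs + TB (\<lambda>b. Dd v (Bv b) z) (\<lambda>us. nder us h z) vs) + Dd v (lower_terms vs) z"
      by (simp add: sum.distrib T(2))
    have 2: "Dd (Dd v G z) (nder vs h) z = (\<Sum>b\<in>Basis. (Bv v z \<bullet> b) *\<^sub>R nder (b # vs) h z)"
      unfolding Dd_G[OF z] nder.simps by (rule Dd_eq_sum_Basis[OF dv])
    have 3: "lower_terms (v # vs) z = Dd v (lower_terms vs) z + (\<Sum>e\<in>Basis. (nder vs h z \<bullet> e) *\<^sub>R Dd v (A e) z) -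
        TB (\<lambda>b. Dd v (Bv b) z) (\<lambda>us. nder us h z) vs"
      unfolding uw by (simp only: lower_terms.simps)
    show "Dd v (rhs vs) z - Dd (Dd v G z) (nder vs h) z = rhs (v # vs) z"
      unfolding rhs_def[of "v # vs"] 1 2 3 TB_Cons by (simp only: algebra_simps)
  qed
  thus ?thesis by simp
qed

text \<open>For \<open>k \<ge> 2\<close> the coefficients \<open>A\<close> and \<open>Bv\<close> are
  already \<open>C^1\<close> by \<open>HB (k - 1)\<close>, so only increments of the derivatives of
  order \<open>k\<close> have to be tracked; all others are remainders.\<close>

lemma level_regularity:
  assumes HB: "HB (k - 1)" "k \<ge> 2" "k + 1 \<le> r"
    and ev: "\<And>vs. vs \<in> blists k \<Longrightarrow> flow.evolves (nder vs h) (rhs vs)"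
  shows "HB k"
proof -
  have k1: "k - 1 \<le> r - 1" "1 \<le> k - 1" "Suc (k - 1) = k" using HB by auto
  have C1: "CB 1 K u" if "CB (k - 1) K u" for u :: "'b \<Rightarrow> 'c::euclidean_space"
    using that k1(2) by (rule CB_mono)
  have CBA: "CB 1 K (A e)" if "e \<in> Basis" for e by (rule C1[OF CB_A[OF HB(1) k1(1) that]])
  have CBB: "CB 1 K (Bv b)" if "b \<in> Basis" for b by (rule C1[OF CB_Bv[OF HB(1) k1(1) that]])
  have BL1: "BL K u" if "CB 1 K u" for u :: "'b \<Rightarrow> 'c::euclidean_space" using BL_CB1[of 0 u] that by simp
  have lin1: "lin_along K W u (\<lambda>_ _. 0)" if "CB 1 K u" for u :: "'b \<Rightarrow> 'c::euclidean_space"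
    using lin_along_C1[OF openK, of 0 u] that by simp
  have CBb: "CB 1 K (lower_terms vs)" if "vs \<in> blists k" for vs
  proof -
    have "CB (min (r - 2) (k - 1) - (k - 2)) K (lower_terms vs)" using HB k1 that by (intro CB_lower_terms) (auto simp: blists_def)
    moreover have "1 \<le> min (r - 2) (k - 1) - (k - 2)" using HB by auto
    ultimately show ?thesis by (rule CB_mono)
  qed
  have bdd: "bounded (nder vs h ` K)" if "vs \<in> blists k" for vs
    using CB_bounded[OF HB_nder[OF HB(1), of vs]] that HB(2) by (cases vs) (auto simp: blists_def)
  have "CB 1 K (nder vs h)" if vs: "vs \<in> blists k" for vs
  proof (rule level_CB[where k = k and \<phi> = rhs, OF HB(3) bdd ev _ _ vs])
    fix us :: "'b list" assume us: "us \<in> blists k"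
    have len: "length us = k" using us by (simp add: blists_def)
    have "lip_along K W (rhs us) (\<lambda>x y w. (\<Sum>e\<in>Basis. (W us y \<bullet> e) *\<^sub>R 0 + (w us \<bullet> e) *\<^sub>R A e x) -
        (\<Sum>i<length us. \<Sum>b\<in>Basis. (Bv (us ! i) y \<bullet> b) *\<^sub>R w (us[i := b]) + 0 *\<^sub>R W (us[i := b]) x) + 0)"
      unfolding rhs_def[abs_def] TB_def
      by (intro lip_along_add lip_along_diff lip_along_sum lip_along_scaleR lip_along_W
          lip_along_linear[OF bounded_linear_inner_left lip_along_W] bounded_inner bdd us lip_along_BL
          BL_linear[OF bounded_linear_inner_left] BL1 CBA CBB CBb CB_bounded[OF CBA] CB_bounded[OF CBB]
          blists_update[OF us] blists_nth[OF us]) (auto simp: len)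
    thus "lip_along K W (rhs us) (\<lambda>x y w. (\<Sum>e\<in>Basis. (w us \<bullet> e) *\<^sub>R A e x) - TB (\<lambda>v. Bv v y) w us)"
      by (rule lip_along_cong) (simp_all add: TB_def)
    assume BLW: "\<And>us. us \<in> blists k \<Longrightarrow> BL K (nder us h)"
    have "lin_along K W (rhs us) (\<lambda>z w. (\<Sum>e\<in>Basis. (W us z \<bullet> e) *\<^sub>R 0 + (w us \<bullet> e) *\<^sub>R A e z) -
        (\<Sum>i<length us. \<Sum>b\<in>Basis. (Bv (us ! i) z \<bullet> b) *\<^sub>R w (us[i := b]) + (0 \<bullet> b) *\<^sub>R W (us[i := b]) z) + 0)"
      unfolding rhs_def[abs_def] TB_def
      by (intro lin_along_add lin_along_diff lin_along_sum lin_along_scaleR lin_along_W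
          lin_along_linear[OF bounded_linear_inner_left lin_along_W] lin_along_linear[OF bounded_linear_inner_left lin1]
          us lin1 BL_linear[OF bounded_linear_inner_left] BLW BL1 CBA CBB CBb
          blists_update[OF us] blists_nth[OF us]) (auto simp: len)
    thus "lin_along K W (rhs us) (\<lambda>z w. (\<Sum>e\<in>Basis. (w us \<bullet> e) *\<^sub>R A e z) - TB (\<lambda>v. Bv v z) w us)"
      by (rule lin_along_cong) (simp_all add: TB_def)
  qed
  thus ?thesis using HB_step[OF HB(1)] unfolding k1(3) by blast
qed

text \<open>Regularity and equation advance in turn: the equation of order \<open>k + 2\<close>
  yields \<open>HB (k + 2)\<close>, hence derivatives of order \<open>k + 3\<close>, and only then
  can the equation of that order be derived.\<close>

lemma HB_evolves:
  "k + 2 \<le> r \<Longrightarrow> HB (Suc k) \<and> (\<forall>vs\<in>blists (k + 2). flow.evolves (nder vs h) (rhs vs))"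
proof (induction k)
  case 0
  have "flow.evolves (nder vs h) (rhs vs)" if "vs \<in> blists (0 + 2)" for vs
  proof -
    have "vs \<in> blists (Suc (Suc 0))" using that by simp
    then obtain v2 v1 where "vs = [v2, v1]" "v1 \<in> Basis" "v2 \<in> Basis"
      by (auto simp: blists_Suc blists_0)
    thus ?thesis using evolves_level2 by simp
  qed
  moreover have "HB (Suc 0)" using HB_1 by simp
  ultimately show ?case by blast
next
  case (Suc k)
  hence IH: "HB (Suc k)" "\<And>vs. vs \<in> blists (k + 2) \<Longrightarrow> flow.evolves (nder vs h) (rhs vs)" by auto
  have HB: "HB (k + 2)"
    using level_regularity[of "k + 2"] IH Suc.prems by simp
  have "flow.evolves (nder vs h) (rhs vs)" if "vs \<in> blists (Suc k + 2)" for vs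
  proof -
    have "vs \<in> blists (Suc (k + 2))" using that by simp
    then obtain v us where vu: "vs = v # us" "v \<in> Basis" "us \<in> blists (k + 2)" unfolding blists_Suc by auto
    show ?thesis unfolding vu(1)
      by (rule evolves_step[OF HB _ _ vu(3,2) IH(2)[OF vu(3)]]) (use Suc.prems in auto)
  qed
  thus ?case using HB by simp
qed

lemma HB_top: "HB (r - 1)"
proof -
  have "HB (Suc (r - 2))" using HB_evolves[of "r - 2"] r by simp
  moreover have "Suc (r - 2) = r - 1" using r by simp
  ultimately show ?thesis by simp
qed

end

section \<open>Conclusion\<close>

text \<open>The family is built by linear extension in the last list entry, the direction
  differentiated first, since regularity is given for basis derivatives. The bounds start at order 1
  so that the lemma applies to \<open>h\<close>, which may be unbounded.\<close>

lemma derivative_family_step: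
  fixes u :: "'b::euclidean_space \<Rightarrow> 'a::real_normed_vector"
  assumes u: "\<And>z. z \<in> S \<Longrightarrow> u differentiable (at z)"
    and fam: "\<And>b. b \<in> Basis \<Longrightarrow> \<exists>E. higher_derivs N S (Dd b u) E \<and> (\<forall>j\<le>N. deriv_bounded_on S E j)"
  shows "\<exists>D. higher_derivs (Suc N) S u D \<and> (\<forall>j\<in>{1..Suc N}. deriv_bounded_on S D j) \<and>
    (\<forall>z\<in>S. \<forall>v. D z [v] = Dd v u z)"
proof -
  obtain E where E: "\<And>b. b \<in> Basis \<Longrightarrow> higher_derivs N S (Dd b u) (E b)"
    "\<And>b j. b \<in> Basis \<Longrightarrow> j \<le> N \<Longrightarrow> deriv_bounded_on S (E b) j"
    using fam by metis
  define D where "D x ws = (if ws = [] then u x else \<Sum>b\<in>Basis. (last ws \<bullet> b) *\<^sub>R E b x (butlast ws))" for x ws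
  have D1: "D z [v] = Dd v u z" if z: "z \<in> S" for z v
  proof -
    have "E b z [] = Dd b u z" if "b \<in> Basis" for b using E(1)[OF that] z by (simp add: higher_derivs_def)
    thus ?thesis by (subst Dd_eq_sum_Basis[OF u[OF z]]) (simp add: D_def)
  qed
  have "higher_derivs (Suc N) S u D"
    unfolding higher_derivs_def
  proof (intro conjI allI impI ballI)
    show "D x [] = u x" for x by (simp add: D_def)
    fix vs :: "'b list"
    {
      fix j x assume j: "j < Suc N" "length vs = j" and x: "x \<in> S"
      show "((\<lambda>y. D y vs) has_derivative (\<lambda>v. D x (v # vs))) (at x within S)"
      proof (cases "vs = []")
        case True
        have "(u has_derivative (\<lambda>v. Dd v u x)) (at x within S)"
          by (rule has_derivative_at_withinI[OF has_derivative_Dd[OF u[OF x]]])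
        moreover have "(\<lambda>y. D y []) = u" by (rule ext) (simp add: D_def)
        ultimately show ?thesis using True by (simp add: D1[OF x])
      next
        case False
        have "((\<lambda>y. \<Sum>b\<in>Basis. (last vs \<bullet> b) *\<^sub>R E b y (butlast vs)) has_derivative
            (\<lambda>v. \<Sum>b\<in>Basis. (last vs \<bullet> b) *\<^sub>R E b x (v # butlast vs))) (at x within S)"
        proof (intro has_derivative_sum has_derivative_scaleR_right)
          fix b :: 'b assume b: "b \<in> Basis"
          have "length (butlast vs) < N" using j False by (cases vs rule: rev_cases) auto
          thus "((\<lambda>y. E b y (butlast vs)) has_derivative (\<lambda>v. E b x (v # butlast vs))) (at x within S)"
            using E(1)[OF b] x unfolding higher_derivs_def by blast
        qed
        thus ?thesis using False by (simp add: D_def)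
      qed
    }
    assume l: "length vs = Suc N"
    hence ne: "vs \<noteq> []" by auto
    have "continuous_on S (\<lambda>x. E b x (butlast vs))" if "b \<in> Basis" for b
      using E(1)[OF that] l unfolding higher_derivs_def by simp
    thus "continuous_on S (\<lambda>x. D x vs)" unfolding D_def using ne by (auto intro!: continuous_intros)
  qed
  moreover have "deriv_bounded_on S D j" if j: "j \<in> {1..Suc N}" for j
  proof -
    have "\<exists>B. \<forall>x\<in>S. \<forall>vs. length vs = j - 1 \<longrightarrow> norm (E b x vs) \<le> B * prod_list (map norm vs)" if "b \<in> Basis" for b
      using E(2)[OF that, of "j - 1"] j unfolding deriv_bounded_on_def by auto
    then obtain B where B: "\<And>b x vs. b \<in> Basis \<Longrightarrow> x \<in> S \<Longrightarrow> length vs = j - 1 \<Longrightarrow>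
        norm (E b x vs) \<le> B b * prod_list (map norm vs)" by metis
    have pos: "prod_list (map norm vs) \<ge> 0" for vs :: "'b list" by (induction vs) auto
    show ?thesis unfolding deriv_bounded_on_def
    proof (intro exI[of _ "\<Sum>b\<in>Basis. \<bar>B b\<bar>"] ballI allI impI)
      fix x and vs :: "'b list" assume x: "x \<in> S" and l: "length vs = j"
      then obtain ws w where vs: "vs = ws @ [w]" using j by (cases vs rule: rev_cases) auto
      have "norm (D x vs) \<le> (\<Sum>b\<in>Basis. norm w * (\<bar>B b\<bar> * prod_list (map norm ws)))"
        unfolding D_def vs
      proof (simp, rule sum_norm_le)
        fix b :: 'b assume b: "b \<in> Basis"
        have "B b * prod_list (map norm ws) \<le> \<bar>B b\<bar> * prod_list (map norm ws)"
          by (intro mult_right_mono pos) auto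
        hence "norm (E b x ws) \<le> \<bar>B b\<bar> * prod_list (map norm ws)"
          using B[OF b x, of ws] l vs by fastforce
        thus "norm ((w \<bullet> b) *\<^sub>R E b x ws) \<le> norm w * (\<bar>B b\<bar> * prod_list (map norm ws))"
          unfolding norm_scaleR real_norm_def using Basis_le_norm[OF b, of w] by (intro mult_mono) auto
      qed
      also have "\<dots> = (\<Sum>b\<in>Basis. \<bar>B b\<bar>) * prod_list (map norm vs)"
        by (simp add: vs sum_distrib_left sum_distrib_right mult_ac)
      finally show "norm (D x vs) \<le> (\<Sum>b\<in>Basis. \<bar>B b\<bar>) * prod_list (map norm vs)" .
    qed
  qed
  ultimately show ?thesis using D1 by blast
qed

lemma CB_derivative_family:
  fixes u :: "'b::euclidean_space \<Rightarrow> 'a::real_normed_vector"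
  shows "CB N S u \<Longrightarrow> \<exists>D. higher_derivs N S u D \<and> (\<forall>j\<le>N. deriv_bounded_on S D j)"
proof (induction N arbitrary: u)
  case 0
  obtain B where "\<And>x. x \<in> S \<Longrightarrow> norm (u x) \<le> B" using CB_bounded[OF 0] by (auto simp: bounded_iff)
  thus ?case using CB_continuous[OF 0]
    by (intro exI[of _ "\<lambda>x _. u x"]) (auto simp: higher_derivs_def deriv_bounded_on_def)
next
  case (Suc N)
  obtain D where D: "higher_derivs (Suc N) S u D" "\<forall>j\<in>{1..Suc N}. deriv_bounded_on S D j"
    using derivative_family_step[of S u N] Suc.IH Suc.prems unfolding CB_Suc by blast
  obtain B where B: "\<And>x. x \<in> S \<Longrightarrow> norm (u x) \<le> B" using CB_bounded[OF Suc.prems] by (auto simp: bounded_iff)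
  have "deriv_bounded_on S D 0"
    using B D(1) unfolding deriv_bounded_on_def higher_derivs_def by (intro exI[of _ B]) auto
  hence "deriv_bounded_on S D j" if "j \<le> Suc N" for j using D(2) that by (cases "j = 0") auto
  thus ?case using D(1) by blast
qed

theorem theorem1p3:
  fixes f :: "(real^'n) \<times> (real^'m) \<Rightarrow> real^'n"
    and g :: "(real^'n) \<times> (real^'m) \<Rightarrow> real^'m"
    and Df :: "(real^'n) \<times> (real^'m) \<Rightarrow> ((real^'n) \<times> (real^'m)) list \<Rightarrow> real^'n"
    and Dg :: "(real^'n) \<times> (real^'m) \<Rightarrow> ((real^'n) \<times> (real^'m)) list \<Rightarrow> real^'m"
    and U \<Gamma> :: "((real^'n) \<times> (real^'m)) set"
    and r :: nat and d c1 cr :: real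
    and \<alpha> ell :: "(real^'n) \<times> (real^'m) \<Rightarrow> real"
  assumes r: "r \<ge> 2"
    and H1_open: "open U" and H1_convex: "convex U"
    and H1_d: "d > 0" and H1_cone: "\<forall>x\<in>U. cone x \<inter> U \<subseteq> boxB d x"
    and H2_f: "higher_derivs r U f Df" and H2_g: "higher_derivs r U g Dg"
    and H2_fb: "\<forall>j\<in>{1..r}. deriv_bounded_on U Df j"
    and H2_gb: "\<forall>j\<in>{1..r}. deriv_bounded_on U Dg j"
    and H2_alpha: "continuous_on U \<alpha>" "\<forall>x\<in>U. \<alpha> x > 0"
    and H2_ell: "continuous_on U ell" "\<forall>x\<in>U. ell x \<ge> 0"
    and H2_c: "c1 > 0" "cr > 0"
    and H2_mon: "\<forall>x\<in>U. \<forall>a'. inner a' (Df x [(a', 0)]) \<ge> \<alpha> x * (norm a')\<^sup>2"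
    and H2_dis: "\<forall>x\<in>U. \<forall>z'. inner z' (Dg x [(0, z')]) \<le> ell x * (norm z')\<^sup>2"
    and H2_gap1: "\<forall>x\<in>U. \<alpha> x \<ge> ell x + onorm (\<lambda>z'. Df x [(0, z')])
                               + onorm (\<lambda>a'. Dg x [(a', 0)]) + c1"
    and H2_gapr: "\<forall>x\<in>U. \<alpha> x \<ge> real r * ell x
                               + real (r + 1) * onorm (\<lambda>a'. Dg x [(a', 0)]) + cr"
    and H3_inv: "pos_invariant (\<lambda>x. (f x, g x)) U \<Gamma>"
    and H3_proj: "snd ` \<Gamma> = snd ` U"
  shows "(\<forall>S. S \<subseteq> U \<longrightarrow> pos_invariant (\<lambda>x. (f x, g x)) U S \<longrightarrow> S \<subseteq> \<Gamma>) \<and>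
         (\<exists>h :: real^'m \<Rightarrow> real^'n. \<exists>Dh.
            higher_derivs r (snd ` U) h Dh \<and>
            \<Gamma> = {(h z, z) | z. z \<in> snd ` U} \<and>
            (\<forall>z1\<in>snd ` U. \<forall>z2\<in>snd ` U. z1 \<noteq> z2 \<longrightarrow> norm (h z2 - h z1) < norm (z2 - z1)) \<and>
            (\<forall>z\<in>snd ` U. onorm (\<lambda>v. Dh z [v]) < 1) \<and>
            (\<forall>j\<in>{2..r}. deriv_bounded_on (snd ` U) Dh j))"
proof -
  interpret cone_system f g Df Dg U \<Gamma> r d c1 cr \<alpha> ell
    by unfold_locales (fact r H1_open H1_convex H1_cone H2_f H2_g H2_fb H2_gb H2_ell H2_c H2_mon H2_dis
        H2_gap1 H2_gapr H3_inv H3_proj)+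
  have K: "snd ` U = K" by (simp add: K_def)
  \<comment> \<open>\<open>HB (r - 1)\<close> concerns the first partial derivatives of
    \<open>h\<close>; passing from them to \<open>h\<close> restores order \<open>r\<close>.\<close>
  have "\<exists>D. higher_derivs (Suc (r - 1)) K h D \<and> (\<forall>j\<in>{1..Suc (r - 1)}. deriv_bounded_on K D j) \<and>
    (\<forall>z\<in>K. \<forall>v. D z [v] = Dd v h z)"
    using HB_top by (intro derivative_family_step h_diff CB_derivative_family) (auto simp: HB_def)
  then obtain Dh where Dh: "higher_derivs r K h Dh" "\<forall>j\<in>{1..r}. deriv_bounded_on K Dh j"
    "\<And>z v. z \<in> K \<Longrightarrow> Dh z [v] = Dd v h z"
    using r by auto
  have "onorm (\<lambda>v. Dh z [v]) < 1" if z: "z \<in> K" for z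
  proof -
    have "onorm (\<lambda>v. Dh z [v]) \<le> \<rho>" using Dh_bound[OF z] by (intro onorm_le) (simp add: Dh(3)[OF z])
    thus ?thesis using \<rho> by simp
  qed
  moreover have "\<forall>z1\<in>K. \<forall>z2\<in>K. z1 \<noteq> z2 \<longrightarrow> norm (h z2 - h z1) < norm (z2 - z1)"
    using h_strict_contraction by blast
  ultimately show ?thesis
    unfolding K using Dh(1,2) \<Gamma>_graph invariant_subset by (intro conjI allI impI exI[of _ h] exI[of _ Dh]) auto
qed

end
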